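(* Let $X$ be a closed Riemann surface of genus $g$, realized by the standard polygon model described in the context, and let $G=(V,E)$ be a finite graph embedded in $X$ as described there. Then, as an identity of formal power series in the variables $x=(x_e)_{e\in E}$, $$\mathcal E(G,x)=2^{-g}\sum_{s\in F_2^{2g}}\mathrm{sign}(s)\,F(G,x,s),$$ where $\mathrm{sign}(s)=(-1)^{\sum_{i=1}^{g}s_{2i-1}s_{2i}}$.
   Context: Model of $X$: a regular $4g$-gon $R$ in the plane whose sides, labelled anticlockwise $z_1,\dots,z_{4g}$, are identified in pairs: $z_i$ with $z_{i+2}^{-1}$ and $z_{i+1}$ with $z_{i+3}^{-1}$ for $i=1,5,\dots,4(g-1)+1$. The graph $G$ is embedded in $X$ so that every vertex lies in the interior of $R$, every edge is a union of straight segments in $R$, and edges meet $\partial R$ transversally. The highway surface $S_g$ is obtained from $R$ by attaching $2g$ rectangular bridges $R_1,\dots,R_{2g}$: for each $i=1,\dots,g$, the bridge $R_{2i-1}$ is glued along two opposite sides to the pair of identified sides of $R$ with indices $4i-3$ and $4i-1$, and $R_{2i}$ is glued to the pair with indices $4i-2$ and $4i$ (indices mod $4g$). Thus $X$ is $S_g$ with a disk attached along its boundary. After an isotopy, $G\subset S_g$, all vertices lie in the interior of $R$, and each edge $e$ meets each bridge $R_i$ in finitely many disjoint straight segments joining the two glued sides of $R_i$; let $r_i(e)$ be the number of these segments. There is an orientation-preserving immersion $\Phi$ of $S_g$ into the plane, injective except that $\Phi(R_{2i-1})$ and $\Phi(R_{2i})$ overlap in a square for each $i$. The planar drawing $G^g=\Phi(G)$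 (the "$g$-graph") represents each edge by a piecewise-linear curve. A prime reduced cycle of $G$ is a circular sequence (sequence up to cyclic shift) $o_1,\dots,o_n$ of directed edges (each $o_j$ is one of the two orientations of an edge of $G$) forming a closed walk, such that $o_{j+1}\neq o_j^{-1}$ for all $j$ (cyclically, also $o_1\neq o_n^{-1}$) and $(o_1,\dots,o_n)$ is not of the form $Z^m$ for a sequence $Z$ and $m>1$. For a prime reduced cycle $p$, $p^{-1}$ is the reversed cycle, and $p^g$ is the corresponding closed piecewise-linear curve in $G^g$. Let $[\mathcal G]^g$ be the set of unordered pairs $\{p^g,(p^g)^{-1}\}$. Rotations: $rot_0(p^g)=\frac1{2\pi}\sum_t z_0(t)\pmod 2$, where the sum is over all transitions $t$ between consecutive linear pieces of the closed curve $p^g$ and $z_0(t)$ is the signed angle of the turn (positive if anticlockwise, negative if clockwise). For $s\in F_2^{2g}$, $rot_s(p^g)=rot_0(p^g)+s\cdot r(p)\pmod 2$, where $r(p)\in\mathbb Z^{2g}$ has $i$-th coordinate $\sum r_i(e)$ over all edge traversals $e$ of $p$ and $\cdot$ is the scalar product. $(-1)^{rot_s}$ does not depend on the orientation of the cycle. Feynman function: $F(G,x,s)=\sum_{\mathcal F}(-1)^{|\mathcal F|}\prod_{[\gamma]\in\mathcal F}(-1)^{rot_s(\gamma)}\prod_{e\in\gamma}x_e$, the sum over all finite subsets $\mathcal F$ of $[\mathcal G]^g$, where $\prod_{e\in\gamma}x_e$ is the product over the edge traversals of $\gamma$ (with multiplicity). A set $E'\subseteq E$ is even if every vertex has even degree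 in $(V,E')$; $\mathcal E(G,x)=\sum_{E'\text{ even}}\prod_{e\in E'}x_e$. *)

theory Defs
  imports "HOL-Analysis.Analysis" "HOL-Library.Multiset"
begin

section \<open>The polygon model of the surface of genus \<open>g\<close>\<close>

definition corner :: "nat \<Rightarrow> nat \<Rightarrow> complex" where
  "corner g k = cis (2 * pi * real k / real (4 * g))"

definition polygon :: "nat \<Rightarrow> complex set" where
  "polygon g = convex hull (corner g ` {..<4 * g})"

text \<open>Sides are numbered \<open>1, \<dots>, 4g\<close> anticlockwise; side \<open>i\<close> runs anticlockwise from
  \<open>corner g (i - 1)\<close> to \<open>corner g i\<close>.\<close>

definition side :: "nat \<Rightarrow> nat \<Rightarrow> real \<Rightarrow> complex" where
  "side g i t = linepath (corner g (i - 1)) (corner g i) t"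

text \<open>The \<open>2g\<close> pairs of identified sides are numbered like the bridges \<open>R\<^sub>1, \<dots>, R\<^sub>2\<^sub>g\<close>: pair
  \<open>2i - 1\<close> is \<open>(4i - 3, 4i - 1)\<close> and pair \<open>2i\<close> is \<open>(4i - 2, 4i)\<close>, so that pair \<open>j\<close> is
  \<open>(first_side j, first_side j + 2)\<close>.\<close>

definition first_side :: "nat \<Rightarrow> nat" where
  "first_side j = (if odd j then 2 * j - 1 else 2 * j - 2)"

text \<open>The second side of a pair carries the inverse label, hence the parameter \<open>1 - t\<close>.\<close>

definition glueing :: "nat \<Rightarrow> (complex \<times> complex) set" where
  "glueing g = {(side g (first_side j) t, side g (first_side j + 2) (1 - t)) | j t.
     j \<in> {1..2 * g} \<and> t \<in> {0..1}}"

text \<open>The point of \<open>X\<close> represented by a point of the polygon, i.e. its class under the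
  identification of the sides.\<close>

definition surface_point :: "nat \<Rightarrow> complex \<Rightarrow> complex set" where
  "surface_point g z = (glueing g \<union> (glueing g)\<inverse>)\<^sup>* `` {z}"


section \<open>Graphs embedded in the surface\<close>

text \<open>An edge is given by a list of waypoints joined by straight segments of the polygon.
  \<open>Inner z\<close> is a break point in the interior of the polygon.  \<open>Cross j d t\<close> is a passage through
  the \<open>j\<close>-th pair of identified sides, at parameter \<open>t\<close> of its first side: if \<open>d\<close> holds, the
  edge leaves the polygon through the first side and comes back through the second one,
  otherwise it passes in the opposite direction.\<close>

datatype waypoint = Inner complex | Cross nat bool real

fun arrival :: "nat \<Rightarrow> waypoint \<Rightarrow> complex" where
  "arrival g (Inner z) = z"
| "arrival g (Cross j d t) =
     (if d then side g (first_side j) t else side g (first_side j + 2) (1 - t))"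

fun departure :: "nat \<Rightarrow> waypoint \<Rightarrow> complex" where
  "departure g (Inner z) = z"
| "departure g (Cross j d t) =
     (if d then side g (first_side j + 2) (1 - t) else side g (first_side j) t)"

fun waypoint_ok :: "nat \<Rightarrow> waypoint \<Rightarrow> bool" where
  "waypoint_ok g (Inner z) \<longleftrightarrow> z \<in> interior (polygon g)"
| "waypoint_ok g (Cross j d t) \<longleftrightarrow> j \<in> {1..2 * g} \<and> 0 < t \<and> t < 1"

text \<open>A graph may have loops and parallel edges.  Every edge is listed with a reference
  orientation from \<open>src\<close> to \<open>tgt\<close>, along which its route is described.\<close>

record ('v, 'e) graph =
  verts :: "'v set"
  edges :: "'e set"
  src :: "'e \<Rightarrow> 'v"
  tgt :: "'e \<Rightarrow> 'v"

record ('v, 'e) polygon_graph = "('v, 'e) graph" +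
  pos :: "'v \<Rightarrow> complex"
  route :: "'e \<Rightarrow> waypoint list"

definition finite_graph :: "('v, 'e, 'z) graph_scheme \<Rightarrow> bool" where
  "finite_graph G \<longleftrightarrow> finite (verts G) \<and> finite (edges G) \<and>
     src G ` edges G \<subseteq> verts G \<and> tgt G ` edges G \<subseteq> verts G"

definition segments :: "nat \<Rightarrow> waypoint list \<Rightarrow> (complex \<times> complex) list" where
  "segments g ws = zip (map (departure g) (butlast ws)) (map (arrival g) (tl ws))"

definition edge_point :: "nat \<Rightarrow> ('v, 'e) polygon_graph \<Rightarrow> 'e \<times> nat \<times> real \<Rightarrow> complex" where
  "edge_point g G = (\<lambda>(e, k, \<tau>).
     linepath (fst (segments g (route G e) ! k)) (snd (segments g (route G e) ! k)) \<tau>)"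

text \<open>Parameters of the points of the open edges.  The end of each segment is the beginning of
  the next one as a point of \<open>X\<close>, so it is enough to let \<open>\<tau>\<close> range over \<open>[0, 1)\<close>.\<close>

definition open_edge_params :: "nat \<Rightarrow> ('v, 'e) polygon_graph \<Rightarrow> ('e \<times> nat \<times> real) set" where
  "open_edge_params g G = {(e, k, \<tau>). e \<in> edges G \<and> k < length (segments g (route G e)) \<and>
     0 \<le> \<tau> \<and> \<tau> < 1 \<and> (k, \<tau>) \<noteq> (0, 0)}"

text \<open>The condition on \<open>open_segment\<close> says that the edges meet the boundary of the polygon only
  in passages; together with the convexity of the polygon it makes them transversal to the
  boundary.  The last three conditions express injectivity of the map into \<open>X\<close>.\<close>

definition embedded_in_surface :: "nat \<Rightarrow> ('v, 'e) polygon_graph \<Rightarrow> bool" where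
  "embedded_in_surface g G \<longleftrightarrow>
     pos G ` verts G \<subseteq> interior (polygon g) \<and>
     (\<forall>e\<in>edges G.
        2 \<le> length (route G e) \<and>
        hd (route G e) = Inner (pos G (src G e)) \<and>
        last (route G e) = Inner (pos G (tgt G e)) \<and>
        (\<forall>w\<in>set (route G e). waypoint_ok g w) \<and>
        (\<forall>(a, b)\<in>set (segments g (route G e)). open_segment a b \<subseteq> interior (polygon g))) \<and>
     inj_on (pos G) (verts G) \<and>
     inj_on (\<lambda>q. surface_point g (edge_point g G q)) (open_edge_params g G) \<and>
     (\<forall>q\<in>open_edge_params g G. \<forall>v\<in>verts G.
        surface_point g (edge_point g G q) \<noteq> surface_point g (pos G v))"


section \<open>The highway surface and its planar drawing\<close>

text \<open>The bridge \<open>R\<^sub>j\<close> joins the two sides of pair \<open>j\<close>; for each \<open>t\<close> it contains a straight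
  segment joining the point \<open>t\<close> of the first side to the point \<open>1 - t\<close> of the second side, and
  \<open>X\<close> away from the corner is obtained from the highway surface by collapsing these segments.
  Accordingly an edge of \<open>G \<subseteq> S\<^sub>g\<close> contains one such segment for each passage.

  The immersion \<open>\<Phi>\<close> is the identity on the polygon.  It maps the above segment to the
  polyline below, which leaves the first side orthogonally up to height \<open>h\<close>, follows the
  boundary of the concentric polygon at distance \<open>h\<close> anticlockwise, and returns orthogonally to
  the second side.  With \<open>l\<close> the side length, \<open>h\<close> ranges over \<open>[l, 2l]\<close> for odd \<open>j\<close>
  and over \<open>[3l, 4l]\<close> for even \<open>j\<close>.  Hence \<open>\<Phi>(R\<^sub>2\<^sub>i\<^sub>-\<^sub>1)\<close> and \<open>\<Phi>(R\<^sub>2\<^sub>i)\<close> overlap exactly in the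
  square of points with foot on side \<open>4i - 2\<close> and height in \<open>[l, 2l]\<close>, and there are no
  other overlaps.\<close>

definition side_length :: "nat \<Rightarrow> real" where
  "side_length g = 2 * sin (pi / real (4 * g))"

definition apothem :: "nat \<Rightarrow> real" where
  "apothem g = cos (pi / real (4 * g))"

definition side_normal :: "nat \<Rightarrow> nat \<Rightarrow> complex" where
  "side_normal g i = cis ((2 * real i - 1) * pi / real (4 * g))"

definition bridge_image :: "nat \<Rightarrow> nat \<Rightarrow> real \<Rightarrow> complex list" where
  "bridge_image g j t =
    (let a = first_side j;
         p = side g a t;
         q = side g (a + 2) (1 - t);
         h = side_length g * ((if odd j then 1 else 3) + (1 - t));
         c = complex_of_real (1 + h / apothem g)
     in [p, p + complex_of_real h * side_normal g a,
         c * corner g a, c * corner g (a + 1),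
         q + complex_of_real h * side_normal g (a + 2), q])"

fun waypoint_image :: "nat \<Rightarrow> waypoint \<Rightarrow> complex list" where
  "waypoint_image g (Inner z) = [z]"
| "waypoint_image g (Cross j d t) =
     (if d then bridge_image g j t else rev (bridge_image g j t))"

text \<open>The curve of the \<open>g\<close>-graph representing an edge, as the list of its successive corners.\<close>

definition edge_image :: "nat \<Rightarrow> ('v, 'e) polygon_graph \<Rightarrow> 'e \<Rightarrow> complex list" where
  "edge_image g G e = concat (map (waypoint_image g) (route G e))"

text \<open>The numbers \<open>r\<^sub>j(e)\<close>.\<close>

definition bridge_count :: "('v, 'e) polygon_graph \<Rightarrow> nat \<Rightarrow> 'e \<Rightarrow> nat" where
  "bridge_count G j e = length (filter (\<lambda>w. \<exists>d t. w = Cross j d t) (route G e))"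


section \<open>Prime reduced cycles\<close>

text \<open>\<open>(e, True)\<close> is \<open>e\<close> in its reference orientation and \<open>(e, False)\<close> is \<open>e\<close> reversed.\<close>

type_synonym 'e dedge = "'e \<times> bool"

definition dinv :: "'e dedge \<Rightarrow> 'e dedge" where
  "dinv = (\<lambda>(e, d). (e, \<not> d))"

definition dtail :: "('v, 'e, 'z) graph_scheme \<Rightarrow> 'e dedge \<Rightarrow> 'v" where
  "dtail G = (\<lambda>(e, d). if d then src G e else tgt G e)"

definition dhead :: "('v, 'e, 'z) graph_scheme \<Rightarrow> 'e dedge \<Rightarrow> 'v" where
  "dhead G = (\<lambda>(e, d). if d then tgt G e else src G e)"

definition prime_reduced_cycle :: "('v, 'e, 'z) graph_scheme \<Rightarrow> 'e dedge list \<Rightarrow> bool" where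
  "prime_reduced_cycle G p \<longleftrightarrow>
     p \<noteq> [] \<and> fst ` set p \<subseteq> edges G \<and>
     (\<forall>i<length p. dhead G (p ! i) = dtail G (p ! (Suc i mod length p))) \<and>
     (\<forall>i<length p. p ! (Suc i mod length p) \<noteq> dinv (p ! i)) \<and>
     (\<nexists>z m. 1 < m \<and> p = concat (replicate m z))"

definition inverse_cycle :: "'e dedge list \<Rightarrow> 'e dedge list" where
  "inverse_cycle p = rev (map dinv p)"

definition circular :: "'a list \<Rightarrow> 'a list set" where
  "circular p = range (\<lambda>k. rotate k p)"

definition unoriented :: "'e dedge list \<Rightarrow> 'e dedge list set set" where
  "unoriented p = {circular p, circular (inverse_cycle p)}"

text \<open>The set \<open>[\<G>]\<^sup>g\<close>; a closed curve of the \<open>g\<close>-graph is identified with the cycle it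
  represents.\<close>

definition cycle_classes :: "('v, 'e, 'z) graph_scheme \<Rightarrow> 'e dedge list set set set" where
  "cycle_classes G = unoriented ` {p. prime_reduced_cycle G p}"

definition representative ::
    "('v, 'e, 'z) graph_scheme \<Rightarrow> 'e dedge list set set \<Rightarrow> 'e dedge list" where
  "representative G \<gamma> = (SOME p. prime_reduced_cycle G p \<and> unoriented p = \<gamma>)"


section \<open>Rotation\<close>

text \<open>A closed polyline is given by the cyclic list of its corners.  \<open>Arg\<close> takes values in
  \<open>(-\<pi>, \<pi>]\<close>, so that \<open>Arg ((c - b) / (b - a))\<close> is the signed angle of the turn at \<open>b\<close>.\<close>

definition total_turning :: "complex list \<Rightarrow> real" where
  "total_turning P = (\<Sum>i<length P.
     let a = P ! i; b = P ! (Suc i mod length P); c = P ! (Suc (Suc i) mod length P)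
     in Arg ((c - b) / (b - a)))"

definition dedge_image :: "nat \<Rightarrow> ('v, 'e) polygon_graph \<Rightarrow> 'e dedge \<Rightarrow> complex list" where
  "dedge_image g G = (\<lambda>(e, d). if d then edge_image g G e else rev (edge_image g G e))"

text \<open>The last corner of each edge is dropped because it is the first corner of the next one.\<close>

definition cycle_image :: "nat \<Rightarrow> ('v, 'e) polygon_graph \<Rightarrow> 'e dedge list \<Rightarrow> complex list" where
  "cycle_image g G p = concat (map (\<lambda>d. butlast (dedge_image g G d)) p)"

text \<open>The floor only turns an integral real number into an integer, see
  \<open>total_turning_integral\<close> below.\<close>

definition rot0 :: "nat \<Rightarrow> ('v, 'e) polygon_graph \<Rightarrow> 'e dedge list \<Rightarrow> int" where
  "rot0 g G p = \<lfloor>total_turning (cycle_image g G p) / (2 * pi)\<rfloor> mod 2"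

definition cycle_bridge_count :: "('v, 'e) polygon_graph \<Rightarrow> nat \<Rightarrow> 'e dedge list \<Rightarrow> nat" where
  "cycle_bridge_count G j p = (\<Sum>d\<leftarrow>p. bridge_count G j (fst d))"

definition rot :: "nat \<Rightarrow> ('v, 'e) polygon_graph \<Rightarrow> (nat \<Rightarrow> nat) \<Rightarrow> 'e dedge list \<Rightarrow> int" where
  "rot g G s p = (rot0 g G p + int (\<Sum>j=1..2 * g. s j * cycle_bridge_count G j p)) mod 2"

lemma total_turning_integral:
  assumes "\<And>i. i < length P \<Longrightarrow> P ! i \<noteq> P ! (Suc i mod length P)"
  shows "total_turning P / (2 * pi) \<in> \<int>"
proof (cases "P = []")
  case True
  then show ?thesis by (simp add: total_turning_def)
next
  case False
  define n where "n = length P"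
  have n: "0 < n" using False by (simp add: n_def)
  define D where "D i = sgn (P ! (Suc i mod n) - P ! (i mod n))" for i
  have D0: "D i \<noteq> 0" for i
    using assms[of "i mod n"] n by (simp add: D_def n_def sgn_zero_iff mod_simps)
  have step: "cis (Arg ((P ! (Suc (Suc i) mod n) - P ! (Suc i mod n)) /
                        (P ! (Suc i mod n) - P ! i))) = D (Suc i) / D i" if "i < n" for i
  proof -
    have "(P ! (Suc (Suc i) mod n) - P ! (Suc i mod n)) / (P ! (Suc i mod n) - P ! i) \<noteq> 0"
      using D0[of i] D0[of "Suc i"] that by (auto simp: D_def sgn_zero_iff)
    then show ?thesis
      using that by (simp add: cis_Arg D_def sgn_divide)
  qed
  have cis_sum: "cis (\<Sum>i<m. f i) = (\<Prod>i<m. cis (f i))" for m and f :: "nat \<Rightarrow> real"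
    by (induction m) (simp_all add: cis_mult [symmetric])
  have tel: "(\<Prod>i<m. D (Suc i) / D i) = D m / D 0" for m
    using D0 by (induction m) (simp_all add: field_simps)
  have "D n = D 0" by (simp add: D_def mod_Suc)
  have "cis (total_turning P) = (\<Prod>i<n. D (Suc i) / D i)"
    unfolding total_turning_def cis_sum Let_def n_def [symmetric]
    by (intro prod.cong refl) (use step in auto)
  also have "\<dots> = 1" using tel[of n] D0 \<open>D n = D 0\<close> by simp
  finally have "exp (\<i> * complex_of_real (total_turning P)) = 1"
    by (simp add: cis_conv_exp)
  then obtain k :: int where "total_turning P = of_int (2 * k) * pi"
    by (auto simp: exp_eq_1)
  then have "total_turning P / (2 * pi) = of_int k" by simp
  then show ?thesis by simp
qed


section \<open>Formal power series\<close>

text \<open>A formal power series in the variables \<open>x\<^sub>e\<close> is the function assigning to each monomial,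
  i.e. multiset of variables, its coefficient.  \<open>formal_sum A c m\<close> is the formal sum of the terms
  \<open>c a \<sqdot> x\<^bsup>m a\<^esup>\<close> for \<open>a \<in> A\<close>; it makes sense if every monomial occurs for finitely many \<open>a\<close>.\<close>

type_synonym 'e mfps = "'e multiset \<Rightarrow> real"

definition formal_sum :: "'a set \<Rightarrow> ('a \<Rightarrow> real) \<Rightarrow> ('a \<Rightarrow> 'e multiset) \<Rightarrow> 'e mfps" where
  "formal_sum A c m = (\<lambda>\<alpha>. \<Sum>a | a \<in> A \<and> m a = \<alpha>. c a)"

definition cycle_monomial ::
    "('v, 'e, 'z) graph_scheme \<Rightarrow> 'e dedge list set set \<Rightarrow> 'e multiset" where
  "cycle_monomial G \<gamma> = mset (map fst (representative G \<gamma>))"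

definition feynman :: "nat \<Rightarrow> ('v, 'e) polygon_graph \<Rightarrow> (nat \<Rightarrow> nat) \<Rightarrow> 'e mfps" where
  "feynman g G s = formal_sum {F. finite F \<and> F \<subseteq> cycle_classes G}
     (\<lambda>F. (-1) ^ card F * (\<Prod>\<gamma>\<in>F. (-1) ^ nat (rot g G s (representative G \<gamma>))))
     (\<lambda>F. \<Sum>\<gamma>\<in>F. cycle_monomial G \<gamma>)"

lemma finite_feynman_terms:
  fixes G :: "('v, 'e, 'z) graph_scheme"
  assumes "finite (edges G)"
  shows "finite {F. F \<in> {F. finite F \<and> F \<subseteq> cycle_classes G} \<and>
                    (\<Sum>\<gamma>\<in>F. cycle_monomial G \<gamma>) = \<alpha>}" (is "finite ?S")
proof -
  let ?L = "{p. set p \<subseteq> edges G \<times> (UNIV :: bool set) \<and> length p \<le> size \<alpha>}"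
  have fin: "finite (Pow (unoriented ` ?L))"
    using finite_lists_length_le[of "edges G \<times> (UNIV :: bool set)" "size \<alpha>"] assms by simp
  have "F \<subseteq> unoriented ` ?L" if F: "F \<in> ?S" for F
  proof
    fix \<gamma> assume \<gamma>: "\<gamma> \<in> F"
    define p where "p = representative G \<gamma>"
    have "\<exists>p. prime_reduced_cycle G p \<and> unoriented p = \<gamma>"
      using F \<gamma> by (auto simp: cycle_classes_def)
    then have p: "prime_reduced_cycle G p \<and> unoriented p = \<gamma>"
      unfolding p_def representative_def by (rule someI_ex)
    have "cycle_monomial G \<gamma> \<subseteq># \<alpha>"
      using F \<gamma> sum.remove[of F \<gamma> "cycle_monomial G"] by auto
    then have "length p \<le> size \<alpha>"
      using size_mset_mono[of "cycle_monomial G \<gamma>" \<alpha>] by (simp add: cycle_monomial_def p_def)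
    moreover have "fst ` set p \<subseteq> edges G"
      using p unfolding prime_reduced_cycle_def by blast
    then have "set p \<subseteq> edges G \<times> UNIV" by (auto simp: image_subset_iff)
    ultimately show "\<gamma> \<in> unoriented ` ?L" using p by blast
  qed
  then have "?S \<subseteq> Pow (unoriented ` ?L)" by blast
  then show ?thesis using fin by (rule finite_subset)
qed

text \<open>A loop contributes two to the degree of its vertex.\<close>

definition degree_in :: "('v, 'e, 'z) graph_scheme \<Rightarrow> 'e set \<Rightarrow> 'v \<Rightarrow> nat" where
  "degree_in G A v = card {e \<in> A. src G e = v} + card {e \<in> A. tgt G e = v}"

definition even_set :: "('v, 'e, 'z) graph_scheme \<Rightarrow> 'e set \<Rightarrow> bool" where
  "even_set G A \<longleftrightarrow> A \<subseteq> edges G \<and> (\<forall>v\<in>verts G. even (degree_in G A v))"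

definition even_series :: "('v, 'e, 'z) graph_scheme \<Rightarrow> 'e mfps" where
  "even_series G = formal_sum {A. even_set G A} (\<lambda>_. 1) mset_set"

text \<open>Elements of \<open>F\<^sub>2\<^bsup>2g\<^esup>\<close> are functions on \<open>{1..2 * g}\<close> with values in \<open>{0, 1}\<close>.\<close>

definition binary_vectors :: "nat \<Rightarrow> (nat \<Rightarrow> nat) set" where
  "binary_vectors g = {1..2 * g} \<rightarrow>\<^sub>E {0, 1}"

definition sign_vec :: "nat \<Rightarrow> (nat \<Rightarrow> nat) \<Rightarrow> real" where
  "sign_vec g s = (-1) ^ (\<Sum>i=1..g. s (2 * i - 1) * s (2 * i))"

end

theory Submission
  imports Defs
begin

text \<open>A term of the Feynman function is a product over the steps of reduced closed walks of signs
  that are antisymmetric in the two half-edges meeting at a vertex. The logarithmic derivative with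
  respect to \<open>x\<^sub>e\<close> is a sum over closed walks through \<open>e\<close>. Walks using \<open>e\<close> in both directions cancel
  by reversing a loop, and the remaining ones satisfy a renewal equation. Hence the series is linear
  in each variable and determined by a recursion, which is solved as follows: place the half-edges
  on a line such that those of a vertex are consecutive and draw each edge as a chord. The
  coefficient of an even set is the sign of its number of crossing pairs of chords, and all other
  coefficients vanish.

  In the drawing, half-edges are ordered by polar coordinates around a generic observer close to
  the corner \<open>1\<close>. Half of each turning angle is a difference of lifted positions up to a sign, so
  along a cycle the phases telescope and the rotation becomes a product of such signs. The crossings
  of chords are counted on the segments and bridges of the edges. Crossings caused by segments
  cancel for even sets, so an even set crossing the \<open>j\<close>-th bridge \<open>r\<^sub>j\<close> times has the coefficient
  \<open>-1\<close> to the power \<open>\<Sum>s\<^sub>j r\<^sub>j + \<Sum>r\<^sub>2\<^sub>i\<^sub>-\<^sub>1 r\<^sub>2\<^sub>i\<close>. The signed average over \<open>s\<close> of this sign is \<open>1\<close>.\<close>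

section \<open>Primitive words\<close>

text \<open>Write \<open>S\<close> for the series, \<open>R\<close> for the sum over walks that use
  \<open>e\<close> only once, and \<open>S_n\<close> for the part of degree \<open>n\<close> in
  \<open>x_e\<close>. As \<open>R\<close> has degree one in \<open>x_e\<close>, the renewal equation
  becomes \<open>n * S_n = (n - 2) * R * S_(n-1)\<close>; this is where linearity comes from. Chord
  diagrams solve the recursion in degree one because of an alternating identity: among an even
  number of points on a line, the partners of a fixed point, each with the parity sign of the points
  in between, add up to 1.

  On the geometric side the obstacle is that angles are defined modulo 2 pi only. The cut of the
  observer runs to the right, into a small region near the corner 1 that contains no part of the
  graph; so no segment meets the cut, and the sides appear in the order of their numbers. Angles
  then have canonical lifts. The crossings of segments can be discarded because the chords of two
  disjoint segments cross with the parity of the number of end points lying beyond the other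
  segment. Such a parity depends on one segment and one point, so along an edge only its two
  vertices remain, and at even degree each vertex cancels.\<close>

definition primitive :: "'a list \<Rightarrow> bool" where
  "primitive p \<longleftrightarrow> p \<noteq> [] \<and> (\<nexists>z m. 1 < m \<and> p = concat (replicate m z))"

lemma concat_replicate_add:
  "concat (replicate (m + n) z) = concat (replicate m z) @ concat (replicate n z)"
  by (simp add: replicate_add)

lemma concat_replicate_mult:
  "concat (replicate m (concat (replicate n z))) = concat (replicate (m * n) z)"
  by (induction m) (simp_all add: concat_replicate_add)

lemma length_concat_replicate: "length (concat (replicate m z)) = m * length z"
  by (induction m) auto

lemma primitive_root_exists:
  "p \<noteq> [] \<Longrightarrow> \<exists>q m. primitive q \<and> 0 < m \<and> p = concat (replicate m q)"
proof (induction "length p" arbitrary: p rule: less_induct)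
  case less
  show ?case
  proof (cases "primitive p")
    case True
    then have "primitive p \<and> 0 < (1::nat) \<and> p = concat (replicate 1 p)" by simp
    then show ?thesis by blast
  next
    case False
    then obtain z m where m: "1 < m" "p = concat (replicate m z)"
      using less.prems by (auto simp: primitive_def)
    have "z \<noteq> []" using m less.prems by auto
    then have "length z < length p" using m by (simp add: length_concat_replicate)
    from less.hyps[OF this \<open>z \<noteq> []\<close>] obtain q k where
      "primitive q" "0 < k" "z = concat (replicate k q)" by blast
    then have "primitive q \<and> 0 < m * k \<and> p = concat (replicate (m * k) q)"
      using m by (simp add: concat_replicate_mult)
    then show ?thesis by blast
  qed
qed

lemma append_concat_replicate_commute:
  assumes "u @ w = w @ u"
  shows "u @ concat (replicate k w) = concat (replicate k w) @ u"
proof (induction k)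
  case (Suc k)
  have "u @ concat (replicate (Suc k) w) = (u @ w) @ concat (replicate k w)" by simp
  also have "\<dots> = w @ (u @ concat (replicate k w))" unfolding assms by simp
  finally show ?case using Suc by simp
qed simp

text \<open>Both words commute with the common power, hence so do \<open>q @ r\<close> and
  \<open>r @ q\<close>. Both are therefore prefixes of a sufficiently high power \<open>K\<close> of
  it, and they have the same length.\<close>

lemma concat_replicate_eq_imp_commute:
  assumes "concat (replicate m q) = concat (replicate n r)" "0 < m" "0 < n"
  shows "q @ r = r @ q"
proof (cases "q = []")
  case True then show ?thesis by simp
next
  case False
  define w where "w = concat (replicate m q)"
  have q: "q @ w = w @ q" unfolding w_def by (intro append_concat_replicate_commute) simp
  have r: "r @ w = w @ r" unfolding w_def assms(1) by (intro append_concat_replicate_commute) simp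
  have w: "w \<noteq> []" using False assms(2) by (cases m) (auto simp: w_def)
  define K where "K = concat (replicate (length (q @ r)) w)"
  have len: "length (q @ r) \<le> length K"
    using w by (cases w) (auto simp: K_def length_concat_replicate)
  have "(q @ r) @ w = w @ (q @ r)" using q r by (metis append_assoc)
  then have 1: "(q @ r) @ K = K @ (q @ r)"
    unfolding K_def by (rule append_concat_replicate_commute)
  have "(r @ q) @ w = w @ (r @ q)" using q r by (metis append_assoc)
  then have 2: "(r @ q) @ K = K @ (r @ q)"
    unfolding K_def by (rule append_concat_replicate_commute)
  have "q @ r = take (length (q @ r)) K"
    using arg_cong[OF 1, of "take (length (q @ r))"] len by simp
  moreover have "r @ q = take (length (r @ q)) K"
    using arg_cong[OF 2, of "take (length (r @ q))"] len by (simp add: add.commute)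
  ultimately show ?thesis by (simp add: add.commute)
qed

text \<open>Commuting words are powers of one word, and primitivity forces both exponents to be
  1.\<close>

lemma primitive_commute_eq:
  assumes "primitive q" "primitive r" "q @ r = r @ q"
  shows "q = r"
proof -
  obtain m n z where z: "concat (replicate m z) = q" "concat (replicate n z) = r"
    using comm_append_are_replicate[OF assms(3)] by blast
  have "\<not> 1 < m" "\<not> 1 < n" "m \<noteq> 0" "n \<noteq> 0"
    using z assms unfolding primitive_def by (blast, blast, auto)
  then have "m = 1" "n = 1" by auto
  then show ?thesis using z by simp
qed

lemma primitive_root_unique:
  assumes "primitive q" "primitive r" "0 < m" "0 < n"
    and eq: "concat (replicate m q) = concat (replicate n r)"
  shows "q = r \<and> m = n"
proof -
  have "q = r"
    using primitive_commute_eq concat_replicate_eq_imp_commute assms by blast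
  moreover have "m * length q = n * length r"
    using arg_cong[OF eq, of length] by (simp only: length_concat_replicate)
  ultimately show ?thesis using assms(1) by (simp add: primitive_def)
qed

lemma rotate1_concat_replicate:
  "rotate1 (concat (replicate m z)) = concat (replicate m (rotate1 z))"
proof (cases z)
  case (Cons a y)
  have "y @ concat (replicate k (a # y)) @ [a] = concat (replicate (Suc k) (y @ [a]))" for k
    by (induction k) auto
  then show ?thesis using Cons by (cases m) (auto simp: replicate_append_same)
next
  case Nil
  then show ?thesis by (induction m) auto
qed

lemma rotate_concat_replicate:
  "rotate k (concat (replicate m z)) = concat (replicate m (rotate k z))"
  by (induction k) (simp_all add: rotate1_concat_replicate)

lemma rotate_inverse: "\<exists>j. rotate j (rotate k p) = p"
proof (cases "p = []")
  case False
  have "k \<le> length p * k" using False by (cases p) auto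
  then have "rotate (length p * k - k) (rotate k p) = rotate (length p * k) p"
    by (simp add: rotate_rotate)
  also have "\<dots> = p" by (subst rotate_conv_mod) simp
  finally show ?thesis ..
qed simp

lemma primitive_rotate:
  assumes "primitive p" shows "primitive (rotate k p)"
proof -
  obtain j where j: "rotate j (rotate k p) = p" using rotate_inverse by blast
  have False if "1 < m" "rotate k p = concat (replicate m z)" for z m
  proof -
    have "p = concat (replicate m (rotate j z))"
      using j unfolding that(2) by (simp add: rotate_concat_replicate)
    then show False using assms that(1) unfolding primitive_def by blast
  qed
  then show ?thesis using assms unfolding primitive_def by auto
qed

text \<open>A rotation that fixes \<open>p\<close> splits it into a prefix and a suffix that
  commute, hence into powers of a common word.\<close>

lemma primitive_rotate_eq:
  assumes p: "primitive p" and k: "k < length p" "rotate k p = p"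
  shows "k = 0"
proof (rule ccontr)
  assume "k \<noteq> 0"
  have "take k p @ drop k p = drop k p @ take k p"
    using k by (simp add: rotate_drop_take)
  then obtain m n z where z: "concat (replicate m z) = take k p" "concat (replicate n z) = drop k p"
    using comm_append_are_replicate by blast
  have ne: "take k p \<noteq> []" "drop k p \<noteq> []" using k \<open>k \<noteq> 0\<close> by auto
  have "m \<noteq> 0" "n \<noteq> 0" using z ne by (metis concat.simps(1) replicate_0)+
  then have "1 < m + n" by simp
  moreover have "p = concat (replicate (m + n) z)"
    by (simp only: concat_replicate_add z append_take_drop_id)
  ultimately show False using p unfolding primitive_def by blast
qed

lemma primitive_rotate_inj:
  assumes p: "primitive p" and ij: "i < length p" "j < length p" and eq: "rotate i p = rotate j p"
  shows "i = j"
proof -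
  have *: "i = j" if "i \<le> j" "j < length p" "rotate i p = rotate j p" for i j
  proof -
    have "rotate (j - i) (rotate i p) = rotate (j - i + i) p" by (simp only: rotate_rotate)
    then have "rotate (j - i) (rotate i p) = rotate i p" using that by simp
    moreover have "j - i < length (rotate i p)" using that by simp
    ultimately have "j - i = 0" using primitive_rotate_eq[OF primitive_rotate[OF p, of i]] by blast
    then show ?thesis using that(1) by simp
  qed
  show ?thesis
  proof (cases "i \<le> j")
    case True then show ?thesis using * ij eq by blast
  next
    case False then show ?thesis using *[of j i] ij eq by simp
  qed
qed


section \<open>Formal products over cycle classes\<close>

text \<open>The coefficient at \<alpha> of the formal product of the factors
  \<open>1 + c \<gamma> * x^(\<mu> \<gamma>)\<close>; the set \<open>F\<close> records from which
  factors the second term is chosen.\<close>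

definition product_series :: "('i \<Rightarrow> real) \<Rightarrow> ('i \<Rightarrow> 'e multiset) \<Rightarrow> 'i set \<Rightarrow> 'e mfps" where
  "product_series c \<mu> \<Gamma> \<alpha> =
     (\<Sum>F | finite F \<and> F \<subseteq> \<Gamma> \<and> (\<Sum>\<gamma>\<in>F. \<mu> \<gamma>) = \<alpha>. \<Prod>\<gamma>\<in>F. c \<gamma>)"

lemma member_subset_sum_mset:
  fixes \<mu> :: "'i \<Rightarrow> 'e multiset"
  assumes "finite F" "\<gamma> \<in> F" shows "\<mu> \<gamma> \<subseteq># (\<Sum>\<gamma>\<in>F. \<mu> \<gamma>)"
  using assms by (simp add: sum.remove)

text \<open>Local finiteness gives a meaning to products over infinitely many factors; nonempty
  monomials do the same for the geometric series of a single factor.\<close>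

locale product_family =
  fixes c :: "'i \<Rightarrow> real" and \<mu> :: "'i \<Rightarrow> 'e multiset" and \<Gamma> :: "'i set"
  assumes locally_finite: "\<And>\<alpha>. finite {\<gamma> \<in> \<Gamma>. \<mu> \<gamma> \<subseteq># \<alpha>}"
    and \<mu>_nonempty: "\<And>\<gamma>. \<gamma> \<in> \<Gamma> \<Longrightarrow> \<mu> \<gamma> \<noteq> {#}"
begin

abbreviation "F \<equiv> product_series c \<mu>"

lemma finite_terms:
  assumes "\<Gamma>' \<subseteq> \<Gamma>"
  shows "finite {F. finite F \<and> F \<subseteq> \<Gamma>' \<and> (\<Sum>\<gamma>\<in>F. \<mu> \<gamma>) = \<alpha>}"
proof (rule finite_subset)
  show "{F. finite F \<and> F \<subseteq> \<Gamma>' \<and> (\<Sum>\<gamma>\<in>F. \<mu> \<gamma>) = \<alpha>} \<subseteq> Pow {\<gamma> \<in> \<Gamma>. \<mu> \<gamma> \<subseteq># \<alpha>}"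
    using assms member_subset_sum_mset[where \<mu> = \<mu>] by blast
qed (simp add: locally_finite)

text \<open>Deleting \<gamma> is a bijection onto the index sets avoiding \<gamma>. Divisibility has
  to be tested since subtraction of multisets truncates.\<close>

lemma terms_containing:
  assumes "\<gamma> \<in> \<Gamma>"
  shows "(\<Sum>F | finite F \<and> F \<subseteq> \<Gamma> \<and> (\<Sum>\<gamma>\<in>F. \<mu> \<gamma>) = \<alpha> \<and> \<gamma> \<in> F. \<Prod>\<gamma>\<in>F. c \<gamma>) =
    (if \<mu> \<gamma> \<subseteq># \<alpha> then c \<gamma> * F (\<Gamma> - {\<gamma>}) (\<alpha> - \<mu> \<gamma>) else 0)"
proof (cases "\<mu> \<gamma> \<subseteq># \<alpha>")
  case True
  have "(\<Sum>F | finite F \<and> F \<subseteq> \<Gamma> \<and> (\<Sum>\<gamma>\<in>F. \<mu> \<gamma>) = \<alpha> \<and> \<gamma> \<in> F. \<Prod>\<gamma>\<in>F. c \<gamma>) =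
    (\<Sum>F | finite F \<and> F \<subseteq> \<Gamma> - {\<gamma>} \<and> (\<Sum>\<gamma>\<in>F. \<mu> \<gamma>) = \<alpha> - \<mu> \<gamma>. c \<gamma> * (\<Prod>\<gamma>\<in>F. c \<gamma>))"
  proof (rule sum.reindex_bij_witness[where i = "insert \<gamma>" and j = "\<lambda>F. F - {\<gamma>}"])
    fix F assume F: "F \<in> {F. finite F \<and> F \<subseteq> \<Gamma> - {\<gamma>} \<and> (\<Sum>\<gamma>\<in>F. \<mu> \<gamma>) = \<alpha> - \<mu> \<gamma>}"
    then have "\<gamma> \<notin> F" "finite F" by auto
    then show "insert \<gamma> F \<in> {F. finite F \<and> F \<subseteq> \<Gamma> \<and> (\<Sum>\<gamma>\<in>F. \<mu> \<gamma>) = \<alpha> \<and> \<gamma> \<in> F}"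
      using F True assms by auto
    show "insert \<gamma> F - {\<gamma>} = F" using \<open>\<gamma> \<notin> F\<close> by simp
  qed (use True in \<open>auto simp: insert_absorb sum.remove prod.remove\<close>)
  then show ?thesis using True by (simp add: product_series_def sum_distrib_left)
next
  case False
  then have "{F. finite F \<and> F \<subseteq> \<Gamma> \<and> (\<Sum>\<gamma>\<in>F. \<mu> \<gamma>) = \<alpha> \<and> \<gamma> \<in> F} = {}"
    using member_subset_sum_mset[where \<mu> = \<mu>] by blast
  then show ?thesis using False by (simp only: sum.empty if_False)
qed

text \<open>The factor \<open>1 + c \<gamma> * x^(\<mu> \<gamma>)\<close> is split off the product
  and the result is read at one coefficient.\<close>

lemma product_series_remove:
  assumes "\<gamma> \<in> \<Gamma>"
  shows "F \<Gamma> \<alpha> = F (\<Gamma> - {\<gamma>}) \<alpha> +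
    (if \<mu> \<gamma> \<subseteq># \<alpha> then c \<gamma> * F (\<Gamma> - {\<gamma>}) (\<alpha> - \<mu> \<gamma>) else 0)"
proof -
  let ?S = "{F. finite F \<and> F \<subseteq> \<Gamma> \<and> (\<Sum>\<gamma>\<in>F. \<mu> \<gamma>) = \<alpha>}"
  have "F \<Gamma> \<alpha> = (\<Sum>F\<in>{F \<in> ?S. \<gamma> \<notin> F}. \<Prod>\<gamma>\<in>F. c \<gamma>) + (\<Sum>F\<in>{F \<in> ?S. \<gamma> \<in> F}. \<Prod>\<gamma>\<in>F. c \<gamma>)"
    unfolding product_series_def
    by (subst sum.union_disjoint[symmetric])
      (auto intro!: sum.cong intro: finite_subset[OF _ finite_terms[of \<Gamma> \<alpha>]])
  moreover have "{F \<in> ?S. \<gamma> \<notin> F} = {F. finite F \<and> F \<subseteq> \<Gamma> - {\<gamma>} \<and> (\<Sum>\<gamma>\<in>F. \<mu> \<gamma>) = \<alpha>}" by auto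
  moreover have "{F \<in> ?S. \<gamma> \<in> F} = {F. finite F \<and> F \<subseteq> \<Gamma> \<and> (\<Sum>\<gamma>\<in>F. \<mu> \<gamma>) = \<alpha> \<and> \<gamma> \<in> F}"
    by auto
  ultimately show ?thesis using terms_containing[OF assms, of \<alpha>] by (simp add: product_series_def)
qed

text \<open>This is the operator \<open>x_e d/dx_e\<close> applied to the product: the degree of a
  term in \<open>x_e\<close> is the sum of the degrees of its factors, and the double sum over a
  term and one of its factors is reordered by the factor.\<close>

lemma product_series_derivative:
  "real (count \<alpha> e) * F \<Gamma> \<alpha> =
    (\<Sum>\<gamma> | \<gamma> \<in> \<Gamma> \<and> \<mu> \<gamma> \<subseteq># \<alpha>. real (count (\<mu> \<gamma>) e) * (c \<gamma> * F (\<Gamma> - {\<gamma>}) (\<alpha> - \<mu> \<gamma>)))"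
proof -
  let ?S = "{F. finite F \<and> F \<subseteq> \<Gamma> \<and> (\<Sum>\<gamma>\<in>F. \<mu> \<gamma>) = \<alpha>}"
  let ?A = "{\<gamma> \<in> \<Gamma>. \<mu> \<gamma> \<subseteq># \<alpha>}"
  have fin: "finite ?S" "finite ?A" using finite_terms[of \<Gamma> \<alpha>] locally_finite by auto
  have "real (count \<alpha> e) * F \<Gamma> \<alpha> = (\<Sum>F\<in>?S. real (count \<alpha> e) * (\<Prod>\<gamma>\<in>F. c \<gamma>))"
    by (simp add: product_series_def sum_distrib_left)
  also have "\<dots> = (\<Sum>F\<in>?S. \<Sum>\<gamma>\<in>?A. if \<gamma> \<in> F then real (count (\<mu> \<gamma>) e) * (\<Prod>\<gamma>\<in>F. c \<gamma>) else 0)"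
  proof (intro sum.cong refl)
    fix F assume F: "F \<in> ?S"
    then have "?A \<inter> F = F" using member_subset_sum_mset[where \<mu> = \<mu>] by blast
    moreover have "count \<alpha> e = (\<Sum>\<gamma>\<in>F. count (\<mu> \<gamma>) e)" using F by (auto simp: count_sum)
    ultimately show "real (count \<alpha> e) * (\<Prod>\<gamma>\<in>F. c \<gamma>) =
        (\<Sum>\<gamma>\<in>?A. if \<gamma> \<in> F then real (count (\<mu> \<gamma>) e) * (\<Prod>\<gamma>\<in>F. c \<gamma>) else 0)"
      using fin(2) by (simp add: sum.inter_restrict[symmetric] sum_distrib_right)
  qed
  also have "\<dots> = (\<Sum>\<gamma>\<in>?A. \<Sum>F\<in>?S. if \<gamma> \<in> F then real (count (\<mu> \<gamma>) e) * (\<Prod>\<gamma>\<in>F. c \<gamma>) else 0)"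
    by (rule sum.swap)
  also have "\<dots> = (\<Sum>\<gamma>\<in>?A. real (count (\<mu> \<gamma>) e) *
      (\<Sum>F\<in>{F \<in> ?S. \<gamma> \<in> F}. \<Prod>\<gamma>\<in>F. c \<gamma>))"
    using fin(1) by (simp add: sum.inter_filter[symmetric] sum_distrib_left)
  also have "\<dots> = (\<Sum>\<gamma>\<in>?A. real (count (\<mu> \<gamma>) e) * (c \<gamma> * F (\<Gamma> - {\<gamma>}) (\<alpha> - \<mu> \<gamma>)))"
  proof (intro sum.cong refl)
    fix \<gamma> assume \<gamma>: "\<gamma> \<in> ?A"
    have "{F \<in> ?S. \<gamma> \<in> F} = {F. finite F \<and> F \<subseteq> \<Gamma> \<and> (\<Sum>\<gamma>\<in>F. \<mu> \<gamma>) = \<alpha> \<and> \<gamma> \<in> F}" by auto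
    then show "real (count (\<mu> \<gamma>) e) * (\<Sum>F\<in>{F \<in> ?S. \<gamma> \<in> F}. \<Prod>\<gamma>\<in>F. c \<gamma>) =
      real (count (\<mu> \<gamma>) e) * (c \<gamma> * F (\<Gamma> - {\<gamma>}) (\<alpha> - \<mu> \<gamma>))"
      using terms_containing[of \<gamma> \<alpha>] \<gamma> by simp
  qed
  finally show ?thesis by simp
qed

lemma finite_repeat_mset_subset:
  assumes "\<nu> \<noteq> {#}" shows "finite {m. repeat_mset m \<nu> \<subseteq># \<alpha>}"
proof (rule finite_subset)
  have "m \<le> size \<alpha>" if "repeat_mset m \<nu> \<subseteq># \<alpha>" for m
  proof -
    have "m * 1 \<le> m * size \<nu>" using assms by (intro mult_le_mono) (auto simp: Suc_le_eq nonempty_has_size)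
    also have "\<dots> \<le> size \<alpha>" using size_mset_mono[OF that] by simp
    finally show ?thesis by simp
  qed
  then show "{m. repeat_mset m \<nu> \<subseteq># \<alpha>} \<subseteq> {..size \<alpha>}" by blast
qed simp

text \<open>Multiplying the product by the geometric series of \<open>- c \<gamma> x\<^bsup>\<mu> \<gamma>\<^esup>\<close> removes the factor of
  \<open>\<gamma>\<close>.\<close>

lemma product_series_geometric:
  assumes \<gamma>: "\<gamma> \<in> \<Gamma>"
  shows "(\<Sum>m | 0 < m \<and> repeat_mset m (\<mu> \<gamma>) \<subseteq># \<alpha>. (- c \<gamma>) ^ m * F \<Gamma> (\<alpha> - repeat_mset m (\<mu> \<gamma>))) =
    (if \<mu> \<gamma> \<subseteq># \<alpha> then - c \<gamma> * F (\<Gamma> - {\<gamma>}) (\<alpha> - \<mu> \<gamma>) else 0)"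
proof (induction "size \<alpha>" arbitrary: \<alpha> rule: less_induct)
  case less
  let ?M = "\<lambda>\<alpha>. {m. 0 < m \<and> repeat_mset m (\<mu> \<gamma>) \<subseteq># \<alpha>}"
  let ?f = "\<lambda>\<alpha> m. (- c \<gamma>) ^ m * F \<Gamma> (\<alpha> - repeat_mset m (\<mu> \<gamma>))"
  have fin: "finite (?M \<alpha>)" for \<alpha>
    by (rule finite_subset[OF _ finite_repeat_mset_subset[OF \<mu>_nonempty[OF \<gamma>], of \<alpha>]]) auto
  show ?case
  proof (cases "\<mu> \<gamma> \<subseteq># \<alpha>")
    case True
    define \<beta> where "\<beta> = \<alpha> - \<mu> \<gamma>"
    have \<alpha>: "\<alpha> = \<mu> \<gamma> + \<beta>" using True by (simp add: \<beta>_def)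
    have "size \<beta> < size \<alpha>" using \<mu>_nonempty[OF \<gamma>] by (simp add: \<alpha> nonempty_has_size[symmetric])
    note IH = less.hyps[OF this]
    \<comment> \<open>The exponent 1 is split off and the others are shifted down by one, which
      turns the sum at \<alpha> into the sum at \<beta>.\<close>
    have M: "?M \<alpha> = insert 1 (Suc ` ?M \<beta>)"
    proof (intro set_eqI iffI)
      fix m assume m: "m \<in> ?M \<alpha>"
      then obtain k where k: "m = Suc k" by (cases m) auto
      show "m \<in> insert 1 (Suc ` ?M \<beta>)" using m by (cases "k = 0") (auto simp: k \<alpha>)
    qed (auto simp: \<alpha>)
    have "sum (?f \<alpha>) (?M \<alpha>) = ?f \<alpha> 1 + sum (?f \<alpha>) (Suc ` ?M \<beta>)"
      unfolding M by (subst sum.insert) (use fin in auto)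
    also have "sum (?f \<alpha>) (Suc ` ?M \<beta>) = - c \<gamma> * sum (?f \<beta>) (?M \<beta>)"
      by (subst sum.reindex) (auto simp: sum_distrib_left \<alpha> algebra_simps intro!: sum.cong)
    finally have eq: "sum (?f \<alpha>) (?M \<alpha>) = ?f \<alpha> 1 + - c \<gamma> * sum (?f \<beta>) (?M \<beta>)" .
    have "?f \<alpha> 1 = - c \<gamma> * F \<Gamma> \<beta>" by (simp add: \<beta>_def)
    then show ?thesis
      unfolding eq IH product_series_remove[OF \<gamma>, of \<beta>] using True
      by (cases "\<mu> \<gamma> \<subseteq># \<beta>") (simp_all add: \<beta>_def[symmetric] algebra_simps)
  next
    case False
    have "?M \<alpha> = {}"
    proof -
      have "\<mu> \<gamma> \<subseteq># repeat_mset m (\<mu> \<gamma>)" if "0 < m" for m using that by (cases m) auto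
      then show ?thesis using False by (auto dest: subset_mset.order_trans)
    qed
    then show ?thesis using False by (simp only: sum.empty if_False)
  qed
qed

end

section \<open>Cyclic walks, their reversal and their weights\<close>

lemma dinv_dinv [simp]: "dinv (dinv a) = a"
  by (cases a) (simp add: dinv_def)

lemma fst_dinv [simp]: "fst (dinv a) = fst a"
  by (cases a) (simp add: dinv_def)

lemma dinv_neq [simp]: "dinv a \<noteq> a" "a \<noteq> dinv a"
  by (cases a; simp add: dinv_def)+

lemma dtail_dinv [simp]: "dtail G (dinv a) = dhead G a"
  by (cases a) (auto simp: dinv_def dtail_def dhead_def)

lemma inverse_cycle_simps [simp]:
  "inverse_cycle [] = []"
  "inverse_cycle (a # p) = inverse_cycle p @ [dinv a]"
  "inverse_cycle (p @ q) = inverse_cycle q @ inverse_cycle p"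
  by (simp_all add: inverse_cycle_def)

lemma inverse_cycle_inverse [simp]: "inverse_cycle (inverse_cycle p) = p"
  by (induction p) auto

lemma inverse_cycle_eq_Nil [simp]: "inverse_cycle p = [] \<longleftrightarrow> p = []"
  by (simp add: inverse_cycle_def)

lemma set_inverse_cycle: "set (inverse_cycle p) = dinv ` set p"
  by (simp add: inverse_cycle_def)

lemma length_inverse_cycle [simp]: "length (inverse_cycle p) = length p"
  by (simp add: inverse_cycle_def)

lemma mset_fst_inverse_cycle [simp]: "mset (map fst (inverse_cycle p)) = mset (map fst p)"
  by (induction p) auto

lemma inverse_cycle_concat_replicate:
  "inverse_cycle (concat (replicate m z)) = concat (replicate m (inverse_cycle z))"
  by (induction m) (auto simp: append_concat_replicate_commute)

lemma inverse_cycle_rotate: "\<exists>j. inverse_cycle (rotate k p) = rotate j (inverse_cycle p)"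
proof -
  have "inverse_cycle (rotate1 q) = rotate (length q - 1) (inverse_cycle q)" for q :: "'a dedge list"
  proof (cases q)
    case (Cons a r)
    have "rotate (length r) (inverse_cycle r @ [dinv a]) = dinv a # inverse_cycle r"
      using rotate_append[of "inverse_cycle r" "[dinv a]"] by simp
    then show ?thesis using Cons by simp
  qed simp
  then show ?thesis
    by (induction k) (metis rotate0 id_apply, metis rotate_Suc rotate_rotate)
qed

lemma primitive_inverse_cycle: "primitive p \<Longrightarrow> primitive (inverse_cycle p)"
  unfolding primitive_def
  by (metis inverse_cycle_concat_replicate inverse_cycle_eq_Nil inverse_cycle_inverse)

lemma circular_eq_iff: "circular p = circular q \<longleftrightarrow> (\<exists>k. q = rotate k p)"
proof
  assume "circular p = circular q"
  moreover have "q \<in> circular q" unfolding circular_def by (rule range_eqI[of _ _ 0]) simp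
  ultimately show "\<exists>k. q = rotate k p" by (auto simp: circular_def)
next
  assume "\<exists>k. q = rotate k p"
  then obtain k where k: "q = rotate k p" by blast
  obtain j where j: "rotate j q = p" using rotate_inverse[of k p] k by blast
  have "circular q \<subseteq> circular p" unfolding circular_def k by (auto simp: rotate_rotate)
  moreover have "circular p \<subseteq> circular q"
    unfolding circular_def j[symmetric] by (auto simp: rotate_rotate)
  ultimately show "circular p = circular q" by blast
qed

lemma unoriented_eq_iff:
  "unoriented q = unoriented p \<longleftrightarrow> (\<exists>k. q = rotate k p \<or> q = rotate k (inverse_cycle p))"
proof -
  have *: "circular (inverse_cycle p) = circular (inverse_cycle q)" if "circular p = circular q"
    for p q :: "'a dedge list"
    using that inverse_cycle_rotate unfolding circular_eq_iff by blast
  have "unoriented q = unoriented p \<longleftrightarrow>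
    circular p = circular q \<or> circular (inverse_cycle p) = circular q"
    unfolding unoriented_def using *[of p q] *[of "inverse_cycle p" q] by (auto simp: doubleton_eq_iff)
  then show ?thesis unfolding circular_eq_iff by blast
qed

text \<open>\<open>\<tau>\<close> compares two half-edges leaving the same vertex and
  \<open>\<eta>\<close> carries the sign of traversing an edge. Under reversal of a walk both change
  sign in every step, so the changes cancel. The support of \<open>\<tau>\<close> encodes that a
  step is composable and reduced.\<close>

locale signed_walks =
  fixes G :: "('v, 'e, 'z) graph_scheme"
    and \<tau> :: "'e dedge \<Rightarrow> 'e dedge \<Rightarrow> real" and \<eta> :: "'e dedge \<Rightarrow> real"
  assumes finite_edges: "finite (edges G)"
    and \<tau>_swap: "\<And>a b. \<tau> a b = - \<tau> b a"
    and \<tau>_nonzero: "\<And>a b. fst a \<in> edges G \<Longrightarrow> fst b \<in> edges G \<Longrightarrow>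
          \<tau> a b \<noteq> 0 \<longleftrightarrow> dtail G a = dtail G b \<and> a \<noteq> b"
    and \<eta>_dinv: "\<And>a. \<eta> (dinv a) = - \<eta> a"
    and \<eta>_nonzero: "\<And>a. \<eta> a \<noteq> 0"
begin

text \<open>The half-edges that meet between the steps \<open>a\<close> and \<open>b\<close> are
  \<open>dinv a\<close> and \<open>b\<close>, both directed away from the vertex. A closed walk
  collects \<open>\<eta>\<close> once per traversal.\<close>

definition wt :: "'e dedge \<Rightarrow> 'e dedge \<Rightarrow> real" where
  "wt a b = \<tau> (dinv a) b * \<eta> a"

definition D :: "'e dedge set" where
  "D = edges G \<times> UNIV"

text \<open>The edge sign of the last entry is not included; this asymmetry is what
  \<open>path_weight_inverse\<close> has to correct.\<close>

fun path_weight :: "'e dedge list \<Rightarrow> real" where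
  "path_weight (a # b # p) = wt a b * path_weight (b # p)"
| "path_weight _ = 1"

definition cycle_weight :: "'e dedge list \<Rightarrow> real" where
  "cycle_weight p = (\<Prod>i<length p. wt (p ! i) (p ! (Suc i mod length p)))"

lemma finite_D: "finite D" by (simp add: D_def finite_edges)

lemma D_iff: "a \<in> D \<longleftrightarrow> fst a \<in> edges G" by (cases a) (simp add: D_def)

lemma subset_D_iff: "A \<subseteq> D \<longleftrightarrow> fst ` A \<subseteq> edges G" by (auto simp: D_iff)

lemma path_weight_append:
  "path_weight (p @ a # q) = path_weight (p @ [a]) * path_weight (a # q)"
  by (induction p rule: path_weight.induct) simp_all

lemma path_weight_conv_prod:
  "path_weight p = (\<Prod>i<length p - 1. wt (p ! i) (p ! Suc i))"
  by (induction p rule: path_weight.induct) (simp_all add: prod.lessThan_Suc_shift del: prod.lessThan_Suc)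

lemma cycle_weight_Cons: "cycle_weight (a # p) = path_weight (a # p @ [a])"
proof -
  have "wt ((a # p) ! i) ((a # p) ! (Suc i mod length (a # p))) =
      wt ((a # p @ [a]) ! i) ((a # p @ [a]) ! Suc i)" if "i < length (a # p)" for i
  proof (cases "i = length p")
    case True
    then show ?thesis by (simp add: nth_append nth_Cons')
  next
    case False
    then have "i < length p" using that by simp
    then show ?thesis by (cases i) (simp_all add: nth_append)
  qed
  then show ?thesis unfolding cycle_weight_def path_weight_conv_prod
    by (intro prod.cong) auto
qed

lemma cycle_weight_hd: "p \<noteq> [] \<Longrightarrow> cycle_weight p = path_weight (p @ [hd p])"
  by (cases p) (simp_all add: cycle_weight_Cons)

lemma cycle_weight_append:
  assumes "p \<noteq> []" "q \<noteq> []" "hd p = hd q"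
  shows "cycle_weight (p @ q) = cycle_weight p * cycle_weight q"
proof -
  obtain a p' q' where "p = a # p'" "q = a # q'" using assms by (cases p; cases q) auto
  then show ?thesis
    using path_weight_append[of "a # p'" a "q' @ [a]"] by (simp add: cycle_weight_Cons)
qed

lemma cycle_weight_power:
  assumes "p \<noteq> []" shows "cycle_weight (concat (replicate m p)) = cycle_weight p ^ m"
proof (induction m)
  case (Suc m)
  then show ?case
  proof (cases m)
    case (Suc k)
    then show ?thesis
      using Suc.IH assms cycle_weight_append[of p "concat (replicate m p)"] by simp
  qed simp
qed (simp add: cycle_weight_def)

lemma cycle_weight_rotate1: "cycle_weight (rotate1 p) = cycle_weight p"
proof (cases p)
  case (Cons a q)
  show ?thesis
  proof (cases q)
    case (Cons b r)
    have "cycle_weight (b # r @ [a]) = path_weight (b # r @ [a]) * wt a b"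
      using path_weight_append[of "b # r" a "[b]"] by (simp add: cycle_weight_Cons)
    then show ?thesis using \<open>p = a # q\<close> Cons by (simp add: cycle_weight_Cons)
  qed (use Cons in simp)
qed simp

lemma cycle_weight_rotate: "cycle_weight (rotate k p) = cycle_weight p"
  by (induction k) (simp_all add: cycle_weight_rotate1)

text \<open>Each reversed step changes sign once through \<open>\<tau>\<close> and once through
  \<open>\<eta>\<close>, and it charges the edge sign of its other end. Only the signs of the two
  end edges fail to match.\<close>

lemma path_weight_inverse:
  "p \<noteq> [] \<Longrightarrow> \<eta> (hd p) * path_weight (inverse_cycle p) = \<eta> (last p) * path_weight p"
proof (induction p rule: path_weight.induct)
  case (1 a b p)
  have "path_weight (inverse_cycle (a # b # p)) =
      path_weight (inverse_cycle (b # p)) * wt (dinv b) (dinv a)"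
    using path_weight_append[of "inverse_cycle p" "dinv b" "[dinv a]"] by simp
  moreover have "wt (dinv b) (dinv a) = \<tau> (dinv a) b * \<eta> b"
    using \<tau>_swap[of b "dinv a"] by (simp add: wt_def \<eta>_dinv)
  moreover have "\<eta> b * path_weight (inverse_cycle (b # p)) = \<eta> (last (b # p)) * path_weight (b # p)"
    using 1 by simp
  ultimately show ?case by (auto simp: wt_def mult.commute)
qed simp_all

text \<open>Closing the walk at its first edge makes the two end signs in
  \<open>path_weight_inverse\<close> equal.\<close>

lemma cycle_weight_inverse: "cycle_weight (inverse_cycle p) = cycle_weight p"
proof (cases p)
  case (Cons a q)
  have "cycle_weight (inverse_cycle p) = cycle_weight (rotate1 (dinv a # inverse_cycle q))"
    using Cons by simp
  also have "\<dots> = cycle_weight (dinv a # inverse_cycle q)"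
    by (rule cycle_weight_rotate1)
  also have "\<dots> = path_weight (inverse_cycle (a # q @ [a]))" by (simp add: cycle_weight_Cons)
  also have "\<dots> = path_weight (a # q @ [a])"
    using path_weight_inverse[of "a # q @ [a]"] \<eta>_nonzero[of a] by simp
  finally show ?thesis using Cons by (simp add: cycle_weight_Cons)
qed simp

lemma wt_nonzero:
  assumes "a \<in> D" "b \<in> D"
  shows "wt a b \<noteq> 0 \<longleftrightarrow> dhead G a = dtail G b \<and> b \<noteq> dinv a"
  using assms \<tau>_nonzero[of "dinv a" b] \<eta>_nonzero by (auto simp: wt_def D_iff)

text \<open>Incidence and reducedness are absorbed into the nonvanishing of the weight, so sums over
  cycles may run over arbitrary sequences of directed edges.\<close>

lemma prime_reduced_cycle_iff:
  "prime_reduced_cycle G p \<longleftrightarrow> primitive p \<and> set p \<subseteq> D \<and> cycle_weight p \<noteq> 0"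
proof -
  have "cycle_weight p \<noteq> 0 \<longleftrightarrow> (\<forall>i<length p. dhead G (p ! i) = dtail G (p ! (Suc i mod length p)))
      \<and> (\<forall>i<length p. p ! (Suc i mod length p) \<noteq> dinv (p ! i))" if "set p \<subseteq> D"
  proof -
    have "p ! i \<in> D \<and> p ! (Suc i mod length p) \<in> D" if "i < length p" for i
    proof -
      have "Suc i mod length p < length p" using that by (intro mod_less_divisor) auto
      then show ?thesis using that \<open>set p \<subseteq> D\<close> by (meson nth_mem subsetD)
    qed
    then show ?thesis
      by (simp add: cycle_weight_def wt_nonzero) blast
  qed
  then show ?thesis unfolding prime_reduced_cycle_def primitive_def subset_D_iff by blast
qed

lemma prime_reduced_cycle_rotate: "prime_reduced_cycle G p \<Longrightarrow> prime_reduced_cycle G (rotate k p)"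
  by (simp add: prime_reduced_cycle_iff primitive_rotate cycle_weight_rotate)

lemma prime_reduced_cycle_inverse:
  "prime_reduced_cycle G p \<Longrightarrow> prime_reduced_cycle G (inverse_cycle p)"
  by (auto simp: prime_reduced_cycle_iff primitive_inverse_cycle cycle_weight_inverse
      set_inverse_cycle D_iff)

text \<open>A coincidence of a cycle with its reversal has a centre of symmetry, at which some step is
  its own inverse or is followed by its inverse.\<close>

lemma prime_reduced_cycle_not_self_inverse:
  assumes "prime_reduced_cycle G p"
  shows "rotate k p \<noteq> inverse_cycle p"
proof
  assume eq: "rotate k p = inverse_cycle p"
  define n where "n = length p"
  have n: "0 < n" using assms by (simp add: prime_reduced_cycle_def n_def)
  have red: "p ! (Suc i mod n) \<noteq> dinv (p ! i)" if "i < n" for i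
    using assms that by (simp add: prime_reduced_cycle_def n_def)
  have sym: "p ! ((i + k) mod n) = dinv (p ! (n - Suc i))" if "i < n" for i
  proof -
    have "rotate k p ! i = p ! ((k + i) mod n)" using that by (simp add: nth_rotate n_def)
    moreover have "inverse_cycle p ! i = dinv (p ! (n - Suc i))"
      using that by (simp add: inverse_cycle_def rev_nth n_def)
    ultimately show ?thesis using eq by (simp add: add.commute)
  qed
  \<comment> \<open>The coincidence exchanges the positions \<open>i + k\<close> and
    \<open>n - 1 - i\<close> modulo \<open>n\<close>, whose sum is always \<open>k + n - 1\<close>.
    Half of this sum is the centre of the reflection; the parity of the sum decides whether it is a
    position or lies between two positions.\<close>
  define a where "a = ((k + n - 1) div 2) mod n"
  define i where "i = n - Suc a"
  have "a < n" using n by (simp add: a_def)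
  then have a: "a < n" "i < n" "n - Suc i = a" by (simp_all add: i_def)
  have s: "p ! ((i + k) mod n) = dinv (p ! a)" using sym[OF a(2)] a(3) by simp
  define t where "t = (k + n - 1) div 2 div n"
  have t: "(k + n - 1) div 2 = a + n * t"
    unfolding a_def t_def by (simp add: mult.commute)
  consider "k + n = 2 * (a + n * t) + 1" | "k + n = 2 * (a + n * t) + 2"
  proof -
    have "k + n = 2 * ((k + n - 1) div 2) + 1 \<or> k + n = 2 * ((k + n - 1) div 2) + 2"
      using n by presburger
    then show thesis using that unfolding t by blast
  qed
  then show False
  proof cases
    case 1
    then have "i + k + n = a + n * (2 * t + 1)" using a(1) by (simp add: i_def algebra_simps)
    then have "(i + k + n) mod n = a" using a(1) by (simp only: mod_mult_self2 mod_less)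
    then show False using s by simp
  next
    case 2
    then have "i + k + n = Suc a + n * (2 * t + 1)" using a(1) by (simp add: i_def algebra_simps)
    then have "(i + k + n) mod n = Suc a mod n" by (simp only: mod_mult_self2)
    then show False using s red[OF a(1)] by simp
  qed
qed

text \<open>The cycles in question are rotations of \<open>p\<close>, one for each forward traversal
  of \<open>e\<close>, and rotations of the reversed \<open>p\<close>, one for each backward
  traversal. Primitivity makes the rotations distinct, and \<open>p\<close> is not a rotation of its
  reversal.\<close>

lemma card_cycles_from:
  assumes p: "prime_reduced_cycle G p"
  shows "card {q. prime_reduced_cycle G q \<and> hd q = (e, True) \<and> unoriented q = unoriented p} =
    count (mset (map fst p)) e"
proof -
  let ?R = "\<lambda>p. {q. hd q = (e, True) \<and> (\<exists>k. q = rotate k p)}"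
  have card: "card (?R p) = count (mset p) (e, True) \<and> finite (?R p)"
    if p: "prime_reduced_cycle G p" for p
  proof -
    have ne: "p \<noteq> []" and prim: "primitive p"
      using p by (auto simp: prime_reduced_cycle_iff primitive_def)
    have "?R p = (\<lambda>i. rotate i p) ` {i. i < length p \<and> p ! i = (e, True)}"
    proof (intro set_eqI iffI)
      fix q assume "q \<in> ?R p"
      then obtain k where k: "hd q = (e, True)" "q = rotate k p" by blast
      then have "q = rotate (k mod length p) p" by (simp add: rotate_conv_mod[symmetric])
      moreover have "p ! (k mod length p) = (e, True)"
        using k ne by (simp add: hd_rotate_conv_nth)
      ultimately show "q \<in> (\<lambda>i. rotate i p) ` {i. i < length p \<and> p ! i = (e, True)}"
        using ne by auto
    next
      fix q assume "q \<in> (\<lambda>i. rotate i p) ` {i. i < length p \<and> p ! i = (e, True)}"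
      then show "q \<in> ?R p" using ne by (auto simp: hd_rotate_conv_nth)
    qed
    moreover have "inj_on (\<lambda>i. rotate i p) {i. i < length p \<and> p ! i = (e, True)}"
      by (rule inj_onI) (use primitive_rotate_inj[OF prim] in auto)
    ultimately show ?thesis
      by (simp add: card_image count_mset count_list_eq_length_filter length_filter_conv_card
          eq_commute[of "(e, True)"])
  qed
  have "{q. prime_reduced_cycle G q \<and> hd q = (e, True) \<and> unoriented q = unoriented p} =
      ?R p \<union> ?R (inverse_cycle p)"
    using p prime_reduced_cycle_rotate prime_reduced_cycle_inverse
    by (auto simp: unoriented_eq_iff)
  moreover have "?R p \<inter> ?R (inverse_cycle p) = {}"
  proof -
    have "rotate k p \<noteq> rotate j (inverse_cycle p)" for k j
    proof
      assume *: "rotate k p = rotate j (inverse_cycle p)"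
      obtain l where "rotate l (rotate j (inverse_cycle p)) = inverse_cycle p"
        using rotate_inverse by blast
      then have "rotate (l + k) p = inverse_cycle p" using * by (simp add: rotate_rotate[symmetric])
      then show False using prime_reduced_cycle_not_self_inverse[OF p] by blast
    qed
    then show ?thesis by blast
  qed
  moreover have "count (mset (inverse_cycle p)) (e, True) = count (mset p) (e, False)"
    by (induction p) (auto simp: dinv_def)
  moreover have "count (mset (map fst p)) e = count (mset p) (e, True) + count (mset p) (e, False)"
  proof (induction p)
    case (Cons a p)
    then show ?case by (cases a; cases "snd a") auto
  qed simp
  ultimately show ?thesis
    using card[OF p] card[OF prime_reduced_cycle_inverse[OF p]] by (simp add: card_Un_disjoint)
qed

end


section \<open>Logarithmic derivatives and renewal\<close>

lemma finite_submultisets: "finite {\<beta>. \<beta> \<subseteq># (\<alpha> :: 'a multiset)}"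
proof (rule finite_subset)
  show "{\<beta>. \<beta> \<subseteq># \<alpha>} \<subseteq> mset ` {xs. set xs \<subseteq> set_mset \<alpha> \<and> length xs \<le> size \<alpha>}"
  proof
    fix \<beta> assume "\<beta> \<in> {\<beta>. \<beta> \<subseteq># \<alpha>}"
    then have \<beta>: "\<beta> \<subseteq># \<alpha>" by simp
    obtain xs where xs: "mset xs = \<beta>" using ex_mset by blast
    have "set xs \<subseteq> set_mset \<alpha>" using xs set_mset_mono[OF \<beta>] by auto
    moreover have "length xs \<le> size \<alpha>" using xs size_mset_mono[OF \<beta>] by auto
    ultimately show "\<beta> \<in> mset ` {xs. set xs \<subseteq> set_mset \<alpha> \<and> length xs \<le> size \<alpha>}"
      using xs by blast
  qed
qed (simp add: finite_lists_length_le)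

text \<open>For products of power series this is \<open>f * (g * h) = g * (f * h)\<close>.\<close>

lemma sum_convolution_assoc:
  fixes f g h :: "'a multiset \<Rightarrow> real"
  shows "(\<Sum>\<beta> | \<beta> \<subseteq># \<alpha>. f (\<alpha> - \<beta>) * (\<Sum>\<gamma> | \<gamma> \<subseteq># \<beta>. g \<gamma> * h (\<beta> - \<gamma>))) =
    (\<Sum>\<gamma> | \<gamma> \<subseteq># \<alpha>. g \<gamma> * (\<Sum>\<beta> | \<beta> \<subseteq># \<alpha> - \<gamma>. f (\<alpha> - \<gamma> - \<beta>) * h \<beta>))"
proof -
  have "(\<Sum>(\<beta>, \<gamma>)\<in>(SIGMA \<beta>:{\<beta>. \<beta> \<subseteq># \<alpha>}. {\<gamma>. \<gamma> \<subseteq># \<beta>}). f (\<alpha> - \<beta>) * (g \<gamma> * h (\<beta> - \<gamma>))) =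
    (\<Sum>(\<gamma>, \<beta>)\<in>(SIGMA \<gamma>:{\<gamma>. \<gamma> \<subseteq># \<alpha>}. {\<beta>. \<beta> \<subseteq># \<alpha> - \<gamma>}). g \<gamma> * (f (\<alpha> - \<gamma> - \<beta>) * h \<beta>))"
    by (rule sum.reindex_bij_witness[where i = "\<lambda>(\<gamma>, \<beta>). (\<gamma> + \<beta>, \<gamma>)" and j = "\<lambda>(\<beta>, \<gamma>). (\<gamma>, \<beta> - \<gamma>)"])
      (auto simp: subset_mset.le_diff_conv2 subset_mset.le_add_same_cancel1 add.commute
        intro: subset_mset.order_trans)
  then show ?thesis
    by (simp add: sum.Sigma[symmetric] finite_submultisets sum_distrib_left mult.assoc)
qed

lemma mset_map_concat_replicate:
  "mset (map f (concat (replicate m q))) = repeat_mset m (mset (map f q))"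
  by (induction m) auto

lemma mset_rotate: "mset (rotate k p) = mset p"
proof -
  have "mset (rotate1 q) = mset q" for q :: "'a list" by (cases q) auto
  then show ?thesis by (induction k) auto
qed

context signed_walks
begin

text \<open>Weight and monomial are invariant under rotation and reversal, hence independent of the
  chosen representative.\<close>

lemma representative_props:
  assumes "prime_reduced_cycle G p"
  defines "q \<equiv> representative G (unoriented p)"
  shows "prime_reduced_cycle G q" "unoriented q = unoriented p"
    "cycle_weight q = cycle_weight p" "cycle_monomial G (unoriented p) = mset (map fst p)"
proof -
  have "prime_reduced_cycle G q \<and> unoriented q = unoriented p"
    unfolding q_def representative_def by (rule someI) (use assms in simp)
  then show 1: "prime_reduced_cycle G q" "unoriented q = unoriented p" by auto
  then obtain k where "q = rotate k p \<or> q = rotate k (inverse_cycle p)"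
    by (auto simp: unoriented_eq_iff)
  then show "cycle_weight q = cycle_weight p" "cycle_monomial G (unoriented p) = mset (map fst p)"
    unfolding cycle_monomial_def q_def[symmetric]
    by (auto simp: cycle_weight_rotate cycle_weight_inverse mset_rotate
        simp flip: mset_fst_inverse_cycle[of p, unfolded mset_map] simp del: mset_fst_inverse_cycle)
qed

text \<open>The minus sign is the factor \<open>-1\<close> per cycle in the Feynman
  function.\<close>

definition class_coeff :: "'e dedge list set set \<Rightarrow> real" where
  "class_coeff \<gamma> = - cycle_weight (representative G \<gamma>)"

lemma finite_bounded_lists:
  "finite {p. set p \<subseteq> D \<and> mset (map fst p) \<subseteq># \<alpha>}"
proof (rule finite_subset)
  show "{p. set p \<subseteq> D \<and> mset (map fst p) \<subseteq># \<alpha>} \<subseteq> {p. set p \<subseteq> D \<and> length p \<le> size \<alpha>}"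
    using size_mset_mono by fastforce
qed (simp add: finite_lists_length_le finite_D)

sublocale product_family class_coeff "cycle_monomial G" "cycle_classes G"
proof
  fix \<alpha>
  have "{\<gamma> \<in> cycle_classes G. cycle_monomial G \<gamma> \<subseteq># \<alpha>} \<subseteq>
      unoriented ` {p. set p \<subseteq> D \<and> mset (map fst p) \<subseteq># \<alpha>}"
  proof
    fix \<gamma> assume \<gamma>: "\<gamma> \<in> {\<gamma> \<in> cycle_classes G. cycle_monomial G \<gamma> \<subseteq># \<alpha>}"
    then obtain p where "prime_reduced_cycle G p" "\<gamma> = unoriented p"
      by (auto simp: cycle_classes_def)
    then show "\<gamma> \<in> unoriented ` {p. set p \<subseteq> D \<and> mset (map fst p) \<subseteq># \<alpha>}"
      using \<gamma> representative_props[of p] by (auto simp: prime_reduced_cycle_iff)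
  qed
  then show "finite {\<gamma> \<in> cycle_classes G. cycle_monomial G \<gamma> \<subseteq># \<alpha>}"
    using finite_bounded_lists finite_subset by blast
next
  fix \<gamma> assume "\<gamma> \<in> cycle_classes G"
  then obtain p where "prime_reduced_cycle G p" "\<gamma> = unoriented p"
    by (auto simp: cycle_classes_def)
  then show "cycle_monomial G \<gamma> \<noteq> {#}"
    using representative_props[of p] by (auto simp: prime_reduced_cycle_def)
qed

abbreviation "series \<equiv> product_series class_coeff (cycle_monomial G) (cycle_classes G)"

text \<open>No incidence condition is imposed: \<open>cycle_weight\<close> includes the step from
  the last entry to the first and vanishes unless the sequence is a reduced closed walk.\<close>

definition closed_walks :: "'e \<Rightarrow> 'e multiset \<Rightarrow> 'e dedge list set" where
  "closed_walks e \<alpha> = {p. p \<noteq> [] \<and> hd p = (e, True) \<and> set p \<subseteq> D \<and> mset (map fst p) = \<alpha>}"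

definition walk_sum :: "'e \<Rightarrow> 'e multiset \<Rightarrow> real" where
  "walk_sum e \<alpha> = (\<Sum>p\<in>closed_walks e \<alpha>. cycle_weight p)"

lemma finite_closed_walks: "finite (closed_walks e \<alpha>)"
  unfolding closed_walks_def by (rule finite_subset[OF _ finite_bounded_lists[of \<alpha>]]) auto

text \<open>The logarithmic derivative of a factor \<open>1 - w * x^\<mu>\<close> is a negative
  multiple of the geometric series of \<open>w * x^\<mu>\<close>, whose terms belong to the powers
  of the cycle. By uniqueness of primitive roots the powers of prime cycles are exactly the closed
  walks of nonzero weight, and the degree of a class in \<open>e\<close> is the number of its cycles
  that start with \<open>e\<close> forward.\<close>

lemma series_logarithmic_derivative:
  "real (count \<alpha> e) * series \<alpha> = - (\<Sum>\<beta> | \<beta> \<subseteq># \<alpha>. series (\<alpha> - \<beta>) * walk_sum e \<beta>)"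
proof -
  let ?m = "\<lambda>p :: 'e dedge list. mset (map fst p)"
  define P where "P = {p. p \<noteq> [] \<and> hd p = (e, True) \<and> set p \<subseteq> D \<and> ?m p \<subseteq># \<alpha>}"
  define Q where "Q = {q. prime_reduced_cycle G q \<and> hd q = (e, True) \<and> ?m q \<subseteq># \<alpha>}"
  define M where "M q = {m. 0 < m \<and> repeat_mset m (?m q) \<subseteq># \<alpha>}" for q
  define g where "g p = series (\<alpha> - ?m p) * cycle_weight p" for p
  have finP: "finite P" unfolding P_def
    by (rule finite_subset[OF _ finite_bounded_lists[of \<alpha>]]) auto
  have finQ: "finite Q" unfolding Q_def
    by (rule finite_subset[OF _ finite_bounded_lists[of \<alpha>]]) (auto simp: prime_reduced_cycle_iff)
  have finM: "finite (M q)" if "q \<in> Q" for q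
  proof -
    have "?m q \<noteq> {#}" using that by (auto simp: Q_def prime_reduced_cycle_def)
    from finite_repeat_mset_subset[OF this, of \<alpha>] show ?thesis
      unfolding M_def by (rule rev_finite_subset) auto
  qed
  have Qne: "q \<noteq> []" "primitive q" if "q \<in> Q" for q
    using that by (auto simp: Q_def prime_reduced_cycle_iff primitive_def)
  have inj: "inj_on (\<lambda>(q, m). concat (replicate m q)) (Sigma Q M)"
  proof (rule inj_onI, clarify)
    fix q m r n assume "q \<in> Q" "m \<in> M q" "r \<in> Q" "n \<in> M r"
      and "concat (replicate m q) = concat (replicate n r)"
    then show "q = r \<and> m = n"
      using primitive_root_unique[OF Qne(2)[of q] Qne(2)[of r], of m n] unfolding M_def by blast
  qed
  \<comment> \<open>The weight of a power is the power of the weight, so nonvanishing passes from a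
    walk to its primitive root and back.\<close>
  have img: "(\<lambda>(q, m). concat (replicate m q)) ` Sigma Q M = {p \<in> P. cycle_weight p \<noteq> 0}"
  proof (intro equalityI subsetI)
    fix p assume "p \<in> (\<lambda>(q, m). concat (replicate m q)) ` Sigma Q M"
    then obtain q m where q: "q \<in> Q" "m \<in> M q" and p: "p = concat (replicate m q)" by auto
    have m: "0 < m" "repeat_mset m (?m q) \<subseteq># \<alpha>" using q(2) by (auto simp: M_def)
    have hd: "hd p = hd q" "p \<noteq> []"
      using Qne[OF q(1)] m(1) by (cases m; auto simp: p)+
    moreover have "?m p \<subseteq># \<alpha>"
      unfolding p mset_map_concat_replicate by (rule m(2))
    moreover have "set p \<subseteq> D" using q(1) by (auto simp: p Q_def prime_reduced_cycle_iff)
    moreover have "cycle_weight p \<noteq> 0"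
      using q(1) Qne[OF q(1)] by (simp add: p cycle_weight_power Q_def prime_reduced_cycle_iff)
    ultimately show "p \<in> {p \<in> P. cycle_weight p \<noteq> 0}" using q(1) by (auto simp: P_def Q_def)
  next
    fix p assume p: "p \<in> {p \<in> P. cycle_weight p \<noteq> 0}"
    then obtain q m where qm: "primitive q" "0 < m" "p = concat (replicate m q)"
      using primitive_root_exists[of p] by (auto simp: P_def)
    then have q: "q \<noteq> []" by (auto simp: primitive_def)
    obtain k where k: "m = Suc k" using qm(2) by (cases m) auto
    have "?m p \<subseteq># \<alpha>" using p unfolding P_def by blast
    then have "repeat_mset m (?m q) \<subseteq># \<alpha>" unfolding qm(3) mset_map_concat_replicate .
    moreover have "?m q \<subseteq># repeat_mset m (?m q)" unfolding k by simp
    ultimately have "?m q \<subseteq># \<alpha>" "m \<in> M q"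
      using qm(2) subset_mset.order_trans unfolding M_def by blast+
    moreover have "hd q = (e, True)" "set q \<subseteq> D" using p q unfolding P_def qm(3) k by auto
    moreover have "cycle_weight q \<noteq> 0"
      using p cycle_weight_power[OF q, of m] qm(2) unfolding qm(3) by (auto simp: zero_power)
    ultimately show "p \<in> (\<lambda>(q, m). concat (replicate m q)) ` Sigma Q M"
      using qm(1,3) by (force simp: Q_def prime_reduced_cycle_iff)
  qed
  have "(\<Sum>\<beta> | \<beta> \<subseteq># \<alpha>. series (\<alpha> - \<beta>) * walk_sum e \<beta>) =
      (\<Sum>\<beta> | \<beta> \<subseteq># \<alpha>. \<Sum>p | p \<in> P \<and> ?m p = \<beta>. g p)"
    unfolding walk_sum_def sum_distrib_left
    by (intro sum.cong refl) (auto simp: closed_walks_def P_def g_def)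
  also have "\<dots> = sum g P"
    by (rule sum.group) (use finP finite_submultisets in \<open>auto simp: P_def\<close>)
  also have "\<dots> = sum g {p \<in> P. cycle_weight p \<noteq> 0}"
    by (intro sum.mono_neutral_right finP) (auto simp: g_def)
  also have "\<dots> = (\<Sum>(q, m)\<in>Sigma Q M. g (concat (replicate m q)))"
    unfolding img[symmetric] by (subst sum.reindex[OF inj]) (auto intro: sum.cong)
  also have "\<dots> = (\<Sum>q\<in>Q. \<Sum>m\<in>M q. g (concat (replicate m q)))"
    by (rule sum.Sigma[symmetric]) (use finQ finM in auto)
  \<comment> \<open>Summing over the exponents removes the factor of the class of \<open>q\<close>
    from the product.\<close>
  also have "\<dots> = (\<Sum>q\<in>Q. - class_coeff (unoriented q) *
      F (cycle_classes G - {unoriented q}) (\<alpha> - cycle_monomial G (unoriented q)))"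
  proof (intro sum.cong refl)
    fix q assume q: "q \<in> Q"
    then have prc: "prime_reduced_cycle G q" by (simp add: Q_def)
    then have \<gamma>: "unoriented q \<in> cycle_classes G" by (simp add: cycle_classes_def)
    note rep = representative_props[OF prc]
    have c: "- class_coeff (unoriented q) = cycle_weight q" by (simp add: class_coeff_def rep)
    have "(\<Sum>m\<in>M q. g (concat (replicate m q))) =
      (\<Sum>m | 0 < m \<and> repeat_mset m (cycle_monomial G (unoriented q)) \<subseteq># \<alpha>.
         (- class_coeff (unoriented q)) ^ m *
           series (\<alpha> - repeat_mset m (cycle_monomial G (unoriented q))))"
      unfolding c rep M_def g_def mset_map_concat_replicate cycle_weight_power[OF Qne(1)[OF q]]
      by (simp add: mult.commute)
    also have "\<dots> = - class_coeff (unoriented q) *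
      F (cycle_classes G - {unoriented q}) (\<alpha> - cycle_monomial G (unoriented q))"
      using product_series_geometric[OF \<gamma>, of \<alpha>] q by (simp add: rep Q_def)
    finally show "(\<Sum>m\<in>M q. g (concat (replicate m q))) = - class_coeff (unoriented q) *
      F (cycle_classes G - {unoriented q}) (\<alpha> - cycle_monomial G (unoriented q))" .
  qed
  \<comment> \<open>Grouping the prime cycles by their class produces the multiplicities of
    \<open>card_cycles_from\<close>, which are the degrees needed for
    \<open>product_series_derivative\<close>.\<close>
  also have "\<dots> = (\<Sum>\<gamma> | \<gamma> \<in> cycle_classes G \<and> cycle_monomial G \<gamma> \<subseteq># \<alpha>.
      \<Sum>q | q \<in> Q \<and> unoriented q = \<gamma>. - class_coeff (unoriented q) *
      F (cycle_classes G - {unoriented q}) (\<alpha> - cycle_monomial G (unoriented q)))"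
    by (rule sum.group[symmetric])
      (use finQ locally_finite in \<open>auto simp: Q_def cycle_classes_def representative_props\<close>)
  also have "\<dots> = (\<Sum>\<gamma> | \<gamma> \<in> cycle_classes G \<and> cycle_monomial G \<gamma> \<subseteq># \<alpha>.
      - (real (count (cycle_monomial G \<gamma>) e) * (class_coeff \<gamma> *
      F (cycle_classes G - {\<gamma>}) (\<alpha> - cycle_monomial G \<gamma>))))"
  proof (intro sum.cong refl)
    fix \<gamma> assume \<gamma>: "\<gamma> \<in> {\<gamma>. \<gamma> \<in> cycle_classes G \<and> cycle_monomial G \<gamma> \<subseteq># \<alpha>}"
    then obtain p where p: "prime_reduced_cycle G p" "\<gamma> = unoriented p"
      by (auto simp: cycle_classes_def)
    have "?m q \<subseteq># \<alpha>" if "prime_reduced_cycle G q" "unoriented q = unoriented p" for q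
      using representative_props(4)[OF that(1)] \<gamma> that(2) p(2) by (simp del: mset_map)
    then have "{q. q \<in> Q \<and> unoriented q = \<gamma>} =
        {q. prime_reduced_cycle G q \<and> hd q = (e, True) \<and> unoriented q = unoriented p}"
      unfolding Q_def p(2) by blast
    then have "card {q. q \<in> Q \<and> unoriented q = \<gamma>} = count (cycle_monomial G \<gamma>) e"
      using card_cycles_from[OF p(1), of e] by (simp add: p(2) representative_props(4)[OF p(1)])
    then show "(\<Sum>q | q \<in> Q \<and> unoriented q = \<gamma>. - class_coeff (unoriented q) *
      F (cycle_classes G - {unoriented q}) (\<alpha> - cycle_monomial G (unoriented q))) =
      - (real (count (cycle_monomial G \<gamma>) e) * (class_coeff \<gamma> *
      F (cycle_classes G - {\<gamma>}) (\<alpha> - cycle_monomial G \<gamma>)))" by simp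
  qed
  finally show ?thesis
    using product_series_derivative[of \<alpha> e] by (simp add: sum_negf)
qed

end

section \<open>First returns, cancellation of backward walks, and the recursion in one
  variable\<close>

context signed_walks
begin

definition first_returns :: "'e \<Rightarrow> 'e multiset \<Rightarrow> 'e dedge list set" where
  "first_returns e \<alpha> = {p \<in> closed_walks e \<alpha>. e \<notin> fst ` set (tl p)}"

definition return_sum :: "'e \<Rightarrow> 'e multiset \<Rightarrow> real" where
  "return_sum e \<alpha> = (\<Sum>p\<in>first_returns e \<alpha>. cycle_weight p)"

text \<open>A first return uses \<open>e\<close> exactly once, so the series of first returns is
  homogeneous of degree one in \<open>x_e\<close>.\<close>

lemma return_sum_eq_0: "count \<alpha> e \<noteq> 1 \<Longrightarrow> return_sum e \<alpha> = 0"
proof -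
  assume "count \<alpha> e \<noteq> 1"
  have False if "p \<in> first_returns e \<alpha>" for p
  proof -
    have "e \<notin> fst ` set (tl p)" "p \<noteq> []" "hd p = (e, True)" "mset (map fst p) = \<alpha>"
      using that by (auto simp: first_returns_def closed_walks_def)
    moreover have "count (mset (map fst (tl p))) e = 0"
      using calculation(1) by (simp add: count_eq_zero_iff)
    ultimately have "count \<alpha> e = 1" by (cases p) auto
    then show False using \<open>count \<alpha> e \<noteq> 1\<close> by blast
  qed
  then have "first_returns e \<alpha> = {}" by blast
  then show ?thesis by (simp only: return_sum_def sum.empty)
qed

text \<open>The reversed sequence again runs from \<open>e\<close> forward to \<open>e\<close>
  backward, but the two end signs in \<open>path_weight_inverse\<close> are opposite.\<close>

lemma path_weight_reverse_piece:
  "path_weight ((e, True) # inverse_cycle P @ [(e, False)]) =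
   - path_weight ((e, True) # P @ [(e, False)])"
proof -
  have "\<eta> (e, False) = - \<eta> (e, True)" using \<eta>_dinv[of "(e, True)"] by (simp add: dinv_def)
  then have "\<eta> (e, True) * path_weight ((e, True) # inverse_cycle P @ [(e, False)]) =
      \<eta> (e, True) * - path_weight ((e, True) # P @ [(e, False)])"
    using path_weight_inverse[of "(e, True) # P @ [(e, False)]"] by (simp add: dinv_def)
  then show ?thesis using \<eta>_nonzero[of "(e, True)"] by (simp only: mult_cancel_left) simp
qed

text \<open>Between the last traversal of \<open>e\<close> before its first backward traversal and that
  traversal, the walk avoids \<open>e\<close>.\<close>

definition flip :: "'e \<Rightarrow> 'e dedge list \<Rightarrow> 'e dedge list" where
  "flip e p = (let u = rev (takeWhile (\<lambda>a. a \<noteq> (e, False)) p) in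
     rev (dropWhile (\<lambda>a. fst a \<noteq> e) u) @ inverse_cycle (rev (takeWhile (\<lambda>a. fst a \<noteq> e) u)) @
     dropWhile (\<lambda>a. a \<noteq> (e, False)) p)"

lemma flip_eq:
  assumes "(e, False) \<notin> set x" "e \<notin> fst ` set P"
  shows "flip e (x @ (e, True) # P @ (e, False) # y) =
    x @ (e, True) # inverse_cycle P @ (e, False) # y"
proof -
  have P: "\<forall>a\<in>set P. a \<noteq> (e, False) \<and> fst a \<noteq> e" using assms(2) by force
  have x: "\<forall>a\<in>set x. a \<noteq> (e, False)" using assms(1) by blast
  have 1: "takeWhile (\<lambda>a. a \<noteq> (e, False)) (x @ (e, True) # P @ (e, False) # y) = x @ (e, True) # P"
    using x P by (simp add: takeWhile_append2)
  have 2: "dropWhile (\<lambda>a. a \<noteq> (e, False)) (x @ (e, True) # P @ (e, False) # y) = (e, False) # y"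
    using x P by (simp add: dropWhile_append2)
  have 3: "takeWhile (\<lambda>a. fst a \<noteq> e) (rev P @ (e, True) # rev x) = rev P"
    using P by (subst takeWhile_append2) auto
  have 4: "dropWhile (\<lambda>a. fst a \<noteq> e) (rev P @ (e, True) # rev x) = (e, True) # rev x"
    using P by (subst dropWhile_append2) auto
  have 5: "rev (x @ (e, True) # P) = rev P @ (e, True) # rev x" by simp
  show ?thesis unfolding flip_def 1 2 Let_def 5 3 4 by simp
qed

lemma flip_decomposition:
  assumes "p \<in> closed_walks e \<alpha>" "(e, False) \<in> set p"
  obtains x P y where "p = x @ (e, True) # P @ (e, False) # y"
    "(e, False) \<notin> set x" "e \<notin> fst ` set P"
proof -
  obtain u y where u: "p = u @ (e, False) # y" "(e, False) \<notin> set u"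
    using split_list_first[OF assms(2)] by blast
  have "u \<noteq> []" "hd u = (e, True)"
    using assms(1) u by (cases u; auto simp: closed_walks_def)+
  then have "(e, True) \<in> set u" by (metis hd_in_set)
  then obtain x P where x: "u = x @ (e, True) # P" "(e, True) \<notin> set P"
    using split_list_last by metis
  have "e \<notin> fst ` set P"
  proof
    assume "e \<in> fst ` set P"
    then obtain d where "(e, d) \<in> set P" by auto
    then show False using x u(2) by (cases d) auto
  qed
  with that[of x P y] x u show thesis by auto
qed

text \<open>\<open>flip e\<close> is an involution that negates weights, so the sum equals its own
  negative.\<close>

lemma backward_walks_cancel:
  "(\<Sum>p | p \<in> closed_walks e \<alpha> \<and> (e, False) \<in> set p. cycle_weight p) = 0"
proof -
  let ?B = "{p. p \<in> closed_walks e \<alpha> \<and> (e, False) \<in> set p}"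
  have *: "flip e p \<in> ?B \<and> flip e (flip e p) = p \<and> cycle_weight (flip e p) = - cycle_weight p"
    if p: "p \<in> ?B" for p
  proof -
    obtain x P y where eq: "p = x @ (e, True) # P @ (e, False) # y"
      and av: "(e, False) \<notin> set x" "e \<notin> fst ` set P"
      using flip_decomposition p by blast
    have av': "e \<notin> fst ` set (inverse_cycle P)" using av(2) by (simp add: set_inverse_cycle image_image)
    have f: "flip e p = x @ (e, True) # inverse_cycle P @ (e, False) # y"
      unfolding eq by (rule flip_eq[OF av])
    have ff: "flip e (flip e p) = p"
      unfolding f flip_eq[OF av(1) av'] by (simp add: eq)
    have hd: "hd (flip e p) = hd p" unfolding f by (cases x) (auto simp: eq)
    have w: "cycle_weight q = path_weight (x @ [(e, True)]) *
      (path_weight ((e, True) # R @ [(e, False)]) * path_weight ((e, False) # y @ [hd q]))"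
      if "q = x @ (e, True) # R @ (e, False) # y" for q R
    proof -
      have "cycle_weight q = path_weight (x @ (e, True) # R @ (e, False) # y @ [hd q])"
        using cycle_weight_hd[of q] that by simp
      then show ?thesis
        using path_weight_append[of x "(e, True)" "R @ (e, False) # y @ [hd q]"]
          path_weight_append[of "(e, True) # R" "(e, False)" "y @ [hd q]"] by simp
    qed
    have "cycle_weight (flip e p) = - cycle_weight p"
      unfolding w[OF f] w[OF eq] hd path_weight_reverse_piece by simp
    moreover have "set (flip e p) \<subseteq> D" "mset (map fst (flip e p)) = mset (map fst p)"
      using p unfolding f by (auto simp: eq closed_walks_def set_inverse_cycle D_iff
          mset_fst_inverse_cycle[unfolded mset_map])
    ultimately show ?thesis using ff p hd f by (auto simp: closed_walks_def)
  qed
  have "(\<Sum>p\<in>?B. cycle_weight p) = (\<Sum>p\<in>?B. - cycle_weight p)"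
    by (rule sum.reindex_bij_witness[where i = "flip e" and j = "flip e"]) (use * in auto)
  then show ?thesis by (simp add: sum_negf)
qed

definition forward_walks :: "'e \<Rightarrow> 'e multiset \<Rightarrow> 'e dedge list set" where
  "forward_walks e \<alpha> = {p \<in> closed_walks e \<alpha>. (e, False) \<notin> set p}"

lemma walk_sum_forward: "walk_sum e \<alpha> = (\<Sum>p\<in>forward_walks e \<alpha>. cycle_weight p)"
proof -
  have "walk_sum e \<alpha> = (\<Sum>p\<in>forward_walks e \<alpha>. cycle_weight p) +
    (\<Sum>p | p \<in> closed_walks e \<alpha> \<and> (e, False) \<in> set p. cycle_weight p)"
    unfolding walk_sum_def forward_walks_def
    by (subst sum.union_disjoint[symmetric])
      (auto intro!: sum.cong intro: finite_subset[OF _ finite_closed_walks[of e \<alpha>]])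
  then show ?thesis by (simp add: backward_walks_cancel)
qed

lemma first_returns_subset: "first_returns e \<alpha> \<subseteq> forward_walks e \<alpha>"
proof
  fix p assume "p \<in> first_returns e \<alpha>"
  then show "p \<in> forward_walks e \<alpha>"
    by (cases p) (force simp: first_returns_def forward_walks_def closed_walks_def)+
qed

text \<open>A walk using \<open>e\<close> only forward is a first return, or it splits uniquely in
  front of its second traversal of \<open>e\<close> into a first return and a shorter walk of the
  same kind.\<close>

lemma walk_sum_renewal:
  "walk_sum e \<alpha> = return_sum e \<alpha> + (\<Sum>\<beta> | \<beta> \<subseteq># \<alpha>. return_sum e \<beta> * walk_sum e (\<alpha> - \<beta>))"
proof -
  let ?m = "\<lambda>p :: 'e dedge list. mset (map fst p)"
  let ?T = "SIGMA \<beta>:{\<beta>. \<beta> \<subseteq># \<alpha>}. first_returns e \<beta> \<times> forward_walks e (\<alpha> - \<beta>)"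
  have fin: "finite (first_returns e \<beta>)" "finite (forward_walks e \<beta>)" for \<beta>
    using finite_closed_walks[of e \<beta>] by (auto simp: first_returns_def forward_walks_def)
  have "(\<Sum>p\<in>forward_walks e \<alpha> - first_returns e \<alpha>. cycle_weight p) =
      (\<Sum>(\<beta>, q, r)\<in>?T. cycle_weight q * cycle_weight r)"
  proof (rule sum.reindex_bij_witness[symmetric, where i = "\<lambda>p. let q = hd p # takeWhile (\<lambda>a. fst a \<noteq> e) (tl p);
        r = dropWhile (\<lambda>a. fst a \<noteq> e) (tl p) in (?m q, q, r)" and j = "\<lambda>(\<beta>, q, r). q @ r"])
    fix t assume "t \<in> ?T"
    then obtain \<beta> q r where t: "t = (\<beta>, q, r)" "\<beta> \<subseteq># \<alpha>" "q \<in> first_returns e \<beta>"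
      "r \<in> forward_walks e (\<alpha> - \<beta>)" by auto
    obtain q' where q': "q = (e, True) # q'" "e \<notin> fst ` set q'"
      using t(3) by (cases q) (auto simp: first_returns_def closed_walks_def)
    obtain r' where r': "r = (e, True) # r'"
      using t(4) by (cases r) (auto simp: forward_walks_def closed_walks_def)
    have av: "\<forall>a\<in>set q'. fst a \<noteq> e" using q'(2) by force
    have mq: "?m q = \<beta>" and mr: "?m r = \<alpha> - \<beta>"
      using t(3,4) by (auto simp: first_returns_def forward_walks_def closed_walks_def)
    show "(let q = hd (case t of (\<beta>, q, r) \<Rightarrow> q @ r) # takeWhile (\<lambda>a. fst a \<noteq> e) (tl (case t of (\<beta>, q, r) \<Rightarrow> q @ r));
        r = dropWhile (\<lambda>a. fst a \<noteq> e) (tl (case t of (\<beta>, q, r) \<Rightarrow> q @ r)) in (?m q, q, r)) = t"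
      using mq av unfolding t(1) q' r' by (simp add: takeWhile_append2 dropWhile_append2)
    have qf: "q \<in> forward_walks e \<beta>" using t(3) first_returns_subset by blast
    have "?m (q @ r) = \<alpha>" using t(2) mq mr by simp
    moreover have "set (q @ r) \<subseteq> D" "(e, False) \<notin> set (q @ r)"
      using qf t(4) by (auto simp: forward_walks_def closed_walks_def)
    ultimately have "q @ r \<in> forward_walks e \<alpha>"
      by (simp add: forward_walks_def closed_walks_def q')
    moreover have "q @ r \<notin> first_returns e \<alpha>"
      by (auto simp: first_returns_def q' r')
    ultimately show "(case t of (\<beta>, q, r) \<Rightarrow> q @ r) \<in> forward_walks e \<alpha> - first_returns e \<alpha>"
      by (simp add: t)
    show "cycle_weight (case t of (\<beta>, q, r) \<Rightarrow> q @ r) = (case t of (\<beta>, q, r) \<Rightarrow> cycle_weight q * cycle_weight r)"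
      using cycle_weight_append[of q r] by (simp add: t(1) q' r')
  next
    fix p assume p: "p \<in> forward_walks e \<alpha> - first_returns e \<alpha>"
    then obtain p' where p': "p = (e, True) # p'"
      by (cases p) (auto simp: forward_walks_def closed_walks_def)
    define q where "q = (e, True) # takeWhile (\<lambda>a. fst a \<noteq> e) p'"
    define r where "r = dropWhile (\<lambda>a. fst a \<noteq> e) p'"
    have pqr: "p = q @ r" by (simp add: p' q_def r_def)
    have "e \<in> fst ` set p'" using p by (auto simp: p' first_returns_def forward_walks_def)
    then have "r \<noteq> []" "fst (hd r) = e"
      unfolding r_def using hd_dropWhile[of "\<lambda>a. fst a \<noteq> e" p'] by (auto simp: dropWhile_eq_Nil_conv)
    moreover have D: "(e, False) \<notin> set p" "set p \<subseteq> D" "?m p = \<alpha>"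
      using p by (auto simp: forward_walks_def closed_walks_def)
    ultimately have hr: "hd r = (e, True)"
      unfolding pqr by (metis (full_types) Un_iff hd_in_set prod.collapse set_append)
    have "e \<notin> fst ` set (takeWhile (\<lambda>a. fst a \<noteq> e) p')" by (auto dest: set_takeWhileD)
    then have 1: "q \<in> first_returns e (?m q)"
      using D unfolding pqr by (auto simp: first_returns_def closed_walks_def q_def)
    have sub: "?m q \<subseteq># \<alpha>" "?m r = \<alpha> - ?m q" using D(3) unfolding pqr by auto
    then have 2: "r \<in> forward_walks e (\<alpha> - ?m q)"
      using D \<open>r \<noteq> []\<close> hr unfolding pqr by (auto simp: forward_walks_def closed_walks_def)
    have *: "(let q = hd p # takeWhile (\<lambda>a. fst a \<noteq> e) (tl p);
        r = dropWhile (\<lambda>a. fst a \<noteq> e) (tl p) in (?m q, q, r)) = (?m q, q, r)"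
      by (simp add: p' q_def r_def)
    show "(let q = hd p # takeWhile (\<lambda>a. fst a \<noteq> e) (tl p);
        r = dropWhile (\<lambda>a. fst a \<noteq> e) (tl p) in (?m q, q, r)) \<in> ?T"
      unfolding * using 1 2 sub(1) by simp
    show "(case let q = hd p # takeWhile (\<lambda>a. fst a \<noteq> e) (tl p);
        r = dropWhile (\<lambda>a. fst a \<noteq> e) (tl p) in (?m q, q, r) of (\<beta>, q, r) \<Rightarrow> q @ r) = p"
      unfolding * by (simp add: pqr)
  qed
  also have "\<dots> = (\<Sum>\<beta> | \<beta> \<subseteq># \<alpha>. \<Sum>(q, r)\<in>first_returns e \<beta> \<times> forward_walks e (\<alpha> - \<beta>).
      cycle_weight q * cycle_weight r)"
    by (subst sum.Sigma) (use fin finite_submultisets in \<open>auto simp: case_prod_beta\<close>)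
  also have "\<dots> = (\<Sum>\<beta> | \<beta> \<subseteq># \<alpha>. return_sum e \<beta> * walk_sum e (\<alpha> - \<beta>))"
    by (simp add: return_sum_def walk_sum_forward sum_product sum.cartesian_product)
  finally show ?thesis
    unfolding walk_sum_forward[of e \<alpha>] return_sum_def
    using sum.subset_diff[OF first_returns_subset fin(2), of cycle_weight] by simp
qed

text \<open>With \<open>D = x_e d/dx_e\<close> and the walk series \<open>W\<close>, the equations
  \<open>D S = - S * W\<close> and \<open>W = R + R * W\<close> give
  \<open>D S = - R * S + R * D S\<close>. Where the return sum of \<beta> is nonzero, the degree of
  \<open>\<alpha> - \<beta>\<close> in \<open>e\<close> is one less than that of \<alpha>, and the
  two terms combine to the factor \<open>count \<alpha> e - 2\<close>.\<close>

lemma series_recursion: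
  "real (count \<alpha> e) * series \<alpha> =
     (\<Sum>\<beta> | \<beta> \<subseteq># \<alpha>. (real (count \<alpha> e) - 2) * (return_sum e \<beta> * series (\<alpha> - \<beta>)))"
proof -
  have "real (count \<alpha> e) * series \<alpha> =
      - (\<Sum>\<beta> | \<beta> \<subseteq># \<alpha>. series (\<alpha> - \<beta>) * (return_sum e \<beta> +
         (\<Sum>\<gamma> | \<gamma> \<subseteq># \<beta>. return_sum e \<gamma> * walk_sum e (\<beta> - \<gamma>))))"
    unfolding series_logarithmic_derivative walk_sum_renewal[symmetric] ..
  also have "\<dots> = - (\<Sum>\<beta> | \<beta> \<subseteq># \<alpha>. return_sum e \<beta> * series (\<alpha> - \<beta>)) +
      (\<Sum>\<gamma> | \<gamma> \<subseteq># \<alpha>. return_sum e \<gamma> * (real (count (\<alpha> - \<gamma>) e) * series (\<alpha> - \<gamma>)))"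
    unfolding distrib_left sum.distrib sum_convolution_assoc series_logarithmic_derivative
    by (simp add: sum_negf mult.commute)
  also have "\<dots> = (\<Sum>\<beta> | \<beta> \<subseteq># \<alpha>.
      return_sum e \<beta> * (real (count (\<alpha> - \<beta>) e) * series (\<alpha> - \<beta>)) - return_sum e \<beta> * series (\<alpha> - \<beta>))"
    by (simp add: sum_subtractf)
  also have "\<dots> = (\<Sum>\<beta> | \<beta> \<subseteq># \<alpha>. (real (count \<alpha> e) - 2) * (return_sum e \<beta> * series (\<alpha> - \<beta>)))"
  proof (intro sum.cong refl)
    fix \<beta> assume \<beta>: "\<beta> \<in> {\<beta>. \<beta> \<subseteq># \<alpha>}"
    then have "count \<beta> e \<le> count \<alpha> e" by (simp add: mset_subset_eq_count)
    then show "return_sum e \<beta> * (real (count (\<alpha> - \<beta>) e) * series (\<alpha> - \<beta>)) -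
        return_sum e \<beta> * series (\<alpha> - \<beta>) =
        (real (count \<alpha> e) - 2) * (return_sum e \<beta> * series (\<alpha> - \<beta>))"
      using return_sum_eq_0[of \<beta> e]
      by (cases "count \<beta> e = 1") (auto simp: of_nat_diff algebra_simps)
  qed
  finally show ?thesis .
qed

text \<open>The factor \<open>count \<alpha> e - 2\<close> of the recursion kills degree 2; in
  higher degree every term refers back to a smaller monomial of degree at least 2.\<close>

lemma series_eq_0: "2 \<le> count \<alpha> e \<Longrightarrow> series \<alpha> = 0"
proof (induction "size \<alpha>" arbitrary: \<alpha> rule: less_induct)
  case less
  show ?case
  proof (cases "count \<alpha> e = 2")
    case True
    then show ?thesis using series_recursion[of \<alpha> e] by simp
  next
    case False
    have "return_sum e \<beta> * series (\<alpha> - \<beta>) = 0" if \<beta>: "\<beta> \<subseteq># \<alpha>" for \<beta>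
    proof (cases "count \<beta> e = 1")
      case True
      then have "\<beta> \<noteq> {#}" by auto
      then have "size (\<alpha> - \<beta>) < size \<alpha>"
        using size_mset_mono[OF \<beta>] by (simp add: size_Diff_submset[OF \<beta>] nonempty_has_size[symmetric])
          (metis \<beta> diff_less nonempty_has_size size_mset_mono order_less_le_trans)
      moreover have "2 \<le> count (\<alpha> - \<beta>) e" using True False less.prems by simp
      ultimately show ?thesis using less.hyps[of "\<alpha> - \<beta>"] by simp
    qed (simp add: return_sum_eq_0)
    then have "real (count \<alpha> e) * series \<alpha> = 0"
      unfolding series_recursion by (intro sum.neutral) auto
    then show ?thesis using less.prems by auto
  qed
qed

text \<open>In degree one the recursion has the factor \<open>-1\<close> and expands the coefficient
  over the first returns to \<open>e\<close>.\<close>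

lemma series_linear:
  assumes "count \<alpha> e = 1"
  shows "series \<alpha> = - (\<Sum>p | p \<noteq> [] \<and> hd p = (e, True) \<and> set p \<subseteq> D \<and> e \<notin> fst ` set (tl p) \<and>
    mset (map fst p) \<subseteq># \<alpha>. cycle_weight p * series (\<alpha> - mset (map fst p)))" (is "_ = - sum ?g ?P")
proof -
  have "series \<alpha> = - (\<Sum>\<beta> | \<beta> \<subseteq># \<alpha>. return_sum e \<beta> * series (\<alpha> - \<beta>))"
    using series_recursion[of \<alpha> e] assms by (simp add: sum_negf)
  also have "(\<Sum>\<beta> | \<beta> \<subseteq># \<alpha>. return_sum e \<beta> * series (\<alpha> - \<beta>)) =
      (\<Sum>\<beta> | \<beta> \<subseteq># \<alpha>. \<Sum>p | p \<in> ?P \<and> mset (map fst p) = \<beta>. ?g p)"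
    unfolding return_sum_def sum_distrib_right
    by (intro sum.cong refl) (auto simp: first_returns_def closed_walks_def)
  also have "\<dots> = sum ?g ?P"
    by (rule sum.group)
      (auto intro: finite_subset[OF _ finite_bounded_lists[of \<alpha>]] simp: finite_submultisets)
  finally show ?thesis .
qed

lemma series_empty: "series {#} = 1"
proof -
  have "{F. finite F \<and> F \<subseteq> cycle_classes G \<and> (\<Sum>\<gamma>\<in>F. cycle_monomial G \<gamma>) = {#}} = {{}}"
    using \<mu>_nonempty member_subset_sum_mset[where \<mu> = "cycle_monomial G"] by fastforce
  then show ?thesis by (simp only: product_series_def) simp
qed

end


section \<open>Chord diagrams\<close>

definition sg :: "'p::linorder \<Rightarrow> 'p \<Rightarrow> real" where
  "sg a b = (if a < b then 1 else if b < a then -1 else 0)"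

lemma sg_swap: "sg a b = - sg b a" by (auto simp: sg_def)

lemma sg_eq_0_iff [simp]: "sg a b = 0 \<longleftrightarrow> a = b" by (auto simp: sg_def)

lemma sg_same [simp]: "sg a a = 0" by simp

lemma sg_mult_self: "a \<noteq> b \<Longrightarrow> sg a b * sg a b = 1" by (auto simp: sg_def)

text \<open>In increasing order of \<open>x\<close> the terms are 1, -1, 1, and so on.\<close>

lemma sum_alternating_max:
  "finite (U :: 'p::linorder set) \<Longrightarrow>
    (\<Sum>x\<in>U. (-1) ^ card {y \<in> U. y < x}) = (if odd (card U) then 1 else 0 :: real)"
proof (induction U rule: finite_linorder_max_induct)
  case (insert b A)
  have "b \<notin> A" using insert by auto
  have "(\<Sum>x\<in>A. (-1) ^ card {y \<in> insert b A. y < x}) = (\<Sum>x\<in>A. (-1) ^ card {y \<in> A. y < x} :: real)"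
  proof (intro sum.cong refl)
    fix x assume "x \<in> A"
    then have "{y \<in> insert b A. y < x} = {y \<in> A. y < x}" using insert by force
    then show "(-1) ^ card {y \<in> insert b A. y < x} = ((-1) ^ card {y \<in> A. y < x} :: real)" by simp
  qed
  moreover have "{y \<in> insert b A. y < b} = A" using insert by auto
  ultimately show ?case using insert \<open>b \<notin> A\<close> by (auto simp: power_minus_odd power_minus_even)
qed simp

lemma sum_alternating_min:
  "finite (U :: 'p::linorder set) \<Longrightarrow>
    (\<Sum>x\<in>U. (-1) ^ card {y \<in> U. x < y}) = (if odd (card U) then 1 else 0 :: real)"
proof (induction U rule: finite_linorder_min_induct)
  case (insert b A)
  have "b \<notin> A" using insert by auto
  have "(\<Sum>x\<in>A. (-1) ^ card {y \<in> insert b A. x < y}) = (\<Sum>x\<in>A. (-1) ^ card {y \<in> A. x < y} :: real)"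
  proof (intro sum.cong refl)
    fix x assume "x \<in> A"
    then have "{y \<in> insert b A. x < y} = {y \<in> A. x < y}" using insert by force
    then show "(-1) ^ card {y \<in> insert b A. x < y} = ((-1) ^ card {y \<in> A. x < y} :: real)" by simp
  qed
  moreover have "{y \<in> insert b A. b < y} = A" using insert by auto
  ultimately show ?case using insert \<open>b \<notin> A\<close> by (auto simp: power_minus_odd power_minus_even)
qed simp

text \<open>A position contributes \<open>-1\<close> exactly when it separates \<open>h\<close> and
  \<open>x\<close>.\<close>

lemma prod_sg_between:
  assumes "finite K" "h \<in> K" "x \<in> K" "h < (x :: 'p::linorder)"
  shows "(\<Prod>p\<in>K - {h, x}. sg h p * sg x p) = (-1) ^ card {y \<in> {y \<in> K. h < y}. y < x}"
proof -
  have "(\<Prod>p\<in>K - {h, x}. sg h p * sg x p) = (\<Prod>p\<in>K - {h, x}. if h < p \<and> p < x then -1 else 1)"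
    by (intro prod.cong refl) (use assms in \<open>auto simp: sg_def\<close>)
  also have "\<dots> = (\<Prod>p\<in>(K - {h, x}) \<inter> {p. h < p \<and> p < x}. -1)"
    using assms by (simp add: prod.If_cases)
  also have "(K - {h, x}) \<inter> {p. h < p \<and> p < x} = {y \<in> {y \<in> K. h < y}. y < x}" by auto
  finally show ?thesis by simp
qed

text \<open>On each side of \<open>h\<close> the signs alternate, starting with 1 at the neighbour
  of \<open>h\<close>. Since \<open>card K - 1\<close> is odd, exactly one side has odd size and
  contributes 1. The identity allows a sign to be distributed over all possible partners of a
  half-edge.\<close>

lemma sum_prod_sg:
  assumes fin: "finite K" and h: "h \<in> K" and ev: "even (card K)"
  shows "(\<Sum>x\<in>K - {h}. \<Prod>p\<in>K - {h, x}. sg h p * sg x p) = 1"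
proof -
  let ?U = "{y \<in> K. h < y}" and ?L = "{y \<in> K. y < h}"
  have K: "K - {h} = ?U \<union> ?L" by auto
  have "card (K - {h}) = card ?U + card ?L" unfolding K by (rule card_Un_disjoint) (use fin in auto)
  then have par: "odd (card ?U) \<longleftrightarrow> even (card ?L)"
    using ev card_Suc_Diff1[OF fin h] by presburger
  have "(\<Sum>x\<in>?U. \<Prod>p\<in>K - {h, x}. sg h p * sg x p) = (\<Sum>x\<in>?U. (-1) ^ card {y \<in> ?U. y < x})"
    by (intro sum.cong refl prod_sg_between) (use fin h in auto)
  moreover have "(\<Sum>x\<in>?L. \<Prod>p\<in>K - {h, x}. sg h p * sg x p) = (\<Sum>x\<in>?L. (-1) ^ card {y \<in> ?L. x < y})"
  proof (intro sum.cong refl)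
    fix x assume x: "x \<in> ?L"
    then have "(\<Prod>p\<in>K - {x, h}. sg x p * sg h p) = (-1) ^ card {y \<in> {y \<in> K. x < y}. y < h}"
      by (intro prod_sg_between) (use fin h in auto)
    moreover have "{y \<in> {y \<in> K. x < y}. y < h} = {y \<in> ?L. x < y}" by auto
    ultimately show "(\<Prod>p\<in>K - {h, x}. sg h p * sg x p) = (-1) ^ card {y \<in> ?L. x < y}"
      by (simp add: insert_commute mult.commute)
  qed
  moreover have "(\<Sum>x\<in>K - {h}. \<Prod>p\<in>K - {h, x}. sg h p * sg x p) =
    (\<Sum>x\<in>?U. \<Prod>p\<in>K - {h, x}. sg h p * sg x p) + (\<Sum>x\<in>?L. \<Prod>p\<in>K - {h, x}. sg h p * sg x p)"
    unfolding K by (rule sum.union_disjoint) (use fin in auto)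
  ultimately show ?thesis using par fin sum_alternating_max[of ?U] sum_alternating_min[of ?L] by simp
qed

text \<open>Positions outside a convex block contribute trivially.\<close>

lemma sum_prod_sg_block:
  assumes fin: "finite P" and K: "K \<subseteq> P" "h \<in> K" "even (card K)"
    and convex: "\<And>a b p. a \<in> K \<Longrightarrow> b \<in> K \<Longrightarrow> p \<in> P \<Longrightarrow> a < p \<Longrightarrow> p < b \<Longrightarrow> p \<in> K"
  shows "(\<Sum>x\<in>K - {h}. \<Prod>p\<in>P - {h, x}. sg h p * sg x p) = 1"
proof -
  have "(\<Prod>p\<in>P - {h, x}. sg h p * sg x p) = (\<Prod>p\<in>K - {h, x}. sg h p * sg x p)" if x: "x \<in> K - {h}" for x
  proof (rule prod.mono_neutral_right)
    show "\<forall>p\<in>P - {h, x} - (K - {h, x}). sg h p * sg x p = 1"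
    proof
      fix p assume p: "p \<in> P - {h, x} - (K - {h, x})"
      then have "\<not> (h < p \<and> p < x)" "\<not> (x < p \<and> p < h)" "p \<noteq> h" "p \<noteq> x"
        using convex[of h x p] convex[of x h p] K(2) x by auto
      then show "sg h p * sg x p = 1" by (auto simp: sg_def)
    qed
  qed (use fin K in auto)
  then have "(\<Sum>x\<in>K - {h}. \<Prod>p\<in>P - {h, x}. sg h p * sg x p) =
      (\<Sum>x\<in>K - {h}. \<Prod>p\<in>K - {h, x}. sg h p * sg x p)"
    by (rule sum.cong[OF refl])
  also have "\<dots> = 1" using fin K finite_subset by (intro sum_prod_sg) auto
  finally show ?thesis .
qed

section \<open>Signs of chord diagrams and their recursion\<close>

lemma prod_Times_bool:
  "finite A \<Longrightarrow> (\<Prod>a\<in>A \<times> (UNIV :: bool set). f a) = (\<Prod>e\<in>A. f (e, True) * f (e, False))"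
proof -
  have "(\<Prod>a\<in>A \<times> (UNIV :: bool set). f a) = (\<Prod>(e, d)\<in>A \<times> (UNIV :: bool set). f (e, d))" by simp
  then show ?thesis by (subst (asm) prod.cartesian_product[symmetric]) (simp add: UNIV_bool mult.commute)
qed

lemma fst_eq_fst_iff: "fst a = fst c \<longleftrightarrow> a = c \<or> a = dinv c"
  by (cases a; cases c) (auto simp: dinv_def)

text \<open>By \<open>hp_convex\<close> the half-edges of a vertex occupy a block of positions, so a
  half-edge of another vertex never separates two of them. By \<open>\<eta>_square\<close> the edge
  signs are 1 or -1.\<close>

locale chord_system =
  fixes G :: "('v, 'e, 'z) graph_scheme" and hp :: "'e dedge \<Rightarrow> 'p::linorder"
    and \<eta> :: "'e dedge \<Rightarrow> real"
  assumes finite_edges': "finite (edges G)"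
    and hp_inj: "\<And>a b. fst a \<in> edges G \<Longrightarrow> fst b \<in> edges G \<Longrightarrow> hp a = hp b \<Longrightarrow> a = b"
    and hp_convex: "\<And>a b c. fst a \<in> edges G \<Longrightarrow> fst b \<in> edges G \<Longrightarrow> fst c \<in> edges G \<Longrightarrow>
      dtail G a = dtail G b \<Longrightarrow> hp a < hp c \<Longrightarrow> hp c < hp b \<Longrightarrow> dtail G c = dtail G a"
    and \<eta>_dinv': "\<And>a. \<eta> (dinv a) = - \<eta> a"
    and \<eta>_square: "\<And>a. \<eta> a * \<eta> a = 1"
begin

definition \<tau> :: "'e dedge \<Rightarrow> 'e dedge \<Rightarrow> real" where
  "\<tau> a b = (if dtail G a = dtail G b then sg (hp a) (hp b) else 0)"

sublocale signed_walks G \<tau> \<eta>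
proof
  fix a b
  show "\<tau> a b = - \<tau> b a" using sg_swap[of "hp a" "hp b"] by (simp add: \<tau>_def)
  show "\<eta> a \<noteq> 0" using \<eta>_square[of a] by auto
  show "\<tau> a b \<noteq> 0 \<longleftrightarrow> dtail G a = dtail G b \<and> a \<noteq> b" if "fst a \<in> edges G" "fst b \<in> edges G"
    using hp_inj[of a b] that by (auto simp: \<tau>_def)
qed (use finite_edges' \<eta>_dinv' in auto)

text \<open>Independent of the reference orientation, since both factors change sign when the edge
  is reversed.\<close>

definition chord_sign :: "'e \<Rightarrow> real" where
  "chord_sign e = \<eta> (e, True) * sg (hp (e, True)) (hp (e, False))"

text \<open>If no end of a chord sits at \<open>x\<close> or \<open>y\<close>, the chord contributes
  \<open>-1\<close> exactly when one of its ends, and not the other, lies between \<open>x\<close>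
  and \<open>y\<close>, that is, when it crosses the chord from \<open>x\<close> to
  \<open>y\<close>.\<close>

definition cross_sign :: "'p \<Rightarrow> 'p \<Rightarrow> 'e set \<Rightarrow> real" where
  "cross_sign x y A = (\<Prod>a\<in>A \<times> UNIV. sg x (hp a) * sg y (hp a))"

definition crossing :: "'e \<Rightarrow> 'e \<Rightarrow> bool" where
  "crossing e f \<longleftrightarrow> cross_sign (hp (e, True)) (hp (e, False)) {f} = -1"

text \<open>Crossing pairs are counted twice among the ordered pairs.\<close>

definition matching_sign :: "'e set \<Rightarrow> real" where
  "matching_sign A = (\<Prod>e\<in>A. chord_sign e) *
     (-1) ^ (card {(e, f). e \<in> A \<and> f \<in> A \<and> e \<noteq> f \<and> crossing e f} div 2)"

lemma crossing_sym: "crossing e f \<longleftrightarrow> crossing f e"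
  unfolding crossing_def cross_sign_def
  using sg_swap[of "hp (f, True)" "hp (e, True)"] sg_swap[of "hp (f, True)" "hp (e, False)"]
    sg_swap[of "hp (f, False)" "hp (e, True)"] sg_swap[of "hp (f, False)" "hp (e, False)"]
  by (simp add: prod_Times_bool mult_ac)

lemma cross_sign_conv_card:
  assumes "finite A" "A \<subseteq> edges G" "e \<in> edges G" "e \<notin> A"
  shows "cross_sign (hp (e, True)) (hp (e, False)) A = (-1) ^ card {f \<in> A. crossing e f}"
proof -
  have "cross_sign (hp (e, True)) (hp (e, False)) A =
      (\<Prod>f\<in>A. cross_sign (hp (e, True)) (hp (e, False)) {f})"
    using assms by (simp add: cross_sign_def prod_Times_bool)
  also have "\<dots> = (\<Prod>f\<in>A. if crossing e f then -1 else 1)"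
  proof (intro prod.cong refl)
    fix f assume f: "f \<in> A"
    have "hp (e, d) \<noteq> hp (f, d')" for d d' using hp_inj[of "(e, d)" "(f, d')"] f assms by auto
    then have "cross_sign (hp (e, True)) (hp (e, False)) {f} \<in> {1, -1}"
      by (auto simp: cross_sign_def prod_Times_bool sg_def)
    then show "cross_sign (hp (e, True)) (hp (e, False)) {f} = (if crossing e f then -1 else 1)"
      by (auto simp: crossing_def)
  qed
  also have "\<dots> = (-1) ^ card {f \<in> A. crossing e f}"
    using assms by (simp add: prod.If_cases Int_def)
  finally show ?thesis .
qed

text \<open>Each crossing of the new chord adds two ordered pairs, which the halving counts as
  one.\<close>

lemma matching_sign_insert:
  assumes "finite A" "A \<subseteq> edges G" "e \<in> edges G" "e \<notin> A"
  shows "matching_sign (insert e A) = matching_sign A * chord_sign e *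
    cross_sign (hp (e, True)) (hp (e, False)) A"
proof -
  let ?C = "\<lambda>A. {(e, f). e \<in> A \<and> f \<in> A \<and> e \<noteq> f \<and> crossing e f}"
  let ?c = "{f \<in> A. crossing e f}"
  have eq: "?C (insert e A) = ?C A \<union> (Pair e ` ?c \<union> (\<lambda>f. (f, e)) ` ?c)"
    using assms(4) crossing_sym by auto
  have "finite (?C A)" by (rule finite_subset[of _ "A \<times> A"]) (use assms in auto)
  then have "card (?C (insert e A)) = card (?C A) + (card (Pair e ` ?c) + card ((\<lambda>f. (f, e)) ` ?c))"
    unfolding eq using assms by (subst card_Un_disjoint, simp, simp, force)+ simp
  moreover have "card (Pair e ` ?c) = card ?c" "card ((\<lambda>f. (f, e)) ` ?c) = card ?c"
    by (auto intro!: card_image inj_onI)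
  ultimately have "card (?C (insert e A)) div 2 = card (?C A) div 2 + card ?c" by simp
  then show ?thesis
    unfolding cross_sign_conv_card[OF assms] matching_sign_def using assms
    by (simp add: power_add mult_ac)
qed

definition balanced :: "'e dedge set \<Rightarrow> bool" where
  "balanced H \<longleftrightarrow> (\<forall>v. even (card {a \<in> H. dtail G a = v}))"

lemma balanced_remove_pair:
  assumes "finite H" "a \<in> H" "b \<in> H" "a \<noteq> b" "dtail G a = dtail G b"
  shows "balanced (H - {a, b}) \<longleftrightarrow> balanced H"
proof -
  have "even (card {c \<in> H - {a, b}. dtail G c = v}) \<longleftrightarrow> even (card {c \<in> H. dtail G c = v})" for v
  proof (cases "dtail G a = v")
    case True
    have "{c \<in> H. dtail G c = v} = insert a (insert b {c \<in> H - {a, b}. dtail G c = v})"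
      using True assms by auto
    then have "card {c \<in> H. dtail G c = v} = Suc (Suc (card {c \<in> H - {a, b}. dtail G c = v}))"
      using assms by simp
    then show ?thesis by simp
  next
    case False
    then have "{c \<in> H - {a, b}. dtail G c = v} = {c \<in> H. dtail G c = v}" using assms by auto
    then show ?thesis by simp
  qed
  then show ?thesis by (simp add: balanced_def)
qed

definition matching_coeff :: "'e set \<Rightarrow> real" where
  "matching_coeff A = (if balanced (A \<times> UNIV) then matching_sign A else 0)"

text \<open>The sign of \<open>A\<close> together with one more chord from the position of \<open>a\<close> to that of \<open>b\<close>.\<close>

definition open_sign :: "'e set \<Rightarrow> 'e dedge \<Rightarrow> 'e dedge \<Rightarrow> real" where
  "open_sign A a b = matching_sign A * sg (hp a) (hp b) * cross_sign (hp a) (hp b) A"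

definition open_coeff :: "'e set \<Rightarrow> 'e dedge \<Rightarrow> 'e dedge \<Rightarrow> real" where
  "open_coeff A a b = (if balanced (A \<times> UNIV \<union> {a, b}) then open_sign A a b else 0)"

text \<open>Joining \<open>b\<close> with \<open>c\<close> replaces the open chord from
  \<open>a\<close> to \<open>b\<close> and the chord of \<open>c\<close> by one open chord from
  \<open>a\<close> to \<open>dinv c\<close>. The signs against all other positions cancel in
  squares, except those telling which positions separate \<open>b\<close> and \<open>c\<close>;
  these form the product on the right.\<close>

lemma open_sign_step:
  assumes A: "finite A" "A \<subseteq> edges G" and ab: "fst a \<in> edges G" "fst a \<notin> A" "fst b \<in> edges G" "fst b \<notin> A" "a \<noteq> b"
    and c: "fst c \<in> A"
  shows "sg (hp b) (hp c) * \<eta> c * open_sign (A - {fst c}) a (dinv c) =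
    open_sign A a b * (\<Prod>p\<in>hp ` (A \<times> UNIV \<union> {a, b}) - {hp b, hp c}. sg (hp b) p * sg (hp c) p)"
proof -
  define B where "B = A - {fst c}"
  have B: "finite B" "B \<subseteq> edges G" "fst c \<in> edges G" "fst c \<notin> B" "A = insert (fst c) B"
    using A c by (auto simp: B_def)
  have ne: "hp x \<noteq> hp y" if "x \<noteq> y" "fst x \<in> edges G" "fst y \<in> edges G" for x y
    using hp_inj that by blast
  have fab: "fst a \<noteq> fst c" "fst b \<noteq> fst c" using ab c by auto
  have d: "hp a \<noteq> hp b" "hp a \<noteq> hp c" "hp a \<noteq> hp (dinv c)" "hp b \<noteq> hp c" "hp b \<noteq> hp (dinv c)" "hp c \<noteq> hp (dinv c)"
    by (rule ne; use ab B(3) fab in auto)+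
  have dB: "hp x \<noteq> hp y" if "x \<in> {a, b, c, dinv c}" "y \<in> B \<times> UNIV" for x y
  proof (rule ne)
    have y: "fst y \<in> B" using that(2) by (simp add: mem_Times_iff)
    have "fst x \<in> edges G \<and> fst x \<notin> B" using that(1) ab B(3,4) by (auto simp: B_def)
    then show "x \<noteq> y" "fst x \<in> edges G" "fst y \<in> edges G" using y B(2) by auto
  qed
  have cs: "chord_sign (fst c) = \<eta> c * sg (hp c) (hp (dinv c))"
    using \<eta>_dinv'[of c] sg_swap[of "hp c" "hp (dinv c)"]
    by (cases c; cases "snd c") (auto simp: chord_sign_def dinv_def)
  have crs: "cross_sign (hp (fst c, True)) (hp (fst c, False)) B = cross_sign (hp c) (hp (dinv c)) B"
    by (cases c; cases "snd c") (auto simp: cross_sign_def dinv_def mult.commute)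
  have ms: "matching_sign A = matching_sign B * (\<eta> c * sg (hp c) (hp (dinv c))) * cross_sign (hp c) (hp (dinv c)) B"
    unfolding B(5) matching_sign_insert[OF B(1-4)] cs crs ..
  have AU: "A \<times> UNIV = insert c (insert (dinv c) (B \<times> UNIV))"
    unfolding B(5) by (simp add: set_eq_iff mem_Times_iff fst_eq_fst_iff)
  have cn: "c \<notin> insert (dinv c) (B \<times> UNIV)" "dinv c \<notin> B \<times> UNIV"
    using B(4) by (simp_all add: mem_Times_iff)
  have crA: "cross_sign x y A = sg x (hp c) * sg y (hp c) * (sg x (hp (dinv c)) * sg y (hp (dinv c))) * cross_sign x y B"
    for x y
    unfolding cross_sign_def AU using B(1) cn by simp
  have "inj_on hp (A \<times> UNIV \<union> {a, b})"
    by (rule inj_onI, rule hp_inj) (use ab A in auto)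
  then have "hp ` (A \<times> UNIV \<union> {a, b} - {b, c}) = hp ` (A \<times> UNIV \<union> {a, b}) - hp ` {b, c}"
    by (rule inj_on_image_set_diff) (use c in \<open>auto simp: mem_Times_iff\<close>)
  moreover have "A \<times> UNIV \<union> {a, b} - {b, c} = insert a (insert (dinv c) (B \<times> UNIV))"
  proof -
    have "a \<noteq> c" "b \<noteq> dinv c" "b \<notin> B \<times> UNIV"
      using fab ab(4) by (auto simp: B_def mem_Times_iff)
    then show ?thesis unfolding AU using cn ab(5) by blast
  qed
  ultimately have "hp ` (A \<times> UNIV \<union> {a, b}) - {hp b, hp c} = hp ` (insert a (insert (dinv c) (B \<times> UNIV)))"
    by simp
  moreover have "inj_on hp (insert a (insert (dinv c) (B \<times> UNIV)))"
    by (rule inj_onI, rule hp_inj) (use ab(1) B(2,3) in \<open>auto simp: mem_Times_iff\<close>)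
  moreover have "a \<notin> insert (dinv c) (B \<times> UNIV)" using ab(2) fab(1) by (auto simp: mem_Times_iff B_def)
  ultimately have P: "(\<Prod>p\<in>hp ` (A \<times> UNIV \<union> {a, b}) - {hp b, hp c}. sg (hp b) p * sg (hp c) p) =
      sg (hp b) (hp a) * sg (hp c) (hp a) * (sg (hp b) (hp (dinv c)) * sg (hp c) (hp (dinv c))) *
        cross_sign (hp b) (hp c) B"
    using B(1) cn(2) by (simp add: prod.reindex cross_sign_def)
  \<comment> \<open>Every position of \<open>B\<close> is compared twice with \<open>b\<close> and
    twice with \<open>c\<close>, which leaves only the comparisons with \<open>a\<close> and
    \<open>dinv c\<close>.\<close>
  have sq: "cross_sign (hp b) (hp c) B * cross_sign (hp a) (hp b) B * cross_sign (hp c) (hp (dinv c)) B =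
      cross_sign (hp a) (hp (dinv c)) B"
    unfolding cross_sign_def prod.distrib[symmetric]
  proof (intro prod.cong refl)
    fix y assume y: "y \<in> B \<times> (UNIV :: bool set)"
    have "sg (hp b) (hp y) * sg (hp b) (hp y) = 1" "sg (hp c) (hp y) * sg (hp c) (hp y) = 1"
      using dB[of b y] dB[of c y] y by (auto intro: sg_mult_self)
    then show "sg (hp b) (hp y) * sg (hp c) (hp y) * (sg (hp a) (hp y) * sg (hp b) (hp y)) *
        (sg (hp c) (hp y) * sg (hp (dinv c)) (hp y)) = sg (hp a) (hp y) * sg (hp (dinv c)) (hp y)"
      by algebra
  qed
  have q: "sg (hp a) (hp b) * sg (hp a) (hp b) = 1" "sg (hp a) (hp c) * sg (hp a) (hp c) = 1"
    "sg (hp b) (hp (dinv c)) * sg (hp b) (hp (dinv c)) = 1" "sg (hp c) (hp (dinv c)) * sg (hp c) (hp (dinv c)) = 1"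
    using d by (auto intro: sg_mult_self)
  show ?thesis
    unfolding open_sign_def B_def[symmetric] ms P sq[symmetric] crA
      sg_swap[of "hp b" "hp a"] sg_swap[of "hp c" "hp a"]
    using q by algebra
qed

text \<open>Here \<open>b\<close> is joined with \<open>a\<close> itself. The product on the right
  is then the crossing sign of the open chord, which squares to 1.\<close>

lemma open_sign_close:
  assumes A: "finite A" "A \<subseteq> edges G" and ab: "fst a \<in> edges G" "fst a \<notin> A" "fst b \<in> edges G" "fst b \<notin> A" "a \<noteq> b"
  shows "- sg (hp b) (hp a) * matching_sign A =
    open_sign A a b * (\<Prod>p\<in>hp ` (A \<times> UNIV \<union> {a, b}) - {hp b, hp a}. sg (hp b) p * sg (hp a) p)"
proof -
  have ne: "hp x \<noteq> hp y" if "x \<noteq> y" "fst x \<in> edges G" "fst y \<in> edges G" for x y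
    using hp_inj that by blast
  have "hp x \<noteq> hp y" if "x \<in> {a, b}" "y \<in> A \<times> UNIV" for x y
    using that ab A by (intro ne) auto
  then have "hp ` (A \<times> UNIV \<union> {a, b}) - {hp b, hp a} = hp ` (A \<times> UNIV)" by fastforce
  moreover have "inj_on hp (A \<times> UNIV)"
    by (rule inj_onI, rule hp_inj) (use A in auto)
  ultimately have P: "(\<Prod>p\<in>hp ` (A \<times> UNIV \<union> {a, b}) - {hp b, hp a}. sg (hp b) p * sg (hp a) p) =
      cross_sign (hp a) (hp b) A"
    by (simp add: prod.reindex cross_sign_def mult.commute)
  have "cross_sign (hp a) (hp b) A * cross_sign (hp a) (hp b) A = 1"
    unfolding cross_sign_def prod.distrib[symmetric]
  proof (intro prod.neutral ballI)
    fix y assume y: "y \<in> A \<times> (UNIV :: bool set)"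
    have "sg (hp a) (hp y) * sg (hp a) (hp y) = 1" "sg (hp b) (hp y) * sg (hp b) (hp y) = 1"
      by (rule sg_mult_self, rule ne; use y ab A in auto)+
    then show "sg (hp a) (hp y) * sg (hp b) (hp y) * (sg (hp a) (hp y) * sg (hp b) (hp y)) = 1"
      by algebra
  qed
  then show ?thesis unfolding P open_sign_def sg_swap[of "hp b" "hp a"] by algebra
qed

text \<open>\<open>sum_prod_sg_block\<close> distributes the sign over the partners of
  \<open>b\<close> among the half-edges at its vertex. A partner is either \<open>a\<close>, which
  closes the trail, or a half-edge \<open>c\<close> of \<open>A\<close>, which continues it.\<close>

lemma open_coeff_expand:
  assumes A: "finite A" "A \<subseteq> edges G" and ab: "fst a \<in> edges G" "fst a \<notin> A" "fst b \<in> edges G" "fst b \<notin> A" "a \<noteq> b"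
  shows "open_coeff A a b = - \<tau> b a * matching_coeff A +
    (\<Sum>c\<in>A \<times> UNIV. \<tau> b c * \<eta> c * open_coeff (A - {fst c}) a (dinv c))"
proof -
  let ?H = "A \<times> UNIV \<union> {a, b}"
  have finH: "finite ?H" using A by simp
  have "?H - {b, a} = A \<times> UNIV" using ab by auto
  then have close: "balanced (A \<times> UNIV) \<longleftrightarrow> balanced ?H" if "dtail G b = dtail G a"
    using balanced_remove_pair[OF finH, of b a] that ab(5) by auto
  have step: "balanced ((A - {fst c}) \<times> UNIV \<union> {a, dinv c}) \<longleftrightarrow> balanced ?H"
    if "c \<in> A \<times> UNIV" "dtail G b = dtail G c" for c
  proof -
    have c: "fst c \<in> A" using that(1) by (simp add: mem_Times_iff)
    have AU: "A \<times> UNIV = insert c (insert (dinv c) ((A - {fst c}) \<times> UNIV))"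
    proof (rule set_eqI)
      fix x show "x \<in> A \<times> UNIV \<longleftrightarrow> x \<in> insert c (insert (dinv c) ((A - {fst c}) \<times> UNIV))"
        using c fst_eq_fst_iff[of x c] by (auto simp: mem_Times_iff)
    qed
    have "a \<noteq> c" "b \<noteq> dinv c" "b \<notin> (A - {fst c}) \<times> UNIV"
      "c \<notin> (A - {fst c}) \<times> UNIV" "dinv c \<noteq> c"
      using c ab by (auto simp: mem_Times_iff)
    moreover have "insert c (insert d S) \<union> {a, b} - {b, c} = S \<union> {a, d}"
      if "a \<noteq> c" "b \<noteq> d" "b \<notin> S" "c \<notin> S" "d \<noteq> c" for d S using that ab(5) by blast
    ultimately have "?H - {b, c} = (A - {fst c}) \<times> UNIV \<union> {a, dinv c}" unfolding AU by simp
    moreover have "b \<noteq> c" using c ab(4) by blast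
    then have "balanced (?H - {b, c}) \<longleftrightarrow> balanced ?H"
      using that by (intro balanced_remove_pair[OF finH]) simp_all
    ultimately show ?thesis by simp
  qed
  show ?thesis
  proof (cases "balanced ?H")
    case False
    then have "\<tau> b a * matching_coeff A = 0"
      using close by (simp add: \<tau>_def matching_coeff_def)
    moreover have "(\<Sum>c\<in>A \<times> UNIV. \<tau> b c * \<eta> c * open_coeff (A - {fst c}) a (dinv c)) = 0"
      by (intro sum.neutral ballI) (use step False in \<open>simp add: \<tau>_def open_coeff_def\<close>)
    moreover have "open_coeff A a b = 0" using False by (simp add: open_coeff_def)
    ultimately show ?thesis by simp
  next
    case True
    define H where "H = ?H"
    define N where "N = {c \<in> H. dtail G c = dtail G b}"
    define K where "K = hp ` N"
    let ?P = "hp ` H"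
    let ?t = "\<lambda>x. \<Prod>p\<in>?P - {hp b, x}. sg (hp b) p * sg x p"
    have edg: "fst x \<in> edges G" if "x \<in> H" for x
    proof -
      have "x = a \<or> x = b \<or> fst x \<in> A" using that by (auto simp: H_def mem_Times_iff)
      then show ?thesis using A(2) ab(1,3) by blast
    qed
    have b: "b \<in> H" by (simp add: H_def)
    have Hb: "H - {b} = insert a (A \<times> UNIV)"
    proof -
      have "b \<notin> A \<times> UNIV" using ab(4) by (simp add: mem_Times_iff)
      then show ?thesis using ab(5) by (simp add: H_def) blast
    qed
    have finH': "finite H" unfolding H_def by (rule finH)
    have injH: "inj_on hp H" by (rule inj_onI, rule hp_inj[OF edg edg])
    have injN: "inj_on hp N" using injH by (rule inj_on_subset) (auto simp: N_def)
    have "even (card N)" using True by (simp add: balanced_def N_def H_def)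
    then have evK: "even (card K)" unfolding K_def by (simp add: card_image injN)
    have "(\<Sum>x\<in>K - {hp b}. ?t x) = 1"
    proof (rule sum_prod_sg_block)
      show "finite ?P" "K \<subseteq> ?P" "hp b \<in> K" "even (card K)"
        using finH' evK b by (auto simp: K_def N_def)
      fix x y p assume xyp: "x \<in> K" "y \<in> K" "p \<in> ?P" "x < p" "p < y"
      obtain x' where x': "x' \<in> H" "dtail G x' = dtail G b" "x = hp x'"
        using xyp(1) unfolding K_def N_def by blast
      obtain y' where y': "y' \<in> H" "dtail G y' = dtail G b" "y = hp y'"
        using xyp(2) unfolding K_def N_def by blast
      obtain p' where p': "p' \<in> H" "p = hp p'" using xyp(3) by blast
      have "dtail G p' = dtail G x'"
        using xyp(4,5) x' y' p' by (intro hp_convex[of x' y' p'] edg) simp_all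
      then have "p' \<in> N" using p' x' by (simp add: N_def)
      then show "p \<in> K" unfolding K_def p'(2) by (rule imageI)
    qed
    moreover have "K - {hp b} = hp ` (N - {b})"
      using inj_on_image_set_diff[OF injN, of N "{b}"] b by (simp add: K_def N_def)
    ultimately have one: "(\<Sum>c\<in>N - {b}. ?t (hp c)) = 1"
      using injN by (simp add: sum.reindex inj_on_diff)
    have "open_coeff A a b = open_sign A a b * (\<Sum>c\<in>N - {b}. ?t (hp c))"
      unfolding one using True by (simp add: open_coeff_def)
    also have "\<dots> = (\<Sum>c\<in>N - {b}. open_sign A a b * ?t (hp c))" by (rule sum_distrib_left)
    also have "\<dots> = (\<Sum>c\<in>H - {b}. if dtail G b = dtail G c then open_sign A a b * ?t (hp c) else 0)"
      by (rule sum.mono_neutral_cong_left) (use finH' in \<open>auto simp: N_def\<close>)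
    also note Hb
    also have "(\<Sum>c\<in>insert a (A \<times> UNIV). if dtail G b = dtail G c then open_sign A a b * ?t (hp c) else 0) =
        (if dtail G b = dtail G a then open_sign A a b * ?t (hp a) else 0) +
        (\<Sum>c\<in>A \<times> UNIV. if dtail G b = dtail G c then open_sign A a b * ?t (hp c) else 0)"
      using A(1) ab(2) by (subst sum.insert) (auto simp: mem_Times_iff)
    also have "(if dtail G b = dtail G a then open_sign A a b * ?t (hp a) else 0) = - \<tau> b a * matching_coeff A"
      using open_sign_close[OF assms, folded H_def] close True by (simp add: \<tau>_def matching_coeff_def)
    also have "(\<Sum>c\<in>A \<times> UNIV. if dtail G b = dtail G c then open_sign A a b * ?t (hp c) else 0) =
        (\<Sum>c\<in>A \<times> UNIV. \<tau> b c * \<eta> c * open_coeff (A - {fst c}) a (dinv c))"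
    proof (intro sum.cong refl)
      fix c assume c: "c \<in> A \<times> (UNIV :: bool set)"
      show "(if dtail G b = dtail G c then open_sign A a b * ?t (hp c) else 0) =
          \<tau> b c * \<eta> c * open_coeff (A - {fst c}) a (dinv c)"
        using open_sign_step[OF assms, of c, folded H_def] step[OF c] True c
        by (simp add: \<tau>_def open_coeff_def mem_Times_iff)
    qed
    finally show ?thesis .
  qed
qed

section \<open>Trails, and the identification of the series with matching signs\<close>

definition trails :: "'e set \<Rightarrow> 'e dedge list set" where
  "trails A = {q. distinct (map fst q) \<and> fst ` set q \<subseteq> A}"

lemma finite_trails:
  assumes "finite A" shows "finite (trails A)"
proof (rule finite_subset)
  show "trails A \<subseteq> {q. set q \<subseteq> A \<times> UNIV \<and> length q \<le> card A}"
  proof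
    fix q assume q: "q \<in> trails A"
    then have "length q = card (fst ` set q)"
      by (metis (mono_tags) distinct_card length_map list.set_map mem_Collect_eq trails_def)
    also have "\<dots> \<le> card A" using q assms by (auto simp: trails_def intro: card_mono)
    finally show "q \<in> {q. set q \<subseteq> A \<times> UNIV \<and> length q \<le> card A}"
      using q by (fastforce simp: trails_def)
  qed
qed (use assms in \<open>simp add: finite_lists_length_le\<close>)

definition trail_sum :: "'e dedge \<Rightarrow> 'e set \<Rightarrow> 'e dedge \<Rightarrow> real" where
  "trail_sum a A b = (\<Sum>q\<in>trails A. path_weight (b # q @ [a]) * series (mset_set (A - fst ` set q)))"

lemma trail_sum_expand:
  assumes "finite A"
  shows "trail_sum a A b = wt b a * series (mset_set A) +
    (\<Sum>c\<in>A \<times> UNIV. wt b c * trail_sum a (A - {fst c}) c)"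
proof -
  let ?g = "\<lambda>b A q. path_weight (b # q @ [a]) * series (mset_set (A - fst ` set q))"
  let ?S = "SIGMA c:A \<times> (UNIV :: bool set). trails (A - {fst c})"
  have t: "trails A = insert [] ((\<lambda>(c, q). c # q) ` ?S)"
  proof (intro set_eqI iffI)
    fix q assume "q \<in> trails A"
    then show "q \<in> insert [] ((\<lambda>(c, q). c # q) ` ?S)"
      by (cases q) (force simp: trails_def)+
  qed (force simp: trails_def)
  have "finite ?S" by (rule finite_SigmaI) (use assms in \<open>auto intro: finite_trails\<close>)
  then have "trail_sum a A b = ?g b A [] + (\<Sum>p\<in>(\<lambda>(c, q). c # q) ` ?S. ?g b A p)"
    unfolding trail_sum_def t by (subst sum.insert) auto
  also have "(\<Sum>p\<in>(\<lambda>(c, q). c # q) ` ?S. ?g b A p) = (\<Sum>(c, q)\<in>?S. ?g b A (c # q))"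
    by (subst sum.reindex) (auto simp: inj_on_def case_prod_beta intro!: sum.cong)
  also have "\<dots> = (\<Sum>c\<in>A \<times> UNIV. \<Sum>q\<in>trails (A - {fst c}). ?g b A (c # q))"
    by (rule sum.Sigma[symmetric]) (use assms in \<open>auto intro!: finite_trails\<close>)
  also have "\<dots> = (\<Sum>c\<in>A \<times> UNIV. \<Sum>q\<in>trails (A - {fst c}). wt b c * ?g c (A - {fst c}) q)"
  proof (intro sum.cong refl)
    fix c :: "'e dedge" and q
    have "A - fst ` set (c # q) = A - {fst c} - fst ` set q" by auto
    then show "?g b A (c # q) = wt b c * ?g c (A - {fst c}) q" by simp
  qed
  finally show ?thesis by (simp add: trail_sum_def sum_distrib_left)
qed

text \<open>\<open>trail_sum_expand\<close> and \<open>open_coeff_expand\<close> are the same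
  recursion; the minus sign makes their closing terms agree.\<close>

lemma trail_sum_eq:
  assumes "finite A" "A \<subseteq> edges G" "fst a \<in> edges G" "fst a \<notin> A" "fst b \<in> edges G" "fst b \<notin> A" "a \<noteq> dinv b"
    and "\<And>B. B \<subseteq> A \<Longrightarrow> series (mset_set B) = matching_coeff B"
  shows "- trail_sum a A b = \<eta> b * open_coeff A a (dinv b)"
  using assms
proof (induction "card A" arbitrary: A b rule: less_induct)
  case less
  note prems = less.prems
  have "- (wt b c * trail_sum a (A - {fst c}) c) =
      \<eta> b * (\<tau> (dinv b) c * \<eta> c * open_coeff (A - {fst c}) a (dinv c))" if c: "c \<in> A \<times> UNIV" for c
  proof -
    have c': "fst c \<in> A" using c by auto
    have "- trail_sum a (A - {fst c}) c = \<eta> c * open_coeff (A - {fst c}) a (dinv c)"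
    proof (rule less.hyps)
      show "card (A - {fst c}) < card A" using c' prems(1) by (meson card_Diff1_less)
      show "a \<noteq> dinv c" using c' prems(4) by auto
    qed (use prems c' in auto)
    then have "trail_sum a (A - {fst c}) c = - (\<eta> c * open_coeff (A - {fst c}) a (dinv c))" by simp
    then show ?thesis by (simp add: wt_def)
  qed
  then have "- trail_sum a A b = - (wt b a * matching_coeff A) +
    (\<Sum>c\<in>A \<times> UNIV. \<eta> b * (\<tau> (dinv b) c * \<eta> c * open_coeff (A - {fst c}) a (dinv c)))"
    unfolding trail_sum_expand[OF prems(1)] using prems(8)[of A]
    by (simp add: sum_negf[symmetric] cong: sum.cong)
  also have "\<dots> = \<eta> b * (- \<tau> (dinv b) a * matching_coeff A +
    (\<Sum>c\<in>A \<times> UNIV. \<tau> (dinv b) c * \<eta> c * open_coeff (A - {fst c}) a (dinv c)))"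
    by (simp add: wt_def sum_distrib_left algebra_simps)
  also have "\<dots> = \<eta> b * open_coeff A a (dinv b)"
    by (subst open_coeff_expand) (use prems in auto)
  finally show ?case .
qed

text \<open>In a squarefree monomial the first returns to \<open>e\<close> are trails in the
  remaining edges. \<open>trail_sum_eq\<close> evaluates their sum as the sign with an open chord
  from \<open>(e, True)\<close> to \<open>(e, False)\<close>, which is the chord of \<open>e\<close>
  itself.\<close>

theorem series_mset_set:
  assumes "finite A" "A \<subseteq> edges G"
  shows "series (mset_set A) = matching_coeff A"
  using assms
proof (induction "card A" arbitrary: A rule: less_induct)
  case less
  show ?case
  proof (cases "A = {}")
    case True
    then show ?thesis
      by (simp add: series_empty matching_coeff_def balanced_def matching_sign_def)
  next
    case False
    then obtain e where e: "e \<in> A" by blast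
    define B where "B = A - {e}"
    have B: "finite B" "B \<subseteq> edges G" "e \<in> edges G" "e \<notin> B" "A = insert e B"
      using less.prems e by (auto simp: B_def)
    have IH: "series (mset_set C) = matching_coeff C" if "C \<subseteq> B" for C
      using less.hyps[of C] that B by (metis card_insert_disjoint card_mono finite_subset le_imp_less_Suc subset_trans)
    let ?P = "{p. p \<noteq> [] \<and> hd p = (e, True) \<and> set p \<subseteq> D \<and> e \<notin> fst ` set (tl p) \<and>
      mset (map fst p) \<subseteq># mset_set A}"
    have sub: "mset xs \<subseteq># mset_set A \<longleftrightarrow> distinct xs \<and> set xs \<subseteq> A" for xs
    proof
      assume *: "mset xs \<subseteq># mset_set A"
      have le: "count (mset xs) x \<le> count (mset_set A) x" for x
        using * by (rule mset_subset_eq_count)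
      have c: "count (mset xs) x \<le> 1" for x
        by (rule order_trans[OF le]) (cases "x \<in> A"; simp add: less.prems(1))
      have c0: "count (mset xs) x = 0" if "x \<notin> A" for x using le[of x] that by simp
      have "count (mset xs) x = (if x \<in> set xs then 1 else 0)" for x
      proof (cases "x \<in> set xs")
        case True
        then have "0 < count (mset xs) x" unfolding count_greater_zero_iff by simp
        with c[of x] True show ?thesis by (simp only: if_True)
      qed (simp add: count_eq_zero_iff)
      then have "distinct xs" unfolding distinct_count_atmost_1 by blast
      moreover have "set xs \<subseteq> A" using c0 by (auto simp: count_eq_zero_iff)
      ultimately show "distinct xs \<and> set xs \<subseteq> A" by blast
    next
      assume "distinct xs \<and> set xs \<subseteq> A"
      then have "mset xs = mset_set (set xs)" by (simp add: mset_set_set)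
      then show "mset xs \<subseteq># mset_set A"
        using \<open>distinct xs \<and> set xs \<subseteq> A\<close> less.prems(1) by (simp add: subset_imp_msubset_mset_set)
    qed
    have P: "?P = (\<lambda>q. (e, True) # q) ` trails B"
    proof (intro set_eqI iffI)
      fix p assume "p \<in> ?P"
      then obtain q where q: "p = (e, True) # q" "p \<in> ?P" by (cases p) auto
      then have "distinct (map fst p) \<and> set (map fst p) \<subseteq> A" "e \<notin> fst ` set q"
        using sub[of "map fst p"] by auto
      then have "q \<in> trails B" by (auto simp: q(1) trails_def B_def)
      then show "p \<in> (\<lambda>q. (e, True) # q) ` trails B" using q by blast
    next
      fix p assume "p \<in> (\<lambda>q. (e, True) # q) ` trails B"
      then obtain q where q: "p = (e, True) # q" "distinct (map fst q)" "fst ` set q \<subseteq> B"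
        by (auto simp: trails_def)
      then have "distinct (map fst p) \<and> set (map fst p) \<subseteq> A" "e \<notin> fst ` set q"
        using B by auto
      moreover have "set p \<subseteq> D" using q B(2,3) unfolding subset_D_iff by auto
      ultimately show "p \<in> ?P" using sub[of "map fst p"] q by simp
    qed
    have "series (mset_set A) = - (\<Sum>p\<in>?P. cycle_weight p * series (mset_set A - mset (map fst p)))"
      by (rule series_linear) (use less.prems e in simp)
    also have "(\<Sum>p\<in>?P. cycle_weight p * series (mset_set A - mset (map fst p))) =
      (\<Sum>q\<in>trails B. cycle_weight ((e, True) # q) * series (mset_set A - mset (map fst ((e, True) # q))))"
      unfolding P by (subst sum.reindex) (auto simp: inj_on_def)
    also have "\<dots> = trail_sum (e, True) B (e, True)"
      unfolding trail_sum_def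
    proof (intro sum.cong refl)
      fix q assume q: "q \<in> trails B"
      then have "mset (map fst q) = mset_set (fst ` set q)" "fst ` set q \<subseteq> B"
        by (metis (mono_tags) list.set_map mem_Collect_eq mset_set_set trails_def) (use q in \<open>simp add: trails_def\<close>)
      then have "mset_set A - mset (map fst ((e, True) # q)) = mset_set (B - fst ` set q)"
        using B by (simp add: mset_set_Diff)
      then show "cycle_weight ((e, True) # q) * series (mset_set A - mset (map fst ((e, True) # q))) =
        path_weight ((e, True) # q @ [(e, True)]) * series (mset_set (B - fst ` set q))"
        by (simp only: cycle_weight_Cons)
    qed
    finally have "series (mset_set A) = \<eta> (e, True) * open_coeff B (e, True) (e, False)"
      using trail_sum_eq[of B "(e, True)" "(e, True)"] B IH by (simp add: dinv_def)
    moreover have "B \<times> UNIV \<union> {(e, True), (e, False)} = A \<times> UNIV"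
      unfolding B(5) by (auto simp: UNIV_bool)
    ultimately show ?thesis
      using matching_sign_insert[OF B(1-4)] B(5)
      by (simp add: open_coeff_def open_sign_def matching_coeff_def chord_sign_def)
  qed
qed

end


section \<open>Turning of polylines\<close>

text \<open>The angle is halved so that a full turn by \<open>2 * pi\<close> contributes the sign
  -1.\<close>

definition turn :: "complex \<Rightarrow> complex \<Rightarrow> complex \<Rightarrow> complex" where
  "turn a b c = cis (Arg ((c - b) / (b - a)) / 2)"

fun turn_product :: "complex list \<Rightarrow> complex" where
  "turn_product (a # b # c # p) = turn a b c * turn_product (b # c # p)"
| "turn_product _ = 1"

lemma turn_product_append:
  "turn_product (p @ a # b # q) = turn_product (p @ [a, b]) * turn_product (a # b # q)"
proof (induction p rule: turn_product.induct)
  case (1 x y z p)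
  then show ?case by (simp add: mult.assoc)
next
  case ("2_3" v u)
  then show ?case by (cases q) simp_all
qed (cases q; simp)+

lemma turn_product_conv_prod:
  "turn_product p = (\<Prod>i<length p - 2. turn (p ! i) (p ! Suc i) (p ! Suc (Suc i)))"
  by (induction p rule: turn_product.induct)
    (simp_all add: prod.lessThan_Suc_shift del: prod.lessThan_Suc)

lemma cis_sum: "cis (\<Sum>i\<in>A. f i) = (\<Prod>i\<in>A. cis (f i))"
  by (induction A rule: infinite_finite_induct) (simp_all add: cis_mult[symmetric])

text \<open>Repeating the first two corners at the end supplies the turns at the last corner and at
  the first one.\<close>

lemma cis_total_turning:
  assumes "2 \<le> length p"
  shows "cis (total_turning p / 2) = turn_product (p @ take 2 p)"
proof -
  let ?q = "p @ take 2 p"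
  have nth: "?q ! j = p ! (j mod length p)" if "j < length p + 2" for j
    using that assms by (auto simp: nth_append not_less mod_if)
  have "turn_product ?q = (\<Prod>i<length p. turn (?q ! i) (?q ! Suc i) (?q ! Suc (Suc i)))"
    unfolding turn_product_conv_prod using assms by (intro prod.cong) (auto simp: min_def)
  also have "\<dots> = (\<Prod>i<length p. turn (p ! i) (p ! (Suc i mod length p)) (p ! (Suc (Suc i) mod length p)))"
    by (intro prod.cong refl) (simp add: nth)
  finally show ?thesis
    unfolding total_turning_def sum_divide_distrib cis_sum turn_def Let_def by simp
qed

fun join :: "complex list list \<Rightarrow> complex list" where
  "join (L # M # Ls) = butlast L @ join (M # Ls)"
| "join [L] = L"
| "join [] = []"

definition junction :: "complex list \<Rightarrow> complex list \<Rightarrow> complex" where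
  "junction L M = turn (last (butlast L)) (last L) (M ! 1)"

fun join_product :: "complex list list \<Rightarrow> complex" where
  "join_product (L # M # Ls) = turn_product L * junction L M * join_product (M # Ls)"
| "join_product [L] = turn_product L"
| "join_product [] = 1"

fun linked :: "complex list list \<Rightarrow> bool" where
  "linked (L # M # Ls) \<longleftrightarrow> 2 \<le> length L \<and> last L = hd M \<and> linked (M # Ls)"
| "linked [L] \<longleftrightarrow> 2 \<le> length L"
| "linked [] \<longleftrightarrow> True"

lemma two_elems: "2 \<le> length L \<Longrightarrow> \<exists>a b q. L = a # b # q"
  by (cases L; cases "tl L") auto

lemma join_start:
  "linked (L # Ls) \<Longrightarrow> \<exists>q. join (L # Ls) = hd L # L ! 1 # q"
proof (induction Ls arbitrary: L)
  case Nil
  then obtain a b q where "L = a # b # q" using two_elems[of L] by auto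
  then show ?case by simp
next
  case (Cons M Ls)
  obtain a b q where L: "L = a # b # q" using two_elems[of L] Cons.prems by auto
  obtain r where r: "join (M # Ls) = hd M # M ! 1 # r" using Cons by auto
  show ?case using L r Cons.prems by (cases q) auto
qed

lemma join_end:
  "linked Ls \<Longrightarrow> Ls \<noteq> [] \<Longrightarrow>
    last (join Ls) = last (last Ls) \<and> last (butlast (join Ls)) = last (butlast (last Ls)) \<and> 2 \<le> length (join Ls)"
proof (induction Ls rule: linked.induct)
  case (1 L M Ls)
  then have "join (M # Ls) \<noteq> []" "butlast (join (M # Ls)) \<noteq> []"
    by (auto simp: Suc_le_eq) (metis One_nat_def diff_is_0_eq length_butlast list.size(3) not_less_eq_eq numeral_2_eq_2 order_refl)
  moreover have "2 \<le> length (join (L # M # Ls))" 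
  proof -
    have "2 \<le> length L" "2 \<le> length (join (M # Ls))" using 1 by auto
    then show ?thesis by (simp only: join.simps length_append length_butlast)
  qed
  ultimately show ?case using 1 by (simp add: butlast_append)
qed auto

lemma turn_product_join: "linked Ls \<Longrightarrow> turn_product (join Ls) = join_product Ls"
proof (induction Ls rule: linked.induct)
  case (1 L M Ls)
  obtain q where q: "join (M # Ls) = hd M # M ! 1 # q" using join_start[of M Ls] 1 by auto
  have L: "butlast L \<noteq> []" "L \<noteq> []" using 1 two_elems[of L] by auto
  define u where "u = butlast (butlast L)"
  have bl: "butlast L = u @ [last (butlast L)]" using L by (simp add: u_def)
  have L': "L = u @ [last (butlast L), last L]"
    using L bl by (metis append.assoc append_Cons append_Nil append_butlast_last_id)
  have "turn_product (join (L # M # Ls)) =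
      turn_product (u @ last (butlast L) # last L # M ! 1 # q)"
    using q 1 bl by (metis append.assoc append_Cons append_Nil join.simps(1) linked.simps(1))
  also have "\<dots> = turn_product L * (turn (last (butlast L)) (last L) (M ! 1) * turn_product (last L # M ! 1 # q))"
    unfolding turn_product_append[of u "last (butlast L)" "last L" "M ! 1 # q"]
    using L' by simp
  also have "turn_product (last L # M ! 1 # q) = join_product (M # Ls)" using q 1 by simp
  finally show ?case by (simp add: junction_def mult.assoc)
qed simp_all

text \<open>A reversal of direction is excluded because \<open>Arg\<close> assigns it the angle
  \<open>pi\<close> in both orientations, whereas conjugation would require
  \<open>- pi\<close>.\<close>

lemma turn_reverse:
  assumes "Arg ((c - b) / (b - a)) \<noteq> pi"
  shows "turn c b a = cnj (turn a b c)"
proof -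
  have eq: "(a - b) / (b - c) = inverse ((c - b) / (b - a))" 
    using minus_divide_divide[of "b - a" "c - b"] by simp
  show ?thesis
  proof (cases "(c - b) / (b - a) = 0")
    case True
    then show ?thesis unfolding turn_def eq by (auto simp: Arg_zero)
  next
    case False
    have "Arg (inverse ((c - b) / (b - a))) = - Arg ((c - b) / (b - a))"
      unfolding Arg_inverse using assms Arg_eq_0_pi[of "(c - b) / (b - a)"] by auto
    then show ?thesis unfolding turn_def eq by (simp add: cis_cnj)
  qed
qed

lemma Arg_cis_mult:
  assumes "0 < r" "- pi < t" "t \<le> pi" shows "Arg (of_real r * cis t) = t"
  using assms by (intro Arg_unique) (simp_all add: cis_conv_exp)

text \<open>The turn at a vertex from the half-edge \<open>d\<^sub>1\<close> to the half-edge \<open>d\<^sub>2\<close>, both measured from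
  the direction \<open>u\<close>.\<close>

lemma cis_turn_at_vertex:
  assumes nz: "u \<noteq> 0" "d1 \<noteq> 0" "d2 \<noteq> 0"
    and npi: "Arg (d1 / u) \<noteq> pi" "Arg (d2 / u) \<noteq> pi" and ne: "Arg (d1 / u) \<noteq> Arg (d2 / u)"
  shows "cis (Arg (d2 / (- d1)) / 2) =
      - \<i> * of_real (sg (Arg (d1 / u)) (Arg (d2 / u))) * cis ((Arg (d2 / u) - Arg (d1 / u)) / 2)"
    "Arg (d2 / (- d1)) \<noteq> pi"
proof -
  define p1 where "p1 = Arg (d1 / u)"
  define p2 where "p2 = Arg (d2 / u)"
  have b: "- pi < p1" "p1 < pi" "- pi < p2" "p2 < pi"
    using Arg_bounded[of "d1 / u"] Arg_bounded[of "d2 / u"] npi unfolding p1_def p2_def by auto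
  define r1 where "r1 = cmod (d1 / u)"
  define r2 where "r2 = cmod (d2 / u)"
  have r: "0 < r1" "0 < r2" using nz by (auto simp: r1_def r2_def)
  have d1: "d1 / u = of_real r1 * cis p1" and d2: "d2 / u = of_real r2 * cis p2"
    using nz by (auto simp: r1_def r2_def p1_def p2_def cis_Arg sgn_div_norm scaleR_conv_of_real)
  have "d2 / (- d1) = - ((d2 / u) / (d1 / u))" using nz by (simp add: field_simps)
  also have "\<dots> = - (of_real (r2 / r1) * cis (p2 - p1))"
    unfolding d1 d2 by (simp add: cis_divide[symmetric])
  finally have q: "d2 / (- d1) = - (of_real (r2 / r1) * cis (p2 - p1))" .
  have q1: "d2 / (- d1) = of_real (r2 / r1) * cis (p2 - p1 - pi)"
    and q2: "d2 / (- d1) = of_real (r2 / r1) * cis (p2 - p1 + pi)"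
    unfolding q by (simp_all add: complex_eq_iff cos_diff cos_add sin_diff sin_add
        diff_divide_distrib add_divide_distrib algebra_simps)
  consider "p1 < p2" | "p2 < p1" using ne unfolding p1_def p2_def by linarith
  then have "cis (Arg (d2 / (- d1)) / 2) = - \<i> * of_real (sg p1 p2) * cis ((p2 - p1) / 2)
      \<and> Arg (d2 / (- d1)) \<noteq> pi"
  proof cases
    case 1
    \<comment> \<open>The order of the two angles decides which shift by \<open>pi\<close> brings
      their difference into the range of \<open>Arg\<close>. Half of the shift is the factor
      \<open>- \<i>\<close> here and \<open>\<i>\<close> in the other case.\<close>
    have A: "Arg (d2 / (- d1)) = p2 - p1 - pi"
      unfolding q1 by (rule Arg_cis_mult) (use 1 b r in auto)
    have "cis ((p2 - p1 - pi) / 2) = cis ((p2 - p1) / 2) * cis (- pi / 2)"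
      by (simp only: cis_mult) (rule arg_cong[of _ _ cis], simp add: field_simps)
    also have "cis (- pi / 2) = - \<i>" by (simp add: complex_eq_iff)
    finally have e: "cis ((p2 - p1 - pi) / 2) = cis ((p2 - p1) / 2) * - \<i>" .
    show ?thesis unfolding A e using 1 b by (simp add: sg_def)
  next
    case 2
    have A: "Arg (d2 / (- d1)) = p2 - p1 + pi"
      unfolding q2 by (rule Arg_cis_mult) (use 2 b r in auto)
    have "cis ((p2 - p1 + pi) / 2) = cis ((p2 - p1) / 2) * cis (pi / 2)"
      by (simp only: cis_mult) (rule arg_cong[of _ _ cis], simp add: field_simps)
    also have "cis (pi / 2) = \<i>" by (simp add: complex_eq_iff)
    finally have e: "cis ((p2 - p1 + pi) / 2) = cis ((p2 - p1) / 2) * \<i>" .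
    show ?thesis unfolding A e using 2 b by (simp add: sg_def)
  qed
  then show "cis (Arg (d2 / (- d1)) / 2) =
      - \<i> * of_real (sg (Arg (d1 / u)) (Arg (d2 / u))) * cis ((Arg (d2 / u) - Arg (d1 / u)) / 2)"
    "Arg (d2 / (- d1)) \<noteq> pi" unfolding p1_def p2_def by auto
qed

fun no_reversal :: "complex list \<Rightarrow> bool" where
  "no_reversal (a # b # c # p) \<longleftrightarrow> Arg ((c - b) / (b - a)) \<noteq> pi \<and> no_reversal (b # c # p)"
| "no_reversal _ \<longleftrightarrow> True"

lemma turn_product_rev: "no_reversal p \<Longrightarrow> turn_product (rev p) = cnj (turn_product p)"
proof (induction p rule: no_reversal.induct)
  case (1 a b c p)
  then show ?case
    using turn_product_append[of "rev p" c b "[a]"] turn_reverse[of c b a] by simp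
qed auto

lemma no_reversal_append:
  "no_reversal (p @ a # b # q) \<longleftrightarrow> no_reversal (p @ [a, b]) \<and> no_reversal (a # b # q)"
proof (induction p rule: no_reversal.induct)
  case ("2_3" v u)
  then show ?case by (cases q) simp_all
qed (cases q; simp)+

lemma no_reversal_rev: "no_reversal p \<Longrightarrow> no_reversal (rev p)"
proof (induction p rule: no_reversal.induct)
  case (1 a b c p)
  have eq: "(a - b) / (b - c) = inverse ((c - b) / (b - a))"
    using minus_divide_divide[of "b - a" "c - b"] by simp
  have "Arg ((a - b) / (b - c)) \<noteq> pi"
    unfolding eq Arg_inverse using 1 mpi_less_Arg[of "(c - b) / (b - a)"] by (auto split: if_splits)
  then show ?case using 1 no_reversal_append[of "rev p" c b "[a]"] by simp
qed auto

fun join_no_reversal :: "complex list list \<Rightarrow> bool" where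
  "join_no_reversal (L # M # Ls) \<longleftrightarrow> no_reversal L \<and>
     Arg ((M ! 1 - last L) / (last L - last (butlast L))) \<noteq> pi \<and> join_no_reversal (M # Ls)"
| "join_no_reversal [L] \<longleftrightarrow> no_reversal L"
| "join_no_reversal [] \<longleftrightarrow> True"

lemma no_reversal_join: "linked Ls \<Longrightarrow> join_no_reversal Ls \<Longrightarrow> no_reversal (join Ls)"
proof (induction Ls rule: linked.induct)
  case (1 L M Ls)
  obtain q where q: "join (M # Ls) = hd M # M ! 1 # q" using join_start[of M Ls] 1 by auto
  have L: "butlast L \<noteq> []" "L \<noteq> []" using 1 two_elems[of L] by auto
  define u where "u = butlast (butlast L)"
  have bl: "butlast L = u @ [last (butlast L)]" using L by (simp add: u_def)
  have L': "L = u @ [last (butlast L), last L]"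
    using L bl by (metis append.assoc append_Cons append_Nil append_butlast_last_id)
  have J: "join (L # M # Ls) = u @ last (butlast L) # last L # M ! 1 # q"
    using q 1 bl by (metis append.assoc append_Cons append_Nil join.simps(1) linked.simps(1))
  have "no_reversal (u @ [last (butlast L), last L])" using 1 L' by simp
  moreover have "no_reversal (last L # M ! 1 # q)" using 1 q by simp
  ultimately show ?case
    unfolding J no_reversal_append[of u "last (butlast L)" "last L" "M ! 1 # q"] using 1 by simp
qed simp_all


section \<open>Half-edges in polar coordinates\<close>

text \<open>Lexicographic order makes the half-edges of a vertex consecutive as soon as different
  vertices are seen at different angles.\<close>

datatype hpos = HP (angle: real) (slope: real)

instantiation hpos :: linorder
begin

definition less_hpos :: "hpos \<Rightarrow> hpos \<Rightarrow> bool" where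
  "p < q \<longleftrightarrow> angle p < angle q \<or> angle p = angle q \<and> slope p < slope q"

definition less_eq_hpos :: "hpos \<Rightarrow> hpos \<Rightarrow> bool" where
  "p \<le> q \<longleftrightarrow> angle p < angle q \<or> angle p = angle q \<and> slope p \<le> slope q"

instance
  by standard (auto simp: less_hpos_def less_eq_hpos_def intro: hpos.expand)

end

lemma sg_HP: "sg (HP a s) (HP b t) = (if a = b then sg s t else sg a b)"
  by (auto simp: sg_def less_hpos_def)

lemma sg_angle: "angle p \<noteq> angle q \<Longrightarrow> sg p q = sg (angle p) (angle q)"
  by (cases p; cases q) (auto simp: sg_HP)

text \<open>A real lift of the argument of the direction of a half-edge, see
  \<open>cis_lift\<close>.\<close>

definition lift :: "hpos \<Rightarrow> real" where
  "lift p = angle p + slope p"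

text \<open>The cross product of plane vectors, positive when \<open>b\<close> points to the left of
  \<open>a\<close>.\<close>

definition cr :: "complex \<Rightarrow> complex \<Rightarrow> real" where
  "cr a b = Re a * Im b - Im a * Re b"

text \<open>Points are seen from \<open>ob\<close> in polar coordinates with the positive real direction as
  cut. A half-edge at \<open>z\<close> in direction \<open>d\<close> is positioned by the angle of \<open>z\<close> and then by
  its angle to the outward radial direction.\<close>

locale observer =
  fixes ob :: complex
begin

definition \<alpha> :: "complex \<Rightarrow> real" where
  "\<alpha> z = Arg2pi (z - ob)"

definition hpos_at :: "complex \<Rightarrow> complex \<Rightarrow> hpos" where
  "hpos_at z d = HP (\<alpha> z) (Arg (d / (z - ob)))"

definition visible :: "complex \<Rightarrow> bool" where
  "visible z \<longleftrightarrow> z - ob \<notin> \<real>\<^sub>\<ge>\<^sub>0"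

lemma visible_nz: "visible z \<Longrightarrow> z \<noteq> ob"
  by (auto simp: visible_def)

lemma \<alpha>_bounds: "visible z \<Longrightarrow> 0 < \<alpha> z" "\<alpha> z < 2 * pi"
  using Arg2pi_gt_0[of "z - ob"] Arg2pi_lt_2pi[of "z - ob"]
  by (auto simp: visible_def \<alpha>_def)

lemma polar: "z - ob = of_real (cmod (z - ob)) * cis (\<alpha> z)"
  using Arg2pi_eq[of "z - ob"] by (simp add: \<alpha>_def cis_conv_exp)

lemma cis_\<alpha>: "z \<noteq> ob \<Longrightarrow> cis (\<alpha> z) = sgn (z - ob)"
  using polar[of z] by (simp add: sgn_div_norm scaleR_conv_of_real field_simps)

lemma cis_lift:
  assumes "z \<noteq> ob" "d \<noteq> 0" shows "cis (lift (hpos_at z d)) = sgn d"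
proof -
  have "cis (lift (hpos_at z d)) = cis (\<alpha> z) * cis (Arg (d / (z - ob)))"
    by (simp add: lift_def hpos_at_def cis_mult)
  also have "\<dots> = sgn (z - ob) * sgn (d / (z - ob))"
    using assms by (simp add: cis_\<alpha> cis_Arg)
  also have "\<dots> = sgn d" using assms by (simp add: sgn_divide sgn_zero_iff)
  finally show ?thesis .
qed

lemma cr_polar:
  "cr (a - ob) (b - ob) = cmod (a - ob) * cmod (b - ob) * sin (\<alpha> b - \<alpha> a)"
  by (subst polar[of a], subst polar[of b]) (simp add: cr_def sin_diff algebra_simps)

lemma junction_turn:
  assumes "z \<noteq> ob" "d1 \<noteq> 0" "d2 \<noteq> 0"
    and "slope (hpos_at z d1) \<noteq> pi" "slope (hpos_at z d2) \<noteq> pi" "hpos_at z d1 \<noteq> hpos_at z d2"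
  shows "cis (Arg (d2 / (- d1)) / 2) = - \<i> * of_real (sg (hpos_at z d1) (hpos_at z d2)) *
      cis ((lift (hpos_at z d2) - lift (hpos_at z d1)) / 2)"
    "Arg (d2 / (- d1)) \<noteq> pi"
  using cis_turn_at_vertex[of "z - ob" d1 d2] assms
  by (auto simp: hpos_at_def lift_def sg_HP)

definition good_segment :: "complex \<Rightarrow> complex \<Rightarrow> bool" where
  "good_segment a b \<longleftrightarrow> (\<forall>z\<in>closed_segment a b. visible z) \<and> \<alpha> a \<noteq> \<alpha> b"

lemma good_segment_sym: "good_segment a b \<longleftrightarrow> good_segment b a"
  by (auto simp: good_segment_def closed_segment_commute)

lemma good_segment_visible:
  assumes "good_segment a b" shows "visible a" "visible b" "a \<noteq> ob" "b \<noteq> ob" "a \<noteq> b"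
  using assms visible_nz by (auto simp: good_segment_def)

text \<open>Otherwise the segment would meet the cut.\<close>

lemma good_segment_angle:
  assumes g: "good_segment a b" and lt: "\<alpha> a < \<alpha> b"
  shows "\<alpha> b - \<alpha> a < pi"
proof (rule ccontr)
  assume "\<not> \<alpha> b - \<alpha> a < pi"
  note v = good_segment_visible[OF g]
  have bd: "0 < \<alpha> a" "\<alpha> a < pi" "pi < \<alpha> b" "\<alpha> b < 2 * pi"
    using \<open>\<not> \<alpha> b - \<alpha> a < pi\<close> \<alpha>_bounds(1)[OF v(1)] \<alpha>_bounds(2)[of b] by auto
  define A where "A = a - ob"
  define B where "B = b - ob"
  have "Im A = cmod A * sin (\<alpha> a)" "Im B = cmod B * sin (\<alpha> b)"
    using arg_cong[OF polar[of a], of Im] arg_cong[OF polar[of b], of Im] by (auto simp: A_def B_def)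
  moreover have "0 < sin (\<alpha> a)" using bd by (intro sin_gt_zero)
  moreover have "sin (\<alpha> b) < 0" using bd by (intro sin_lt_zero) auto
  moreover have "0 < cmod A" "0 < cmod B" using v by (auto simp: A_def B_def)
  ultimately have im: "0 < Im A" "Im B < 0" by (auto simp: mult_pos_neg)
  have "sin (\<alpha> b - \<alpha> a) \<le> 0"
    using \<open>\<not> \<alpha> b - \<alpha> a < pi\<close> bd sin_ge_zero[of "\<alpha> b - \<alpha> a - pi"] by (simp add: sin_diff)
  then have "cr A B \<le> 0"
    unfolding A_def B_def cr_polar by (intro mult_nonneg_nonpos) auto
  \<comment> \<open>The point of the segment on the horizontal line through \<open>ob\<close>. It
    lies on the cut because \<open>cr A B \<le> 0\<close>.\<close>
  define t where "t = Im A / (Im A - Im B)"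
  have t: "0 \<le> t" "t \<le> 1" using im by (auto simp: t_def field_simps)
  have den: "Im A - Im B > 0" using im by simp
  define z where "z = (1 - t) *\<^sub>R a + t *\<^sub>R b"
  have zo: "z - ob = of_real (1 - t) * A + of_real t * B"
    by (simp add: z_def A_def B_def scaleR_conv_of_real algebra_simps)
  have "Im (z - ob) = 0" unfolding zo using den by (simp add: t_def field_simps)
  moreover have "Re (z - ob) = - cr A B / (Im A - Im B)"
  proof -
    have "1 - t = - Im B / (Im A - Im B)" using den by (simp add: t_def field_simps)
    then show ?thesis unfolding zo by (simp add: t_def cr_def diff_divide_distrib mult.commute)
  qed
  moreover have "0 \<le> - cr A B / (Im A - Im B)"
    using \<open>cr A B \<le> 0\<close> den by (intro divide_nonneg_pos) simp_all
  ultimately have "z - ob \<in> \<real>\<^sub>\<ge>\<^sub>0" by (simp add: complex_nonneg_Reals_iff)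
  moreover have "z \<in> closed_segment a b" using t by (auto simp: z_def closed_segment_def)
  ultimately show False using g by (auto simp: good_segment_def visible_def)
qed

lemma good_segment_cr:
  assumes "good_segment a b" "\<alpha> a < \<alpha> b"
  shows "0 < cr (a - ob) (b - ob)" "0 < sin (\<alpha> b - \<alpha> a)"
proof -
  show s: "0 < sin (\<alpha> b - \<alpha> a)"
    using good_segment_angle[OF assms] assms(2) by (intro sin_gt_zero) auto
  show "0 < cr (a - ob) (b - ob)"
    unfolding cr_polar using s good_segment_visible[OF assms(1)] by simp
qed

lemma Im_divide_cr: "Im (a / b) = cr b a / (cmod b)\<^sup>2"
  by (simp add: Im_divide cmod_power2 cr_def)

text \<open>A segment running anticlockwise around \<open>ob\<close> leaves its first end to the
  left of the radial direction and, looking back, its last end to the right.\<close>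

lemma slope_forward:
  assumes "good_segment a b" "\<alpha> a < \<alpha> b"
  shows "0 < slope (hpos_at a (b - a)) \<and> slope (hpos_at a (b - a)) < pi"
    "- pi < slope (hpos_at b (a - b)) \<and> slope (hpos_at b (a - b)) < 0"
proof -
  note v = good_segment_visible[OF assms(1)]
  have "cr (a - ob) (b - a) = cr (a - ob) (b - ob)" by (simp add: cr_def algebra_simps)
  then have "0 < Im ((b - a) / (a - ob))"
    unfolding Im_divide_cr using good_segment_cr[OF assms] v by simp
  then show "0 < slope (hpos_at a (b - a)) \<and> slope (hpos_at a (b - a)) < pi"
    by (simp add: hpos_at_def Arg_lt_pi)
  have "cr (b - ob) (a - b) = - cr (a - ob) (b - ob)" by (simp add: cr_def algebra_simps)
  then have "Im ((a - b) / (b - ob)) < 0"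
    unfolding Im_divide_cr using good_segment_cr[OF assms] v by (simp add: divide_neg_pos)
  then show "- pi < slope (hpos_at b (a - b)) \<and> slope (hpos_at b (a - b)) < 0"
    using mpi_less_Arg by (simp add: hpos_at_def Arg_neg_iff)
qed

lemma slope_ne_pi:
  assumes "good_segment a b" shows "slope (hpos_at a (b - a)) \<noteq> pi"
proof (cases "\<alpha> a < \<alpha> b")
  case True then show ?thesis using slope_forward[OF assms] by simp
next
  case False
  then have "\<alpha> b < \<alpha> a" using assms by (simp add: good_segment_def)
  then show ?thesis using slope_forward[of b a] assms good_segment_sym pi_gt_zero by force
qed

lemma cis_minus_one_unique:
  assumes "cis x = -1" "- pi < x" "x < 2 * pi" shows "x = pi"
proof -
  have "cis (x - pi) = 1" using assms(1) by (simp add: cis_divide[symmetric])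
  then have "exp (\<i> * complex_of_real (x - pi)) = 1" by (simp add: cis_conv_exp)
  then obtain k :: int where k: "x - pi = of_int (2 * k) * pi" by (auto simp: exp_eq_1)
  have x: "x = (2 * of_int k + 1) * pi" using k by (simp add: algebra_simps)
  have "(-1) * pi < (2 * of_int k + 1) * pi" "(2 * of_int k + 1) * pi < 2 * pi"
    using assms(2,3) unfolding x by simp_all
  then have "(-1 :: real) < 2 * of_int k + 1" "2 * of_int k + 1 < (2 :: real)"
    by (simp_all only: mult_less_cancel_right_pos[OF pi_gt_zero])
  then have "-1 < k" "k < 1" by linarith+
  then have "k = 0" by simp
  then show ?thesis using k by simp
qed

text \<open>The directions at the two ends are opposite, so the lifts differ by an odd multiple of
  \<open>pi\<close>. The bounds on angles and slopes leave only \<open>pi\<close> for an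
  anticlockwise and \<open>- pi\<close> for a clockwise segment.\<close>

lemma segment_phase:
  assumes g: "good_segment a b"
  shows "cis ((lift (hpos_at a (b - a)) - lift (hpos_at b (a - b))) / 2) =
    \<i> * of_real (sg (hpos_at a (b - a)) (hpos_at b (a - b)))"
proof -
  have *: "lift (hpos_at a (b - a)) - lift (hpos_at b (a - b)) = pi"
    if g: "good_segment a b" and lt: "\<alpha> a < \<alpha> b" for a b
  proof -
    note v = good_segment_visible[OF g]
    have "cis (lift (hpos_at a (b - a)) - lift (hpos_at b (a - b))) = sgn (b - a) / sgn (a - b)"
      using v by (simp add: cis_divide[symmetric] cis_lift)
    also have "sgn (a - b) = - sgn (b - a)" by (metis minus_diff_eq sgn_minus)
    finally have "cis (lift (hpos_at a (b - a)) - lift (hpos_at b (a - b))) = -1"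
      using v by (simp add: sgn_zero_iff)
    moreover have "- pi < lift (hpos_at a (b - a)) - lift (hpos_at b (a - b))"
      "lift (hpos_at a (b - a)) - lift (hpos_at b (a - b)) < 2 * pi"
      using slope_forward[OF g lt] good_segment_angle[OF g lt] lt
      by (auto simp: lift_def hpos_at_def)
    ultimately show ?thesis by (rule cis_minus_one_unique)
  qed
  have pi2: "cis (pi / 2) = \<i>" "cis (- pi / 2) = - \<i>" by (simp_all add: complex_eq_iff)
  consider "\<alpha> a < \<alpha> b" | "\<alpha> b < \<alpha> a" using g by (force simp: good_segment_def)
  then show ?thesis
  proof cases
    case 1
    have "sg (hpos_at a (b - a)) (hpos_at b (a - b)) = 1"
      using 1 by (simp add: hpos_at_def sg_HP) (simp add: sg_def)
    then show ?thesis using *[OF g 1] pi2 by simp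
  next
    case 2
    have "sg (hpos_at a (b - a)) (hpos_at b (a - b)) = -1"
      using 2 by (simp add: hpos_at_def sg_HP) (simp add: sg_def)
    moreover have "lift (hpos_at a (b - a)) - lift (hpos_at b (a - b)) = - pi"
      using *[of b a] g 2 good_segment_sym by force
    ultimately show ?thesis using pi2 by simp
  qed
qed

text \<open>\<open>height a b t\<close> is the inverse distance from \<open>ob\<close> of the point of the line through \<open>a\<close> and \<open>b\<close>
  at angle \<open>t\<close>.\<close>

definition height :: "complex \<Rightarrow> complex \<Rightarrow> real \<Rightarrow> real" where
  "height a b t = (cmod (b - ob) * sin (\<alpha> b - t) + cmod (a - ob) * sin (t - \<alpha> a)) /
     (cmod (a - ob) * cmod (b - ob) * sin (\<alpha> b - \<alpha> a))"

lemma height_point: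
  assumes g: "good_segment a b" and lt: "\<alpha> a < \<alpha> b" and t: "\<alpha> a < t" "t < \<alpha> b"
  shows "0 < height a b t" "ob + cis t / of_real (height a b t) \<in> open_segment a b"
proof -
  note v = good_segment_visible[OF g]
  define ra rb S l m N where "ra = cmod (a - ob)" and "rb = cmod (b - ob)" and "S = sin (\<alpha> b - \<alpha> a)"
    and "l = rb * sin (\<alpha> b - t)" and "m = ra * sin (t - \<alpha> a)" and "N = l + m"
  have r: "0 < ra" "0 < rb" using v by (auto simp: ra_def rb_def)
  have S: "0 < S" unfolding S_def by (rule good_segment_cr(2)[OF g lt])
  have "0 < sin (\<alpha> b - t)" "0 < sin (t - \<alpha> a)"
    using t good_segment_angle[OF g lt] by (auto intro!: sin_gt_zero)
  then have "0 < l" "0 < m" using r by (simp_all add: l_def m_def)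
  then have lm: "0 < l" "0 < m" "0 < N" by (simp_all add: N_def)
  have h: "height a b t = N / (ra * rb * S)"
    by (simp add: height_def ra_def rb_def S_def l_def m_def N_def)
  show "0 < height a b t" unfolding h using r S lm by simp
  \<comment> \<open>The weights \<open>l\<close> and \<open>m\<close> are chosen such that the
    combination of the two end points is a positive multiple of \<open>cis t\<close>, by the
    addition theorems.\<close>
  have "of_real l * (a - ob) + of_real m * (b - ob) = of_real (ra * rb) *
      (of_real (sin (\<alpha> b - t)) * cis (\<alpha> a) + of_real (sin (t - \<alpha> a)) * cis (\<alpha> b))"
    by (subst polar[of a], subst polar[of b])
      (simp add: l_def m_def ra_def rb_def algebra_simps)
  also have "of_real (sin (\<alpha> b - t)) * cis (\<alpha> a) + of_real (sin (t - \<alpha> a)) * cis (\<alpha> b) =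
      of_real S * cis t"
  proof -
    have "sin (y - t) * cos x + sin (t - x) * cos y = sin (y - x) * cos t"
      "sin (y - t) * sin x + sin (t - x) * sin y = sin (y - x) * sin t" for x y :: real
      by (simp_all add: sin_diff algebra_simps)
    then show ?thesis by (simp add: complex_eq_iff S_def)
  qed
  finally have comb: "of_real l * (a - ob) + of_real m * (b - ob) = of_real (ra * rb * S) * cis t"
    by (simp add: mult.assoc)
  have "ob + cis t / of_real (height a b t) = ob + (of_real (ra * rb * S) * cis t) / of_real N"
    unfolding h by (simp add: field_simps)
  also have "\<dots> = ob + (of_real l * (a - ob) + of_real m * (b - ob)) / of_real N" unfolding comb ..
  also have "\<dots> = (1 - m / N) *\<^sub>R a + (m / N) *\<^sub>R b"
  proof -
    have lN: "1 - m / N = l / N" using lm by (simp add: N_def field_simps)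
    define s where "s = m / N"
    have "(of_real l * (a - ob) + of_real m * (b - ob)) / of_real N =
        of_real (l / N) * (a - ob) + of_real s * (b - ob)"
      by (simp add: add_divide_distrib s_def)
    then show ?thesis unfolding lN[symmetric] s_def[symmetric] scaleR_conv_of_real of_real_diff of_real_1
      by algebra
  qed
  finally show "ob + cis t / of_real (height a b t) \<in> open_segment a b"
    using lm v(5) unfolding in_segment by (intro conjI exI[of _ "m / N"]) (auto simp: N_def)
qed

lemma height_ends:
  assumes "good_segment a b"
  shows "height a b (\<alpha> a) = 1 / cmod (a - ob)" "height a b (\<alpha> b) = 1 / cmod (b - ob)"
proof -
  note v = good_segment_visible[OF assms]
  have "sin (\<alpha> b - \<alpha> a) \<noteq> 0"
  proof (cases "\<alpha> a < \<alpha> b")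
    case True then show ?thesis using good_segment_cr(2)[OF assms] by simp
  next
    case False
    then have "\<alpha> b < \<alpha> a" using assms by (simp add: good_segment_def)
    then have "0 < sin (\<alpha> a - \<alpha> b)" using good_segment_cr(2)[of b a] assms good_segment_sym by blast
    then show ?thesis using sin_minus[of "\<alpha> a - \<alpha> b"] by simp
  qed
  then show "height a b (\<alpha> a) = 1 / cmod (a - ob)" "height a b (\<alpha> b) = 1 / cmod (b - ob)"
    using v by (auto simp: height_def)
qed

text \<open>On a ray from \<open>ob\<close>, the side of the line through \<open>a\<close> and
  \<open>b\<close> is decided by comparing inverse distances. Unlike the distance, the inverse
  distance along a line is linear in \<open>cos t\<close> and \<open>sin t\<close>, so it stays
  finite and continuous.\<close>

lemma cr_height:
  assumes g: "good_segment a b" and lt: "\<alpha> a < \<alpha> b" and w: "w \<noteq> ob"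
  shows "cr (b - a) (w - a) < 0 \<longleftrightarrow> 1 / cmod (w - ob) < height a b (\<alpha> w)"
    "cr (b - a) (w - a) = 0 \<longleftrightarrow> 1 / cmod (w - ob) = height a b (\<alpha> w)"
proof -
  note v = good_segment_visible[OF g]
  define M where "M = cmod (a - ob) * cmod (b - ob) * sin (\<alpha> b - \<alpha> a)"
  have M: "0 < M" using good_segment_cr(1)[OF g lt] unfolding M_def cr_polar .
  have rw: "0 < cmod (w - ob)" using w by simp
  have "cr (b - a) (w - a) = cr (a - ob) (b - ob) + cr (b - ob) (w - ob) - cr (a - ob) (w - ob)"
    by (simp add: cr_def algebra_simps)
  also have "\<dots> = M - cmod (w - ob) * (cmod (b - ob) * sin (\<alpha> b - \<alpha> w) + cmod (a - ob) * sin (\<alpha> w - \<alpha> a))"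
    unfolding cr_polar M_def by (simp add: sin_diff algebra_simps)
  also have "\<dots> = M * (1 - cmod (w - ob) * height a b (\<alpha> w))"
    unfolding height_def M_def[symmetric] using M by (simp add: field_simps)
  finally have *: "cr (b - a) (w - a) = M * (1 - cmod (w - ob) * height a b (\<alpha> w))" .
  show "cr (b - a) (w - a) < 0 \<longleftrightarrow> 1 / cmod (w - ob) < height a b (\<alpha> w)"
    unfolding * using M rw by (simp add: mult_less_0_iff field_simps)
  show "cr (b - a) (w - a) = 0 \<longleftrightarrow> 1 / cmod (w - ob) = height a b (\<alpha> w)"
    unfolding * using M rw by (auto simp: field_simps)
qed

lemma continuous_height: "continuous_on S (height a b)"
  unfolding height_def divide_inverse by (intro continuous_intros)

end


section \<open>Crossings of straight segments\<close>

text \<open>With all four ends different this is -1 if the two chords cross and 1 otherwise; it is 0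
  if the chords share an end.\<close>

definition cross_pair :: "hpos \<times> hpos \<Rightarrow> hpos \<times> hpos \<Rightarrow> real" where
  "cross_pair p q = sg (fst p) (fst q) * sg (snd p) (fst q) * (sg (fst p) (snd q) * sg (snd p) (snd q))"

lemma cross_pair_sym: "cross_pair p q = cross_pair q p"
  unfolding cross_pair_def
  using sg_swap[of "fst p" "fst q"] sg_swap[of "snd p" "fst q"] sg_swap[of "fst p" "snd q"]
    sg_swap[of "snd p" "snd q"] by (simp add: mult_ac)

lemma cross_pair_swap: "cross_pair (l, r) q = cross_pair (r, l) q"
  by (simp add: cross_pair_def mult_ac)

context observer
begin

text \<open>The point \<open>w\<close> is seen within the angular range of the segment and lies
  beyond it. The two disjuncts cover both directions of the segment.\<close>

definition outer :: "complex \<Rightarrow> complex \<Rightarrow> complex \<Rightarrow> bool" where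
  "outer a b w \<longleftrightarrow> \<alpha> a < \<alpha> w \<and> \<alpha> w < \<alpha> b \<and> cr (b - a) (w - a) < 0 \<or>
     \<alpha> b < \<alpha> w \<and> \<alpha> w < \<alpha> a \<and> cr (a - b) (w - b) < 0"

definition outer_sign :: "complex \<Rightarrow> complex \<Rightarrow> complex \<Rightarrow> real" where
  "outer_sign a b w = (if outer a b w then -1 else 1)"

definition segment_ends :: "complex \<Rightarrow> complex \<Rightarrow> hpos \<times> hpos" where
  "segment_ends a b = (hpos_at a (b - a), hpos_at b (a - b))"

lemma outer_sign_swap: "outer_sign a b w = outer_sign b a w"
  by (auto simp: outer_sign_def outer_def)

lemma outer_iff_height:
  assumes "good_segment a b" "\<alpha> a < \<alpha> b" "w \<noteq> ob"
  shows "outer a b w \<longleftrightarrow> \<alpha> a < \<alpha> w \<and> \<alpha> w < \<alpha> b \<and> 1 / cmod (w - ob) < height a b (\<alpha> w)"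
  using cr_height(1)[OF assms] assms(2) by (auto simp: outer_def)

lemma height_unequal:
  assumes g: "good_segment a b" and lt: "\<alpha> a < \<alpha> b" and w: "w \<noteq> ob"
    and b: "\<alpha> a < \<alpha> w" "\<alpha> w < \<alpha> b" and out: "w \<notin> open_segment a b"
  shows "height a b (\<alpha> w) \<noteq> 1 / cmod (w - ob)"
proof
  assume "height a b (\<alpha> w) = 1 / cmod (w - ob)"
  then have "ob + cis (\<alpha> w) / of_real (height a b (\<alpha> w)) = ob + of_real (cmod (w - ob)) * cis (\<alpha> w)"
    by simp
  also have "\<dots> = w" using polar[of w] by (metis add.commute diff_add_cancel)
  finally show False using height_point(2)[OF g lt b] out by simp
qed

text \<open>The difference of the heights is continuous and has no zero strictly between
  \<open>s\<close> and \<open>t\<close>, since a zero would be a common point of the open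
  segments.\<close>

lemma height_order_constant:
  assumes g: "good_segment a b" "\<alpha> a < \<alpha> b" "good_segment c d" "\<alpha> c < \<alpha> d"
    and disj: "open_segment a b \<inter> open_segment c d = {}"
    and st: "s < t" "\<alpha> a \<le> s" "\<alpha> c \<le> s" "t \<le> \<alpha> b" "t \<le> \<alpha> d"
    and ne: "height a b s \<noteq> height c d s" "height a b t \<noteq> height c d t"
  shows "height c d s < height a b s \<longleftrightarrow> height c d t < height a b t"
proof -
  define H where "H x = height a b x - height c d x" for x
  have cont: "continuous_on {s..t} H"
    unfolding H_def by (intro continuous_intros continuous_height)
  have nz: "H x \<noteq> 0" if "s < x" "x < t" for x
  proof
    assume "H x = 0"
    then have eq: "height a b x = height c d x" by (simp add: H_def)
    have "ob + cis x / of_real (height a b x) \<in> open_segment a b"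
      by (rule height_point(2)) (use g st that in auto)
    moreover have "ob + cis x / of_real (height a b x) \<in> open_segment c d"
      unfolding eq by (rule height_point(2)) (use g st that in auto)
    ultimately show False using disj by blast
  qed
  have ends: "H s \<noteq> 0" "H t \<noteq> 0" using ne by (auto simp: H_def)
  have "0 < H s \<longleftrightarrow> 0 < H t"
  proof (rule ccontr)
    assume *: "\<not> (0 < H s \<longleftrightarrow> 0 < H t)"
    have "\<exists>x. s \<le> x \<and> x \<le> t \<and> H x = 0"
    proof (cases "0 < H s")
      case True
      then show ?thesis using * ends IVT2'[of H t 0 s] cont st(1) by force
    next
      case False
      then show ?thesis using * ends IVT'[of H s 0 t] cont st(1) by force
    qed
    then show False using nz ends by (metis order_less_le)
  qed
  then show ?thesis by (simp add: H_def)
qed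

lemma Arg_less_iff_cr:
  assumes "u \<noteq> 0" "d1 \<noteq> 0" "d2 \<noteq> 0" "\<bar>Arg (d2 / u) - Arg (d1 / u)\<bar> < pi"
  shows "Arg (d1 / u) < Arg (d2 / u) \<longleftrightarrow> 0 < cr d1 d2"
    "Arg (d1 / u) = Arg (d2 / u) \<Longrightarrow> cr d1 d2 = 0 \<and> 0 < Re (d2 / d1)"
proof -
  define p1 where "p1 = Arg (d1 / u)"
  define p2 where "p2 = Arg (d2 / u)"
  define r where "r = cmod (d2 / u) / cmod (d1 / u)"
  have r: "0 < r" using assms by (simp add: r_def)
  have "d1 / u = of_real (cmod (d1 / u)) * cis p1" "d2 / u = of_real (cmod (d2 / u)) * cis p2"
    using assms by (simp_all add: p1_def p2_def cis_Arg sgn_div_norm scaleR_conv_of_real)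
  then have "(d2 / u) / (d1 / u) = of_real r * cis (p2 - p1)"
    unfolding r_def by (metis (no_types, lifting) cis_divide of_real_divide times_divide_times_eq)
  then have q: "d2 / d1 = of_real r * cis (p2 - p1)" using assms by (simp add: field_simps)
  have "cr d1 d2 / (cmod d1)\<^sup>2 = r * sin (p2 - p1)"
    using arg_cong[OF q, of Im] by (simp add: Im_divide cr_def cmod_power2 mult.commute)
  then have c: "cr d1 d2 = r * (cmod d1)\<^sup>2 * sin (p2 - p1)" using assms by (simp add: field_simps)
  have k: "0 < r * (cmod d1)\<^sup>2" using r assms by simp
  show "Arg (d1 / u) < Arg (d2 / u) \<longleftrightarrow> 0 < cr d1 d2"
    unfolding p1_def[symmetric] p2_def[symmetric]
  proof
    assume "p1 < p2"
    then have "0 < sin (p2 - p1)" using assms(4) by (intro sin_gt_zero) (auto simp: p1_def p2_def)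
    then show "0 < cr d1 d2" unfolding c using k by simp
  next
    assume pos: "0 < cr d1 d2"
    show "p1 < p2"
    proof (rule ccontr)
      assume "\<not> p1 < p2"
      then have "0 \<le> sin (p1 - p2)" using assms(4) by (intro sin_ge_zero) (auto simp: p1_def p2_def)
      then have "sin (p2 - p1) \<le> 0" using sin_minus[of "p1 - p2"] by simp
      then have "cr d1 d2 \<le> 0" unfolding c using k by (intro mult_nonneg_nonpos) auto
      then show False using pos by simp
    qed
  qed
  show "cr d1 d2 = 0 \<and> 0 < Re (d2 / d1)" if "Arg (d1 / u) = Arg (d2 / u)"
    using that q r unfolding c p1_def[symmetric] p2_def[symmetric] by simp
qed

text \<open>Common end points are allowed. The last condition holds for a generic observer and turns
  equal angles into equal points.\<close>

definition disjoint_segments :: "complex \<Rightarrow> complex \<Rightarrow> complex \<Rightarrow> complex \<Rightarrow> bool" where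
  "disjoint_segments a b c d \<longleftrightarrow> open_segment a b \<inter> open_segment c d = {} \<and>
     a \<notin> open_segment c d \<and> b \<notin> open_segment c d \<and> c \<notin> open_segment a b \<and> d \<notin> open_segment a b \<and>
     (\<forall>x\<in>{a, b}. \<forall>y\<in>{c, d}. \<alpha> x = \<alpha> y \<longrightarrow> x = y)"

lemma disjoint_segments_sym: "disjoint_segments a b c d \<Longrightarrow> disjoint_segments c d a b"
  unfolding disjoint_segments_def by (auto simp: Int_commute)

lemma disjoint_segments_swap: "disjoint_segments a b c d \<Longrightarrow> disjoint_segments b a c d"
  unfolding disjoint_segments_def by (auto simp: open_segment_commute)

lemma open_segment_same_direction:
  assumes "a \<noteq> b" "a \<noteq> d" "cr (b - a) (d - a) = 0" "0 < Re ((d - a) / (b - a))"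
  shows "open_segment a b \<inter> open_segment a d \<noteq> {}"
proof -
  define r where "r = Re ((d - a) / (b - a))"
  have "Im ((d - a) / (b - a)) = 0"
    using assms by (simp add: Im_divide_cr)
  then have "(d - a) / (b - a) = of_real r" by (simp add: complex_eq_iff r_def)
  then have d: "d = a + of_real r * (b - a)" using assms(1) by (simp add: field_simps)
  have r: "0 < r" using assms(4) by (simp add: r_def)
  define s where "s = min 1 r / 2"
  have s: "0 < s" "s < 1" "s < r" using r by (auto simp: s_def min_def)
  have "a + of_real s * (b - a) \<in> open_segment a b"
    using s assms(1) unfolding in_segment
    by (intro conjI exI[of _ s]) (auto simp: scaleR_conv_of_real algebra_simps)
  moreover have "a + of_real s * (b - a) \<in> open_segment a d"
    unfolding in_segment
  proof (intro conjI exI[of _ "s / r"])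
    have "of_real (s / r) * (d - a) = of_real s * (b - a)" using d r by simp
    then show "a + of_real s * (b - a) = (1 - s / r) *\<^sub>R a + (s / r) *\<^sub>R d"
      unfolding scaleR_conv_of_real of_real_diff of_real_1 by algebra
  qed (use s r assms(2) in auto)
  ultimately show ?thesis by blast
qed

lemma directions_differ:
  assumes g: "good_segment a b" "good_segment a d"
    and disj: "open_segment a b \<inter> open_segment a d = {}"
  shows "hpos_at a (b - a) \<noteq> hpos_at a (d - a)"
proof
  assume "hpos_at a (b - a) = hpos_at a (d - a)"
  then have eq: "Arg ((b - a) / (a - ob)) = Arg ((d - a) / (a - ob))" by (simp add: hpos_at_def)
  note v = good_segment_visible[OF g(1)] good_segment_visible[OF g(2)]
  have "cr (b - a) (d - a) = 0 \<and> 0 < Re ((d - a) / (b - a))"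
    by (rule Arg_less_iff_cr(2)[OF _ _ _ _ eq]) (use v eq in auto)
  then show False using open_segment_same_direction v disj by blast
qed

lemma slope_order:
  assumes g: "good_segment a b" "good_segment a d" and lt: "\<alpha> a < \<alpha> b" "\<alpha> a < \<alpha> d"
  shows "slope (hpos_at a (b - a)) < slope (hpos_at a (d - a)) \<longleftrightarrow> 0 < cr (b - a) (d - a)"
  unfolding hpos_at_def hpos.sel
  by (rule Arg_less_iff_cr)
    (use good_segment_visible[OF g(1)] good_segment_visible[OF g(2)] slope_forward(1)[OF g(1) lt(1)]
      slope_forward(1)[OF g(2) lt(2)] in \<open>auto simp: hpos_at_def abs_if\<close>)

lemma slope_order_end:
  assumes g: "good_segment a b" "good_segment d b" and lt: "\<alpha> a < \<alpha> b" "\<alpha> d < \<alpha> b"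
  shows "slope (hpos_at b (a - b)) < slope (hpos_at b (d - b)) \<longleftrightarrow> 0 < cr (a - b) (d - b)"
  unfolding hpos_at_def hpos.sel
  by (rule Arg_less_iff_cr)
    (use good_segment_visible[OF g(1)] good_segment_visible[OF g(2)] slope_forward(2)[OF g(1) lt(1)]
      slope_forward(2)[OF g(2) lt(2)] in \<open>auto simp: hpos_at_def abs_if\<close>)

text \<open>The cases compare the angular intervals of the two segments. If they interleave, the
  chords cross and exactly one of the two inner end points lies beyond the other segment. If one
  contains the other, both ends of the inner segment lie on the same side. At a common first or last
  end point the slopes decide, and they also decide which segment is beyond the other.\<close>

lemma cross_pair_segments_ordered:
  assumes g: "good_segment a b" "\<alpha> a < \<alpha> b" "good_segment c d" "\<alpha> c < \<alpha> d"
    and dj: "disjoint_segments a b c d" and le: "\<alpha> a \<le> \<alpha> c"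
    and le': "\<alpha> a = \<alpha> c \<Longrightarrow> \<alpha> b \<le> \<alpha> d"
  shows "cross_pair (segment_ends a b) (segment_ends c d) =
    outer_sign a b c * outer_sign a b d * (outer_sign c d a * outer_sign c d b)"
proof -
  note v = good_segment_visible[OF g(1)] good_segment_visible[OF g(3)]
  note sl = slope_forward[OF g(1,2)] slope_forward[OF g(3,4)]
  have disj: "open_segment a b \<inter> open_segment c d = {}" using dj by (simp add: disjoint_segments_def)
  have loc: "\<alpha> x = \<alpha> y \<Longrightarrow> x = y" if "x \<in> {a, b}" "y \<in> {c, d}" for x y
    using dj that by (auto simp: disjoint_segments_def)
  have o: "outer a b w \<longleftrightarrow> \<alpha> a < \<alpha> w \<and> \<alpha> w < \<alpha> b \<and> 1 / cmod (w - ob) < height a b (\<alpha> w)"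
    "outer c d w \<longleftrightarrow> \<alpha> c < \<alpha> w \<and> \<alpha> w < \<alpha> d \<and> 1 / cmod (w - ob) < height c d (\<alpha> w)"
    if "w \<noteq> ob" for w
    using outer_iff_height[OF g(1,2) that] outer_iff_height[OF g(3,4) that] by auto
  have sgHP: "sg (hpos_at x p) (hpos_at y q) = (if \<alpha> x = \<alpha> y then
      sg (slope (hpos_at x p)) (slope (hpos_at y q)) else sg (\<alpha> x) (\<alpha> y))" for x y p q
    by (simp add: hpos_at_def sg_HP)
  have na: "\<not> outer c d a" using le o(2)[OF v(3)] by auto
  have H: "height c d (\<alpha> c) = 1 / cmod (c - ob)" "height c d (\<alpha> d) = 1 / cmod (d - ob)"
    "height a b (\<alpha> b) = 1 / cmod (b - ob)"
    using height_ends[OF g(1)] height_ends[OF g(3)] by auto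
  have nc: "height a b (\<alpha> c) \<noteq> 1 / cmod (c - ob)" if "\<alpha> a < \<alpha> c" "\<alpha> c < \<alpha> b"
    by (rule height_unequal[OF g(1,2) _ that]) (use v dj in \<open>auto simp: disjoint_segments_def\<close>)
  have nd: "height a b (\<alpha> d) \<noteq> 1 / cmod (d - ob)" if "\<alpha> a < \<alpha> d" "\<alpha> d < \<alpha> b"
    by (rule height_unequal[OF g(1,2) _ that]) (use v dj in \<open>auto simp: disjoint_segments_def\<close>)
  have nb: "height c d (\<alpha> b) \<noteq> 1 / cmod (b - ob)" if "\<alpha> c < \<alpha> b" "\<alpha> b < \<alpha> d"
    by (rule height_unequal[OF g(3,4) _ that]) (use v dj in \<open>auto simp: disjoint_segments_def\<close>)
  consider (before) "\<alpha> b < \<alpha> c" | (touch) "\<alpha> b = \<alpha> c" | (start) "\<alpha> a = \<alpha> c" | (inter) "\<alpha> a < \<alpha> c" "\<alpha> c < \<alpha> b" "\<alpha> b < \<alpha> d"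
    | (nested) "\<alpha> a < \<alpha> c" "\<alpha> d < \<alpha> b" | ("end") "\<alpha> a < \<alpha> c" "\<alpha> b = \<alpha> d"
    using le by linarith
  then show ?thesis
  proof cases
    case before
    then have "\<not> outer a b c" "\<not> outer a b d" "\<not> outer c d b" using o v g by auto
    then show ?thesis using na before g
      by (simp add: outer_sign_def cross_pair_def segment_ends_def sgHP) (auto simp: sg_def)
  next
    case touch
    then have "\<not> outer a b c" "\<not> outer a b d" "\<not> outer c d b" using o v g by auto
    then show ?thesis using na touch g sl
      by (simp add: outer_sign_def cross_pair_def segment_ends_def sgHP) (auto simp: sg_def)
  next
    case start
    then have ac: "c = a" using loc[of a c] by simp
    have "\<alpha> b \<noteq> \<alpha> d"
    proof
      assume "\<alpha> b = \<alpha> d"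
      then have "d = b" using loc[of b d] by simp
      then show False using disj ac v(5) by simp
    qed
    then have bd: "\<alpha> b < \<alpha> d" using le'[OF start] by simp
    have "hpos_at a (b - a) \<noteq> hpos_at a (d - a)"
      by (rule directions_differ) (use g disj ac in auto)
    then have sne: "slope (hpos_at a (b - a)) \<noteq> slope (hpos_at a (d - a))" by (simp add: hpos_at_def)
    have so: "slope (hpos_at a (b - a)) < slope (hpos_at a (d - a)) \<longleftrightarrow> 0 < cr (b - a) (d - a)"
      by (rule slope_order) (use g ac in auto)
    have "outer c d b \<longleftrightarrow> slope (hpos_at a (b - a)) < slope (hpos_at a (d - a))"
      unfolding so outer_def using g ac bd by (auto simp: cr_def algebra_simps)
    moreover have "\<not> outer a b c" "\<not> outer a b d" using o v g ac bd by auto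
    ultimately show ?thesis using na ac bd g sne
      by (simp add: outer_sign_def cross_pair_def segment_ends_def sgHP) (auto simp: sg_def)
  next
    case inter
    have "height c d (\<alpha> c) < height a b (\<alpha> c) \<longleftrightarrow> height c d (\<alpha> b) < height a b (\<alpha> b)"
      by (rule height_order_constant[OF g disj]) (use inter H nc nb in auto)
    then have "outer a b c \<longleftrightarrow> \<not> outer c d b"
      using o v inter H nb by auto
    moreover have "\<not> outer a b d" using o v inter by auto
    ultimately show ?thesis using na inter g
      by (simp add: outer_sign_def cross_pair_def segment_ends_def sgHP) (auto simp: sg_def)
  next
    case nested
    have "height c d (\<alpha> c) < height a b (\<alpha> c) \<longleftrightarrow> height c d (\<alpha> d) < height a b (\<alpha> d)"
      by (rule height_order_constant[OF g disj]) (use nested g H nc nd in auto)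
    then have "outer a b c \<longleftrightarrow> outer a b d"
      using o v nested g H by auto
    moreover have "\<not> outer c d b" using o v nested by auto
    ultimately show ?thesis using na nested g
      by (simp add: outer_sign_def cross_pair_def segment_ends_def sgHP) (auto simp: sg_def)
  next
    case "end"
    then have bd: "d = b" using loc[of b d] by simp
    have "hpos_at b (a - b) \<noteq> hpos_at b (c - b)"
      by (rule directions_differ) (use g disj bd in \<open>auto simp: good_segment_sym open_segment_commute\<close>)
    then have sne: "slope (hpos_at b (a - b)) \<noteq> slope (hpos_at b (c - b))" by (simp add: hpos_at_def)
    have so: "slope (hpos_at b (a - b)) < slope (hpos_at b (c - b)) \<longleftrightarrow> 0 < cr (a - b) (c - b)"
      by (rule slope_order_end) (use g bd in auto)
    have "outer a b c \<longleftrightarrow> slope (hpos_at b (a - b)) < slope (hpos_at b (c - b))"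
    proof -
      have "cr (a - b) (c - b) = - cr (b - a) (c - a)" by (simp add: cr_def algebra_simps)
      then show ?thesis unfolding so outer_def using g(2,4) "end"(1) bd by auto
    qed
    moreover have "\<not> outer a b d" "\<not> outer c d b" using o v g bd by auto
    ultimately show ?thesis using na bd "end" g sne
      by (simp add: outer_sign_def cross_pair_def segment_ends_def sgHP) (auto simp: sg_def)
  qed
qed

text \<open>Both sides are invariant under exchanging the segments and under reversing either of
  them, which reduces the claim to the ordered case.\<close>

lemma cross_pair_segments:
  assumes g: "good_segment a b" "good_segment c d" and dj: "disjoint_segments a b c d"
  shows "cross_pair (segment_ends a b) (segment_ends c d) =
    outer_sign a b c * outer_sign a b d * (outer_sign c d a * outer_sign c d b)"
proof -
  let ?Q = "\<lambda>a b c d. cross_pair (segment_ends a b) (segment_ends c d) =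
    outer_sign a b c * outer_sign a b d * (outer_sign c d a * outer_sign c d b)"
  have sym: "?Q c d a b \<Longrightarrow> ?Q a b c d" for a b c d
    by (simp add: cross_pair_sym[of "segment_ends a b"] mult_ac)
  have 1: "?Q a b c d" if g: "good_segment a b" "good_segment c d" and dj: "disjoint_segments a b c d"
    and lt: "\<alpha> a < \<alpha> b" "\<alpha> c < \<alpha> d" for a b c d
  proof (cases "\<alpha> a < \<alpha> c \<or> \<alpha> a = \<alpha> c \<and> \<alpha> b \<le> \<alpha> d")
    case True
    then show ?thesis using cross_pair_segments_ordered[OF g(1) lt(1) g(2) lt(2) dj] by auto
  next
    case False
    then show ?thesis
      using cross_pair_segments_ordered[OF g(2) lt(2) g(1) lt(1) disjoint_segments_sym[OF dj]]
        sym[of c d a b] by linarith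
  qed
  have swap: "?Q b a c d \<Longrightarrow> ?Q a b c d" for a b c d
    by (simp add: segment_ends_def outer_sign_swap[of a b] cross_pair_swap[of "hpos_at a (b - a)"] mult_ac)
  have 2: "?Q a b c d" if g: "good_segment a b" "good_segment c d" and dj: "disjoint_segments a b c d"
    and lt: "\<alpha> c < \<alpha> d" for a b c d
  proof (cases "\<alpha> a < \<alpha> b")
    case True
    then show ?thesis using 1[OF g dj] lt by simp
  next
    case False
    then have "\<alpha> b < \<alpha> a" using g(1) by (auto simp: good_segment_def)
    then have "?Q b a c d"
      using g dj lt by (intro 1) (simp_all add: good_segment_sym[of b a] disjoint_segments_swap)
    then show ?thesis by (rule swap)
  qed
  show ?thesis
  proof (cases "\<alpha> c < \<alpha> d")
    case True
    then show ?thesis using 2[OF g dj] by simp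
  next
    case False
    then have "\<alpha> d < \<alpha> c" using g(2) by (auto simp: good_segment_def)
    have dj': "disjoint_segments d c a b"
      by (rule disjoint_segments_swap, rule disjoint_segments_sym, rule dj)
    have g': "good_segment d c" using g(2) by (simp add: good_segment_sym[of d c])
    have "?Q a b d c" by (rule 2[OF g(1) g' disjoint_segments_sym[OF dj'] \<open>\<alpha> d < \<alpha> c\<close>])
    then have "?Q d c a b" by (rule sym)
    then have "?Q c d a b" by (rule swap)
    then show ?thesis by (rule sym)
  qed
qed

end


section \<open>Sides of the polygon\<close>

definition half_angle :: "nat \<Rightarrow> real" where
  "half_angle g = pi / real (4 * g)"

definition normal_angle :: "nat \<Rightarrow> nat \<Rightarrow> real" where
  "normal_angle g a = (2 * real a - 1) * half_angle g"

lemma half_angle_bounds: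
  assumes "1 \<le> g" shows "0 < half_angle g" "half_angle g \<le> pi / 4"
proof -
  show "0 < half_angle g" using assms by (simp add: half_angle_def)
  have "pi / real (4 * g) \<le> pi / 4" using assms by (intro divide_left_mono) auto
  then show "half_angle g \<le> pi / 4" by (simp add: half_angle_def)
qed

lemma half_angle_pi: "1 \<le> g \<Longrightarrow> real (4 * g) * half_angle g = pi"
  by (simp add: half_angle_def)

lemma side_normal_eq: "side_normal g a = cis (normal_angle g a)"
  by (simp add: side_normal_def normal_angle_def half_angle_def)

lemma corner_eq: "corner g k = cis (2 * real k * half_angle g)"
  by (simp add: corner_def half_angle_def mult_ac)

lemma apothem_eq: "apothem g = cos (half_angle g)"
  by (simp add: apothem_def half_angle_def)

lemma side_length_eq: "side_length g = 2 * sin (half_angle g)"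
  by (simp add: side_length_def half_angle_def)

lemma apothem_pos: "1 \<le> g \<Longrightarrow> 0 < apothem g"
  unfolding apothem_eq using half_angle_bounds[of g] pi_gt_zero by (intro cos_gt_zero_pi) linarith+

lemma sin_half_angle_pos: "1 \<le> g \<Longrightarrow> 0 < sin (half_angle g)"
  using half_angle_bounds[of g] pi_gt_zero by (intro sin_gt_zero) linarith+

lemma corner_after: "corner g a = side_normal g a * Complex (apothem g) (sin (half_angle g))"
proof -
  have "2 * real a * half_angle g = normal_angle g a + half_angle g"
    by (simp add: normal_angle_def algebra_simps)
  then have "corner g a = side_normal g a * cis (half_angle g)"
    by (simp add: corner_eq side_normal_eq cis_mult)
  then show ?thesis by (simp add: apothem_eq cis.code)
qed

lemma corner_before:
  assumes "1 \<le> a" shows "corner g (a - 1) = side_normal g a * Complex (apothem g) (- sin (half_angle g))"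
proof -
  have "2 * real (a - 1) * half_angle g = normal_angle g a - half_angle g"
    using assms by (simp add: normal_angle_def of_nat_diff algebra_simps)
  then have "corner g (a - 1) = side_normal g a * cis (- half_angle g)"
    by (simp add: corner_eq side_normal_eq cis_mult)
  then show ?thesis by (simp add: apothem_eq cis.code)
qed

lemma side_eq:
  assumes "1 \<le> a"
  shows "side g a t = side_normal g a * Complex (apothem g) ((2 * t - 1) * sin (half_angle g))"
  unfolding side_def corner_before[OF assms] corner_after[of g a]
  by (simp add: linepath_def complex_eq_iff algebra_simps)

lemma inner_cis_mult: "inner (cis b) (cis b * z) = Re z"
proof -
  have "inner (cis b) (cis b * z) = ((cos b)\<^sup>2 + (sin b)\<^sup>2) * Re z"
    unfolding inner_complex_def by (simp only: cis.sel times_complex.sel) algebra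
  then show ?thesis by simp
qed

lemma inner_cis_cis: "inner (cis b) (cis t) = cos (t - b)"
  by (simp add: inner_complex_def cos_diff mult_ac)

lemma inner_side: "1 \<le> a \<Longrightarrow> inner (side_normal g a) (side g a t) = apothem g"
  unfolding side_eq side_normal_eq inner_cis_mult by simp

text \<open>Strictness keeps all passages away from the corner 1, near which the observer is going
  to be placed.\<close>

lemma norm_side_less:
  assumes "1 \<le> g" "1 \<le> a" "0 < t" "t < 1" shows "cmod (side g a t) < 1"
proof -
  have s: "0 < sin (half_angle g)" using assms(1) by (rule sin_half_angle_pos)
  have "(2 * t - 1)\<^sup>2 < 1" using assms by (simp add: power2_less_1_iff abs_if)
  then have "((2 * t - 1) * sin (half_angle g))\<^sup>2 < (sin (half_angle g))\<^sup>2"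
    using s by (simp add: power_mult_distrib)
  then have "(apothem g)\<^sup>2 + ((2 * t - 1) * sin (half_angle g))\<^sup>2 < 1"
    using sin_cos_squared_add[of "half_angle g"] unfolding apothem_eq by linarith
  then show ?thesis
    unfolding side_eq[OF assms(2)] norm_mult side_normal_eq norm_cis complex_norm by simp
qed

lemma cos_le_cos_near_0:
  assumes "0 \<le> c" "c \<le> x" "x \<le> 2 * pi - c" shows "cos x \<le> cos c"
proof (cases "x \<le> pi")
  case True
  then show ?thesis using assms by (intro cos_monotone_0_pi_le) auto
next
  case False
  have "cos (2 * pi - x) \<le> cos c" using assms False by (intro cos_monotone_0_pi_le) auto
  then show ?thesis by simp
qed

lemma polygon_halfspace:
  assumes g: "1 \<le> g" and a: "1 \<le> a" "a \<le> 4 * g"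
  shows "polygon g \<subseteq> {z. inner (side_normal g a) z \<le> apothem g}"
  unfolding polygon_def
proof (rule hull_minimal)
  show "corner g ` {..<4 * g} \<subseteq> {z. inner (side_normal g a) z \<le> apothem g}"
  proof
    fix z assume "z \<in> corner g ` {..<4 * g}"
    then obtain k where k: "k < 4 * g" "z = corner g k" by auto
    define m where "m = 2 * real k - (2 * real a - 1)"
    have "inner (side_normal g a) z = cos (m * half_angle g)"
      unfolding k(2) corner_eq side_normal_eq inner_cis_cis
      by (simp add: m_def normal_angle_def algebra_simps)
    also have "\<dots> = cos (\<bar>m\<bar> * half_angle g)" by (simp add: abs_if)
    also have "\<dots> \<le> cos (half_angle g)"
    proof (rule cos_le_cos_near_0)
      \<comment> \<open>The angle between a corner and a side normal is an odd multiple of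
        \<open>half_angle g\<close>, hence at least \<open>half_angle g\<close> in absolute
        value.\<close>
      have "m = of_int (2 * (int k - int a) + 1)" by (simp add: m_def)
      moreover have "1 \<le> \<bar>2 * (int k - int a) + 1\<bar>" by presburger
      ultimately have "1 \<le> \<bar>m\<bar>" by (metis of_int_abs of_int_1_le_iff)
      then show "half_angle g \<le> \<bar>m\<bar> * half_angle g" using half_angle_bounds[OF g] by simp
      have "\<bar>m\<bar> \<le> 8 * real g - 1" using k a by (simp add: m_def abs_if)
      then have "\<bar>m\<bar> * half_angle g \<le> (8 * real g - 1) * half_angle g"
        using half_angle_bounds[OF g] by (intro mult_right_mono) auto
      also have "\<dots> = 2 * pi - half_angle g" using half_angle_pi[OF g] by (simp add: algebra_simps)
      finally show "\<bar>m\<bar> * half_angle g \<le> 2 * pi - half_angle g" .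
    qed (use half_angle_bounds[OF g] in simp)
    finally show "z \<in> {z. inner (side_normal g a) z \<le> apothem g}" by (simp add: apothem_eq)
  qed
qed (rule convex_halfspace_le)

lemma polygon_interior_halfspace:
  assumes "1 \<le> g" "1 \<le> a" "a \<le> 4 * g" "z \<in> interior (polygon g)"
  shows "inner (side_normal g a) z < apothem g"
proof -
  have "z \<in> interior {z. inner (side_normal g a) z \<le> apothem g}"
    using interior_mono[OF polygon_halfspace[OF assms(1-3)]] assms(4) by blast
  moreover have "side_normal g a \<noteq> 0" by (simp add: side_normal_eq)
  ultimately show ?thesis by simp
qed

lemma polygon_subset_cball: "polygon g \<subseteq> cball 0 1"
  unfolding polygon_def by (intro hull_minimal convex_cball) (auto simp: corner_eq)

lemma polygon_interior_norm: "z \<in> interior (polygon g) \<Longrightarrow> cmod z < 1"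
  using interior_mono[OF polygon_subset_cball[of g]] by auto

lemma one_in_polygon: "1 \<le> g \<Longrightarrow> 1 \<in> polygon g"
  unfolding polygon_def by (rule hull_inc) (auto simp: corner_def intro!: image_eqI[of _ _ 0])

lemma side_in_polygon:
  assumes "1 \<le> g" "1 \<le> a" "a \<le> 4 * g" "0 \<le> t" "t \<le> 1" shows "side g a t \<in> polygon g"
proof -
  have "corner g (4 * g) = corner g 0" using assms(1) by (simp add: corner_def)
  then have "corner g k \<in> corner g ` {..<4 * g}" if "k \<le> 4 * g" for k
    using that assms(1) by (cases "k = 4 * g") auto
  then have "corner g (a - 1) \<in> polygon g" "corner g a \<in> polygon g"
    using assms unfolding polygon_def by (auto intro!: hull_inc)
  moreover have "side g a t \<in> closed_segment (corner g (a - 1)) (corner g a)"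
    using assms by (auto simp: side_def linepath_def closed_segment_def)
  moreover have "convex (polygon g)" by (simp add: polygon_def convex_convex_hull)
  ultimately show ?thesis using closed_segment_subset by blast
qed

lemma Im_side_upper:
  assumes g: "1 \<le> g" and a: "1 \<le> a" "a \<le> 2 * g" and t: "0 < t" "t < 1"
  shows "0 < Im (side g a t)"
proof -
  let ?h = "half_angle g"
  note h = half_angle_bounds[OF g]
  have gh: "2 * real (2 * g) * ?h = pi" using half_angle_pi[OF g] by simp
  have nn: "0 \<le> Im (corner g k)" if "k \<le> 2 * g" for k
  proof -
    have "2 * real k * ?h \<le> 2 * real (2 * g) * ?h" using h that by (intro mult_right_mono mult_left_mono) auto
    then show ?thesis unfolding corner_eq gh using h by (auto intro!: sin_ge_zero)
  qed
  have pos: "0 < Im (corner g k)" if "1 \<le> k" "k < 2 * g" for k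
  proof -
    have "2 * real k * ?h < 2 * real (2 * g) * ?h" using h that by (intro mult_strict_right_mono mult_strict_left_mono) auto
    then show ?thesis unfolding corner_eq gh using h that by (auto intro!: sin_gt_zero)
  qed
  have eq: "Im (side g a t) = (1 - t) * Im (corner g (a - 1)) + t * Im (corner g a)"
    by (simp add: side_def linepath_def)
  show ?thesis
  proof (cases "a = 1")
    case True
    then have "0 < Im (corner g a)" "0 \<le> Im (corner g (a - 1))" using pos[of 1] nn[of 0] g by auto
    then show ?thesis unfolding eq using t by (intro add_nonneg_pos mult_pos_pos mult_nonneg_nonneg) auto
  next
    case False
    then have "0 \<le> Im (corner g a)" "0 < Im (corner g (a - 1))"
      using pos[of "a - 1"] nn[of a] a by auto
    then show ?thesis unfolding eq using t by (intro add_pos_nonneg mult_pos_pos mult_nonneg_nonneg) auto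
  qed
qed

lemma Im_side_lower:
  assumes g: "1 \<le> g" and a: "2 * g < a" "a \<le> 4 * g" and t: "0 < t" "t < 1"
  shows "Im (side g a t) < 0"
proof -
  define b where "b = a - 2 * g"
  have b: "1 \<le> b" "b \<le> 2 * g" "a = b + 2 * g" using a by (auto simp: b_def)
  have "corner g (k + 2 * g) = - corner g k" for k
  proof -
    have "2 * real (k + 2 * g) * half_angle g = 2 * real k * half_angle g + pi"
      using half_angle_pi[OF g] by (simp add: algebra_simps)
    then show ?thesis unfolding corner_eq by (simp add: cis_mult[symmetric])
  qed
  moreover have "b + 2 * g - 1 = b - 1 + 2 * g" using b by simp
  ultimately have "side g a t = - side g b t"
    by (simp add: side_def b(3) linepath_def)
  then show ?thesis using Im_side_upper[OF g b(1,2) t] by simp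
qed

section \<open>The polygon as seen from an observer near the corner 1\<close>

locale polygon_observer = observer +
  fixes g :: nat
  assumes g: "1 \<le> g" and ob_interior: "ob \<in> interior (polygon g)"
begin

definition far :: "complex \<Rightarrow> bool" where
  "far z \<longleftrightarrow> dist ob 1 < dist z 1"

text \<open>A point of the polygon on the cut is at the same height as \<open>ob\<close> and not to
  its left. Its real part is at most 1, so it is no farther from 1 than \<open>ob\<close>.\<close>

lemma far_visible:
  assumes "z \<in> polygon g" "far z" shows "visible z"
  unfolding visible_def
proof
  assume "z - ob \<in> \<real>\<^sub>\<ge>\<^sub>0"
  then have "Re ob \<le> Re z" "Im z = Im ob" by (auto simp: complex_nonneg_Reals_iff)
  moreover have "cmod z \<le> 1" using polygon_subset_cball assms(1) by fastforce
  then have "Re z \<le> 1" using complex_Re_le_cmod[of z] by linarith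
  ultimately have "(Re z - 1)\<^sup>2 + (Im z)\<^sup>2 \<le> (Re ob - 1)\<^sup>2 + (Im ob)\<^sup>2"
    by (auto intro!: power2_mono simp: abs_if power2_le_iff_abs_le)
  then have "dist z 1 \<le> dist ob 1" by (simp add: dist_norm cmod_def)
  then show False using assms(2) by (simp add: far_def)
qed

lemma normal_angle_bounds:
  assumes "1 \<le> a" "a \<le> 4 * g"
  shows "0 < normal_angle g a" "normal_angle g a < 2 * pi"
proof -
  note h = half_angle_bounds[OF g]
  show "0 < normal_angle g a" using h assms by (simp add: normal_angle_def)
  have "normal_angle g a < 2 * real (4 * g) * half_angle g"
    unfolding normal_angle_def using h assms by (intro mult_strict_right_mono) auto
  also have "\<dots> = 2 * pi" using half_angle_pi[OF g] by simp
  finally show "normal_angle g a < 2 * pi" .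
qed

definition boundary :: "nat \<Rightarrow> real \<Rightarrow> bool" where
  "boundary a t \<longleftrightarrow> 1 \<le> a \<and> a \<le> 4 * g \<and> 0 < t \<and> t < 1 \<and> far (side g a t)"

lemma boundary_polygon: "boundary a t \<Longrightarrow> side g a t \<in> polygon g"
  using side_in_polygon g by (simp add: boundary_def)

lemma boundary_visible: "boundary a t \<Longrightarrow> visible (side g a t)"
  by (rule far_visible[OF boundary_polygon]) (auto simp: boundary_def)

lemma boundary_inner:
  assumes "boundary a t"
  shows "0 < cmod (side g a t - ob) * cos (\<alpha> (side g a t) - normal_angle g a)"
    "inner (side_normal g a) (side g a t - ob) =
      cmod (side g a t - ob) * cos (\<alpha> (side g a t) - normal_angle g a)"
proof -
  let ?p = "side g a t"
  have a: "1 \<le> a" "a \<le> 4 * g" using assms by (auto simp: boundary_def)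
  have "?p - ob = cmod (?p - ob) *\<^sub>R cis (\<alpha> ?p)" using polar[of ?p] by (simp add: scaleR_conv_of_real)
  then have "inner (side_normal g a) (?p - ob) = inner (side_normal g a) (cmod (?p - ob) *\<^sub>R cis (\<alpha> ?p))" by simp
  then show eq: "inner (side_normal g a) (?p - ob) = cmod (?p - ob) * cos (\<alpha> ?p - normal_angle g a)"
    by (simp only: inner_scaleR_right side_normal_eq inner_cis_cis)
  have "0 < inner (side_normal g a) (?p - ob)"
    using polygon_interior_halfspace[OF g a ob_interior] inner_side[OF a(1)]
    by (simp add: inner_diff_right)
  then show "0 < cmod (?p - ob) * cos (\<alpha> ?p - normal_angle g a)" unfolding eq .
qed

lemma boundary_cos: "boundary a t \<Longrightarrow> 0 < cos (\<alpha> (side g a t) - normal_angle g a)"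
  using boundary_inner(1)[of a t] by (simp add: zero_less_mult_iff)

text \<open>Positivity of the cosine gives the bound only modulo \<open>2 * pi\<close>. In the
  wrapped cases the boundary point would lie to the right of \<open>ob\<close> and, vertically,
  between the real axis and \<open>ob\<close>, hence closer to the corner 1 than
  \<open>ob\<close>.\<close>

lemma boundary_angle:
  assumes "boundary a t"
  shows "\<bar>\<alpha> (side g a t) - normal_angle g a\<bar> < pi / 2"
proof (rule ccontr)
  let ?p = "side g a t"
  let ?x = "\<alpha> ?p - normal_angle g a"
  assume "\<not> \<bar>?x\<bar> < pi / 2"
  have a: "1 \<le> a" "a \<le> 4 * g" "0 < t" "t < 1" "far ?p" using assms by (auto simp: boundary_def)
  note b = normal_angle_bounds[OF a(1,2)] \<alpha>_bounds(1)[OF boundary_visible[OF assms]] \<alpha>_bounds(2)[of ?p]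
  have x2: "\<bar>?x\<bar> < 2 * pi" using b by linarith
  have big: "3 * pi / 2 < \<bar>?x\<bar>"
  proof (rule ccontr)
    assume "\<not> 3 * pi / 2 < \<bar>?x\<bar>"
    then have "0 \<le> cos (\<bar>?x\<bar> - pi)" using \<open>\<not> \<bar>?x\<bar> < pi / 2\<close> by (intro cos_ge_zero) auto
    then have "cos \<bar>?x\<bar> \<le> 0" by (simp add: cos_diff)
    then show False using boundary_cos[OF assms] by (simp add: abs_if split: if_splits) 
        (metis cos_minus minus_diff_eq not_le)
  qed
  have "cmod ?p \<le> 1" using norm_side_less[OF g a(1,3,4)] by simp
  then have re1: "Re ?p \<le> 1" using complex_Re_le_cmod[of ?p] by linarith
  have pol: "Re (?p - ob) = cmod (?p - ob) * cos (\<alpha> ?p)" "Im (?p - ob) = cmod (?p - ob) * sin (\<alpha> ?p)"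
    using arg_cong[OF polar[of ?p], of Re] arg_cong[OF polar[of ?p], of Im] by auto
  have rho: "0 < cmod (?p - ob)" using visible_nz[OF boundary_visible[OF assms]] by simp
  note h = half_angle_bounds[OF g]
  have gh: "real g * half_angle g = pi / 4" using half_angle_pi[OF g] by simp
  have near: "False" if "Re ob < Re ?p" "\<bar>Im ?p\<bar> \<le> \<bar>Im ob\<bar>"
  proof -
    have "(Re ?p - 1)\<^sup>2 \<le> (Re ob - 1)\<^sup>2" 
      unfolding abs_le_square_iff[symmetric] using that(1) re1 by (simp add: abs_if)
    moreover have "(Im ?p)\<^sup>2 \<le> (Im ob)\<^sup>2" using that(2) by (simp add: abs_le_square_iff)
    ultimately have "dist ?p 1 \<le> dist ob 1" by (simp add: dist_norm cmod_def)
    then show False using a(5) by (simp add: far_def)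
  qed
  show False
  proof (cases "0 < ?x")
    case True
    then have al: "3 * pi / 2 < \<alpha> ?p" "normal_angle g a < pi / 2" using big b by linarith+
    have "real (2 * a) - 1 < 2 * real g"
    proof (rule ccontr)
      assume "\<not> real (2 * a) - 1 < 2 * real g"
      then have "2 * real g * half_angle g \<le> normal_angle g a"
        unfolding normal_angle_def using h by (intro mult_right_mono) auto
      then show False using al gh by linarith
    qed
    then have "a \<le> 2 * g" by linarith
    then have im: "0 < Im ?p" using Im_side_upper[OF g a(1)] a by simp
    have "0 < cos (2 * pi - \<alpha> ?p)" "0 < sin (2 * pi - \<alpha> ?p)"
      using al b by (auto intro!: cos_gt_zero_pi sin_gt_zero simp del: sin_2pi_minus cos_2pi_minus)
    then have "0 < Re (?p - ob)" "Im (?p - ob) < 0" unfolding pol using rho by (auto simp: mult_pos_neg)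
    then show False using im near by auto
  next
    case False
    then have al: "\<alpha> ?p < pi / 2" "3 * pi / 2 < normal_angle g a" using big b by linarith+
    have "6 * real g < real (2 * a) - 1"
    proof (rule ccontr)
      assume "\<not> 6 * real g < real (2 * a) - 1"
      then have "normal_angle g a \<le> 6 * real g * half_angle g"
        unfolding normal_angle_def using h by (intro mult_right_mono) auto
      then show False using al gh by linarith
    qed
    then have "2 * g < a" by linarith
    then have im: "Im ?p < 0" using Im_side_lower[OF g _ a(2)] a by simp
    have "0 < cos (\<alpha> ?p)" "0 < sin (\<alpha> ?p)"
      using al b by (auto intro!: cos_gt_zero_pi sin_gt_zero)
    then have "0 < Re (?p - ob)" "0 < Im (?p - ob)" unfolding pol using rho by auto
    then show False using im near by auto
  qed
qed

end

text \<open>The scalar product with the other normal is affine along the side and at most the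
  apothem at both corners. If it is not constant, it is strictly smaller inside the side; it is
  constant only on the opposite side, where it is minus the apothem.\<close>

lemma inner_side_other:
  assumes g: "1 \<le> g" and a: "1 \<le> a" "a \<le> 4 * g" and b: "1 \<le> b" "b \<le> 4 * g"
    and ne: "a \<noteq> b" and t: "0 < t" "t < 1"
  shows "inner (side_normal g b) (side g a t) < apothem g"
proof -
  define e where "e = normal_angle g a - normal_angle g b"
  note h = half_angle_bounds[OF g]
  have s: "0 < sin (half_angle g)" by (rule sin_half_angle_pos[OF g])
  have e: "e = 2 * (real a - real b) * half_angle g"
    by (simp add: e_def normal_angle_def algebra_simps)
  have inn: "inner (side_normal g b) (side g a u) = cos e * apothem g - sin e * ((2 * u - 1) * sin (half_angle g))" for u
    unfolding side_eq[OF a(1)] side_normal_eq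
    by (simp add: inner_complex_def e_def cos_diff sin_diff algebra_simps)
  have le: "inner (side_normal g b) (side g a u) \<le> apothem g" if "0 \<le> u" "u \<le> 1" for u
    using side_in_polygon[OF g a that] polygon_halfspace[OF g b] by blast
  show ?thesis
  proof (cases "sin e = 0")
    case False
    define A where "A = inner (side_normal g b) (side g a 0)"
    define B where "B = inner (side_normal g b) (side g a 1)"
    have "A - B = 2 * (sin e * sin (half_angle g))" by (simp add: A_def B_def inn algebra_simps)
    then have "A \<noteq> B" using False s by auto
    moreover have "A \<le> apothem g" "B \<le> apothem g" using le by (auto simp: A_def B_def)
    ultimately consider "A < apothem g" | "B < apothem g" by linarith
    then have "(1 - t) * A + t * B < (1 - t) * apothem g + t * apothem g"
    proof cases
      case 1
      then show ?thesis using t \<open>B \<le> apothem g\<close>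
        by (intro add_less_le_mono mult_strict_left_mono mult_left_mono) auto
    next
      case 2
      then show ?thesis using t \<open>A \<le> apothem g\<close>
        by (intro add_le_less_mono mult_strict_left_mono mult_left_mono) auto
    qed
    moreover have "inner (side_normal g b) (side g a t) = (1 - t) * A + t * B"
      by (simp add: A_def B_def inn algebra_simps)
    ultimately show ?thesis by (simp add: algebra_simps)
  next
    case True
    have "\<bar>e\<bar> < 2 * pi"
    proof -
      have "\<bar>e\<bar> = 2 * \<bar>real a - real b\<bar> * half_angle g" unfolding e abs_mult using h by simp
      also have "\<dots> < 2 * real (4 * g) * half_angle g"
        using a b h by (intro mult_strict_right_mono) auto
      also have "\<dots> = 2 * pi" using half_angle_pi[OF g] by simp
      finally show ?thesis .
    qed
    have "cos e \<noteq> 1"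
    proof
      assume "cos e = 1"
      then obtain k :: int where k: "e = of_int k * 2 * pi" using cos_one_2pi_int by blast
      then have "\<bar>of_int k * (2 * pi)\<bar> < 1 * (2 * pi)" using \<open>\<bar>e\<bar> < 2 * pi\<close> by (simp add: mult.assoc)
      then have "\<bar>of_int k :: real\<bar> * (2 * pi) < 1 * (2 * pi)" by (simp add: abs_mult)
      then have "\<bar>of_int k :: real\<bar> < 1" using mult_less_cancel_right_pos[of "2 * pi"] pi_gt_zero by simp
      then have "k = 0" by linarith
      then show False using k e ne h by simp
    qed
    moreover have "(cos e)\<^sup>2 = 1" using True sin_cos_squared_add[of e] by simp
    ultimately have "cos e = -1" by (simp add: power2_eq_1_iff)
    then show ?thesis using True apothem_pos[OF g] by (simp add: inn)
  qed
qed

lemma side_inj: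
  assumes g: "1 \<le> g" and a: "1 \<le> a" "a \<le> 4 * g" and b: "1 \<le> b" "b \<le> 4 * g"
    and t: "0 < t" "t < 1" and eq: "side g a t = side g b u"
  shows "a = b \<and> t = u"
proof
  show ab: "a = b"
    using inner_side_other[OF g a b _ t] inner_side[OF b(1), of g u] eq by force
  have "Complex (apothem g) ((2 * t - 1) * sin (half_angle g)) =
      Complex (apothem g) ((2 * u - 1) * sin (half_angle g))"
    using eq unfolding ab side_eq[OF b(1)] side_normal_eq by simp
  then show "t = u" using sin_half_angle_pos[OF g] by simp
qed

context polygon_observer
begin

text \<open>Moving anticlockwise along a side turns to the left about every interior point of the
  polygon.\<close>

lemma boundary_order_same:
  assumes p: "boundary a t" and q: "boundary a u" and lt: "t < u"
  shows "\<alpha> (side g a t) < \<alpha> (side g a u)"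
proof (rule ccontr)
  let ?p = "side g a t" and ?q = "side g a u"
  assume *: "\<not> \<alpha> ?p < \<alpha> ?q"
  have a: "1 \<le> a" using p by (simp add: boundary_def)
  have s: "0 < sin (half_angle g)" by (rule sin_half_angle_pos[OF g])
  define k where "k = 2 * (u - t) * sin (half_angle g)"
  have k: "0 < k" using lt s by (simp add: k_def)
  have qp: "?q - ?p = side_normal g a * Complex 0 k"
    unfolding side_eq[OF a] k_def by (simp add: complex_eq_iff algebra_simps)
  have "cr (?p - ob) (?q - ob) = cr (?p - ob) (?q - ?p)" by (simp add: cr_def algebra_simps)
  also have "\<dots> = k * inner (side_normal g a) (?p - ob)"
    unfolding qp by (simp add: cr_def inner_complex_def algebra_simps)
  also have "0 < \<dots>" using k boundary_inner[OF p] by simp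
  finally have pos: "0 < cr (?p - ob) (?q - ob)" .
  have "0 \<le> sin (\<alpha> ?p - \<alpha> ?q)"
    using * boundary_angle[OF p] boundary_angle[OF q] by (intro sin_ge_zero) (auto simp: abs_if split: if_splits)
  then have "sin (\<alpha> ?q - \<alpha> ?p) \<le> 0" using sin_minus[of "\<alpha> ?p - \<alpha> ?q"] by simp
  then have "cr (?p - ob) (?q - ob) \<le> 0"
    unfolding cr_polar by (intro mult_nonneg_nonpos) auto
  then show False using pos by simp
qed

text \<open>Each of the two points maximises the scalar product with the normal of its own side. If
  the angles were in the wrong order, multiplying the two inequalities would give
  \<open>sin (B - A) * sin (y - x) < 0\<close> for the normal angles \<open>A < B\<close> and the
  angles \<open>x \<le> y\<close> of the points, although both differences lie between 0 and
  \<open>pi\<close>.\<close>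

lemma boundary_order:
  assumes p: "boundary a t" and q: "boundary b u" and lt: "a < b"
  shows "\<alpha> (side g a t) < \<alpha> (side g b u)"
proof (rule ccontr)
  let ?p = "side g a t" and ?q = "side g b u"
  assume *: "\<not> \<alpha> ?p < \<alpha> ?q"
  have a: "1 \<le> a" "a \<le> 4 * g" "0 < t" "t < 1" and b: "1 \<le> b" "b \<le> 4 * g" "0 < u" "u < 1"
    using p q by (auto simp: boundary_def)
  let ?A = "normal_angle g a" and ?B = "normal_angle g b"
  let ?r = "cmod (?p - ob)" and ?s = "cmod (?q - ob)"
  let ?x = "\<alpha> ?q" and ?y = "\<alpha> ?p"
  have AB: "?A < ?B" unfolding normal_angle_def using lt half_angle_bounds[OF g]
    by (intro mult_strict_right_mono) auto
  have rs: "0 < ?r" "0 < ?s" using visible_nz[OF boundary_visible[OF p]] visible_nz[OF boundary_visible[OF q]] by auto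
  note pa = boundary_angle[OF p] and qb = boundary_angle[OF q]
  have bd: "?B - pi / 2 < ?x" "?x \<le> ?y" "?y < ?A + pi / 2"
    using * pa qb by (auto simp: abs_if split: if_splits)
  have c: "0 < cos (?x - ?A)" "0 < cos (?y - ?B)" "0 < cos (?y - ?A)" "0 < cos (?x - ?B)"
    using bd AB by (auto intro!: cos_gt_zero_pi)
  have polp: "?p - ob = ?r *\<^sub>R cis ?y" and polq: "?q - ob = ?s *\<^sub>R cis ?x"
    using polar[of ?p] polar[of ?q] by (simp_all add: scaleR_conv_of_real)
  have inn: "inner (side_normal g m) (?p - ob) = ?r * cos (?y - normal_angle g m)"
    "inner (side_normal g m) (?q - ob) = ?s * cos (?x - normal_angle g m)" for m
    by (subst polp polq, simp only: inner_scaleR_right side_normal_eq inner_cis_cis)+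
  have "inner (side_normal g a) ?q \<le> inner (side_normal g a) ?p"
    using boundary_polygon[OF q] polygon_halfspace[OF g a(1,2)] inner_side[OF a(1), of g t] by auto
  then have 1: "?s * cos (?x - ?A) \<le> ?r * cos (?y - ?A)"
    unfolding inn[symmetric] by (simp add: inner_diff_right)
  have "inner (side_normal g b) ?p < inner (side_normal g b) ?q"
    using inner_side_other[OF g a(1,2) b(1,2) _ a(3,4)] lt inner_side[OF b(1), of g u] by auto
  then have 2: "?r * cos (?y - ?B) < ?s * cos (?x - ?B)"
    unfolding inn[symmetric] by (simp add: inner_diff_right)
  have "(?s * cos (?x - ?A)) * (?r * cos (?y - ?B)) < (?r * cos (?y - ?A)) * (?s * cos (?x - ?B))"
    by (rule mult_le_less_imp_less) (use 1 2 c rs in auto)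
  then have "(?r * ?s) * (cos (?x - ?A) * cos (?y - ?B)) < (?r * ?s) * (cos (?y - ?A) * cos (?x - ?B))"
    by (simp add: mult_ac)
  then have "cos (?x - ?A) * cos (?y - ?B) < cos (?y - ?A) * cos (?x - ?B)"
    using rs by (simp add: mult_less_cancel_left_pos)
  moreover have "cos (x - A) * cos (y - B) - cos (y - A) * cos (x - B) = sin (B - A) * sin (y - x)"
    for x y A B :: real
    unfolding cos_diff sin_diff by algebra
  ultimately have "sin (?B - ?A) * sin (?y - ?x) < 0" by (metis diff_less_0_iff_less)
  moreover have "0 \<le> sin (?B - ?A)" "0 \<le> sin (?y - ?x)"
    using bd AB by (auto intro!: sin_ge_zero)
  ultimately show False by (simp add: mult_less_0_iff)
qed

text \<open>By \<open>boundary_angle\<close> the difference of the two angles is already in the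
  range of \<open>Arg\<close>, so the lift is exact and not only correct modulo
  \<open>2 * pi\<close>.\<close>

lemma boundary_hpos:
  assumes "boundary a t"
  shows "slope (hpos_at (side g a t) (side_normal g a)) = normal_angle g a - \<alpha> (side g a t)"
    "lift (hpos_at (side g a t) (side_normal g a)) = normal_angle g a"
proof -
  let ?p = "side g a t"
  have rho: "0 < cmod (?p - ob)" using visible_nz[OF boundary_visible[OF assms]] by simp
  have "side_normal g a / (?p - ob) = of_real (1 / cmod (?p - ob)) * cis (normal_angle g a - \<alpha> ?p)"
    by (subst polar[of ?p]) (simp add: side_normal_eq cis_divide[symmetric])
  then have "Arg (side_normal g a / (?p - ob)) = normal_angle g a - \<alpha> ?p"
    using Arg_cis_mult[of "1 / cmod (?p - ob)" "normal_angle g a - \<alpha> ?p"] boundary_angle[OF assms] rho pi_gt_zero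
    by (auto simp: abs_if split: if_splits)
  then show "slope (hpos_at ?p (side_normal g a)) = normal_angle g a - \<alpha> ?p"
    "lift (hpos_at ?p (side_normal g a)) = normal_angle g a"
    by (simp_all add: hpos_at_def lift_def)
qed

text \<open>The segment enters the polygon and so makes an obtuse angle with the outward normal,
  whose slope is less than \<open>pi / 2\<close> in absolute value.\<close>

lemma boundary_slope_order:
  assumes p: "boundary a t" and s: "good_segment (side g a t) d"
    and inn: "open_segment (side g a t) d \<subseteq> interior (polygon g)"
  defines "n \<equiv> slope (hpos_at (side g a t) (side_normal g a))"
    and "f \<equiv> slope (hpos_at (side g a t) (d - side g a t))"
  shows "if \<alpha> (side g a t) < \<alpha> d then n < f else f < n"
proof -
  let ?p = "side g a t"
  note v = good_segment_visible[OF s]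
  have a: "1 \<le> a" "a \<le> 4 * g" using p by (auto simp: boundary_def)
  have "midpoint ?p d \<in> interior (polygon g)" using inn v(5) by (meson midpoint_in_open_segment subsetD)
  then have "inner (side_normal g a) (midpoint ?p d) < apothem g"
    by (rule polygon_interior_halfspace[OF g a])
  then have neg: "inner (side_normal g a) (d - ?p) < 0"
    using inner_side[OF a(1), of g t] by (simp add: midpoint_def inner_diff_right inner_add_right)
  define r rho where "r = cmod (d - ?p)" and "rho = cmod (?p - ob)"
  have "(d - ?p) / (?p - ob) = of_real (cmod ((d - ?p) / (?p - ob))) * cis f"
    using v by (simp add: f_def hpos_at_def cis_Arg sgn_div_norm scaleR_conv_of_real)
  then have "d - ?p = of_real (cmod ((d - ?p) / (?p - ob))) * cis f * (?p - ob)"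
    using v by (simp add: field_simps)
  also have "cmod ((d - ?p) / (?p - ob)) = r / rho" by (simp add: r_def rho_def norm_divide)
  also have "?p - ob = of_real rho * cis (\<alpha> ?p)" unfolding rho_def by (rule polar)
  finally have "d - ?p = of_real (r / rho * rho) * (cis f * cis (\<alpha> ?p))" by (simp add: mult_ac)
  then have "d - ?p = r *\<^sub>R cis (f + \<alpha> ?p)"
    using v by (simp add: cis_mult scaleR_conv_of_real rho_def)
  then have "inner (side_normal g a) (d - ?p) = r * cos (f + \<alpha> ?p - normal_angle g a)"
    by (simp only: inner_scaleR_right side_normal_eq inner_cis_cis)
  also have "f + \<alpha> ?p - normal_angle g a = f - n" by (simp add: n_def boundary_hpos[OF p])
  finally have cneg: "cos (f - n) < 0" using neg v by (auto simp: r_def mult_less_0_iff)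
  have n: "\<bar>n\<bar> < pi / 2" using boundary_angle[OF p] by (simp add: n_def boundary_hpos[OF p] abs_minus_commute)
  show ?thesis
  proof (cases "\<alpha> ?p < \<alpha> d")
    case True
    have f: "0 < f" "f < pi" using slope_forward(1)[OF s True] by (auto simp: f_def)
    have "n < f"
    proof (rule ccontr)
      assume "\<not> n < f"
      then have "0 < cos (f - n)" using f n by (intro cos_gt_zero_pi) auto
      then show False using cneg by simp
    qed
    then show ?thesis using True by simp
  next
    case False
    then have "\<alpha> d < \<alpha> ?p" using s by (auto simp: good_segment_def)
    then have f: "- pi < f" "f < 0" using slope_forward(2)[of d ?p] s good_segment_sym by (auto simp: f_def)
    have "f < n"
    proof (rule ccontr)
      assume "\<not> f < n"
      then have "0 < cos (f - n)" using f n by (intro cos_gt_zero_pi) auto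
      then show False using cneg by simp
    qed
    then show ?thesis using False by simp
  qed
qed

text \<open>Within the angular range of an inner segment, a boundary point always lies beyond the
  segment, since the points of the segment satisfy the half-plane condition of the side strictly. At
  a common point, \<open>boundary_slope_order\<close> places the outward normal outside the interval
  between the two ends.\<close>

lemma boundary_end_ordered:
  assumes p: "boundary a t" and s: "good_segment c d" "\<alpha> c < \<alpha> d"
    and inn: "open_segment c d \<subseteq> interior (polygon g)"
    and loc: "\<And>x. x \<in> {c, d} \<Longrightarrow> \<alpha> (side g a t) = \<alpha> x \<Longrightarrow> side g a t = x"
  shows "sg (hpos_at (side g a t) (side_normal g a)) (fst (segment_ends c d)) *
      sg (hpos_at (side g a t) (side_normal g a)) (snd (segment_ends c d)) = outer_sign c d (side g a t)"
proof -
  let ?p = "side g a t"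
  have a: "1 \<le> a" "a \<le> 4 * g" using p by (auto simp: boundary_def)
  have sgHP: "sg (hpos_at x p) (hpos_at y q) = (if \<alpha> x = \<alpha> y then
      sg (slope (hpos_at x p)) (slope (hpos_at y q)) else sg (\<alpha> x) (\<alpha> y))" for x y p q
    by (simp add: hpos_at_def sg_HP)
  have pob: "?p \<noteq> ob" by (rule visible_nz[OF boundary_visible[OF p]])
  consider (out) "\<alpha> ?p < \<alpha> c \<or> \<alpha> d < \<alpha> ?p" | (mid) "\<alpha> c < \<alpha> ?p" "\<alpha> ?p < \<alpha> d" | (left) "\<alpha> ?p = \<alpha> c" | (right) "\<alpha> ?p = \<alpha> d"
    by linarith
  then show ?thesis
  proof cases
    case out
    then have "\<not> outer c d ?p" using s(2) by (auto simp: outer_def)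
    then show ?thesis using out s(2)
      by (simp add: outer_sign_def segment_ends_def sgHP) (auto simp: sg_def)
  next
    case mid
    let ?h = "height c d (\<alpha> ?p)"
    note hp = height_point[OF s mid]
    have "inner (side_normal g a) (ob + cis (\<alpha> ?p) / of_real ?h) < apothem g"
      by (rule polygon_interior_halfspace[OF g a]) (use hp inn in blast)
    then have "inner (side_normal g a) (cis (\<alpha> ?p) / of_real ?h) < inner (side_normal g a) (?p - ob)"
      using inner_side[OF a(1), of g t] by (simp add: inner_diff_right inner_add_right)
    also have "inner (side_normal g a) (?p - ob) = cmod (?p - ob) * cos (\<alpha> ?p - normal_angle g a)"
      by (rule boundary_inner[OF p])
    also have "cis (\<alpha> ?p) / of_real ?h = (1 / ?h) *\<^sub>R cis (\<alpha> ?p)" by (simp add: scaleR_conv_of_real)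
    finally have "1 / ?h * cos (\<alpha> ?p - normal_angle g a) < cmod (?p - ob) * cos (\<alpha> ?p - normal_angle g a)"
      by (simp only: inner_scaleR_right side_normal_eq inner_cis_cis)
    then have "1 / ?h < cmod (?p - ob)" using boundary_cos[OF p] mult_less_cancel_right_pos by blast
    then have "1 / cmod (?p - ob) < ?h" using hp(1) pob by (simp add: field_simps)
    then have "outer c d ?p" using outer_iff_height[OF s pob] mid by simp
    then show ?thesis using mid s(2)
      by (simp add: outer_sign_def segment_ends_def sgHP) (auto simp: sg_def)
  next
    case left
    then have pc: "?p = c" using loc by simp
    have "slope (hpos_at ?p (side_normal g a)) < slope (hpos_at c (d - c))"
      using boundary_slope_order[OF p, of d] s inn unfolding pc by simp
    moreover have "\<not> outer c d ?p" using left s(2) by (auto simp: outer_def)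
    ultimately show ?thesis using left s(2)
      by (simp add: outer_sign_def segment_ends_def sgHP) (auto simp: sg_def)
  next
    case right
    then have pd: "?p = d" using loc by simp
    have "slope (hpos_at d (c - d)) < slope (hpos_at ?p (side_normal g a))"
      using boundary_slope_order[OF p, of c] s inn unfolding pd
      by (simp add: good_segment_sym[of d c] open_segment_commute[of d c])
    moreover have "\<not> outer c d ?p" using right s(2) by (auto simp: outer_def)
    ultimately show ?thesis using right s(2)
      by (simp add: outer_sign_def segment_ends_def sgHP) (auto simp: sg_def)
  qed
qed

lemma boundary_end:
  assumes p: "boundary a t" and s: "good_segment c d"
    and inn: "open_segment c d \<subseteq> interior (polygon g)"
    and loc: "\<And>x. x \<in> {c, d} \<Longrightarrow> \<alpha> (side g a t) = \<alpha> x \<Longrightarrow> side g a t = x"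
  shows "sg (hpos_at (side g a t) (side_normal g a)) (fst (segment_ends c d)) *
      sg (hpos_at (side g a t) (side_normal g a)) (snd (segment_ends c d)) = outer_sign c d (side g a t)"
proof (cases "\<alpha> c < \<alpha> d")
  case True
  then show ?thesis using boundary_end_ordered[OF p s True inn loc] by blast
next
  case False
  then have "\<alpha> d < \<alpha> c" using s by (auto simp: good_segment_def)
  moreover have "good_segment d c" using s good_segment_sym by blast
  moreover have "open_segment d c \<subseteq> interior (polygon g)" using inn by (simp add: open_segment_commute)
  ultimately have "sg (hpos_at (side g a t) (side_normal g a)) (fst (segment_ends d c)) *
      sg (hpos_at (side g a t) (side_normal g a)) (snd (segment_ends d c)) = outer_sign d c (side g a t)"
    using boundary_end_ordered[OF p, of d c] loc by blast
  then show ?thesis by (simp add: outer_sign_swap[of c d] segment_ends_def mult.commute)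
qed

end


section \<open>Segments and bridges\<close>

datatype piece = Seg complex complex | Br nat bool real

lemma first_side_bounds:
  assumes "j \<in> {1..2 * g}"
  shows "1 \<le> first_side j" "first_side j + 2 \<le> 4 * g"
proof -
  have j: "1 \<le> j" "j \<le> 2 * g" using assms by auto
  show "1 \<le> first_side j" using j by (cases "odd j") (simp_all add: first_side_def, presburger)
  show "first_side j + 2 \<le> 4 * g"
  proof (cases "odd j")
    case True
    then have "j \<noteq> 2 * g" by auto
    then show ?thesis using True j by (simp add: first_side_def)
  next
    case False
    then show ?thesis using j by (simp add: first_side_def)
  qed
qed

text \<open>What remains of the phases of a path: one sign per piece and one per junction.\<close>

fun chain_sign :: "(hpos \<times> hpos) list \<Rightarrow> real" where
  "chain_sign (p # q # ps) = sg (fst p) (snd p) * sg (snd p) (fst q) * chain_sign (q # ps)"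
| "chain_sign [p] = sg (fst p) (snd p)"
| "chain_sign [] = 1"

context polygon_observer
begin

fun start :: "piece \<Rightarrow> complex" where
  "start (Seg a b) = a"
| "start (Br j d t) = arrival g (Cross j d t)"

fun finish :: "piece \<Rightarrow> complex" where
  "finish (Seg a b) = b"
| "finish (Br j d t) = departure g (Cross j d t)"

fun start_dir :: "piece \<Rightarrow> complex" where
  "start_dir (Seg a b) = b - a"
| "start_dir (Br j d t) = side_normal g (if d then first_side j else first_side j + 2)"

text \<open>Like \<open>start_dir\<close>, this points from the end into the piece; the exit of a
  bridge therefore also gets the outward normal.\<close>

fun finish_dir :: "piece \<Rightarrow> complex" where
  "finish_dir (Seg a b) = a - b"
| "finish_dir (Br j d t) = side_normal g (if d then first_side j + 2 else first_side j)"

definition ends :: "piece \<Rightarrow> hpos \<times> hpos" where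
  "ends P = (hpos_at (start P) (start_dir P), hpos_at (finish P) (finish_dir P))"

fun poly :: "piece \<Rightarrow> complex list" where
  "poly (Seg a b) = [a, b]"
| "poly (Br j d t) = waypoint_image g (Cross j d t)"

fun good_piece :: "piece \<Rightarrow> bool" where
  "good_piece (Seg a b) \<longleftrightarrow> good_segment a b \<and> open_segment a b \<subseteq> interior (polygon g)"
| "good_piece (Br j d t) \<longleftrightarrow> j \<in> {1..2 * g} \<and> boundary (first_side j) t \<and> boundary (first_side j + 2) (1 - t)"

text \<open>The polyline of a bridge turns left by \<open>pi / 2\<close>, twice by
  \<open>2 * half_angle g\<close>, and again by \<open>pi / 2\<close>; half of the total is
  \<open>pi / 2 + 2 * half_angle g\<close>.\<close>

lemma bridge_turning:
  assumes j: "j \<in> {1..2 * g}" and t: "0 < t" "t < 1"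
  shows "turn_product (bridge_image g j t) = cis (pi / 2 + 2 * half_angle g)"
    "no_reversal (bridge_image g j t)"
    "\<exists>k>0. bridge_image g j t ! 1 - hd (bridge_image g j t) = of_real k * side_normal g (first_side j)"
    "\<exists>k>0. last (butlast (bridge_image g j t)) - last (bridge_image g j t) =
      of_real k * side_normal g (first_side j + 2)"
proof -
  note add_2_eq_Suc' [simp del]
  define a where "a = first_side j"
  have a: "1 \<le> a" using first_side_bounds[OF j] by (simp add: a_def)
  define p q h where "p = side g a t" and "q = side g (a + 2) (1 - t)"
    and "h = side_length g * ((if odd j then 1 else 3) + (1 - t))"
  define c where "c = complex_of_real (1 + h / apothem g)"
  define n where "n = side_normal g a"
  let ?y = "half_angle g"
  note y = half_angle_bounds[OF g]
  have s: "0 < sin ?y" by (rule sin_half_angle_pos[OF g])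
  have ap: "0 < apothem g" by (rule apothem_pos[OF g])
  have h: "0 < h" unfolding h_def side_length_eq using s t by (intro mult_pos_pos) auto
  have img: "bridge_image g j t = [p, p + of_real h * n, c * corner g a, c * corner g (a + 1),
      q + of_real h * side_normal g (a + 2), q]"
    by (simp add: bridge_image_def Let_def a_def p_def q_def h_def c_def n_def)
  have n0: "n \<noteq> 0" by (simp add: n_def side_normal_eq)
  have "normal_angle g (a + 1) = normal_angle g a + 2 * ?y" "normal_angle g (a + 2) = normal_angle g a + 4 * ?y"
    by (simp_all add: normal_angle_def algebra_simps)
  then have n1: "side_normal g (a + 1) = n * cis (2 * ?y)" and n2: "side_normal g (a + 2) = n * cis (4 * ?y)"
    by (simp_all add: n_def side_normal_eq cis_mult)
  \<comment> \<open>\<open>k\<close> is the length of the two outer parts, and \<open>k'\<close>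
    that of the middle part, of the bridge along the concentric polygon.\<close>
  define k where "k = sin ?y * (2 * (1 - t) + h / apothem g)"
  define k' where "k' = 2 * sin ?y * (1 + h / apothem g)"
  have k: "0 < k" "0 < k'" unfolding k_def k'_def using s t h ap by (auto intro!: mult_pos_pos add_pos_pos)
  have v1: "(p + of_real h * n) - p = of_real h * n" by simp
  have e1: "c * corner g a - (p + of_real h * n) = n * (c * Complex (apothem g) (sin ?y) -
      Complex (apothem g) ((2 * t - 1) * sin ?y) - of_real h)"
    unfolding corner_after[of g a] p_def side_eq[OF a] n_def by (simp add: algebra_simps)
  have "c * Complex (apothem g) (sin ?y) - Complex (apothem g) ((2 * t - 1) * sin ?y) - of_real h = of_real k * \<i>"
    using ap by (simp add: complex_eq_iff c_def k_def field_simps)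
  then have v2: "c * corner g a - (p + of_real h * n) = of_real k * \<i> * n"
    unfolding e1 by (simp add: mult_ac)
  have cb: "corner g a = side_normal g (a + 1) * Complex (apothem g) (- sin ?y)"
    using corner_before[of "a + 1" g] by simp
  have v3: "c * corner g (a + 1) - c * corner g a = of_real k' * \<i> * (n * cis (2 * ?y))"
  proof -
    have "c * Complex (apothem g) (sin ?y) - c * Complex (apothem g) (- sin ?y) = of_real k' * \<i>"
      by (simp add: complex_eq_iff c_def k'_def)
    moreover have "c * corner g (a + 1) - c * corner g a = side_normal g (a + 1) *
        (c * Complex (apothem g) (sin ?y) - c * Complex (apothem g) (- sin ?y))"
      unfolding cb corner_after[of g "a + 1"] by (simp only: algebra_simps)
    ultimately show ?thesis unfolding n1 by (simp add: mult_ac)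
  qed
  have cb2: "corner g (a + 1) = side_normal g (a + 2) * Complex (apothem g) (- sin ?y)"
    using corner_before[of "a + 2" g] by simp
  have e4: "(q + of_real h * side_normal g (a + 2)) - c * corner g (a + 1) = side_normal g (a + 2) *
      (Complex (apothem g) ((2 * (1 - t) - 1) * sin ?y) + of_real h - c * Complex (apothem g) (- sin ?y))"
  proof -
    have "1 \<le> a + 2" by simp
    then show ?thesis unfolding cb2 q_def side_eq[OF \<open>1 \<le> a + 2\<close>] by (simp only: distrib_left right_diff_distrib mult_ac)
  qed
  have "Complex (apothem g) ((2 * (1 - t) - 1) * sin ?y) + of_real h - c * Complex (apothem g) (- sin ?y) = of_real k * \<i>"
    using ap by (simp add: complex_eq_iff c_def k_def field_simps)
  then have v4: "(q + of_real h * side_normal g (a + 2)) - c * corner g (a + 1) = of_real k * \<i> * (n * cis (4 * ?y))"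
    unfolding e4 unfolding n2 by (simp add: mult_ac)
  have v5: "q - (q + of_real h * side_normal g (a + 2)) = - of_real h * (n * cis (4 * ?y))" by (simp add: n2)
  have c4: "cis (4 * ?y) = cis (2 * ?y) * cis (2 * ?y)" by (simp add: cis_mult)
  have q1: "(of_real k * \<i> * n) / (of_real h * n) = of_real (k / h) * cis (pi / 2)"
    using n0 h by simp
  have q2: "(of_real k' * \<i> * (n * cis (2 * ?y))) / (of_real k * \<i> * n) = of_real (k' / k) * cis (2 * ?y)"
    using n0 k by simp
  have q3: "(of_real k * \<i> * (n * cis (4 * ?y))) / (of_real k' * \<i> * (n * cis (2 * ?y))) = of_real (k / k') * cis (2 * ?y)"
    unfolding c4 using n0 k by simp
  have q4: "(- of_real h * (n * cis (4 * ?y))) / (of_real k * \<i> * (n * cis (4 * ?y))) = of_real (h / k) * cis (pi / 2)"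
    using n0 k by (simp add: field_simps)
  have A: "Arg (of_real (k / h) * cis (pi / 2)) = pi / 2" "Arg (of_real (k' / k) * cis (2 * ?y)) = 2 * ?y"
    "Arg (of_real (k / k') * cis (2 * ?y)) = 2 * ?y" "Arg (of_real (h / k) * cis (pi / 2)) = pi / 2"
    by (rule Arg_cis_mult; use k h y pi_gt_zero in simp)+
  have "2 * ?y < pi" using y pi_gt_zero by linarith
  then show "no_reversal (bridge_image g j t)"
    unfolding img no_reversal.simps v1 v2 v3 v4 v5 q1 q2 q3 q4 A using pi_gt_zero by simp
  have "turn_product (bridge_image g j t) = cis (pi / 2 / 2) * (cis (2 * ?y / 2) * (cis (2 * ?y / 2) * cis (pi / 2 / 2)))"
    unfolding img turn_product.simps turn_def v1 v2 v3 v4 v5 q1 q2 q3 q4 A by simp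
  also have "\<dots> = cis (pi / 2 + 2 * ?y)" by (simp only: cis_mult) (rule arg_cong[of _ _ cis], simp)
  finally show "turn_product (bridge_image g j t) = cis (pi / 2 + 2 * ?y)" .
  show "\<exists>k>0. bridge_image g j t ! 1 - hd (bridge_image g j t) = of_real k * side_normal g (first_side j)"
    using h unfolding img by (auto simp: n_def a_def)
  show "\<exists>k>0. last (butlast (bridge_image g j t)) - last (bridge_image g j t) =
      of_real k * side_normal g (first_side j + 2)"
    using h unfolding img by (auto simp: a_def)
qed

lemma bridge_image_ends: "hd (bridge_image g j t) = side g (first_side j) t"
    "last (bridge_image g j t) = side g (first_side j + 2) (1 - t)" "length (bridge_image g j t) = 6"
  by (simp_all add: bridge_image_def Let_def)

lemma hd_tl_rev:
  assumes "2 \<le> length L" shows "rev L ! 1 = last (butlast L)" "last (butlast (rev L)) = L ! 1"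
proof -
  have "rev L ! 1 = L ! (length L - 2)" using assms by (simp add: rev_nth numeral_2_eq_2)
  also have "\<dots> = last (butlast L)"
    using assms by (subst last_conv_nth) (auto simp: nth_butlast numeral_2_eq_2 simp flip: length_0_conv)
  finally show 1: "rev L ! 1 = last (butlast L)" .
  obtain a b q where "L = a # b # q" using two_elems[OF assms] by auto
  then show "last (butlast (rev L)) = L ! 1" by (simp add: butlast_append)
qed

lemma poly_length: "2 \<le> length (poly P)"
  by (cases P) (auto simp: bridge_image_ends)

lemma poly_ends: "hd (poly P) = start P" "last (poly P) = finish P"
  by (cases P; auto simp: bridge_image_ends hd_rev last_rev)+

lemma good_bridgeD:
  assumes "good_piece (Br j d t)"
  shows "j \<in> {1..2 * g}" "boundary (first_side j) t" "boundary (first_side j + 2) (1 - t)" "0 < t" "t < 1"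
  using assms by (auto simp: boundary_def)

lemma poly_start_dir:
  assumes "good_piece P"
  shows "\<exists>k>0. poly P ! 1 - start P = of_real k * start_dir P"
proof (cases P)
  case (Seg a b)
  then show ?thesis by (auto intro!: exI[of _ 1])
next
  case (Br j d t)
  note b = good_bridgeD[OF assms[unfolded Br]]
  show ?thesis
    using bridge_turning(3,4)[OF b(1,4,5)] hd_tl_rev[of "bridge_image g j t"]
    by (cases d) (auto simp: Br bridge_image_ends)
qed

lemma poly_finish_dir:
  assumes "good_piece P"
  shows "\<exists>k>0. last (butlast (poly P)) - finish P = of_real k * finish_dir P"
proof (cases P)
  case (Seg a b)
  then show ?thesis by (auto intro!: exI[of _ 1])
next
  case (Br j d t)
  note b = good_bridgeD[OF assms[unfolded Br]]
  show ?thesis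
    using bridge_turning(3,4)[OF b(1,4,5)] hd_tl_rev[of "bridge_image g j t"]
    by (cases d) (auto simp: Br bridge_image_ends)
qed

lemma hpos_at_scale: "0 < k \<Longrightarrow> hpos_at z (of_real k * d) = hpos_at z d"
  using Arg_times_of_real[of k "d / (z - ob)"] by (simp add: hpos_at_def)

lemma boundary_slope_ne_pi:
  "boundary a t \<Longrightarrow> slope (hpos_at (side g a t) (side_normal g a)) \<noteq> pi"
  using boundary_angle[of a t] boundary_hpos(1)[of a t] pi_gt_zero by (auto simp: abs_if split: if_splits)

lemma good_piece_nondegenerate:
  assumes "good_piece P"
  shows "start P \<noteq> ob" "finish P \<noteq> ob" "start_dir P \<noteq> 0" "finish_dir P \<noteq> 0"
    "slope (fst (ends P)) \<noteq> pi" "slope (snd (ends P)) \<noteq> pi"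
proof -
  have "start P \<noteq> ob \<and> finish P \<noteq> ob \<and> start_dir P \<noteq> 0 \<and> finish_dir P \<noteq> 0 \<and>
    slope (fst (ends P)) \<noteq> pi \<and> slope (snd (ends P)) \<noteq> pi"
  proof (cases P)
    case (Seg a b)
    then show ?thesis
      using assms good_segment_visible[of a b] slope_ne_pi[of a b] slope_ne_pi[of b a]
      by (auto simp: ends_def good_segment_sym[of b a])
  next
    case (Br j d t)
    note b = good_bridgeD[OF assms[unfolded Br]]
    have n: "side_normal g k \<noteq> 0" for k by (simp add: side_normal_eq)
    show ?thesis
      using n visible_nz[OF boundary_visible[OF b(2)]] visible_nz[OF boundary_visible[OF b(3)]]
        boundary_slope_ne_pi[OF b(2)] boundary_slope_ne_pi[OF b(3)]
      by (cases d) (simp_all add: Br ends_def)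
  qed
  then show "start P \<noteq> ob" "finish P \<noteq> ob" "start_dir P \<noteq> 0" "finish_dir P \<noteq> 0"
    "slope (fst (ends P)) \<noteq> pi" "slope (snd (ends P)) \<noteq> pi" by auto
qed

text \<open>The lifts at the two ends of a bridge are the angles of the normals of the sides
  \<open>a\<close> and \<open>a + 2\<close>, which differ by \<open>4 * half_angle g\<close>. Half
  of this cancels the corresponding part of the turning and leaves the quarter turn
  \<open>\<i>\<close> or \<open>- \<i>\<close>, as for a segment.\<close>

lemma piece_phase:
  assumes "good_piece P"
  shows "turn_product (poly P) * cis ((lift (fst (ends P)) - lift (snd (ends P))) / 2) =
      \<i> * of_real (sg (fst (ends P)) (snd (ends P)))"
    "no_reversal (poly P)"
proof -
  have "turn_product (poly P) * cis ((lift (fst (ends P)) - lift (snd (ends P))) / 2) =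
      \<i> * of_real (sg (fst (ends P)) (snd (ends P))) \<and> no_reversal (poly P)"
  proof (cases P)
    case (Seg a b)
    then show ?thesis using segment_phase[of a b] assms by (simp add: ends_def)
  next
    case (Br j d t)
    note b = good_bridgeD[OF assms[unfolded Br]]
    note T = bridge_turning(1,2)[OF b(1,4,5)]
    let ?a = "first_side j" and ?y = "half_angle g"
    have L: "lift (hpos_at (side g ?a t) (side_normal g ?a)) = normal_angle g ?a"
      "lift (hpos_at (side g (?a + 2) (1 - t)) (side_normal g (?a + 2))) = normal_angle g ?a + 4 * ?y"
      using boundary_hpos(2)[OF b(2)] boundary_hpos(2)[OF b(3)]
      by (simp_all add: normal_angle_def algebra_simps)
    have al: "\<alpha> (side g ?a t) < \<alpha> (side g (?a + 2) (1 - t))"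
      by (rule boundary_order[OF b(2,3)]) simp
    have S: "sg (hpos_at (side g ?a t) n) (hpos_at (side g (?a + 2) (1 - t)) m) = 1"
      "sg (hpos_at (side g (?a + 2) (1 - t)) m) (hpos_at (side g ?a t) n) = -1" for n m
      using al by (simp add: hpos_at_def sg_HP, simp add: sg_def)+
    have C: "cis (pi / 2 + 2 * ?y) * cis (- (2 * ?y)) = \<i>"
      by (simp only: cis_mult) simp
    have C': "cnj (cis (pi / 2 + 2 * ?y)) * cis (2 * ?y) = - \<i>"
      using arg_cong[OF C, of cnj] by (simp add: cis_cnj)
    show ?thesis
    proof (cases d)
      case True
      then show ?thesis using T C S(1)
        by (simp add: Br ends_def L del: add_2_eq_Suc add_2_eq_Suc')
    next
      case False
      have "no_reversal (rev (bridge_image g j t))"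
        by (rule no_reversal_rev[OF T(2)])
      then show ?thesis using False T C' S(2) turn_product_rev[OF T(2)]
        by (simp add: Br ends_def L del: add_2_eq_Suc add_2_eq_Suc')
    qed
  qed
  then show "turn_product (poly P) * cis ((lift (fst (ends P)) - lift (snd (ends P))) / 2) =
      \<i> * of_real (sg (fst (ends P)) (snd (ends P)))"
    "no_reversal (poly P)" by auto
qed

fun piece_chain :: "piece list \<Rightarrow> bool" where
  "piece_chain (P # Q # Ps) \<longleftrightarrow> good_piece P \<and> finish P = start Q \<and>
     snd (ends P) \<noteq> fst (ends Q) \<and> piece_chain (Q # Ps)"
| "piece_chain [P] \<longleftrightarrow> good_piece P"
| "piece_chain [] \<longleftrightarrow> True"

lemma piece_junction:
  assumes "good_piece P" "good_piece Q" "finish P = start Q" "snd (ends P) \<noteq> fst (ends Q)"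
  shows "junction (poly P) (poly Q) = - \<i> * of_real (sg (snd (ends P)) (fst (ends Q))) *
      cis ((lift (fst (ends Q)) - lift (snd (ends P))) / 2)"
    "Arg ((poly Q ! 1 - last (poly P)) / (last (poly P) - last (butlast (poly P)))) \<noteq> pi"
proof -
  let ?z = "start Q"
  define d1 where "d1 = last (butlast (poly P)) - ?z"
  define d2 where "d2 = poly Q ! 1 - ?z"
  obtain k1 where k1: "k1 > 0" "d1 = of_real k1 * finish_dir P"
    using poly_finish_dir[OF assms(1)] assms(3) by (auto simp: d1_def)
  obtain k2 where k2: "k2 > 0" "d2 = of_real k2 * start_dir Q"
    using poly_start_dir[OF assms(2)] by (auto simp: d2_def)
  have e: "hpos_at ?z d1 = snd (ends P)" "hpos_at ?z d2 = fst (ends Q)"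
    using k1 k2 assms(3) by (simp_all add: hpos_at_scale ends_def)
  note nd = good_piece_nondegenerate[OF assms(1)] good_piece_nondegenerate[OF assms(2)]
  have nz: "?z \<noteq> ob" "d1 \<noteq> 0" "d2 \<noteq> 0" using nd k1 k2 by auto
  note J = junction_turn[OF nz, unfolded e, OF nd(6) nd(11) assms(4)]
  have "last (poly P) - last (butlast (poly P)) = - d1" "poly Q ! 1 - last (poly P) = d2"
    by (simp_all add: d1_def d2_def poly_ends assms(3))
  then show "junction (poly P) (poly Q) = - \<i> * of_real (sg (snd (ends P)) (fst (ends Q))) *
      cis ((lift (fst (ends Q)) - lift (snd (ends P))) / 2)"
    "Arg ((poly Q ! 1 - last (poly P)) / (last (poly P) - last (butlast (poly P)))) \<noteq> pi"
    using J unfolding junction_def turn_def by simp_all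
qed

lemma piece_chain_good: "piece_chain Ps \<Longrightarrow> P \<in> set Ps \<Longrightarrow> good_piece P"
  by (induction Ps rule: piece_chain.induct) auto

lemma piece_chain_linked: "piece_chain Ps \<Longrightarrow> linked (map poly Ps)"
  by (induction Ps rule: piece_chain.induct) (use poly_length poly_ends in auto)

lemma piece_chain_no_reversal:
  assumes "piece_chain Ps" shows "no_reversal (join (map poly Ps))"
proof (rule no_reversal_join[OF piece_chain_linked[OF assms]])
  show "join_no_reversal (map poly Ps)" using assms
  proof (induction Ps rule: piece_chain.induct)
    case (1 P Q Ps)
    then have "good_piece Q" using piece_chain_good[of "Q # Ps" Q] by simp
    then show ?case using 1 piece_phase(2)[of P] piece_junction(2)[of P Q] by simp
  qed (use piece_phase(2) in auto)
qed

text \<open>The phases at the inner vertices cancel; only signs remain.\<close>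

lemma piece_chain_phase:
  assumes "piece_chain Ps" "Ps \<noteq> []"
  shows "turn_product (join (map poly Ps)) *
      cis ((lift (fst (ends (hd Ps))) - lift (snd (ends (last Ps)))) / 2) =
    \<i> * of_real (chain_sign (map ends Ps))"
  unfolding turn_product_join[OF piece_chain_linked[OF assms(1)]] using assms
proof (induction Ps rule: piece_chain.induct)
  case (1 P Q Ps)
  then have gQ: "good_piece Q" using piece_chain_good[of "Q # Ps" Q] by simp
  define lp rp lq rr where "lp = lift (fst (ends P))" and "rp = lift (snd (ends P))"
    and "lq = lift (fst (ends Q))" and "rr = lift (snd (ends (last (Q # Ps))))"
  define T where "T = join_product (map poly (Q # Ps))"
  define s1 s2 s3 where "s1 = sg (fst (ends P)) (snd (ends P))" and "s2 = sg (snd (ends P)) (fst (ends Q))"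
    and "s3 = chain_sign (map ends (Q # Ps))"
  have A: "turn_product (poly P) * cis ((lp - rp) / 2) = \<i> * of_real s1"
    using piece_phase(1)[of P] 1 by (simp add: lp_def rp_def s1_def)
  have B: "junction (poly P) (poly Q) = - \<i> * of_real s2 * cis ((lq - rp) / 2)"
    using piece_junction(1)[of P Q] 1 gQ by (simp add: rp_def lq_def s2_def)
  have C: "T * cis ((lq - rr) / 2) = \<i> * of_real s3"
    using 1 by (simp add: T_def lq_def rr_def s3_def)
  have "cis ((lp - rp) / 2) * cis ((lq - rr) / 2) = cis ((lq - rp) / 2) * cis ((lp - rr) / 2)"
    by (simp only: cis_mult) (rule arg_cong[of _ _ cis], simp add: field_simps)
  then have "turn_product (poly P) * junction (poly P) (poly Q) * T * cis ((lp - rr) / 2) =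
      - \<i> * of_real s2 * (turn_product (poly P) * cis ((lp - rp) / 2)) * (T * cis ((lq - rr) / 2))"
    unfolding B by algebra
  also have "\<dots> = \<i> * of_real (s1 * s2 * s3)" unfolding A C by (simp add: algebra_simps)
  finally show ?case by (simp add: T_def lp_def rr_def s1_def s2_def s3_def)
qed (use piece_phase(1) in auto)

end


section \<open>Crossing signs of piecewise paths\<close>

fun pair_product :: "('a \<Rightarrow> 'a \<Rightarrow> real) \<Rightarrow> 'a list \<Rightarrow> real" where
  "pair_product f (x # xs) = (\<Prod>y\<leftarrow>xs. f x y) * pair_product f xs"
| "pair_product f [] = 1"

lemma prod_list_mult: "(\<Prod>x\<leftarrow>xs. f x * g x) = (\<Prod>x\<leftarrow>xs. f x) * (\<Prod>x\<leftarrow>xs. g x :: real)"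
  by (induction xs) (simp_all add: mult_ac)

lemma prod_list_1: "(\<Prod>x\<leftarrow>xs. 1) = (1 :: real)"
  by (induction xs) simp_all

lemma prod_list_swap:
  "(\<Prod>x\<leftarrow>xs. \<Prod>y\<leftarrow>ys. f x y) = (\<Prod>y\<leftarrow>ys. \<Prod>x\<leftarrow>xs. f x y :: real)"
  by (induction xs) (simp_all add: prod_list_mult prod_list_1)

lemma pair_product_append:
  "pair_product f (xs @ ys) = pair_product f xs * pair_product f ys * (\<Prod>x\<leftarrow>xs. \<Prod>y\<leftarrow>ys. f x y)"
  by (induction xs) (simp_all add: mult_ac prod_list_1)

lemma pair_product_map: "pair_product f (map h xs) = pair_product (\<lambda>x y. f (h x) (h y)) xs"
  by (induction xs) (simp_all add: comp_def)

text \<open>The factors \<open>o' x y * o' y x\<close> over unordered pairs make up the product of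
  \<open>o'\<close> over all ordered pairs, as the diagonal is trivial.\<close>

lemma pair_product_split:
  assumes "sorted_wrt (\<lambda>x y. f x y = b x y * (o' x y * o' y x)) xs" "\<And>x. x \<in> set xs \<Longrightarrow> o' x x = 1"
  shows "pair_product f xs = pair_product b xs * (\<Prod>x\<leftarrow>xs. \<Prod>y\<leftarrow>xs. o' x y)"
  using assms
proof (induction xs)
  case (Cons x xs)
  have "(\<Prod>y\<leftarrow>xs. f x y) = (\<Prod>y\<leftarrow>xs. b x y * (o' x y * o' y x))"
    by (rule arg_cong[of _ _ prod_list], rule map_cong[OF refl]) (use Cons.prems in simp)
  then have fx: "(\<Prod>y\<leftarrow>xs. f x y) = (\<Prod>y\<leftarrow>xs. b x y) * ((\<Prod>y\<leftarrow>xs. o' x y) * (\<Prod>y\<leftarrow>xs. o' y x))"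
    unfolding prod_list_mult .
  have IH: "pair_product f xs = pair_product b xs * (\<Prod>x\<leftarrow>xs. \<Prod>y\<leftarrow>xs. o' x y)"
    using Cons by simp
  have sq: "(\<Prod>z\<leftarrow>x # xs. \<Prod>y\<leftarrow>x # xs. o' z y) =
      (\<Prod>y\<leftarrow>xs. o' x y) * ((\<Prod>y\<leftarrow>xs. o' y x) * (\<Prod>z\<leftarrow>xs. \<Prod>y\<leftarrow>xs. o' z y))"
    using Cons.prems(2)[of x] by (simp add: prod_list_mult)
  show ?case unfolding pair_product.simps sq fx IH by (simp only: mult_ac)
qed simp

text \<open>Seen from \<open>y\<close>, the end of a piece and the start of the next one lie on the
  same side, so that signs telescope along the path.\<close>

fun adjacent_to :: "hpos \<Rightarrow> (hpos \<times> hpos) list \<Rightarrow> bool" where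
  "adjacent_to y (p # q # ps) \<longleftrightarrow> sg y (snd p) = sg y (fst q) \<and> sg y (snd p) \<noteq> 0 \<and> adjacent_to y (q # ps)"
| "adjacent_to y _ \<longleftrightarrow> True"

lemma sg_square: "sg a b \<noteq> 0 \<Longrightarrow> sg a b * sg a b = 1"
  by (rule sg_mult_self) simp

lemma prod_adjacent:
  assumes "adjacent_to y ps" "ps \<noteq> []"
  shows "(\<Prod>p\<leftarrow>ps. sg y (fst p) * sg y (snd p)) = sg y (fst (hd ps)) * sg y (snd (last ps))"
  using assms
proof (induction y ps rule: adjacent_to.induct)
  case (1 y p q ps)
  then have "sg y (snd p) = sg y (fst q)" "sg y (snd p) \<noteq> 0" by auto
  then have "sg y (snd p) * sg y (fst q) = 1" using sg_square by metis
  moreover have "(\<Prod>p\<leftarrow>q # ps. sg y (fst p) * sg y (snd p)) = sg y (fst q) * sg y (snd (last (q # ps)))"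
    using 1 by simp
  ultimately show ?case
    by (simp only: list.map prod_list.Cons list.sel last.simps list.distinct if_False) algebra
qed auto

text \<open>This makes each junction of a path look like a single position from all ends at other
  angles.\<close>

fun separated :: "(hpos \<times> hpos) list \<Rightarrow> bool" where
  "separated (p # q # ps) \<longleftrightarrow> angle (snd p) = angle (fst q) \<and> angle (fst p) \<noteq> angle (snd p) \<and>
     angle (snd p) \<notin> angle ` snd ` set (q # ps) \<and> angle (fst p) \<notin> angle ` fst ` set (q # ps) \<and>
     separated (q # ps)"
| "separated _ \<longleftrightarrow> True"

lemma sg_same_angle:
  assumes "angle p = angle q" "angle y \<noteq> angle p"
  shows "sg y p = sg y q" "sg p y = sg q y" "sg y p \<noteq> 0" "sg p y \<noteq> 0"
  using assms sg_angle[of y p] sg_angle[of y q] sg_angle[of p y] sg_angle[of q y] by auto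

lemma separated_adjacent:
  assumes "separated ps" "angle y \<notin> angle ` snd ` set (butlast ps)"
  shows "adjacent_to y ps"
  using assms
proof (induction ps rule: separated.induct)
  case (1 p q ps)
  then have ne: "angle y \<noteq> angle (snd p)" and rest: "adjacent_to y (q # ps)" by auto
  show ?case using sg_same_angle[of "snd p" "fst q" y] ne rest 1 by simp
qed auto

lemma separated_fst_snd:
  "separated ps \<Longrightarrow> ps \<noteq> [] \<Longrightarrow> angle ` fst ` set (tl ps) = angle ` snd ` set (butlast ps)"
  by (induction ps rule: separated.induct) auto

text \<open>The local signs of a path measure its self-crossings. A piece \<open>p\<close> added in
  front moves the start of the long chord from that of \<open>q\<close> to that of \<open>p\<close>,
  and the crossing signs of \<open>p\<close> with the later pieces telescope to the four signs that
  compensate for this change, for the piece and for the junction.\<close>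

lemma chain_sign_pair_product:
  assumes "separated ps" "ps \<noteq> []" "fst (hd ps) \<noteq> snd (last ps)"
  shows "chain_sign ps = sg (fst (hd ps)) (snd (last ps)) * pair_product cross_pair ps"
  using assms
proof (induction ps rule: separated.induct)
  case (1 p q ps)
  let ?r = "snd (last (q # ps))"
  have sep: "angle (snd p) \<notin> angle ` snd ` set (q # ps)" "angle (fst p) \<notin> angle ` fst ` set (q # ps)"
    "separated (q # ps)" "angle (snd p) = angle (fst q)" "angle (fst p) \<noteq> angle (snd p)"
    using "1.prems"(1) unfolding separated.simps by blast+
  then have adj1: "adjacent_to (snd p) (q # ps)"
    by (intro separated_adjacent) (blast dest: in_set_butlastD)+
  have "angle (fst p) \<notin> angle ` snd ` set (butlast (q # ps))"
    using separated_fst_snd[OF sep(3)] sep(2) by auto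
  then have adj2: "adjacent_to (fst p) (q # ps)" by (rule separated_adjacent[OF sep(3)])
  have "(\<Prod>s\<leftarrow>q # ps. cross_pair p s) =
      (\<Prod>s\<leftarrow>q # ps. sg (fst p) (fst s) * sg (fst p) (snd s)) *
      (\<Prod>s\<leftarrow>q # ps. sg (snd p) (fst s) * sg (snd p) (snd s))"
    unfolding prod_list_mult[symmetric] cross_pair_def by (simp only: mult_ac)
  also have "\<dots> = (sg (fst p) (fst q) * sg (fst p) ?r) * (sg (snd p) (fst q) * sg (snd p) ?r)"
    by (simp only: prod_adjacent[OF adj1 list.distinct(2)] prod_adjacent[OF adj2 list.distinct(2)] list.sel)
  finally have P: "(\<Prod>s\<leftarrow>q # ps. cross_pair p s) =
    (sg (fst p) (fst q) * sg (fst p) ?r) * (sg (snd p) (fst q) * sg (snd p) ?r)" .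
  have s1: "sg (fst p) (fst q) = sg (fst p) (snd p)"
    using sg_same_angle(1)[OF sep(4,5)] by simp
  have "?r \<in> snd ` set (q # ps)" by (metis imageI last_in_set list.distinct(1))
  then have ar: "angle ?r \<noteq> angle (snd p)" using sep(1) by (metis imageI)
  have s2: "sg (snd p) ?r = sg (fst q) ?r" and nz: "sg (fst q) ?r \<noteq> 0"
    using sg_same_angle[OF sep(4) ar] by auto
  then have s3: "sg (fst q) ?r * sg (fst q) ?r = 1" by (intro sg_square)
  have "fst q \<noteq> ?r" using nz by simp
  then have IH: "chain_sign (q # ps) = sg (fst q) ?r * pair_product cross_pair (q # ps)"
    using "1.IH" sep(3) by simp
  have "fst p \<noteq> ?r" using "1.prems"(3) by simp
  then have s4: "sg (fst p) ?r * sg (fst p) ?r = 1" by (intro sg_mult_self)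
  have "chain_sign (p # q # ps) = sg (fst p) (snd p) * sg (snd p) (fst q) *
      (sg (fst q) ?r * pair_product cross_pair (q # ps))"
    using IH by simp
  moreover have "sg (fst (hd (p # q # ps))) (snd (last (p # q # ps))) * pair_product cross_pair (p # q # ps) =
      sg (fst p) ?r * ((sg (fst p) (snd p) * sg (fst p) ?r) * (sg (snd p) (fst q) * sg (fst q) ?r) *
      pair_product cross_pair (q # ps))"
    unfolding pair_product.simps(1)[of cross_pair p] P s1 s2 by simp
  ultimately show ?case using s4 by (simp only:) algebra
qed auto

text \<open>Telescoping along both paths replaces each of them by the chord between its
  ends.\<close>

lemma cross_pair_paths:
  assumes ps: "ps \<noteq> []" "\<And>q. q \<in> set qs \<Longrightarrow> adjacent_to (fst q) ps \<and> adjacent_to (snd q) ps"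
    and qs: "qs \<noteq> []" "adjacent_to (fst (hd ps)) qs" "adjacent_to (snd (last ps)) qs"
  shows "(\<Prod>p\<leftarrow>ps. \<Prod>q\<leftarrow>qs. cross_pair p q) =
    cross_pair (fst (hd ps), snd (last ps)) (fst (hd qs), snd (last qs))"
proof -
  have "(\<Prod>p\<leftarrow>ps. cross_pair p q) = cross_pair (fst (hd ps), snd (last ps)) q" if "q \<in> set qs" for q
  proof -
    have "(\<Prod>p\<leftarrow>ps. cross_pair p q) =
        (\<Prod>p\<leftarrow>ps. sg (fst q) (fst p) * sg (fst q) (snd p)) * (\<Prod>p\<leftarrow>ps. sg (snd q) (fst p) * sg (snd q) (snd p))"
      unfolding prod_list_mult[symmetric] cross_pair_sym[of _ q]
      by (simp only: cross_pair_def mult_ac)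
    also have "\<dots> = cross_pair q (fst (hd ps), snd (last ps))"
      using prod_adjacent[OF _ ps(1), of "fst q"] prod_adjacent[OF _ ps(1), of "snd q"] ps(2)[OF that]
      by (simp add: cross_pair_def mult_ac)
    finally show ?thesis by (simp add: cross_pair_sym)
  qed
  then have eq: "(\<Prod>q\<leftarrow>qs. \<Prod>p\<leftarrow>ps. cross_pair p q) = (\<Prod>q\<leftarrow>qs. cross_pair (fst (hd ps), snd (last ps)) q)"
    by (intro arg_cong[of _ _ prod_list] map_cong refl)
  have "(\<Prod>p\<leftarrow>ps. \<Prod>q\<leftarrow>qs. cross_pair p q) = (\<Prod>q\<leftarrow>qs. \<Prod>p\<leftarrow>ps. cross_pair p q)"
    by (rule prod_list_swap)
  also have "\<dots> = (\<Prod>q\<leftarrow>qs. cross_pair (fst (hd ps), snd (last ps)) q)" by (rule eq)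
  also have "\<dots> = (\<Prod>q\<leftarrow>qs. sg (fst (hd ps)) (fst q) * sg (fst (hd ps)) (snd q)) *
      (\<Prod>q\<leftarrow>qs. sg (snd (last ps)) (fst q) * sg (snd (last ps)) (snd q))"
    unfolding prod_list_mult[symmetric] by (simp only: cross_pair_def fst_conv snd_conv mult_ac)
  also have "\<dots> = cross_pair (fst (hd ps), snd (last ps)) (fst (hd qs), snd (last qs))"
    using prod_adjacent[OF qs(2,1)] prod_adjacent[OF qs(3,1)] by (simp add: cross_pair_def mult_ac)
  finally show ?thesis .
qed

definition paired :: "nat \<Rightarrow> nat \<Rightarrow> bool" where
  "paired j k \<longleftrightarrow> j \<noteq> k \<and> (j + 1) div 2 = (k + 1) div 2"

fun bridge_cross :: "piece \<Rightarrow> piece \<Rightarrow> real" where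
  "bridge_cross (Br j d t) (Br k e u) = (if paired j k then -1 else 1)"
| "bridge_cross _ _ = 1"

fun bridge_index :: "nat \<Rightarrow> piece \<Rightarrow> bool" where
  "bridge_index j (Br k d t) \<longleftrightarrow> k = j"
| "bridge_index j (Seg a b) \<longleftrightarrow> False"

definition bridge_number :: "nat \<Rightarrow> piece list \<Rightarrow> nat" where
  "bridge_number j Ps = length (filter (bridge_index j) Ps)"

lemma paired_odd: "1 \<le> i \<Longrightarrow> paired (2 * i - 1) k \<longleftrightarrow> k = 2 * i"
  unfolding paired_def by presburger

lemma paired_even: "1 \<le> i \<Longrightarrow> paired (2 * i) k \<longleftrightarrow> k = 2 * i - 1"
  unfolding paired_def by presburger

lemma index_cases:
  assumes "1 \<le> (j :: nat)" obtains i where "1 \<le> i" "j = 2 * i - 1" | i where "1 \<le> i" "j = 2 * i"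
proof (cases "odd j")
  case True
  then obtain m where "j = 2 * m + 1" by (rule oddE)
  then show thesis using that(1)[of "m + 1"] by simp
next
  case False
  then have "even j" by simp
  then obtain m where "j = 2 * m" by (rule evenE)
  then show thesis using that(2)[of m] assms by simp
qed

lemma first_side_odd: "1 \<le> i \<Longrightarrow> first_side (2 * i - 1) = 4 * i - 3"
  by (simp add: first_side_def)

lemma first_side_even: "first_side (2 * i) = 4 * i - 2"
  by (simp add: first_side_def)

lemma first_side_paired:
  assumes "1 \<le> j" "j < k" "paired j k"
  shows "first_side j < first_side k" "first_side k < first_side j + 2"
proof -
  have "first_side j < first_side k \<and> first_side k < first_side j + 2"
    using assms(1)
  proof (cases rule: index_cases)
    case (1 i)
    then have k: "k = 2 * i" using assms(3) paired_odd by simp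
    have "first_side j = 4 * i - 3" "first_side k = 4 * i - 2"
      unfolding 1(2) k by (rule first_side_odd[OF 1(1)], rule first_side_even)
    then show ?thesis using 1(1) by linarith
  next
    case (2 i)
    then have "k = 2 * i - 1" using assms(3) paired_even by simp
    then show ?thesis using 2 assms(2) by linarith
  qed
  then show "first_side j < first_side k" "first_side k < first_side j + 2" by auto
qed

lemma first_side_unpaired:
  assumes "1 \<le> j" "j < k" "\<not> paired j k"
  shows "first_side j + 2 < first_side k"
proof -
  have f: "first_side j \<le> 2 * j - 1" "2 * j - 2 \<le> first_side j" "even j \<Longrightarrow> first_side j = 2 * j - 2" for j
    by (auto simp: first_side_def)
  show ?thesis
  proof (cases "k = j + 1")
    case False
    have "first_side j + 2 < 2 * j - 2 + 4 \<or> first_side j = 2 * j - 1"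
      using f(1,2)[of j] assms(1) by linarith
    moreover have "2 * k - 2 \<le> first_side k" by (rule f(2))
    moreover have "j + 2 \<le> k" using False assms(2) by linarith
    moreover have "first_side k \<noteq> 2 * k - 2 \<or> even k" using assms by (auto simp: first_side_def)
    moreover have "k = j + 2 \<Longrightarrow> even j = even k" by simp
    ultimately show ?thesis using f(1)[of j] f(3)[of j] f(3)[of k] assms(1)
      by (cases "even j"; cases "even k") linarith+
  next
    case True
    have "even j"
    proof (rule ccontr)
      assume "odd j"
      then have "paired j k" unfolding paired_def True by presburger
      then show False using assms(3) by simp
    qed
    then have "first_side j = 2 * j - 2" "first_side k = 2 * k - 1" using True by (auto simp: first_side_def)
    then show ?thesis using True assms(1) by linarith
  qed
qed

lemma pair_product_bridges:
  assumes "\<And>j d t. Br j d t \<in> set Ps \<Longrightarrow> j \<in> {1..2 * g}"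
  shows "pair_product bridge_cross Ps = (-1) ^ (\<Sum>i=1..g. bridge_number (2 * i - 1) Ps * bridge_number (2 * i) Ps)"
  using assms
proof (induction Ps)
  case (Cons P Ps)
  have IH: "pair_product bridge_cross Ps = (-1) ^ (\<Sum>i=1..g. bridge_number (2 * i - 1) Ps * bridge_number (2 * i) Ps)"
    using Cons by auto
  show ?case
  proof (cases P)
    case (Seg a b)
    have "(\<Prod>Q\<leftarrow>Ps. bridge_cross P Q) = 1" by (induction Ps) (auto simp: Seg)
    moreover have "bridge_number k (P # Ps) = bridge_number k Ps" for k
      by (simp add: bridge_number_def Seg)
    ultimately show ?thesis using IH by simp
  next
    case (Br j d t)
    then have j: "1 \<le> j" "j \<le> 2 * g" using Cons.prems[of j d t] by auto
    obtain i m where i: "i = (j + 1) div 2" "1 \<le> i" "\<And>k. paired j k \<longleftrightarrow> k = m"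
      "j = 2 * i - 1 \<and> m = 2 * i \<or> j = 2 * i \<and> m = 2 * i - 1"
    proof (rule index_cases[OF j(1)])
      fix i assume "1 \<le> i" "j = 2 * i - 1"
      then show thesis using that[of i "2 * i"] paired_odd by simp
    next
      fix i assume "1 \<le> i" "j = 2 * i"
      then show thesis using that[of i "2 * i - 1"] paired_even by simp
    qed
    have ig: "i \<in> {1..g}" using i j by auto
    have "(\<Prod>Q\<leftarrow>Ps. bridge_cross P Q) = (-1) ^ bridge_number m Ps"
    proof (induction Ps)
      case (Cons Q Ps)
      then show ?case by (cases Q) (auto simp: Br i(3) bridge_number_def)
    qed (simp add: bridge_number_def)
    moreover have n: "bridge_number k (P # Ps) = bridge_number k Ps + (if k = j then 1 else 0)" for k
      by (auto simp: bridge_number_def Br)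
    let ?s = "\<lambda>Ps i. bridge_number (2 * i - 1) Ps * bridge_number (2 * i) Ps"
    have "?s (P # Ps) i = ?s Ps i + bridge_number m Ps"
      using i(2,4) unfolding n by (auto simp: algebra_simps)
    moreover have "?s (P # Ps) k = ?s Ps k" if "k \<in> {1..g} - {i}" for k
    proof -
      have "2 * k - 1 \<noteq> j" "2 * k \<noteq> j" using i(2,4) that by auto
      then show ?thesis unfolding n by simp
    qed
    then have "sum (?s (P # Ps)) ({1..g} - {i}) = sum (?s Ps) ({1..g} - {i})" by (rule sum.cong[OF refl])
    ultimately have "sum (?s (P # Ps)) {1..g} = sum (?s Ps) {1..g} + bridge_number m Ps"
      by (simp only: sum.remove[OF finite_atLeastAtMost ig])
    then show ?thesis using IH \<open>(\<Prod>Q\<leftarrow>Ps. bridge_cross P Q) = (-1) ^ bridge_number m Ps\<close>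
      by (simp add: power_add mult.commute)
  qed
qed (simp add: bridge_number_def)

context polygon_observer
begin

text \<open>A crossing of a segment with a bridge is accounted for by the segment alone, and a
  crossing of two bridges by \<open>bridge_cross\<close>; so bridges get the value 1.\<close>

fun outer_of :: "piece \<Rightarrow> complex \<Rightarrow> real" where
  "outer_of (Seg a b) w = outer_sign a b w"
| "outer_of (Br j d t) w = 1"

lemma outer_of_square: "outer_of P w * outer_of P w = 1"
  by (cases P) (auto simp: outer_sign_def)

definition outer_piece :: "piece \<Rightarrow> piece \<Rightarrow> real" where
  "outer_piece P Q = outer_of P (start Q) * outer_of P (finish Q)"

lemma outer_piece_self: "outer_piece P P = 1"
  by (cases P) (auto simp: outer_piece_def outer_sign_def outer_def)

fun apart :: "piece \<Rightarrow> piece \<Rightarrow> bool" where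
  "apart (Seg a b) (Seg c d) \<longleftrightarrow> disjoint_segments a b c d"
| "apart (Br j d t) (Br k e u) \<longleftrightarrow> \<not> (j = k \<and> t = u)"
| "apart P Q \<longleftrightarrow> (\<forall>x\<in>{start P, finish P}. \<forall>y\<in>{start Q, finish Q}. \<alpha> x = \<alpha> y \<longrightarrow> x = y)"

definition bridge_ends :: "nat \<Rightarrow> real \<Rightarrow> hpos \<times> hpos" where
  "bridge_ends j t = (hpos_at (side g (first_side j) t) (side_normal g (first_side j)),
     hpos_at (side g (first_side j + 2) (1 - t)) (side_normal g (first_side j + 2)))"

lemma cross_pair_bridge: "cross_pair (ends (Br j d t)) q = cross_pair (bridge_ends j t) q"
  by (cases d) (simp_all add: ends_def bridge_ends_def cross_pair_swap)

lemma ends_Seg: "ends (Seg a b) = segment_ends a b"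
  by (simp add: ends_def segment_ends_def)

text \<open>Both ends of the bridge are boundary points with outward directions, and
  \<open>boundary_end\<close> applies to each of them.\<close>

lemma cross_pair_bridge_segment:
  assumes "good_piece (Br j e t)" "good_piece (Seg c d)" "apart (Br j e t) (Seg c d)"
  shows "cross_pair (ends (Br j e t)) (ends (Seg c d)) = outer_piece (Seg c d) (Br j e t)"
proof -
  note b = good_bridgeD[OF assms(1)]
  let ?p = "side g (first_side j) t" and ?q = "side g (first_side j + 2) (1 - t)"
  have loc: "\<alpha> x = \<alpha> y \<longrightarrow> x = y" if "x \<in> {?p, ?q}" "y \<in> {c, d}" for x y
    using assms(3) that by (cases e) auto
  have s: "good_segment c d" "open_segment c d \<subseteq> interior (polygon g)" using assms(2) by auto
  have l1: "?p = x" if "x \<in> {c, d}" "\<alpha> ?p = \<alpha> x" for x using loc[of ?p x] that by blast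
  have l2: "?q = x" if "x \<in> {c, d}" "\<alpha> ?q = \<alpha> x" for x using loc[of ?q x] that by blast
  have "cross_pair (bridge_ends j t) (segment_ends c d) = outer_sign c d ?p * outer_sign c d ?q"
  proof -
    have "sg (hpos_at ?p (side_normal g (first_side j))) (fst (segment_ends c d)) *
        sg (hpos_at ?p (side_normal g (first_side j))) (snd (segment_ends c d)) = outer_sign c d ?p"
      by (rule boundary_end[OF b(2) s]) (use l1 in blast)
    moreover have "sg (hpos_at ?q (side_normal g (first_side j + 2))) (fst (segment_ends c d)) *
        sg (hpos_at ?q (side_normal g (first_side j + 2))) (snd (segment_ends c d)) = outer_sign c d ?q"
      by (rule boundary_end[OF b(3) s]) (use l2 in blast)
    moreover have "x1 * x3 * (x2 * x4) = y1 * y2" if "x1 * x2 = y1" "x3 * x4 = y2"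
      for x1 x2 x3 x4 y1 y2 :: real unfolding that[symmetric] by (simp only: mult_ac)
    ultimately show ?thesis unfolding cross_pair_def bridge_ends_def fst_conv snd_conv by blast
  qed
  then show ?thesis by (cases e) (simp_all add: cross_pair_bridge ends_Seg outer_piece_def mult.commute)
qed

text \<open>Angles increase with the number of the side. Paired bridges start at sides with
  \<open>a < b < a + 2 < b + 2\<close> and interleave; unpaired bridges with different indices have
  disjoint intervals; parallel strands of one bridge are nested because the second side is traversed
  backwards.\<close>

lemma cross_pair_bridges:
  assumes P: "good_piece (Br j d t)" and Q: "good_piece (Br k e u)" and ne: "\<not> (j = k \<and> t = u)"
  shows "cross_pair (ends (Br j d t)) (ends (Br k e u)) = bridge_cross (Br j d t) (Br k e u)"
proof -
  note bP = good_bridgeD[OF P] and bQ = good_bridgeD[OF Q]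
  have sgH: "sg (hpos_at x m) (hpos_at y n) = 1 \<and> sg (hpos_at y n) (hpos_at x m) = -1" if "\<alpha> x < \<alpha> y" for x y m n
    using that by (simp add: hpos_at_def sg_HP) (simp add: sg_def)
  have le: "cross_pair (bridge_ends j t) (bridge_ends k u) = (if paired j k then -1 else 1)"
    if P: "good_piece (Br j d t)" and Q: "good_piece (Br k e u)" and lt: "j < k \<or> j = k \<and> t < u"
    for j d t k e u
  proof -
    note bP = good_bridgeD[OF P] and bQ = good_bridgeD[OF Q]
    let ?a = "first_side j" and ?b = "first_side k"
    consider (same) "j = k" "t < u" | (pair) "paired j k" "j < k" | (far) "\<not> paired j k" "j < k"
      using lt by blast
    then show ?thesis
    proof cases
      case same
      then have "\<alpha> (side g ?a t) < \<alpha> (side g ?b u)"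
        "\<alpha> (side g (?b + 2) (1 - u)) < \<alpha> (side g (?a + 2) (1 - t))"
        "\<alpha> (side g ?b u) < \<alpha> (side g (?b + 2) (1 - u))"
        using boundary_order_same[OF bP(2), of u] boundary_order_same[OF bQ(3), of "1 - t"] bQ bP
          boundary_order[OF bQ(2,3)] by auto
      then show ?thesis using same sgH
        by (simp add: cross_pair_def bridge_ends_def paired_def)
    next
      case pair
      have "?a < ?b" "?b < ?a + 2" "?a + 2 < ?b + 2"
        using first_side_paired[OF _ pair(2,1)] bP(1) by auto
      then have "\<alpha> (side g ?a t) < \<alpha> (side g ?b u)" "\<alpha> (side g ?b u) < \<alpha> (side g (?a + 2) (1 - t))"
        "\<alpha> (side g (?a + 2) (1 - t)) < \<alpha> (side g (?b + 2) (1 - u))"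
        using boundary_order[OF bP(2) bQ(2)] boundary_order[OF bQ(2) bP(3)] boundary_order[OF bP(3) bQ(3)] by auto
      then show ?thesis using pair sgH
        by (simp add: cross_pair_def bridge_ends_def)
    next
      case far
      have "?a + 2 < ?b"
        using first_side_unpaired[OF _ far(2,1)] bP(1) by auto
      then have "\<alpha> (side g ?a t) < \<alpha> (side g (?a + 2) (1 - t))" "\<alpha> (side g (?a + 2) (1 - t)) < \<alpha> (side g ?b u)"
        "\<alpha> (side g ?b u) < \<alpha> (side g (?b + 2) (1 - u))"
        using boundary_order[OF bP(2) bP(3)] boundary_order[OF bP(3) bQ(2)] boundary_order[OF bQ(2) bQ(3)] by auto
      then show ?thesis using far sgH
        by (simp add: cross_pair_def bridge_ends_def)
    qed
  qed
  have "cross_pair (bridge_ends j t) (bridge_ends k u) = (if paired j k then -1 else 1)"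
  proof (cases "j < k \<or> j = k \<and> t < u")
    case True
    then show ?thesis using le[OF P Q] by blast
  next
    case False
    then have "k < j \<or> k = j \<and> u < t" using ne by auto
    then have "cross_pair (bridge_ends k u) (bridge_ends j t) = (if paired k j then -1 else 1)"
      using le[OF Q P] by blast
    then show ?thesis by (auto simp: cross_pair_sym paired_def)
  qed
  then show ?thesis
    using cross_pair_bridge[of j d t "ends (Br k e u)"] cross_pair_bridge[of k e u "bridge_ends j t"]
      cross_pair_sym[of "bridge_ends j t"] by simp
qed

text \<open>Apart from the bridges, a crossing sign factors into terms that depend on one piece and
  one end point of the other. This is what makes it cancel over even sets.\<close>

lemma cross_pair_pieces:
  assumes "good_piece P" "good_piece Q" "apart P Q"
  shows "cross_pair (ends P) (ends Q) = bridge_cross P Q * (outer_piece P Q * outer_piece Q P)"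
proof (cases P)
  case P: (Seg a b)
  show ?thesis
  proof (cases Q)
    case Q: (Seg c d)
    show ?thesis using cross_pair_segments[of a b c d] assms
      by (simp add: P Q ends_Seg outer_piece_def)
  next
    case Q: (Br k e u)
    have "apart (Br k e u) (Seg a b)"
      unfolding apart.simps
    proof (intro ballI impI)
      fix x y assume "x \<in> {start (Br k e u), finish (Br k e u)}" "y \<in> {start (Seg a b), finish (Seg a b)}" "\<alpha> x = \<alpha> y"
      then have "y = x" using assms(3)[unfolded P Q apart.simps] by metis
      then show "x = y" by simp
    qed
    then have "cross_pair (ends (Br k e u)) (ends (Seg a b)) = outer_piece (Seg a b) (Br k e u)"
      using cross_pair_bridge_segment assms unfolding P Q by blast
    moreover have "outer_piece (Br k e u) (Seg a b) = 1" by (simp add: outer_piece_def)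
    ultimately show ?thesis
      unfolding P Q cross_pair_sym[of "ends (Seg a b)" "ends (Br k e u)"] by (simp only: bridge_cross.simps mult_1 mult_1_right)
  qed
next
  case P: (Br j d t)
  show ?thesis
  proof (cases Q)
    case Q: (Seg a b)
    have "cross_pair (ends (Br j d t)) (ends (Seg a b)) = outer_piece (Seg a b) (Br j d t)"
      using cross_pair_bridge_segment assms unfolding P Q by blast
    moreover have "outer_piece (Br j d t) (Seg a b) = 1" by (simp add: outer_piece_def)
    ultimately show ?thesis unfolding P Q by (simp only: bridge_cross.simps mult_1 mult_1_right)
  next
    case Q: (Br k e u)
    have "cross_pair (ends (Br j d t)) (ends (Br k e u)) = bridge_cross (Br j d t) (Br k e u)"
      using cross_pair_bridges assms unfolding P Q apart.simps by blast
    moreover have "outer_piece (Br j d t) (Br k e u) = 1" "outer_piece (Br k e u) (Br j d t) = 1"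
      by (simp_all add: outer_piece_def)
    ultimately show ?thesis unfolding P Q by (simp only: mult_1_right)
  qed
qed

text \<open>Every inner node is the end of one piece and the start of the next, so its sign occurs
  twice.\<close>

lemma outer_piece_chain:
  assumes "piece_chain Ps" "Ps \<noteq> []"
  shows "(\<Prod>Q\<leftarrow>Ps. outer_piece P Q) = outer_of P (start (hd Ps)) * outer_of P (finish (last Ps))"
  using assms
proof (induction Ps rule: piece_chain.induct)
  case (1 Q R Ps)
  have "(\<Prod>Q\<leftarrow>R # Ps. outer_piece P Q) = outer_of P (start R) * outer_of P (finish (last (R # Ps)))"
    using 1 by simp
  moreover have "outer_of P (start R) * outer_of P (start R) = 1" by (rule outer_of_square)
  moreover have "outer_piece P Q = outer_of P (start Q) * outer_of P (start R)"
    using 1 by (simp add: outer_piece_def)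
  ultimately show ?case
    by (simp only: list.map prod_list.Cons list.sel last.simps list.distinct if_False) algebra
qed (simp_all add: outer_piece_def)

end


section \<open>Edges of an embedded graph\<close>

lemma length_segments: "length (segments g ws) = length ws - 1"
  by (simp add: segments_def)

lemma nth_segments:
  "k < length ws - 1 \<Longrightarrow> segments g ws ! k = (departure g (ws ! k), arrival g (ws ! Suc k))"
  by (simp add: segments_def nth_butlast nth_tl)

lemma surface_point_glued:
  assumes "(x, y) \<in> glueing g" shows "surface_point g x = surface_point g y"
proof -
  let ?R = "glueing g \<union> (glueing g)\<inverse>"
  have s: "(a, b) \<in> ?R\<^sup>* \<Longrightarrow> (b, a) \<in> ?R\<^sup>*" for a b
    by (rule symD[OF sym_rtrancl]) (auto simp: sym_def)
  have "(x, y) \<in> ?R\<^sup>*" using assms by blast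
  then show ?thesis unfolding surface_point_def
    using s by (auto intro: rtrancl_trans)
qed

lemma surface_point_passage:
  assumes "waypoint_ok g w" shows "surface_point g (arrival g w) = surface_point g (departure g w)"
proof (cases w)
  case (Cross j d t)
  then have "(side g (first_side j) t, side g (first_side j + 2) (1 - t)) \<in> glueing g"
    unfolding glueing_def using assms by (intro CollectI exI[of _ j] exI[of _ t]) simp
  from surface_point_glued[OF this] show ?thesis using Cross by (cases d) auto
qed simp

fun waypoint_nodes :: "nat \<Rightarrow> waypoint \<Rightarrow> complex list" where
  "waypoint_nodes g (Inner z) = [z]"
| "waypoint_nodes g (Cross j d t) = [arrival g (Cross j d t), departure g (Cross j d t)]"

lemma set_waypoint_nodes: "set (waypoint_nodes g w) = {arrival g w, departure g w}"
  by (cases w) auto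

locale drawing =
  fixes g :: nat and G :: "('v, 'e) polygon_graph"
  assumes genus: "1 \<le> g" and finite_graph: "finite_graph G" and embedded: "embedded_in_surface g G"
begin

abbreviation "S \<equiv> surface_point g"
abbreviation "len e \<equiv> length (route G e) - 1"

lemma edge_route:
  assumes "e \<in> edges G"
  shows "2 \<le> length (route G e)" "hd (route G e) = Inner (pos G (src G e))"
    "last (route G e) = Inner (pos G (tgt G e))" "\<And>w. w \<in> set (route G e) \<Longrightarrow> waypoint_ok g w"
    "\<And>a b. (a, b) \<in> set (segments g (route G e)) \<Longrightarrow> open_segment a b \<subseteq> interior (polygon g)"
    "src G e \<in> verts G" "tgt G e \<in> verts G"
proof -
  have "\<forall>e\<in>edges G. 2 \<le> length (route G e) \<and>
        hd (route G e) = Inner (pos G (src G e)) \<and>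
        last (route G e) = Inner (pos G (tgt G e)) \<and>
        (\<forall>w\<in>set (route G e). waypoint_ok g w) \<and>
        (\<forall>(a, b)\<in>set (segments g (route G e)). open_segment a b \<subseteq> interior (polygon g))"
    using embedded unfolding embedded_in_surface_def by (elim conjE)
  note e = bspec[OF this assms]
  show "2 \<le> length (route G e)" "hd (route G e) = Inner (pos G (src G e))"
    "last (route G e) = Inner (pos G (tgt G e))"
    using e by simp_all
  show "waypoint_ok g w" if "w \<in> set (route G e)" for w using e that by (elim conjE) (rule bspec)
  show "open_segment a b \<subseteq> interior (polygon g)" if "(a, b) \<in> set (segments g (route G e))" for a b
    using e that by (elim conjE) (drule (1) bspec, simp)
  show "src G e \<in> verts G" "tgt G e \<in> verts G"
    using finite_graph assms unfolding finite_graph_def by (simp_all add: image_subset_iff)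
qed

lemma pos_interior: "v \<in> verts G \<Longrightarrow> pos G v \<in> interior (polygon g)"
  using embedded unfolding embedded_in_surface_def by (elim conjE) (erule subsetD, erule imageI)

lemma pos_inj: "inj_on (pos G) (verts G)"
  using embedded unfolding embedded_in_surface_def by (elim conjE)

definition seg_start :: "'e \<Rightarrow> nat \<Rightarrow> complex" where
  "seg_start e k = departure g (route G e ! k)"

definition seg_end :: "'e \<Rightarrow> nat \<Rightarrow> complex" where
  "seg_end e k = arrival g (route G e ! Suc k)"

lemma edge_point_eq:
  "k < len e \<Longrightarrow> edge_point g G (e, k, u) = linepath (seg_start e k) (seg_end e k) u"
  by (simp add: edge_point_def nth_segments seg_start_def seg_end_def)

lemma params_iff: "(e, k, u) \<in> open_edge_params g G \<longleftrightarrow>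
    e \<in> edges G \<and> k < len e \<and> 0 \<le> u \<and> u < 1 \<and> (k, u) \<noteq> (0, 0)"
  by (simp add: open_edge_params_def length_segments)

lemma edge_point_inj:
  assumes "(e, k, u) \<in> open_edge_params g G" "(e', k', u') \<in> open_edge_params g G"
    "S (edge_point g G (e, k, u)) = S (edge_point g G (e', k', u'))"
  shows "e = e' \<and> k = k' \<and> u = u'"
proof -
  have "inj_on (\<lambda>q. S (edge_point g G q)) (open_edge_params g G)"
    using embedded unfolding embedded_in_surface_def by (elim conjE)
  from inj_onD[OF this, of "(e, k, u)" "(e', k', u')"] assms show ?thesis by simp
qed

lemma edge_point_not_vertex:
  assumes "q \<in> open_edge_params g G" "v \<in> verts G" shows "S (edge_point g G q) \<noteq> S (pos G v)"
proof -
  have "\<forall>q\<in>open_edge_params g G. \<forall>v\<in>verts G. S (edge_point g G q) \<noteq> S (pos G v)"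
    using embedded unfolding embedded_in_surface_def by (elim conjE)
  from bspec[OF this assms(1)] have "\<forall>v\<in>verts G. S (edge_point g G q) \<noteq> S (pos G v)" .
  from bspec[OF this assms(2)] show ?thesis .
qed

lemma open_segment_param:
  assumes "e \<in> edges G" "k < len e" "z \<in> open_segment (seg_start e k) (seg_end e k)"
  obtains u where "0 < u" "u < 1" "(e, k, u) \<in> open_edge_params g G" "z = edge_point g G (e, k, u)"
proof -
  obtain u where u: "0 < u" "u < 1" "z = (1 - u) *\<^sub>R seg_start e k + u *\<^sub>R seg_end e k"
    using assms(3) unfolding in_segment by blast
  then have "(e, k, u) \<in> open_edge_params g G" using assms by (simp add: params_iff)
  moreover have "z = edge_point g G (e, k, u)" using u assms(2) by (simp add: edge_point_eq linepath_def)
  ultimately show thesis using that u by blast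
qed

text \<open>A passage has two points in the polygon but one point in the surface, and this point has
  the parameter 0 on the segment leaving the waypoint.\<close>

lemma inner_waypoint_param:
  assumes "e \<in> edges G" "0 < k" "k < len e" "z \<in> {arrival g (route G e ! k), departure g (route G e ! k)}"
  shows "(e, k, 0) \<in> open_edge_params g G" "S z = S (edge_point g G (e, k, 0))"
proof -
  show "(e, k, 0) \<in> open_edge_params g G" using assms by (simp add: params_iff)
  have "edge_point g G (e, k, 0) = departure g (route G e ! k)"
    using assms by (simp add: edge_point_eq linepath_def seg_start_def)
  moreover have "S (arrival g (route G e ! k)) = S (departure g (route G e ! k))"
    using assms by (intro surface_point_passage edge_route(4)[of e] nth_mem) auto
  ultimately show "S z = S (edge_point g G (e, k, 0))" using assms(4) by auto
qed

lemma seg_nondegenerate: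
  assumes "e \<in> edges G" "k < len e" shows "seg_start e k \<noteq> seg_end e k"
proof
  assume *: "seg_start e k = seg_end e k"
  \<comment> \<open>A degenerate segment would give the same point to two different parameters; 1/2
    and 1/3 are arbitrary choices.\<close>
  have "S (edge_point g G (e, k, 1/2)) = S (edge_point g G (e, k, 1/3))"
    using assms * by (simp add: edge_point_eq linepath_def scaleR_left_distrib[symmetric])
  moreover have "(e, k, 1/2) \<in> open_edge_params g G" "(e, k, 1/3) \<in> open_edge_params g G"
    using assms by (auto simp: params_iff)
  ultimately have "(1/2 :: real) = 1/3" using edge_point_inj by blast
  then show False by simp
qed

lemma inner_waypoints_distinct:
  assumes "e \<in> edges G" "0 < k" "k < len e" "e' \<in> edges G" "0 < k'" "k' < len e'"
    "z \<in> set (waypoint_nodes g (route G e ! k))" "z \<in> set (waypoint_nodes g (route G e' ! k'))"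
  shows "e = e' \<and> k = k'"
  using inner_waypoint_param[of e k z] inner_waypoint_param[of e' k' z] edge_point_inj[of e k 0 e' k' 0] assms
  by (simp add: set_waypoint_nodes)

lemma inner_waypoint_not_vertex:
  assumes "e \<in> edges G" "0 < k" "k < len e" "z \<in> set (waypoint_nodes g (route G e ! k))" "v \<in> verts G"
  shows "z \<noteq> pos G v"
  using inner_waypoint_param[of e k z] edge_point_not_vertex[of "(e, k, 0)" v] assms
  by (auto simp: set_waypoint_nodes)

lemma open_segments_disjoint:
  assumes "e \<in> edges G" "k < len e" "e' \<in> edges G" "k' < len e'" "(e, k) \<noteq> (e', k')"
  shows "open_segment (seg_start e k) (seg_end e k) \<inter> open_segment (seg_start e' k') (seg_end e' k') = {}"
proof -
  have False if z: "z \<in> open_segment (seg_start e k) (seg_end e k)" "z \<in> open_segment (seg_start e' k') (seg_end e' k')" for z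
  proof -
    obtain u where u: "(e, k, u) \<in> open_edge_params g G" "z = edge_point g G (e, k, u)"
      using open_segment_param[OF assms(1,2) z(1)] by metis
    obtain u' where u': "(e', k', u') \<in> open_edge_params g G" "z = edge_point g G (e', k', u')"
      using open_segment_param[OF assms(3,4) z(2)] by metis
    show False using edge_point_inj[OF u(1) u'(1)] u(2) u'(2) assms(5) by simp
  qed
  then show ?thesis by blast
qed

lemma route_ends:
  assumes "e \<in> edges G"
  shows "route G e ! 0 = Inner (pos G (src G e))" "route G e ! len e = Inner (pos G (tgt G e))"
proof -
  note r = edge_route[OF assms]
  have "route G e \<noteq> []" using r(1) by auto
  then show "route G e ! 0 = Inner (pos G (src G e))" "route G e ! len e = Inner (pos G (tgt G e))"
    using r(2,3) by (simp_all add: hd_conv_nth last_conv_nth)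
qed

text \<open>All points at which a piece of an edge can begin or end; a passage contributes both of
  its boundary points.\<close>

definition nodes :: "complex set" where
  "nodes = pos G ` verts G \<union> (\<Union>e\<in>edges G. \<Union>w\<in>set (route G e). set (waypoint_nodes g w))"

lemma finite_nodes: "finite nodes"
  using finite_graph by (auto simp: nodes_def finite_graph_def)

lemma nodes_cases:
  assumes "z \<in> nodes"
  obtains v where "v \<in> verts G" "z = pos G v"
  | e k where "e \<in> edges G" "0 < k" "k < len e" "z \<in> set (waypoint_nodes g (route G e ! k))"
proof -
  consider v where "v \<in> verts G" "z = pos G v"
    | e w where "e \<in> edges G" "w \<in> set (route G e)" "z \<in> set (waypoint_nodes g w)"
    using assms unfolding nodes_def by blast
  then show thesis
  proof cases
    case 1 then show thesis using that(1) by blast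
  next
    case (2 e w)
    obtain k where k: "k < length (route G e)" "w = route G e ! k"
      using 2(2) unfolding in_set_conv_nth by blast
    consider "k = 0" | "k = len e" | "0 < k" "k < len e" using k(1) by linarith
    then show thesis
    proof cases
      case 1
      then have "w = Inner (pos G (src G e))" using k(2) route_ends(1)[OF 2(1)] by simp
      then have "z = pos G (src G e)" using 2(3) by simp
      then show thesis by (rule that(1)[OF edge_route(6)[OF 2(1)]])
    next
      case c: 2
      then have "w = Inner (pos G (tgt G e))" using k(2) route_ends(2)[OF 2(1)] by simp
      then have "z = pos G (tgt G e)" using 2(3) by simp
      then show thesis by (rule that(1)[OF edge_route(7)[OF 2(1)]])
    next
      case 3
      show thesis by (rule that(2)[OF 2(1) 3]) (use 2(3) k(2) in simp)
    qed
  qed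
qed

lemma nodes_not_open_segment:
  assumes "e \<in> edges G" "k < len e" "z \<in> nodes"
  shows "z \<notin> open_segment (seg_start e k) (seg_end e k)"
proof
  assume z: "z \<in> open_segment (seg_start e k) (seg_end e k)"
  obtain u where u: "0 < u" "(e, k, u) \<in> open_edge_params g G" "z = edge_point g G (e, k, u)"
    using open_segment_param[OF assms(1,2) z] by metis
  show False
    using assms(3)
  proof (cases rule: nodes_cases)
    case (1 v)
    then show False using edge_point_not_vertex[OF u(2)] u(3) by auto
  next
    case (2 e' k')
    then show False
      using inner_waypoint_param[of e' k' z] edge_point_inj[OF u(2), of e' k' 0] u by (simp add: set_waypoint_nodes)
  qed
qed

lemma waypoint_node_in_nodes:
  assumes "e \<in> edges G" "k < length (route G e)"
  shows "arrival g (route G e ! k) \<in> nodes" "departure g (route G e ! k) \<in> nodes"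
proof -
  have "route G e ! k \<in> set (route G e)" using assms by simp
  then show "arrival g (route G e ! k) \<in> nodes" "departure g (route G e ! k) \<in> nodes"
    using assms(1) set_waypoint_nodes unfolding nodes_def by fastforce+
qed

lemma seg_nodes:
  assumes "e \<in> edges G" "k < len e" shows "seg_start e k \<in> nodes" "seg_end e k \<in> nodes"
  using waypoint_node_in_nodes[of e k] waypoint_node_in_nodes[of e "Suc k"] assms
  by (auto simp: seg_start_def seg_end_def)

lemma seg_interior:
  assumes "e \<in> edges G" "k < len e"
  shows "open_segment (seg_start e k) (seg_end e k) \<subseteq> interior (polygon g)"
proof -
  have "segments g (route G e) ! k \<in> set (segments g (route G e))"
    using assms by (simp add: length_segments)
  then show ?thesis
    using edge_route(5)[OF assms(1)] assms(2) by (simp add: nth_segments seg_start_def seg_end_def)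
qed

lemma nodes_polygon:
  assumes "z \<in> nodes" shows "z \<in> polygon g \<and> cmod z < 1"
proof -
  have *: "x \<in> polygon g \<and> cmod x < 1" if "x \<in> interior (polygon g)" for x
    by (rule conjI[OF subsetD[OF interior_subset that] polygon_interior_norm[OF that]])
  show ?thesis using assms
  proof (cases rule: nodes_cases)
    case (1 v)
    show ?thesis unfolding 1(2) by (rule *[OF pos_interior[OF 1(1)]])
  next
    case (2 e k)
    then have ok: "waypoint_ok g (route G e ! k)" using edge_route(4) by simp
    show ?thesis
    proof (cases "route G e ! k")
      case (Inner x)
      then have "z = x" "x \<in> interior (polygon g)" using ok 2(4) by simp_all
      then show ?thesis using * by blast
    next
      case (Cross j d t)
      then have j: "j \<in> {1..2 * g}" "0 < t" "t < 1" using ok by auto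
      note f = first_side_bounds[OF j(1)]
      have "side g (first_side j) t \<in> polygon g" "side g (first_side j + 2) (1 - t) \<in> polygon g"
        using f j genus by (auto intro!: side_in_polygon)
      moreover have "cmod (side g (first_side j) t) < 1" "cmod (side g (first_side j + 2) (1 - t)) < 1"
        using f j genus by (auto intro!: norm_side_less)
      ultimately show ?thesis using 2(4) Cross by (cases d) auto
    qed
  qed
qed

lemma convex_polygon: "convex (polygon g)"
  by (simp add: polygon_def convex_convex_hull)

lemma seg_closed:
  assumes "e \<in> edges G" "k < len e"
  shows "closed_segment (seg_start e k) (seg_end e k) \<subseteq> polygon g" "1 \<notin> closed_segment (seg_start e k) (seg_end e k)"
proof -
  note n = nodes_polygon[OF seg_nodes(1)[OF assms]] nodes_polygon[OF seg_nodes(2)[OF assms]]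
  show "closed_segment (seg_start e k) (seg_end e k) \<subseteq> polygon g"
    using n convex_polygon closed_segment_subset by blast
  have "closed_segment (seg_start e k) (seg_end e k) \<subseteq> ball 0 1"
    using n by (intro closed_segment_subset convex_ball) auto
  then show "1 \<notin> closed_segment (seg_start e k) (seg_end e k)" by auto
qed

text \<open>Nodes and segments form a closed set inside the open unit disc, so the corner 1 has
  positive distance from it; within that distance there are interior points of the polygon.
  Genericity excludes the finitely many lines through two nodes, a null set.\<close>

lemma exists_observer:
  assumes ne: "edges G \<noteq> {}"
  obtains ob where "ob \<in> interior (polygon g)"
    "\<And>z. z \<in> nodes \<Longrightarrow> dist ob 1 < dist z 1"
    "\<And>e k z. e \<in> edges G \<Longrightarrow> k < len e \<Longrightarrow> z \<in> closed_segment (seg_start e k) (seg_end e k) \<Longrightarrow> dist ob 1 < dist z 1"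
    "\<And>u v. u \<in> nodes \<Longrightarrow> v \<in> nodes \<Longrightarrow> u \<noteq> v \<Longrightarrow> cr (u - ob) (v - ob) \<noteq> 0"
proof -
  define K where "K = nodes \<union> (\<Union>e\<in>edges G. \<Union>k<len e. closed_segment (seg_start e k) (seg_end e k))"
  have finE: "finite (edges G)" using finite_graph by (simp add: finite_graph_def)
  have "closed K" unfolding K_def
    using finE finite_nodes by (intro closed_Un closed_UN finite_imp_closed closed_segment ballI) auto
  moreover have "1 \<notin> K" using nodes_polygon seg_closed(2) by (force simp: K_def)
  ultimately obtain r where r: "0 < r" "\<And>z. z \<in> K \<Longrightarrow> r \<le> dist 1 z"
    using separate_point_closed[of K 1] by blast
  obtain e0 where "e0 \<in> edges G" using ne by blast
  then have int: "pos G (src G e0) \<in> interior (polygon g)" using pos_interior edge_route(6) by blast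
  define U where "U = ball 1 r \<inter> interior (polygon g)"
  have "1 \<in> closure (interior (polygon g))"
    using convex_closure_interior[OF convex_polygon] int one_in_polygon[OF genus] closure_subset by blast
  moreover have "1 \<in> ball (1 :: complex) r" using r(1) by simp
  ultimately have "U \<noteq> {}"
    unfolding U_def using open_Int_closure_eq_empty[OF open_ball, of 1 r "interior (polygon g)"] by blast
  moreover have "open U" by (simp add: U_def open_Int)
  ultimately have nonneg: "\<not> negligible U" using open_not_negligible by blast
  let ?L = "\<lambda>u v. {z. cr (u - z) (v - z) = 0}"
  have neg: "negligible (?L u v)" if "u \<noteq> v" for u v
  proof -
    let ?n = "\<i> * (u - v)"
    \<comment> \<open>The condition is affine in \<open>z\<close>: it describes the line through
      \<open>u\<close> and \<open>v\<close>.\<close>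
    have "cr (u - z) (v - z) = cr u v - inner ?n z" for z
      by (simp add: cr_def inner_complex_def algebra_simps)
    then have "?L u v = {z. inner ?n z = cr u v}" by auto
    moreover have "?n \<noteq> 0" using that by simp
    ultimately show ?thesis using negligible_hyperplane by metis
  qed
  have "negligible (\<Union>u\<in>nodes. \<Union>v\<in>nodes - {u}. ?L u v)"
    by (intro negligible_Union finite_imageI finite_nodes)
      (use finite_nodes in \<open>auto intro!: negligible_Union neg\<close>)
  then have "\<not> U \<subseteq> (\<Union>u\<in>nodes. \<Union>v\<in>nodes - {u}. ?L u v)"
    using nonneg negligible_subset by blast
  then obtain ob where ob: "ob \<in> U" "ob \<notin> (\<Union>u\<in>nodes. \<Union>v\<in>nodes - {u}. ?L u v)" by blast
  have far: "dist ob 1 < dist z 1" if "z \<in> K" for z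
    using ob(1) r(2)[OF that] by (simp add: U_def dist_commute)
  show thesis
  proof (rule that[of ob])
    show "ob \<in> interior (polygon g)" using ob(1) by (simp add: U_def)
    show "dist ob 1 < dist z 1" if "z \<in> nodes" for z using far that by (simp add: K_def)
    show "dist ob 1 < dist z 1" if "e \<in> edges G" "k < len e" "z \<in> closed_segment (seg_start e k) (seg_end e k)" for e k z
      using that by (intro far) (auto simp: K_def)
    show "cr (u - ob) (v - ob) \<noteq> 0" if "u \<in> nodes" "v \<in> nodes" "u \<noteq> v" for u v
      using ob(2) that by blast
  qed
qed

end

section \<open>Edges as chains of segments and bridges\<close>

fun bridge_of :: "waypoint \<Rightarrow> piece list" where
  "bridge_of (Inner z) = []"
| "bridge_of (Cross j d t) = [Br j d t]"

fun pieces :: "nat \<Rightarrow> waypoint list \<Rightarrow> piece list" where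
  "pieces g (w # w' # ws) = Seg (departure g w) (arrival g w') # bridge_of w' @ pieces g (w' # ws)"
| "pieces g _ = []"

lemma pieces_set:
  "P \<in> set (pieces g ws) \<Longrightarrow>
    (\<exists>k < length ws - 1. P = Seg (departure g (ws ! k)) (arrival g (ws ! Suc k))) \<or>
    (\<exists>k j d t. 0 < k \<and> k < length ws \<and> ws ! k = Cross j d t \<and> P = Br j d t)"
proof (induction g ws rule: pieces.induct)
  case (1 g w w' ws)
  then consider "P = Seg (departure g w) (arrival g w')" | "P \<in> set (bridge_of w')"
    | "P \<in> set (pieces g (w' # ws))" by auto
  then show ?case
  proof cases
    case 1
    then show ?thesis by (intro disjI1 exI[of _ 0]) simp
  next
    case 2
    then obtain j d t where "w' = Cross j d t" "P = Br j d t" by (cases w') auto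
    then show ?thesis
      by (intro disjI2 exI[of _ 1] exI[of _ j] exI[of _ d] exI[of _ t]) simp
  next
    case 3
    from "1.IH"[OF 3] show ?thesis
    proof (elim disjE exE conjE)
      fix k assume "k < length (w' # ws) - 1" "P = Seg (departure g ((w' # ws) ! k)) (arrival g ((w' # ws) ! Suc k))"
      then show ?thesis by (intro disjI1 exI[of _ "Suc k"]) simp
    next
      fix k j d t assume "0 < k" "k < length (w' # ws)" "(w' # ws) ! k = Cross j d t" "P = Br j d t"
      then show ?thesis
        by (intro disjI2 exI[of _ "Suc k"] exI[of _ j] exI[of _ d] exI[of _ t]) simp
    qed
  qed
qed auto

lemma two_elems': "2 \<le> length L \<Longrightarrow> \<exists>a L'. L = a # L' \<and> L' \<noteq> []"
  by (cases L; cases "tl L") auto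

lemma bridge_number_pieces:
  "bridge_number j (pieces g (w # ws)) = length (filter (\<lambda>w. \<exists>d t. w = Cross j d t) ws)"
proof (induction ws arbitrary: w)
  case (Cons w' ws)
  then show ?case by (cases w') (auto simp: bridge_number_def)
qed (simp add: bridge_number_def)

text \<open>Requiring a segment among any two neighbours excludes consecutive bridges, whose ends
  could not be told apart by direction in \<open>junction_ends\<close>.\<close>

fun links :: "(piece \<Rightarrow> complex) \<Rightarrow> (piece \<Rightarrow> complex) \<Rightarrow> piece list \<Rightarrow> bool" where
  "links s f (P # Q # Ps) \<longleftrightarrow> f P = s Q \<and>
     ((\<exists>a b. P = Seg a b) \<or> (\<exists>a b. Q = Seg a b)) \<and> links s f (Q # Ps)"
| "links s f _ \<longleftrightarrow> True"

context polygon_observer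
begin

lemma edge_image_join:
  "ws \<noteq> [] \<Longrightarrow> departure g w # concat (map (waypoint_image g) ws) = join (map poly (pieces g (w # ws)))"
proof (induction ws arbitrary: w)
  case (Cons w' ws)
  show ?case
  proof (cases ws)
    case Nil
    then show ?thesis by (cases w') simp_all
  next
    case (Cons w'' ws')
    then have IH: "departure g w' # concat (map (waypoint_image g) ws) = join (map poly (pieces g (w' # ws)))"
      using Cons.IH by simp
    obtain Q Qs where Q: "pieces g (w' # ws) = Q # Qs" using Cons by simp
    show ?thesis
    proof (cases w')
      case (Inner z)
      then show ?thesis using IH Q by simp
    next
      case w': (Cross j d t)
      define L where "L = waypoint_image g w'"
      have L: "L = poly (Br j d t)" by (simp add: L_def w')
      have "L \<noteq> []" using poly_length[of "Br j d t"] unfolding L by (metis length_0_conv not_numeral_le_zero)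
      moreover have "last L = departure g w'" using poly_ends(2)[of "Br j d t"] by (simp add: L w')
      ultimately have L2: "L = butlast L @ [departure g w']" by (metis append_butlast_last_id)
      have "join (map poly (pieces g (w # w' # ws))) =
          departure g w # butlast L @ join (map poly (pieces g (w' # ws)))"
        using Q unfolding L w' by simp
      also have "\<dots> = departure g w # L @ concat (map (waypoint_image g) ws)"
        unfolding IH[symmetric] by (subst (2) L2) simp
      finally show ?thesis by (simp add: L_def)
    qed
  qed
qed simp

lemma pieces_start:
  "ws \<noteq> [] \<Longrightarrow> last ws = Inner z \<Longrightarrow>
    map start (pieces g (w # ws)) = departure g w # concat (map (waypoint_nodes g) (butlast ws)) \<and>
    map finish (pieces g (w # ws)) = concat (map (waypoint_nodes g) (butlast ws)) @ [z]"
proof (induction ws arbitrary: w)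
  case (Cons w' ws)
  show ?case
  proof (cases ws)
    case Nil
    then show ?thesis using Cons.prems by simp
  next
    case (Cons w'' ws')
    then show ?thesis using Cons.IH[of w'] Cons.prems by (cases w') (auto simp del: pieces.simps(2))
  qed
qed simp

lemma pieces_links: "links start finish (pieces g ws)"
proof (induction ws)
  case (Cons w ws)
  show ?case
  proof (cases ws)
    case Nil
    then show ?thesis by simp
  next
    case c: (Cons w' ws')
    then show ?thesis using Cons by (cases w'; cases ws') auto
  qed
qed simp

end

locale observed_drawing = drawing g G + polygon_observer ob g
  for g :: nat and G :: "('v, 'e) polygon_graph" and ob +
  assumes far_nodes: "\<And>z. z \<in> nodes \<Longrightarrow> far z"
    and far_segments: "\<And>e k z. e \<in> edges G \<Longrightarrow> k < len e \<Longrightarrow>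
      z \<in> closed_segment (seg_start e k) (seg_end e k) \<Longrightarrow> far z"
    and generic: "\<And>u v. u \<in> nodes \<Longrightarrow> v \<in> nodes \<Longrightarrow> u \<noteq> v \<Longrightarrow> cr (u - ob) (v - ob) \<noteq> 0"
begin

text \<open>Points at equal angles are collinear with the observer, which genericity excludes for
  different nodes.\<close>

lemma \<alpha>_inj: "u \<in> nodes \<Longrightarrow> v \<in> nodes \<Longrightarrow> \<alpha> u = \<alpha> v \<Longrightarrow> u = v"
  using generic[of u v] by (auto simp: cr_polar)

abbreviation "pcs e \<equiv> pieces g (route G e)"

lemma route_Cons:
  assumes "e \<in> edges G"
  obtains ws where "route G e = Inner (pos G (src G e)) # ws" "ws \<noteq> []" "last ws = Inner (pos G (tgt G e))"
proof -
  note r = edge_route(1-3)[OF assms]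
  obtain w ws where w: "route G e = w # ws" "ws \<noteq> []"
    using r(1) two_elems'[of "route G e"] by blast
  then show thesis using that[of ws] r(2,3) by simp
qed

definition inner_nodes :: "'e \<Rightarrow> complex list" where
  "inner_nodes e = concat (map (waypoint_nodes g) (butlast (tl (route G e))))"

lemma pcs_nodes:
  assumes "e \<in> edges G"
  shows "map start (pcs e) = pos G (src G e) # inner_nodes e"
    "map finish (pcs e) = inner_nodes e @ [pos G (tgt G e)]"
proof -
  obtain ws where ws: "route G e = Inner (pos G (src G e)) # ws" "ws \<noteq> []" "last ws = Inner (pos G (tgt G e))"
    using route_Cons[OF assms] .
  from pieces_start[OF ws(2,3), of "Inner (pos G (src G e))"]
  show "map start (pcs e) = pos G (src G e) # inner_nodes e"
    "map finish (pcs e) = inner_nodes e @ [pos G (tgt G e)]"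
    unfolding inner_nodes_def ws(1) by simp_all
qed

lemma pcs_nonempty: "e \<in> edges G \<Longrightarrow> pcs e \<noteq> []"
  using pcs_nodes(1)[of e] by auto

lemma pcs_start: "e \<in> edges G \<Longrightarrow> start (hd (pcs e)) = pos G (src G e)"
  using pcs_nodes(1)[of e] pcs_nonempty[of e] by (metis list.map_sel(1) list.sel(1))

lemma pcs_finish: "e \<in> edges G \<Longrightarrow> finish (last (pcs e)) = pos G (tgt G e)"
  using pcs_nodes(2)[of e] pcs_nonempty[of e] by (metis last_map last_snoc)

lemma inner_nodes_index:
  assumes "e \<in> edges G"
  shows "inner_nodes e = concat (map (\<lambda>k. waypoint_nodes g (route G e ! k)) [1..<len e])"
proof -
  have "butlast (tl (route G e)) = map (\<lambda>k. route G e ! k) [1..<len e]"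
    by (rule nth_equalityI) (use edge_route(1)[OF assms] in \<open>auto simp: nth_butlast nth_tl\<close>)
  then show ?thesis by (simp add: inner_nodes_def comp_def)
qed

lemma set_inner_nodes:
  assumes "e \<in> edges G"
  shows "z \<in> set (inner_nodes e) \<longleftrightarrow> (\<exists>k. 0 < k \<and> k < len e \<and> z \<in> set (waypoint_nodes g (route G e ! k)))"
  unfolding inner_nodes_index[OF assms] by (auto simp: Suc_le_eq)

lemma distinct_waypoint_nodes:
  assumes "waypoint_ok g w" shows "distinct (waypoint_nodes g w)"
proof (cases w)
  case (Cross j d t)
  then have j: "j \<in> {1..2 * g}" "0 < t" "t < 1" using assms by auto
  note f = first_side_bounds[OF j(1)]
  have "side g (first_side j) t \<noteq> side g (first_side j + 2) (1 - t)"
    using side_inj[OF genus, of "first_side j" "first_side j + 2" t "1 - t"] f j by auto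
  then show ?thesis using Cross by (cases d) auto
qed simp

lemma distinct_inner_nodes:
  assumes e: "e \<in> edges G" shows "distinct (inner_nodes e)"
proof -
  have "distinct (concat (map (\<lambda>k. waypoint_nodes g (route G e ! k)) ks))"
    if "distinct ks" "set ks \<subseteq> {1..<len e}" for ks
    using that
  proof (induction ks)
    case (Cons k ks)
    have "distinct (waypoint_nodes g (route G e ! k))"
      using Cons.prems by (intro distinct_waypoint_nodes edge_route(4)[OF e] nth_mem) auto
    moreover have "set (waypoint_nodes g (route G e ! k)) \<inter> set (waypoint_nodes g (route G e ! m)) = {}"
      if "m \<in> set ks" for m
    proof -
      have "0 < k" "k < len e" "0 < m" "m < len e" "k \<noteq> m" using that Cons.prems by auto
      have False if "z \<in> set (waypoint_nodes g (route G e ! k))" "z \<in> set (waypoint_nodes g (route G e ! m))" for z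
        using inner_waypoints_distinct[OF e \<open>0 < k\<close> \<open>k < len e\<close> e \<open>0 < m\<close> \<open>m < len e\<close> that] \<open>k \<noteq> m\<close> by simp
      then show ?thesis by (simp add: disjoint_iff) metis
    qed
    then have "set (waypoint_nodes g (route G e ! k)) \<inter> (\<Union>m\<in>set ks. set (waypoint_nodes g (route G e ! m))) = {}"
      unfolding disjoint_iff by (metis UN_E)
    moreover have "distinct (concat (map (\<lambda>k. waypoint_nodes g (route G e ! k)) ks))" using Cons by simp
    ultimately show ?case by simp
  qed simp
  then show ?thesis unfolding inner_nodes_index[OF e] by simp
qed

lemma inner_nodes_disjoint:
  assumes "e \<in> edges G" "f \<in> edges G" "e \<noteq> f" shows "set (inner_nodes e) \<inter> set (inner_nodes f) = {}"
proof -
  have False if z: "z \<in> set (inner_nodes e)" "z \<in> set (inner_nodes f)" for z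
  proof -
    obtain k where k: "0 < k" "k < len e" "z \<in> set (waypoint_nodes g (route G e ! k))"
      using z(1) unfolding set_inner_nodes[OF assms(1)] by (elim exE conjE)
    obtain m where m: "0 < m" "m < len f" "z \<in> set (waypoint_nodes g (route G f ! m))"
      using z(2) unfolding set_inner_nodes[OF assms(2)] by (elim exE conjE)
    show False
      using inner_waypoints_distinct[OF assms(1) k(1,2) assms(2) m(1,2) k(3) m(3)] assms(3) by simp
  qed
  then show ?thesis by (simp add: disjoint_iff) metis
qed

lemma inner_nodes_not_vertex:
  assumes "e \<in> edges G" "v \<in> verts G" shows "pos G v \<notin> set (inner_nodes e)"
proof
  assume "pos G v \<in> set (inner_nodes e)"
  then obtain k where "0 < k" "k < len e" "pos G v \<in> set (waypoint_nodes g (route G e ! k))"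
    unfolding set_inner_nodes[OF assms(1)] by (elim exE conjE)
  from inner_waypoint_not_vertex[OF assms(1) this assms(2)] show False by simp
qed

lemma pcs_cases:
  assumes e: "e \<in> edges G" and P: "P \<in> set (pcs e)"
  obtains k where "k < len e" "P = Seg (seg_start e k) (seg_end e k)"
  | k j d t where "0 < k" "k < len e" "route G e ! k = Cross j d t" "P = Br j d t"
proof -
  from pieces_set[OF P] show thesis
  proof (elim disjE exE conjE)
    fix k assume "k < length (route G e) - 1" "P = Seg (departure g (route G e ! k)) (arrival g (route G e ! Suc k))"
    then show thesis using that(1)[of k] by (simp add: seg_start_def seg_end_def)
  next
    fix k j d t assume k: "0 < k" "k < length (route G e)" "route G e ! k = Cross j d t" "P = Br j d t"
    then have "k \<noteq> len e" using route_ends(2)[OF e] by auto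
    then show thesis using that(2)[of k j d t] k by simp
  qed
qed

lemma pcs_piece_nodes:
  assumes "e \<in> edges G" "P \<in> set (pcs e)" shows "start P \<in> nodes" "finish P \<in> nodes"
proof -
  have "start P \<in> nodes \<and> finish P \<in> nodes"
    using assms
  proof (cases rule: pcs_cases)
    case (1 k)
    then show ?thesis using seg_nodes[OF assms(1)] by simp
  next
    case (2 k j d t)
    then show ?thesis using waypoint_node_in_nodes[OF assms(1), of k] by simp
  qed
  then show "start P \<in> nodes" "finish P \<in> nodes" by auto
qed

lemma good_segment_edge:
  assumes "e \<in> edges G" "k < len e" shows "good_segment (seg_start e k) (seg_end e k)"
proof -
  have "visible z" if "z \<in> closed_segment (seg_start e k) (seg_end e k)" for z
    using far_visible far_segments[OF assms that] seg_closed(1)[OF assms] that by blast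
  moreover have "\<alpha> (seg_start e k) \<noteq> \<alpha> (seg_end e k)"
    using \<alpha>_inj seg_nodes[OF assms] seg_nondegenerate[OF assms] by blast
  ultimately show ?thesis by (simp add: good_segment_def)
qed

lemma pcs_good:
  assumes e: "e \<in> edges G" and P: "P \<in> set (pcs e)" shows "good_piece P"
  using assms
proof (cases rule: pcs_cases)
  case (1 k)
  then show ?thesis using good_segment_edge[OF e 1(1)] seg_interior[OF e 1(1)] by simp
next
  case (2 k j d t)
  have "route G e ! k \<in> set (route G e)" using 2 by (intro nth_mem) simp
  then have ok: "waypoint_ok g (route G e ! k)" by (rule edge_route(4)[OF e])
  then have j: "j \<in> {1..2 * g}" "0 < t" "t < 1" using 2 by auto
  note f = first_side_bounds[OF j(1)]
  have "far (arrival g (Cross j d t))" "far (departure g (Cross j d t))"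
    using waypoint_node_in_nodes[OF e, of k] 2 far_nodes by auto
  then have "far (side g (first_side j) t)" "far (side g (first_side j + 2) (1 - t))"
    by (cases d; simp)+
  then show ?thesis using f j 2 by (simp add: boundary_def)
qed

lemma pcs_apart:
  assumes e: "e \<in> edges G" "P \<in> set (pcs e)" and f: "f \<in> edges G" "Q \<in> set (pcs f)" and ne: "P \<noteq> Q"
  shows "apart P Q"
proof -
  note n = pcs_piece_nodes[OF e] pcs_piece_nodes[OF f]
  show ?thesis
    using e
  proof (cases rule: pcs_cases)
    case P: (1 k)
    show ?thesis using f
    proof (cases rule: pcs_cases)
      case Q: (1 m)
      have km: "(e, k) \<noteq> (f, m)" using P Q ne by auto
      have "seg_start e k \<in> nodes" "seg_end e k \<in> nodes" "seg_start f m \<in> nodes" "seg_end f m \<in> nodes"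
        using seg_nodes e f P Q by auto
      then show ?thesis
        using open_segments_disjoint[OF e(1) P(1) f(1) Q(1) km] nodes_not_open_segment[OF e(1) P(1)]
          nodes_not_open_segment[OF f(1) Q(1)] \<alpha>_inj
        unfolding P Q apart.simps disjoint_segments_def by blast
    next
      case Q: (2 m j d t)
      show ?thesis using n \<alpha>_inj unfolding P Q apart.simps by blast
    qed
  next
    case P: (2 k j d t)
    show ?thesis using f
    proof (cases rule: pcs_cases)
      case Q: (1 m)
      show ?thesis using n \<alpha>_inj unfolding P Q apart.simps by blast
    next
      case Q: (2 m i d' u)
      have "\<not> (j = i \<and> t = u)"
      proof
        assume eq: "j = i \<and> t = u"
        have "arrival g (Cross j d t) \<in> set (waypoint_nodes g (route G e ! k))" using P by (simp add: set_waypoint_nodes)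
        moreover have "arrival g (Cross j d t) \<in> set (waypoint_nodes g (route G f ! m))"
          using Q eq by (cases d; cases d') (auto simp: set_waypoint_nodes)
        ultimately have "e = f \<and> k = m"
          using inner_waypoints_distinct[OF e(1) P(1,2) f(1) Q(1,2)] by blast
        then show False using P Q ne by auto
      qed
      then show ?thesis unfolding P Q by simp
    qed
  qed
qed

text \<open>Two disjoint segments leave a common point in different directions; at a boundary point
  a segment goes inwards and a bridge outwards.\<close>

lemma junction_ends:
  assumes "good_piece P" "good_piece Q" "apart P Q" "finish P = start Q"
    and sg: "(\<exists>a b. P = Seg a b) \<or> (\<exists>a b. Q = Seg a b)"
  shows "snd (ends P) \<noteq> fst (ends Q)"
proof -
  have bs: "hpos_at (side g m u) (side_normal g m) \<noteq> hpos_at (side g m u) (x - side g m u)"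
    if "boundary m u" "good_segment (side g m u) x" "open_segment (side g m u) x \<subseteq> interior (polygon g)" for m u x
    using boundary_slope_order[OF that] by (metis less_irrefl)
  show ?thesis
  proof (cases P)
    case P: (Seg a b)
    show ?thesis
    proof (cases Q)
      case Q: (Seg c d)
      have c: "c = b" using assms(4) P Q by simp
      have "hpos_at b (a - b) \<noteq> hpos_at b (d - b)"
        by (rule directions_differ)
          (use assms P Q c in \<open>auto simp: good_segment_sym[of b a] disjoint_segments_def open_segment_commute[of b a]\<close>)
      then show ?thesis by (simp add: P Q c ends_def)
    next
      case Q: (Br j d t)
      note gd = good_bridgeD[OF assms(2)[unfolded Q]]
      have s: "good_segment b a" "open_segment b a \<subseteq> interior (polygon g)"
        using assms(1) P by (auto simp: good_segment_sym[of b a] open_segment_commute[of b a])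
      show ?thesis
      proof (cases d)
        case True
        then have "b = side g (first_side j) t" using assms(4) P Q by simp
        then show ?thesis using bs[OF gd(2), of a] s True by (auto simp: P Q ends_def)
      next
        case False
        then have "b = side g (first_side j + 2) (1 - t)" using assms(4) P Q by simp
        then show ?thesis using bs[OF gd(3), of a] s False by (auto simp: P Q ends_def)
      qed
    qed
  next
    case P: (Br j d t)
    then obtain a b where Q: "Q = Seg a b" using sg by auto
    note gd = good_bridgeD[OF assms(1)[unfolded P]]
    have s: "good_segment a b" "open_segment a b \<subseteq> interior (polygon g)" using assms(2) Q by auto
    show ?thesis
    proof (cases d)
      case True
      then have "a = side g (first_side j + 2) (1 - t)" using assms(4) P Q by simp
      then show ?thesis using bs[OF gd(3), of b] s True by (auto simp: P Q ends_def)
    next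
      case False
      then have "a = side g (first_side j) t" using assms(4) P Q by simp
      then show ?thesis using bs[OF gd(2), of b] s False by (auto simp: P Q ends_def)
    qed
  qed
qed

lemma links_chain:
  assumes "links start finish Ps" "\<And>P. P \<in> set Ps \<Longrightarrow> good_piece P"
    "\<And>P Q. P \<in> set Ps \<Longrightarrow> Q \<in> set Ps \<Longrightarrow> P \<noteq> Q \<Longrightarrow> apart P Q" "distinct Ps"
  shows "piece_chain Ps"
  using assms
proof (induction start finish Ps rule: links.induct)
  case (1 P Q Ps)
  have "snd (ends P) \<noteq> fst (ends Q)"
    by (rule junction_ends) (use 1 in auto)
  then show ?case using 1 by auto
qed auto

lemma distinct_pcs: "e \<in> edges G \<Longrightarrow> distinct (pcs e)"
proof -
  assume e: "e \<in> edges G"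
  have "distinct (map start (pcs e))"
    using distinct_inner_nodes[OF e] inner_nodes_not_vertex[OF e edge_route(6)[OF e]]
    by (simp add: pcs_nodes[OF e])
  then show ?thesis by (simp add: distinct_map)
qed

lemma pcs_chain: "e \<in> edges G \<Longrightarrow> piece_chain (pcs e)"
  using pieces_links pcs_good pcs_apart distinct_pcs by (intro links_chain) blast+

lemma angle_ends: "angle (fst (ends P)) = \<alpha> (start P)" "angle (snd (ends P)) = \<alpha> (finish P)"
  by (simp_all add: ends_def hpos_at_def)

lemma links_separated:
  assumes "links start finish Ps" "distinct (map start Ps)" "distinct (map finish Ps)"
    "\<And>P. P \<in> set Ps \<Longrightarrow> start P \<noteq> finish P \<and> start P \<in> nodes \<and> finish P \<in> nodes"
  shows "separated (map ends Ps)"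
  using assms
proof (induction start finish Ps rule: links.induct)
  case (1 P Q Ps)
  have P: "start P \<noteq> finish P" "start P \<in> nodes" "finish P \<in> nodes" using 1(5)[of P] by auto
  have "\<alpha> (start P) \<noteq> \<alpha> (finish P)" using \<alpha>_inj P by blast
  moreover have "\<alpha> (finish P) \<noteq> \<alpha> (finish R)" "\<alpha> (start P) \<noteq> \<alpha> (start R)" if "R \<in> set (Q # Ps)" for R
  proof -
    have R: "start R \<in> nodes" "finish R \<in> nodes" using 1(5)[of R] that by auto
    have "finish P \<notin> finish ` set (Q # Ps)" "start P \<notin> start ` set (Q # Ps)"
      using 1(3,4) unfolding list.map(2)[of _ P] distinct.simps(2) set_map[symmetric] by simp_all
    then have "finish P \<noteq> finish R" "start P \<noteq> start R"
      using that by blast+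
    then show "\<alpha> (finish P) \<noteq> \<alpha> (finish R)" "\<alpha> (start P) \<noteq> \<alpha> (start R)" using \<alpha>_inj P R by blast+
  qed
  ultimately have ne: "\<alpha> (start P) \<noteq> \<alpha> (finish P)"
    "\<And>R. R \<in> set (Q # Ps) \<Longrightarrow> \<alpha> (finish P) \<noteq> \<alpha> (finish R)"
    "\<And>R. R \<in> set (Q # Ps) \<Longrightarrow> \<alpha> (start P) \<noteq> \<alpha> (start R)" by blast+
  have "angle (snd (ends P)) \<notin> angle ` snd ` set (map ends (Q # Ps))"
    "angle (fst (ends P)) \<notin> angle ` fst ` set (map ends (Q # Ps))"
    unfolding set_map image_image angle_ends using ne(2,3) by blast+
  moreover have "angle (snd (ends P)) = angle (fst (ends Q))" "angle (fst (ends P)) \<noteq> angle (snd (ends P))"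
    unfolding angle_ends using 1(2) ne(1) by simp_all
  moreover have "separated (map ends (Q # Ps))" using 1 by simp
  ultimately show ?case unfolding list.map separated.simps by blast
qed auto

lemma piece_start_ne_finish: "good_piece P \<Longrightarrow> start P \<noteq> finish P"
proof (cases P)
  case (Seg a b)
  then show "good_piece P \<Longrightarrow> ?thesis" using good_segment_visible(5)[of a b] by simp
next
  case (Br j d t)
  assume "good_piece P"
  note gd = good_bridgeD[OF this[unfolded Br]]
  have "\<alpha> (side g (first_side j) t) < \<alpha> (side g (first_side j + 2) (1 - t))"
    by (rule boundary_order[OF gd(2,3)]) simp
  then show ?thesis by (cases d) (auto simp: Br)
qed

lemma pcs_separated: "e \<in> edges G \<Longrightarrow> separated (map ends (pcs e))"
proof -
  assume e: "e \<in> edges G"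
  show ?thesis
  proof (rule links_separated[OF pieces_links])
    show "distinct (map start (pcs e))" "distinct (map finish (pcs e))"
      using distinct_inner_nodes[OF e] inner_nodes_not_vertex[OF e] edge_route(6,7)[OF e]
      by (auto simp: pcs_nodes[OF e])
    show "start P \<noteq> finish P \<and> start P \<in> nodes \<and> finish P \<in> nodes" if "P \<in> set (pcs e)" for P
      using pcs_piece_nodes[OF e that] piece_start_ne_finish pcs_good[OF e that] by blast
  qed
qed

end


section \<open>Chords of the edges\<close>

context observed_drawing
begin

fun half_edge :: "'e dedge \<Rightarrow> hpos" where
  "half_edge (e, True) = fst (ends (hd (pcs e)))"
| "half_edge (e, False) = snd (ends (last (pcs e)))"

text \<open>The sign left over from the turning of the curve of an edge, see
  \<open>edge_phase\<close>. The default 1 outside the edge set serves the conditions on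
  \<open>\<eta>\<close> in \<open>chord_system\<close>, which are imposed on all directed
  edges.\<close>

definition orientation :: "'e dedge \<Rightarrow> real" where
  "orientation a = (if snd a then 1 else -1) *
     (if fst a \<in> edges G then chain_sign (map ends (pcs (fst a))) else 1)"

text \<open>The additional sign makes the weight of a cycle carry the scalar product of
  \<open>s\<close> with the bridge counts, the difference between the rotations for \<open>s\<close>
  and for 0.\<close>

definition spin :: "(nat \<Rightarrow> nat) \<Rightarrow> 'e dedge \<Rightarrow> real" where
  "spin s a = orientation a * (-1) ^ (\<Sum>j=1..2 * g. s j * bridge_count G j (fst a))"

lemma angle_half_edge: "fst a \<in> edges G \<Longrightarrow> angle (half_edge a) = \<alpha> (pos G (dtail G a))"
  by (cases a rule: half_edge.cases) (auto simp: angle_ends pcs_start pcs_finish dtail_def)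

lemma vertex_node: "v \<in> verts G \<Longrightarrow> pos G v \<in> nodes"
  by (simp add: nodes_def)

lemma dtail_vertex: "fst a \<in> edges G \<Longrightarrow> dtail G a \<in> verts G"
  using edge_route(6,7)[of "fst a"] by (cases a) (auto simp: dtail_def)

lemma angle_vertex_inj:
  "u \<in> verts G \<Longrightarrow> v \<in> verts G \<Longrightarrow> \<alpha> (pos G u) = \<alpha> (pos G v) \<Longrightarrow> u = v"
  using \<alpha>_inj[OF vertex_node vertex_node] inj_onD[OF pos_inj] by blast

lemma half_edge_same_angle:
  "fst a \<in> edges G \<Longrightarrow> fst b \<in> edges G \<Longrightarrow> angle (half_edge a) = angle (half_edge b) \<longleftrightarrow> dtail G a = dtail G b"
  using angle_vertex_inj[OF dtail_vertex dtail_vertex, of a b] by (auto simp: angle_half_edge)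

lemma half_edge_convex:
  assumes "fst a \<in> edges G" "fst b \<in> edges G" "fst c \<in> edges G"
    "dtail G a = dtail G b" "half_edge a < half_edge c" "half_edge c < half_edge b"
  shows "dtail G c = dtail G a"
  using assms half_edge_same_angle[of a b] half_edge_same_angle[of c a] by (auto simp: less_hpos_def)

lemma last_pieces: "ws \<noteq> [] \<Longrightarrow> last ws = Inner z \<Longrightarrow>
    last (pieces g (w # ws)) = Seg (departure g (last (butlast (w # ws)))) z"
proof (induction ws arbitrary: w)
  case (Cons w' ws)
  show ?case
  proof (cases ws)
    case Nil
    then show ?thesis using Cons.prems by simp
  next
    case (Cons w'' ws')
    then have "last (pieces g (w' # ws)) = Seg (departure g (last (butlast (w' # ws)))) z"
      using Cons.IH Cons.prems by simp
    moreover have "pieces g (w' # ws) \<noteq> []" using Cons by simp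
    ultimately show ?thesis using Cons by simp
  qed
qed simp

fun half_edge_index :: "'e dedge \<Rightarrow> nat" where
  "half_edge_index (e, d) = (if d then 0 else len e - 1)"

fun half_edge_far :: "'e dedge \<Rightarrow> complex" where
  "half_edge_far (e, d) = (if d then seg_end e 0 else seg_start e (len e - 1))"

lemma half_edge_segment:
  assumes "fst a \<in> edges G"
  shows "half_edge a = hpos_at (pos G (dtail G a)) (half_edge_far a - pos G (dtail G a))"
    "half_edge_index a < len (fst a)"
    "{seg_start (fst a) (half_edge_index a), seg_end (fst a) (half_edge_index a)} = {pos G (dtail G a), half_edge_far a}"
proof -
  obtain e d where a: "a = (e, d)" and e: "e \<in> edges G" using assms by (cases a) auto
  obtain ws where ws: "route G e = Inner (pos G (src G e)) # ws" "ws \<noteq> []" "last ws = Inner (pos G (tgt G e))"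
    using route_Cons[OF e] .
  have len: "0 < len e" using ws by simp
  then show "half_edge_index a < len (fst a)" unfolding a half_edge_index.simps fst_conv by (cases d) auto
  have s: "seg_start e 0 = pos G (src G e)" by (simp add: seg_start_def ws)
  have f: "seg_end e (len e - 1) = pos G (tgt G e)"
  proof -
    have "Suc (len e - 1) = len e" using len by linarith
    then show ?thesis unfolding seg_end_def using route_ends(2)[OF e] by simp
  qed
  show "{seg_start (fst a) (half_edge_index a), seg_end (fst a) (half_edge_index a)} = {pos G (dtail G a), half_edge_far a}"
    using s f by (auto simp: a dtail_def)
  have hd: "hd (pcs e) = Seg (pos G (src G e)) (seg_end e 0)"
    using ws by (cases ws) (simp_all add: seg_end_def)
  have "last (butlast (route G e)) = route G e ! (len e - 1)"
  proof -
    have "length (butlast (route G e)) = len e" by simp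
    then have "butlast (route G e) \<noteq> []" using len by force
    then show ?thesis using len by (simp add: last_conv_nth nth_butlast)
  qed
  then have la: "last (pcs e) = Seg (seg_start e (len e - 1)) (pos G (tgt G e))"
    using last_pieces[OF ws(2,3), of "Inner (pos G (src G e))"] ws(1) by (simp add: seg_start_def)
  show "half_edge a = hpos_at (pos G (dtail G a)) (half_edge_far a - pos G (dtail G a))"
    by (cases d) (simp_all add: a dtail_def hd la ends_def)
qed

lemma half_edge_good:
  assumes "fst a \<in> edges G"
  shows "good_segment (pos G (dtail G a)) (half_edge_far a)"
    "open_segment (pos G (dtail G a)) (half_edge_far a) =
      open_segment (seg_start (fst a) (half_edge_index a)) (seg_end (fst a) (half_edge_index a))"
  using half_edge_segment(3)[OF assms] good_segment_edge[OF assms half_edge_segment(2)[OF assms]]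
  by (auto simp: doubleton_eq_iff good_segment_sym open_segment_commute)

text \<open>Half-edges at different vertices differ in angle. At one vertex their segments are
  disjoint and leave in different directions, unless both half-edges are ends of one segment; this
  would be a loop drawn as a single segment, which is degenerate.\<close>

lemma half_edge_inj:
  assumes ab: "fst a \<in> edges G" "fst b \<in> edges G" and eq: "half_edge a = half_edge b"
  shows "a = b"
proof (rule ccontr)
  assume "a \<noteq> b"
  let ?v = "pos G (dtail G a)"
  have v: "dtail G b = dtail G a" using half_edge_same_angle[OF ab] eq by simp
  have "(fst a, half_edge_index a) = (fst b, half_edge_index b)"
  proof (rule ccontr)
    assume "(fst a, half_edge_index a) \<noteq> (fst b, half_edge_index b)"
    from open_segments_disjoint[OF ab(1) half_edge_segment(2)[OF ab(1)] ab(2) half_edge_segment(2)[OF ab(2)] this]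
    have "open_segment ?v (half_edge_far a) \<inter> open_segment ?v (half_edge_far b) = {}"
      unfolding half_edge_good(2)[OF ab(1)] half_edge_good(2)[OF ab(2), unfolded v] .
    from directions_differ[OF half_edge_good(1)[OF ab(1)] half_edge_good(1)[OF ab(2), unfolded v] this]
    show False using half_edge_segment(1)[OF ab(1)] half_edge_segment(1)[OF ab(2)] v eq by simp
  qed
  then obtain e where "(a = (e, True) \<and> b = (e, False)) \<or> (a = (e, False) \<and> b = (e, True))" "len e = 1"
    using \<open>a \<noteq> b\<close> half_edge_segment(2)[OF ab(1)] by (cases a; cases b) (auto split: if_splits)
  then have "seg_start e 0 = pos G (src G e)" "seg_end e 0 = pos G (tgt G e)" "src G e = tgt G e" "e \<in> edges G"
    using v ab route_ends[of e] by (auto simp: seg_start_def seg_end_def dtail_def)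
  moreover have "0 < len e" using \<open>len e = 1\<close> by linarith
  ultimately show False using seg_nondegenerate[of e 0] by simp
qed

lemma orientation_dinv: "orientation (dinv a) = - orientation a"
  by (cases a) (auto simp: orientation_def dinv_def)

lemma edge_phase:
  assumes "e \<in> edges G"
  shows "turn_product (edge_image g G e) * cis ((lift (half_edge (e, True)) - lift (half_edge (e, False))) / 2) =
    \<i> * of_real (orientation (e, True))"
    "edge_image g G e = join (map poly (pcs e))"
proof -
  obtain ws where ws: "route G e = Inner (pos G (src G e)) # ws" "ws \<noteq> []"
    using route_Cons[OF assms] by metis
  show im: "edge_image g G e = join (map poly (pcs e))"
    using edge_image_join[OF ws(2), of "Inner (pos G (src G e))"] by (simp add: edge_image_def ws(1))
  show "turn_product (edge_image g G e) * cis ((lift (half_edge (e, True)) - lift (half_edge (e, False))) / 2) =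
    \<i> * of_real (orientation (e, True))"
    using piece_chain_phase[OF pcs_chain[OF assms] pcs_nonempty[OF assms]] assms im by (simp add: orientation_def)
qed

lemma norm_turn_product: "cmod (turn_product p) = 1"
  by (induction p rule: turn_product.induct) (simp_all add: norm_mult turn_def)

lemma orientation_square: "orientation a * orientation a = 1"
proof -
  have "orientation (e, True) * orientation (e, True) = 1" for e
  proof (cases "e \<in> edges G")
    case True
    have "\<bar>orientation (e, True)\<bar> = 1"
      using arg_cong[OF edge_phase(1)[OF True], of cmod] by (simp add: norm_mult norm_turn_product)
    then show ?thesis by (metis abs_mult_self_eq mult_1)
  qed (simp add: orientation_def)
  from this[of "fst a"] show ?thesis unfolding orientation_def by (cases a) (simp split: if_splits)
qed

lemma spin_chord_system: "chord_system G half_edge (spin s)"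
proof
  show "finite (edges G)" using finite_graph by (simp add: finite_graph_def)
  show "spin s (dinv a) = - spin s a" for a by (simp add: spin_def orientation_dinv)
  show "spin s a * spin s a = 1" for a
    using orientation_square[of a] by (simp add: spin_def mult_ac power_mult_distrib[symmetric])
qed (use half_edge_inj half_edge_convex in blast)+

sublocale base: chord_system G half_edge orientation
  using spin_chord_system[of "\<lambda>_. 0"] by (simp add: spin_def[abs_def])

lemma bridge_count_pcs: "e \<in> edges G \<Longrightarrow> bridge_count G j e = bridge_number j (pcs e)"
  by (erule route_Cons) (simp add: bridge_count_def bridge_number_pieces)

text \<open>The sign of the long chord occurs both in \<open>chord_sign\<close> and in
  \<open>chain_sign_pair_product\<close> and squares to 1, which leaves the crossings of the pieces
  of the edge among themselves.\<close>

lemma chord_sign_edge: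
  assumes e: "e \<in> edges G" shows "base.chord_sign e = pair_product cross_pair (map ends (pcs e))"
proof -
  have ne: "pcs e \<noteq> []" by (rule pcs_nonempty[OF e])
  have neq: "half_edge (e, True) \<noteq> half_edge (e, False)"
    using half_edge_inj[of "(e, True)" "(e, False)"] e by auto
  have "chain_sign (map ends (pcs e)) =
      sg (half_edge (e, True)) (half_edge (e, False)) * pair_product cross_pair (map ends (pcs e))"
    using chain_sign_pair_product[OF pcs_separated[OF e]] ne neq by (simp add: hd_map last_map)
  moreover have "sg (half_edge (e, True)) (half_edge (e, False)) * sg (half_edge (e, True)) (half_edge (e, False)) = 1"
    by (rule sg_mult_self[OF neq])
  ultimately show ?thesis using e by (simp add: base.chord_sign_def orientation_def)
qed

lemma inner_nodes_nodes:
  assumes "e \<in> edges G" "z \<in> set (inner_nodes e)" shows "z \<in> nodes"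
proof -
  have "z \<in> set (map start (pcs e))" using assms by (simp add: pcs_nodes)
  then show ?thesis using pcs_piece_nodes(1)[OF assms(1)] by auto
qed

lemma adjacent_pcs:
  assumes e: "e \<in> edges G" and y: "angle y = \<alpha> z" "z \<in> nodes" "z \<notin> set (inner_nodes e)"
  shows "adjacent_to y (map ends (pcs e))"
proof (rule separated_adjacent[OF pcs_separated[OF e]])
  have "map finish (butlast (pcs e)) = inner_nodes e" by (simp add: map_butlast pcs_nodes[OF e])
  then have "finish ` set (butlast (pcs e)) = set (inner_nodes e)" by (metis set_map)
  then have "angle ` snd ` set (butlast (map ends (pcs e))) = \<alpha> ` set (inner_nodes e)"
    by (simp add: map_butlast[symmetric] image_image angle_ends) (metis image_image)
  then show "angle y \<notin> angle ` snd ` set (butlast (map ends (pcs e)))"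
    using y \<alpha>_inj inner_nodes_nodes[OF e] by auto
qed

lemma adjacent_edges:
  assumes ef: "e \<in> edges G" "f \<in> edges G" "e \<noteq> f" and P: "P \<in> set (pcs f)"
  shows "adjacent_to (fst (ends P)) (map ends (pcs e))" "adjacent_to (snd (ends P)) (map ends (pcs e))"
proof -
  have *: "z \<notin> set (inner_nodes e)" if "z \<in> {pos G (src G f), pos G (tgt G f)} \<union> set (inner_nodes f)" for z
    using inner_nodes_not_vertex[OF ef(1) edge_route(6)[OF ef(2)]]
      inner_nodes_not_vertex[OF ef(1) edge_route(7)[OF ef(2)]] inner_nodes_disjoint[OF ef] that by blast
  have "start P \<in> set (map start (pcs f))" "finish P \<in> set (map finish (pcs f))" using P by simp_all
  then have "start P \<notin> set (inner_nodes e)" "finish P \<notin> set (inner_nodes e)"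
    unfolding pcs_nodes[OF ef(2)] by (auto intro!: *)
  then show "adjacent_to (fst (ends P)) (map ends (pcs e))" "adjacent_to (snd (ends P)) (map ends (pcs e))"
    by (auto intro!: adjacent_pcs[OF ef(1)] pcs_piece_nodes[OF ef(2) P] simp: angle_ends)
qed

definition chord :: "'e \<Rightarrow> hpos \<times> hpos" where
  "chord e = (half_edge (e, True), half_edge (e, False))"

lemma cross_pair_edges:
  assumes ef: "e \<in> edges G" "f \<in> edges G" "e \<noteq> f"
  shows "(\<Prod>p\<leftarrow>map ends (pcs e). \<Prod>q\<leftarrow>map ends (pcs f). cross_pair p q) = cross_pair (chord e) (chord f)"
proof -
  note ne = pcs_nonempty[OF ef(1)] pcs_nonempty[OF ef(2)]
  have "chord e = (fst (hd (map ends (pcs e))), snd (last (map ends (pcs e))))"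
    "chord f = (fst (hd (map ends (pcs f))), snd (last (map ends (pcs f))))"
    using ne by (simp_all add: chord_def hd_map last_map)
  moreover have "(\<Prod>p\<leftarrow>map ends (pcs e). \<Prod>q\<leftarrow>map ends (pcs f). cross_pair p q) =
      cross_pair (fst (hd (map ends (pcs e))), snd (last (map ends (pcs e))))
        (fst (hd (map ends (pcs f))), snd (last (map ends (pcs f))))"
  proof (rule cross_pair_paths)
    show "adjacent_to (fst q) (map ends (pcs e)) \<and> adjacent_to (snd q) (map ends (pcs e))"
      if "q \<in> set (map ends (pcs f))" for q
      using that adjacent_edges[OF ef] by auto
    show "adjacent_to (fst (hd (map ends (pcs e)))) (map ends (pcs f))"
      "adjacent_to (snd (last (map ends (pcs e)))) (map ends (pcs f))"
      using ne adjacent_edges[OF ef(2,1) ef(3)[symmetric]] by (simp_all add: hd_map last_map)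
  qed (use ne in auto)
  ultimately show ?thesis by simp
qed

lemma prod_list_concat: "(\<Prod>x\<leftarrow>concat xss. f x) = (\<Prod>xs\<leftarrow>xss. \<Prod>x\<leftarrow>xs. f x :: real)"
  by (induction xss) simp_all

text \<open>Crossings of chords become crossings of pieces, within an edge by
  \<open>chord_sign_edge\<close> and between different edges by
  \<open>cross_pair_edges\<close>.\<close>

lemma matching_sign_list:
  assumes "distinct es" "set es \<subseteq> edges G"
  shows "base.matching_sign (set es) = pair_product cross_pair (map ends (concat (map pcs es)))"
  using assms
proof (induction es)
  case Nil
  show ?case by (simp add: base.matching_sign_def)
next
  case (Cons e es)
  let ?c = "\<lambda>P Q. cross_pair (ends P) (ends Q)"
  have e: "e \<in> edges G" using Cons.prems by simp
  have "(\<Prod>P\<leftarrow>pcs e. \<Prod>Q\<leftarrow>concat (map pcs es). ?c P Q) = (\<Prod>f\<leftarrow>es. \<Prod>P\<leftarrow>pcs e. \<Prod>Q\<leftarrow>pcs f. ?c P Q)"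
    unfolding prod_list_concat map_map comp_def by (rule prod_list_swap)
  also have "\<dots> = (\<Prod>f\<leftarrow>es. cross_pair (chord e) (chord f))"
  proof (rule arg_cong[of _ _ prod_list], rule map_cong[OF refl])
    fix f assume "f \<in> set es"
    then have "f \<in> edges G" "e \<noteq> f" using Cons.prems by auto
    from cross_pair_edges[OF e this]
    show "(\<Prod>P\<leftarrow>pcs e. \<Prod>Q\<leftarrow>pcs f. ?c P Q) = cross_pair (chord e) (chord f)" by (simp add: comp_def)
  qed
  also have "\<dots> = (\<Prod>f\<in>set es. cross_pair (chord e) (chord f))"
    using Cons.prems by (simp add: prod.distinct_set_conv_list)
  also have "\<dots> = base.cross_sign (half_edge (e, True)) (half_edge (e, False)) (set es)"
    unfolding base.cross_sign_def prod_Times_bool[OF finite_set]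
    by (intro prod.cong refl) (simp add: cross_pair_def chord_def mult_ac)
  finally have cr: "(\<Prod>P\<leftarrow>pcs e. \<Prod>Q\<leftarrow>concat (map pcs es). ?c P Q) =
      base.cross_sign (half_edge (e, True)) (half_edge (e, False)) (set es)" .
  have "pair_product cross_pair (map ends (concat (map pcs (e # es)))) =
      pair_product ?c (pcs e) * pair_product ?c (concat (map pcs es)) *
      base.cross_sign (half_edge (e, True)) (half_edge (e, False)) (set es)"
    unfolding pair_product_map concat.simps list.map pair_product_append cr ..
  also have "\<dots> = base.chord_sign e * base.matching_sign (set es) *
      base.cross_sign (half_edge (e, True)) (half_edge (e, False)) (set es)"
    using Cons chord_sign_edge[OF e] by (simp add: pair_product_map)
  finally show ?case
    using base.matching_sign_insert[of "set es" e] Cons.prems by simp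
qed

lemma pcs_disjoint:
  assumes ef: "e \<in> edges G" "f \<in> edges G" "e \<noteq> f" and P: "P \<in> set (pcs e)" shows "P \<notin> set (pcs f)"
proof
  assume Pf: "P \<in> set (pcs f)"
  show False
    using ef(1) P
  proof (cases rule: pcs_cases)
    case k: (1 k)
    show ?thesis using ef(2) Pf
    proof (cases rule: pcs_cases)
      case m: (1 m)
      have "(e, k) \<noteq> (f, m)" using ef(3) by simp
      from open_segments_disjoint[OF ef(1) k(1) ef(2) m(1) this]
      have "open_segment (seg_start e k) (seg_end e k) = {}" using k m by simp
      then show False using seg_nondegenerate[OF ef(1) k(1)] by simp
    qed (use k in simp)
  next
    case k: (2 k j d t)
    show ?thesis using ef(2) Pf
    proof (cases rule: pcs_cases)
      case m: (2 m j' d' t')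
      have "arrival g (Cross j d t) \<in> set (waypoint_nodes g (route G e ! k))"
        "arrival g (Cross j d t) \<in> set (waypoint_nodes g (route G f ! m))"
        using k m by (simp_all add: set_waypoint_nodes)
      from inner_waypoints_distinct[OF ef(1) k(1,2) ef(2) m(1,2) this] ef(3) show False by simp
    qed (use k in simp)
  qed
qed

lemma distinct_pieces:
  "distinct es \<Longrightarrow> set es \<subseteq> edges G \<Longrightarrow> distinct (concat (map pcs es))"
proof (induction es)
  case (Cons e es)
  have "set (pcs e) \<inter> set (concat (map pcs es)) = {}"
    using pcs_disjoint Cons.prems by fastforce
  then show ?case using Cons distinct_pcs by simp
qed simp

text \<open>Each factor depends only on a vertex and has square 1, and in a balanced set every
  vertex occurs an even number of times.\<close>

lemma outer_product:
  assumes A: "finite A" "A \<subseteq> edges G" and bal: "base.balanced (A \<times> UNIV)"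
  shows "(\<Prod>e\<in>A. outer_of P (pos G (src G e)) * outer_of P (pos G (tgt G e))) = 1"
proof -
  let ?h = "\<lambda>v. outer_of P (pos G v)"
  let ?H = "A \<times> (UNIV :: bool set)"
  have sq: "?h v ^ n = 1" if "even n" for v n
    using that outer_of_square[of P "pos G v"] by (auto elim!: evenE simp: power_mult power2_eq_square)
  have "(\<Prod>e\<in>A. ?h (src G e) * ?h (tgt G e)) = (\<Prod>a\<in>?H. ?h (dtail G a))"
    unfolding prod_Times_bool[OF A(1)] by (simp add: dtail_def)
  also have "\<dots> = (\<Prod>v\<in>dtail G ` ?H. \<Prod>a\<in>{a \<in> ?H. dtail G a = v}. ?h (dtail G a))"
    by (rule prod.group[symmetric]) (use A in auto)
  also have "\<dots> = (\<Prod>v\<in>dtail G ` ?H. ?h v ^ card {a \<in> ?H. dtail G a = v})"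
  proof (rule prod.cong[OF refl])
    fix v
    have "(\<Prod>a\<in>{a \<in> ?H. dtail G a = v}. ?h (dtail G a)) = (\<Prod>a\<in>{a \<in> ?H. dtail G a = v}. ?h v)"
      by (rule prod.cong) auto
    then show "(\<Prod>a\<in>{a \<in> ?H. dtail G a = v}. ?h (dtail G a)) = ?h v ^ card {a \<in> ?H. dtail G a = v}"
      by simp
  qed
  also have "\<dots> = 1"
    using bal unfolding base.balanced_def by (intro prod.neutral ballI sq) blast
  finally show ?thesis .
qed

lemma bridge_number_concat: "bridge_number j (concat Pss) = (\<Sum>Ps\<leftarrow>Pss. bridge_number j Ps)"
  by (induction Pss) (simp_all add: bridge_number_def)

definition passages :: "nat \<Rightarrow> 'e set \<Rightarrow> nat" where
  "passages j A = (\<Sum>e\<in>A. bridge_count G j e)"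

lemma sorted_wrt_distinct: "distinct xs \<Longrightarrow> sorted_wrt (\<noteq>) xs"
  by (induction xs) auto

text \<open>\<open>cross_pair_pieces\<close> splits the product over pairs of pieces. For each fixed
  piece \<open>P\<close> the factors \<open>outer_piece P Q\<close> telescope along the edges to
  their vertices and give 1 by \<open>outer_product\<close>; what remains counts the pairs of
  interleaved bridges.\<close>

lemma matching_sign_balanced:
  assumes A: "A \<subseteq> edges G" and bal: "base.balanced (A \<times> UNIV)"
  shows "base.matching_sign A = (-1) ^ (\<Sum>i=1..g. passages (2 * i - 1) A * passages (2 * i) A)"
proof -
  have fin: "finite A" using A finite_graph finite_subset by (auto simp: finite_graph_def)
  then obtain es where es: "set es = A" "distinct es" using finite_distinct_list by blast
  have esG: "set es \<subseteq> edges G" using es A by simp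
  let ?L = "concat (map pcs es)"
  have mem: "\<exists>e\<in>edges G. P \<in> set (pcs e)" if P: "P \<in> set ?L" for P
  proof -
    obtain e where "e \<in> set es" "P \<in> set (pcs e)" using P by auto
    then show ?thesis using esG by (intro bexI[of _ e]) auto
  qed
  have "sorted_wrt (\<lambda>P Q. cross_pair (ends P) (ends Q) = bridge_cross P Q * (outer_piece P Q * outer_piece Q P)) ?L"
  proof (rule sorted_wrt_mono_rel)
    show "sorted_wrt (\<noteq>) ?L"
      using distinct_pieces[OF es(2) esG] by (rule sorted_wrt_distinct)
    show "cross_pair (ends P) (ends Q) = bridge_cross P Q * (outer_piece P Q * outer_piece Q P)"
      if PQ: "P \<in> set ?L" "Q \<in> set ?L" "P \<noteq> Q" for P Q
    proof -
      obtain e where e: "e \<in> edges G" "P \<in> set (pcs e)" using mem[OF PQ(1)] by blast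
      obtain f where f: "f \<in> edges G" "Q \<in> set (pcs f)" using mem[OF PQ(2)] by blast
      show ?thesis by (rule cross_pair_pieces[OF pcs_good[OF e] pcs_good[OF f] pcs_apart[OF e f PQ(3)]])
    qed
  qed
  from pair_product_split[OF this outer_piece_self]
  have "pair_product cross_pair (map ends ?L) =
      pair_product bridge_cross ?L * (\<Prod>P\<leftarrow>?L. \<Prod>Q\<leftarrow>?L. outer_piece P Q)"
    by (simp add: pair_product_map)
  also have "(\<Prod>P\<leftarrow>?L. \<Prod>Q\<leftarrow>?L. outer_piece P Q) = 1"
  proof -
    have "(\<Prod>Q\<leftarrow>?L. outer_piece P Q) = 1" for P
    proof -
      have "(\<Prod>Q\<leftarrow>?L. outer_piece P Q) = (\<Prod>e\<leftarrow>es. \<Prod>Q\<leftarrow>pcs e. outer_piece P Q)"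
        by (simp add: prod_list_concat comp_def)
      also have "\<dots> = (\<Prod>e\<leftarrow>es. outer_of P (pos G (src G e)) * outer_of P (pos G (tgt G e)))"
      proof (rule arg_cong[of _ _ prod_list], rule map_cong[OF refl])
        fix e assume "e \<in> set es"
        then have e: "e \<in> edges G" using esG by auto
        show "(\<Prod>Q\<leftarrow>pcs e. outer_piece P Q) = outer_of P (pos G (src G e)) * outer_of P (pos G (tgt G e))"
          using outer_piece_chain[OF pcs_chain[OF e] pcs_nonempty[OF e]] by (simp add: pcs_start[OF e] pcs_finish[OF e])
      qed
      also have "\<dots> = (\<Prod>e\<in>A. outer_of P (pos G (src G e)) * outer_of P (pos G (tgt G e)))"
        using es by (simp add: prod.distinct_set_conv_list[symmetric])
      also have "\<dots> = 1" by (rule outer_product[OF fin A bal])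
      finally show ?thesis .
    qed
    then show ?thesis by (simp add: prod_list_1)
  qed
  also have "pair_product bridge_cross ?L = (-1) ^ (\<Sum>i=1..g. bridge_number (2 * i - 1) ?L * bridge_number (2 * i) ?L)"
  proof (rule pair_product_bridges)
    fix j d t assume "Br j d t \<in> set ?L"
    then obtain e where "e \<in> edges G" "Br j d t \<in> set (pcs e)" using mem[of "Br j d t"] by blast
    from pcs_good[OF this] show "j \<in> {1..2 * g}" by simp
  qed
  finally have eq: "pair_product cross_pair (map ends ?L) =
      (-1) ^ (\<Sum>i=1..g. bridge_number (2 * i - 1) ?L * bridge_number (2 * i) ?L)" by simp
  have "bridge_number j ?L = passages j A" for j
  proof -
    have "bridge_number j ?L = (\<Sum>e\<leftarrow>es. bridge_number j (pcs e))"
      by (simp add: bridge_number_concat comp_def)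
    also have "\<dots> = (\<Sum>e\<in>A. bridge_number j (pcs e))" using es by (simp add: sum.distinct_set_conv_list[symmetric])
    finally show ?thesis using A by (simp add: passages_def bridge_count_pcs subset_iff)
  qed
  then show ?thesis using matching_sign_list[OF es(2) esG] es(1) eq by simp
qed

lemma matching_sign_spin:
  assumes A: "finite A"
  shows "chord_system.matching_sign half_edge (spin s) A =
    (-1) ^ (\<Sum>j=1..2 * g. s j * passages j A) * base.matching_sign A"
proof -
  interpret sp: chord_system G half_edge "spin s" by (rule spin_chord_system)
  have "sp.chord_sign e = (-1) ^ (\<Sum>j=1..2 * g. s j * bridge_count G j e) * base.chord_sign e" for e
    by (simp add: sp.chord_sign_def base.chord_sign_def spin_def)
  then have "(\<Prod>e\<in>A. sp.chord_sign e) =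
      (-1) ^ (\<Sum>e\<in>A. \<Sum>j=1..2 * g. s j * bridge_count G j e) * (\<Prod>e\<in>A. base.chord_sign e)"
    by (simp add: prod.distrib power_sum)
  also have "(\<Sum>e\<in>A. \<Sum>j=1..2 * g. s j * bridge_count G j e) = (\<Sum>j=1..2 * g. s j * passages j A)"
    unfolding passages_def sum_distrib_left by (rule sum.swap)
  finally show ?thesis by (simp add: sp.matching_sign_def base.matching_sign_def)
qed

end


section \<open>Rotation of cycles\<close>

lemma rev_nth_1: "2 \<le> length L \<Longrightarrow> rev L ! 1 = last (butlast L)"
proof -
  assume L: "2 \<le> length L"
  then have "length (butlast L) = length L - 1" "butlast L \<noteq> []" by (auto simp flip: length_greater_0_conv)
  then show ?thesis using L by (simp add: rev_nth last_conv_nth nth_butlast numeral_2_eq_2)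
qed

lemma join_snoc: "join (Ls @ [M]) = concat (map butlast Ls) @ M"
proof (induction Ls)
  case (Cons L Ls)
  then show ?case by (cases Ls) simp_all
qed simp

context observed_drawing
begin

abbreviation "curve \<equiv> dedge_image g G"
abbreviation "\<theta> a \<equiv> lift (half_edge a)"

lemma curve_dinv: "curve (dinv a) = rev (curve a)"
  by (cases a) (auto simp: dedge_image_def dinv_def)

lemma curve_start:
  assumes "fst a \<in> edges G"
  shows "2 \<le> length (curve a)" "hd (curve a) = pos G (dtail G a)" "hd (curve a) \<noteq> ob"
    "curve a ! 1 \<noteq> hd (curve a)" "hpos_at (hd (curve a)) (curve a ! 1 - hd (curve a)) = half_edge a"
    "slope (half_edge a) \<noteq> pi"
proof -
  obtain e d where a: "a = (e, d)" and e: "e \<in> edges G" using assms by (cases a) auto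
  note ne = pcs_nonempty[OF e]
  have lk: "linked (map poly (pcs e))" by (rule piece_chain_linked[OF pcs_chain[OF e]])
  note J = edge_phase(2)[OF e]
  have end': "last (edge_image g G e) = last (poly (last (pcs e)))"
    "last (butlast (edge_image g G e)) = last (butlast (poly (last (pcs e))))" "2 \<le> length (edge_image g G e)"
    using join_end[OF lk] ne unfolding J by (simp_all add: last_map)
  have "2 \<le> length (curve a) \<and> hd (curve a) = pos G (dtail G a) \<and> hd (curve a) \<noteq> ob \<and>
    curve a ! 1 \<noteq> hd (curve a) \<and> hpos_at (hd (curve a)) (curve a ! 1 - hd (curve a)) = half_edge a \<and>
    slope (half_edge a) \<noteq> pi"
  proof (cases d)
    case True
    let ?P = "hd (pcs e)"
    have P: "good_piece ?P" using pcs_good[OF e] ne by simp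
    obtain q where "edge_image g G e = hd (poly ?P) # poly ?P ! 1 # q"
      using join_start[of "poly ?P" "map poly (tl (pcs e))"] lk ne unfolding J by (cases "pcs e") auto
    then have "hd (curve a) = start ?P" "curve a ! 1 = poly ?P ! 1"
      using True by (simp_all add: a dedge_image_def poly_ends)
    moreover obtain k where "k > 0" "poly ?P ! 1 - start ?P = of_real k * start_dir ?P"
      using poly_start_dir[OF P] by blast
    moreover have "half_edge a = hpos_at (start ?P) (start_dir ?P)" using True by (simp add: a ends_def)
    ultimately show ?thesis
      using good_piece_nondegenerate[OF P] pcs_start[OF e] end'(3) True
      by (auto simp: a dedge_image_def dtail_def hpos_at_scale ends_def)
  next
    case False
    let ?P = "last (pcs e)"
    have P: "good_piece ?P" using pcs_good[OF e] ne by simp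
    have "curve a = rev (edge_image g G e)" using False by (simp add: a dedge_image_def)
    moreover have "edge_image g G e \<noteq> []" using end'(3) by auto
    ultimately have "hd (curve a) = finish ?P" "curve a ! 1 = last (butlast (poly ?P))" "2 \<le> length (curve a)"
      using end' rev_nth_1[OF end'(3)] by (simp_all add: hd_rev poly_ends)
    moreover obtain k where "k > 0" "last (butlast (poly ?P)) - finish ?P = of_real k * finish_dir ?P"
      using poly_finish_dir[OF P] by blast
    moreover have "half_edge a = hpos_at (finish ?P) (finish_dir ?P)" using False by (simp add: a ends_def)
    ultimately show ?thesis
      using good_piece_nondegenerate[OF P] pcs_finish[OF e] False
      by (auto simp: a dtail_def hpos_at_scale ends_def)
  qed
  then show "2 \<le> length (curve a)" "hd (curve a) = pos G (dtail G a)" "hd (curve a) \<noteq> ob"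
    "curve a ! 1 \<noteq> hd (curve a)" "hpos_at (hd (curve a)) (curve a ! 1 - hd (curve a)) = half_edge a"
    "slope (half_edge a) \<noteq> pi" by blast+
qed

lemma curve_end:
  assumes "fst a \<in> edges G"
  shows "last (curve a) = hd (curve (dinv a))" "last (butlast (curve a)) = curve (dinv a) ! 1"
  using rev_nth_1[OF curve_start(1)[OF assms]] curve_start(1)[OF assms]
  by (auto simp: curve_dinv hd_rev)

text \<open>For a reversed edge, conjugation turns \<open>\<i>\<close> into \<open>- \<i>\<close>,
  which is the sign change of \<open>orientation\<close>.\<close>

lemma curve_phase:
  assumes "fst a \<in> edges G"
  shows "turn_product (curve a) = \<i> * of_real (orientation a) * cis ((\<theta> (dinv a) - \<theta> a) / 2)"
proof -
  have inv: "x = y * cis (- u)" if "x * cis u = y" for x y :: complex and u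
    using that by (auto simp: mult.assoc cis_mult)
  obtain e d where a: "a = (e, d)" and e: "e \<in> edges G" using assms by (cases a) auto
  have T: "turn_product (edge_image g G e) =
      \<i> * of_real (orientation (e, True)) * cis ((\<theta> (e, False) - \<theta> (e, True)) / 2)"
    using inv[OF edge_phase(1)[OF e]] by (simp add: minus_divide_left)
  show ?thesis
  proof (cases d)
    case True
    then show ?thesis using T by (simp add: a dedge_image_def dinv_def)
  next
    case False
    have "no_reversal (edge_image g G e)"
      unfolding edge_phase(2)[OF e] by (rule piece_chain_no_reversal[OF pcs_chain[OF e]])
    from turn_product_rev[OF this]
    have "turn_product (curve a) = cnj (turn_product (edge_image g G e))"
      using False by (simp add: a dedge_image_def)
    also have "\<dots> = \<i> * of_real (orientation a) * cis ((\<theta> (dinv a) - \<theta> a) / 2)"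
      unfolding T using False
      by (simp add: a dinv_def orientation_def cis_cnj minus_divide_left del: half_edge.simps)
    finally show ?thesis .
  qed
qed

text \<open>The factor \<open>\<i>\<close> of the edge and the factor \<open>- \<i>\<close> of the
  junction cancel, and the lift at the head of \<open>a\<close> drops out of the phase.\<close>

lemma curve_junction:
  assumes "fst a \<in> edges G" "fst b \<in> edges G" "dhead G a = dtail G b" "b \<noteq> dinv a"
  shows "turn_product (curve a) * junction (curve a) (curve b) =
    of_real (base.wt a b) * cis ((\<theta> b - \<theta> a) / 2)"
proof -
  let ?c = "dinv a" and ?z = "hd (curve b)"
  have c: "fst ?c \<in> edges G" using assms by simp
  have z: "hd (curve ?c) = ?z" using curve_start(2)[OF c] curve_start(2)[OF assms(2)] assms(3) by simp
  have ne: "half_edge ?c \<noteq> half_edge b" using half_edge_inj[OF c assms(2)] assms(4) by auto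
  note sc = curve_start[OF c, unfolded z] and sb = curve_start[OF assms(2)]
  have "cis (Arg ((curve b ! 1 - ?z) / (- (curve ?c ! 1 - ?z))) / 2) =
      - \<i> * of_real (sg (half_edge ?c) (half_edge b)) * cis ((\<theta> b - \<theta> ?c) / 2)"
    using junction_turn(1)[of ?z "curve ?c ! 1 - ?z" "curve b ! 1 - ?z"] sc(4-6) sb(3-6) ne by simp
  then have J: "junction (curve a) (curve b) =
      - \<i> * of_real (sg (half_edge ?c) (half_edge b)) * cis ((\<theta> b - \<theta> ?c) / 2)"
    unfolding junction_def turn_def curve_end[OF assms(1)] z by simp
  have w: "base.wt a b = orientation a * sg (half_edge ?c) (half_edge b)"
    using assms(3) by (simp add: base.wt_def base.\<tau>_def)
  have s: "cis ((\<theta> ?c - \<theta> a) / 2) * cis ((\<theta> b - \<theta> ?c) / 2) = cis ((\<theta> b - \<theta> a) / 2)"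
    unfolding cis_mult by (rule arg_cong[of _ _ cis]) (simp add: field_simps)
  show ?thesis unfolding curve_phase[OF assms(1)] J w s[symmetric] by (simp add: mult_ac)
qed

abbreviation "reduced_step a b \<equiv> dhead G a = dtail G b \<and> b \<noteq> dinv a"

text \<open>The phases telescope along the walk. Of the curve of \<open>b\<close> only two corners
  are kept, just enough to determine the turn into it.\<close>

lemma walk_phase:
  assumes "p \<noteq> []" "fst ` set (p @ [b]) \<subseteq> edges G" "successively reduced_step (p @ [b])"
  shows "linked (map curve p @ [take 2 (curve b)])"
    "join_product (map curve p @ [take 2 (curve b)]) =
      cis ((\<theta> b - \<theta> (hd p)) / 2) * of_real (base.path_weight (p @ [b]))"
proof -
  let ?M = "take 2 (curve b)"
  have b: "fst b \<in> edges G" using assms by auto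
  obtain x y q where xy: "curve b = x # y # q" using two_elems[OF curve_start(1)[OF b]] by auto
  have M: "length ?M = 2" "hd ?M = hd (curve b)" "turn_product ?M = 1" "junction L ?M = junction L (curve b)" for L
    by (simp_all add: xy junction_def)
  have "linked (map curve p @ [?M]) \<and> join_product (map curve p @ [?M]) =
      cis ((\<theta> b - \<theta> (hd p)) / 2) * of_real (base.path_weight (p @ [b]))"
    using assms
  proof (induction p)
    case (Cons a p)
    have a: "fst a \<in> edges G" using Cons.prems by auto
    show ?case
    proof (cases p)
      case Nil
      then have st: "reduced_step a b" using Cons.prems by simp
      have "last (curve a) = hd (curve b)"
        using curve_end(1)[OF a] curve_start(2)[of "dinv a"] curve_start(2)[OF b] st a by simp
      then show ?thesis
        using Nil curve_start(1)[OF a] M curve_junction[OF a b] st by simp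
    next
      case c: (Cons c p')
      then have c': "fst c \<in> edges G" and st: "reduced_step a c"
        and rest: "fst ` set (p @ [b]) \<subseteq> edges G" "successively reduced_step (p @ [b])"
        using Cons.prems by auto
      have IH: "linked (map curve p @ [?M])" "join_product (map curve p @ [?M]) =
          cis ((\<theta> b - \<theta> c) / 2) * of_real (base.path_weight (p @ [b]))"
        using Cons.IH[OF _ rest] c by auto
      have "last (curve a) = hd (curve c)"
        using curve_end(1)[OF a] curve_start(2)[of "dinv a"] curve_start(2)[OF c'] st a by simp
      then have lk: "linked (map curve (a # p) @ [?M])" using c IH(1) curve_start(1)[OF a] by simp
      have s: "cis ((\<theta> c - \<theta> a) / 2) * cis ((\<theta> b - \<theta> c) / 2) = cis ((\<theta> b - \<theta> a) / 2)"
        unfolding cis_mult by (rule arg_cong[of _ _ cis]) (simp add: field_simps)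
      have "join_product (map curve (a # p) @ [?M]) =
          turn_product (curve a) * junction (curve a) (curve c) * join_product (map curve p @ [?M])"
        using c by simp
      also have "\<dots> = cis ((\<theta> b - \<theta> a) / 2) * of_real (base.path_weight (a # p @ [b]))"
        unfolding IH(2) curve_junction[OF a c' st[THEN conjunct1] st[THEN conjunct2]] s[symmetric]
        using c by (simp add: mult_ac)
      finally show ?thesis using lk by simp
    qed
  qed simp
  then show "linked (map curve p @ [?M])" "join_product (map curve p @ [?M]) =
      cis ((\<theta> b - \<theta> (hd p)) / 2) * of_real (base.path_weight (p @ [b]))" by auto
qed

lemma cycle_walk:
  assumes "prime_reduced_cycle G p"
  shows "p \<noteq> []" "fst ` set (p @ [hd p]) \<subseteq> edges G" "successively reduced_step (p @ [hd p])"
proof -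
  show ne: "p \<noteq> []" using assms by (simp add: prime_reduced_cycle_def)
  then show "fst ` set (p @ [hd p]) \<subseteq> edges G" using assms by (auto simp: prime_reduced_cycle_def)
  show "successively reduced_step (p @ [hd p])"
    unfolding successively_conv_nth
  proof (intro allI impI)
    fix i assume i: "Suc i < length (p @ [hd p])"
    then have "(p @ [hd p]) ! i = p ! i" "(p @ [hd p]) ! Suc i = p ! (Suc i mod length p)"
      using ne by (auto simp: nth_append hd_conv_nth less_Suc_eq)
    then show "reduced_step ((p @ [hd p]) ! i) ((p @ [hd p]) ! Suc i)"
      using assms i by (simp add: prime_reduced_cycle_def)
  qed
qed

text \<open>The walk is closed by repeating its first edge, so the first and the last lift agree and
  no phase remains.\<close>

lemma cis_turning_cycle:
  assumes p: "prime_reduced_cycle G p"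
  shows "cis (total_turning (cycle_image g G p) / 2) = of_real (base.cycle_weight p)"
proof -
  note w = cycle_walk[OF p]
  let ?b = "hd p" and ?C = "cycle_image g G p"
  let ?Ls = "map curve p @ [take 2 (curve ?b)]"
  have b: "fst ?b \<in> edges G" using w by auto
  note ph = walk_phase[OF w]
  have J: "join ?Ls = ?C @ take 2 (curve ?b)"
    unfolding join_snoc by (simp add: cycle_image_def comp_def)
  obtain x y q where xy: "curve ?b = x # y # q" using two_elems[OF curve_start(1)[OF b]] by auto
  obtain q' where q': "join ?Ls = x # y # q'"
    using join_start[of "curve ?b" "map curve (tl p) @ [take 2 (curve ?b)]"] ph(1) w(1) xy by (cases p) auto
  \<comment> \<open>With fewer than two corners the cycle would be one loop drawn as a single
    segment from a point to itself.\<close>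
  have "2 \<le> length ?C"
  proof (rule ccontr)
    assume "\<not> 2 \<le> length ?C"
    then have "length ?C \<le> 1" by simp
    moreover have len: "1 \<le> length (butlast (curve a))" if "a \<in> set p" for a
      using curve_start(1)[of a] that w(2) by auto
    obtain p' where p': "p = ?b # p'" using w(1) by (cases p) auto
    ultimately have "p' = []" "length (curve ?b) \<le> 2"
    proof -
      have C: "?C = butlast (curve ?b) @ concat (map (\<lambda>d. butlast (curve d)) p')"
        by (subst p') (simp add: cycle_image_def)
      show "length (curve ?b) \<le> 2" using \<open>length ?C \<le> 1\<close> unfolding C by simp
      show "p' = []"
      proof (rule ccontr)
        assume "p' \<noteq> []"
        then obtain a p'' where a: "p' = a # p''" by (cases p') auto
        have "1 \<le> length (butlast (curve ?b))" "1 \<le> length (butlast (curve a))"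
          using len[of ?b] len[of a] w(1) p' a by (auto, metis list.set_intros)
        then show False using \<open>length ?C \<le> 1\<close> unfolding C a by simp
      qed
    qed
    then have "p = [?b]" "q = []" using p' xy by auto
    then obtain c where c: "p = [c]" by blast
    have "dhead G ?b = dtail G ?b" using w(3) unfolding c by simp
    moreover have "last (curve ?b) = pos G (dhead G ?b)"
      using curve_end(1)[OF b] curve_start(2)[of "dinv ?b"] b by simp
    ultimately show False using curve_start(2,4)[OF b] unfolding xy \<open>q = []\<close> by simp
  qed
  then obtain u v C' where C: "?C = u # v # C'" using two_elems by blast
  have "?C @ take 2 (curve ?b) = x # y # q'" using q' unfolding J .
  then have "take 2 ?C = take 2 (curve ?b)" unfolding C xy by simp
  then have "cis (total_turning ?C / 2) = turn_product (join ?Ls)"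
    using cis_total_turning[OF \<open>2 \<le> length ?C\<close>] J by simp
  also have "\<dots> = of_real (base.cycle_weight p)"
    unfolding turn_product_join[OF ph(1)] ph(2) using w(1) by (simp add: base.cycle_weight_hd)
  finally show ?thesis .
qed

text \<open>The weight is real, so half of the total turning is a multiple of \<open>pi\<close>. The
  multiplier is the rotation number, and its parity is the sign of the cosine.\<close>

lemma rotation_sign:
  assumes p: "prime_reduced_cycle G p"
  shows "(-1) ^ nat (rot g G s p) =
    base.cycle_weight p * (-1) ^ (\<Sum>j=1..2 * g. s j * cycle_bridge_count G j p)"
proof -
  let ?T = "total_turning (cycle_image g G p)"
  define B where "B = (\<Sum>j=1..2 * g. s j * cycle_bridge_count G j p)"
  note c = cis_turning_cycle[OF p]
  have "sin (?T / 2) = 0" using arg_cong[OF c, of Im] by simp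
  then obtain n :: int where "?T / 2 = of_int n * pi" unfolding sin_zero_iff_int2 by blast
  then have n: "?T / 2 = pi * of_int n" "?T / (2 * pi) = of_int n" by (simp_all add: field_simps)
  have "base.cycle_weight p = cos (?T / 2)" using arg_cong[OF c, of Re] by simp
  then have cw: "base.cycle_weight p = (if even n then 1 else -1)" unfolding n(1) cos_npi_int .
  have "rot g G s p = (n + int B) mod 2" by (simp only: rot_def rot0_def n(2) B_def[symmetric] floor_of_int mod_simps)
  moreover have "even (nat ((n + int B) mod 2)) \<longleftrightarrow> even n = even B"
    by (simp only: even_nat_iff pos_mod_sign zero_less_numeral even_mod_2_iff even_add even_of_nat)
  ultimately show ?thesis unfolding cw B_def[symmetric] by (simp add: minus_one_power_iff)
qed

lemma cycle_weight_spin: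
  "signed_walks.cycle_weight (chord_system.\<tau> G half_edge) (spin s) p =
    base.cycle_weight p * (-1) ^ (\<Sum>j=1..2 * g. s j * cycle_bridge_count G j p)"
proof -
  interpret sp: chord_system G half_edge "spin s" by (rule spin_chord_system)
  let ?r = "\<lambda>a. \<Sum>j=1..2 * g. s j * bridge_count G j (fst a)"
  have "sp.wt a b = base.wt a b * (-1) ^ ?r a" for a b
    by (simp add: sp.wt_def base.wt_def spin_def)
  then have "sp.cycle_weight p = base.cycle_weight p * (-1) ^ (\<Sum>i<length p. ?r (p ! i))"
    by (simp add: sp.cycle_weight_def base.cycle_weight_def prod.distrib power_sum)
  also have "(\<Sum>i<length p. ?r (p ! i)) = (\<Sum>j=1..2 * g. s j * cycle_bridge_count G j p)"
  proof -
    have "cycle_bridge_count G j p = (\<Sum>i<length p. bridge_count G j (fst (p ! i)))" for j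
      by (simp add: cycle_bridge_count_def sum_list_sum_nth atLeast0LessThan)
    then show ?thesis unfolding sum_distrib_left by (simp add: sum_distrib_left) (rule sum.swap)
  qed
  finally show ?thesis .
qed

end


section \<open>Averaging over binary vectors\<close>

lemma sum_PiE_insert:
  assumes "x \<notin> S"
  shows "(\<Sum>s\<in>PiE (insert x S) T. f s) = (\<Sum>y\<in>T x. \<Sum>s\<in>PiE S T. f (s(x := y)))"
proof -
  have "(\<Sum>s\<in>PiE (insert x S) T. f s) = (\<Sum>(y, s)\<in>T x \<times> PiE S T. f (s(x := y)))"
    unfolding PiE_insert_eq by (subst sum.reindex[OF inj_combinator[OF assms]]) (simp add: case_prod_unfold comp_def)
  then show ?thesis by (simp add: sum.cartesian_product)
qed

lemma sum_pairs:
  fixes f :: "nat \<Rightarrow> nat"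
  shows "(\<Sum>j=1..2 * n. f j) = (\<Sum>i=1..n. f (2 * i - 1) + f (2 * i))"
  by (induction n) simp_all

text \<open>Each summand of the exponent is the product
  \<open>(s (2 * i - 1) + r (2 * i)) * (s (2 * i) + r (2 * i - 1))\<close>, multiplied out.\<close>

definition arf_weight :: "(nat \<Rightarrow> nat) \<Rightarrow> nat \<Rightarrow> (nat \<Rightarrow> nat) \<Rightarrow> real" where
  "arf_weight r n s = (-1) ^ (\<Sum>i=1..n. s (2 * i - 1) * s (2 * i) +
     (s (2 * i - 1) * r (2 * i - 1) + s (2 * i) * r (2 * i)) + r (2 * i - 1) * r (2 * i))"

lemma arf_weight_step:
  "arf_weight r (Suc n) (s(2 * n + 1 := a, 2 * n + 2 := b)) =
    arf_weight r n s * (-1) ^ (a * b + (a * r (2 * n + 1) + b * r (2 * n + 2)) + r (2 * n + 1) * r (2 * n + 2))"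
proof -
  let ?s = "s(2 * n + 1 := a, 2 * n + 2 := b)"
  let ?T = "\<lambda>s i. s (2 * i - 1) * s (2 * i) + (s (2 * i - 1) * r (2 * i - 1) + s (2 * i) * r (2 * i)) +
    r (2 * i - 1) * r (2 * i)"
  have "?T ?s i = ?T s i" if "i \<in> {1..n}" for i
  proof -
    have "2 * i \<noteq> 2 * n + 1" "2 * i \<noteq> 2 * n + 2" "2 * i - 1 \<noteq> 2 * n + 1" "2 * i - 1 \<noteq> 2 * n + 2"
      using that by (simp_all, presburger+)
    then show ?thesis by (simp only: fun_upd_apply if_False)
  qed
  then have "(\<Sum>i=1..n. ?T ?s i) = (\<Sum>i=1..n. ?T s i)" by (rule sum.cong[OF refl])
  moreover have "?T ?s (Suc n) = a * b + (a * r (2 * n + 1) + b * r (2 * n + 2)) + r (2 * n + 1) * r (2 * n + 2)"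
    by simp
  moreover have "(\<Sum>i=1..Suc n. ?T ?s i) = (\<Sum>i=1..n. ?T ?s i) + ?T ?s (Suc n)" by (rule sum.cl_ivl_Suc[THEN trans]) simp
  ultimately show ?thesis by (simp only: arf_weight_def power_add[symmetric])
qed

lemma arf_sum: "(\<Sum>s\<in>{1..2 * n} \<rightarrow>\<^sub>E {0, 1}. arf_weight r n s) = 2 ^ n"
proof (induction n)
  case 0
  show ?case by (simp add: arf_weight_def)
next
  case (Suc n)
  have I: "{1..2 * Suc n} = insert (2 * n + 2) (insert (2 * n + 1) {1..2 * n})" by auto
  let ?c = "\<lambda>a b. (-1) ^ (a * b + (a * r (2 * n + 1) + b * r (2 * n + 2)) + r (2 * n + 1) * r (2 * n + 2)) :: real"
  have "(\<Sum>s\<in>{1..2 * Suc n} \<rightarrow>\<^sub>E {0, 1}. arf_weight r (Suc n) s) =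
      (\<Sum>b\<in>{0, 1}. \<Sum>a\<in>{0, 1}. \<Sum>s\<in>{1..2 * n} \<rightarrow>\<^sub>E {0, 1}. arf_weight r (Suc n) (s(2 * n + 1 := a, 2 * n + 2 := b)))"
    unfolding I by (subst sum_PiE_insert, simp)+ simp
  also have "\<dots> = (\<Sum>b\<in>{0, 1}. \<Sum>a\<in>{0, 1}. 2 ^ n * ?c a b)"
    unfolding arf_weight_step sum_distrib_right[symmetric] Suc.IH ..
  also have "\<dots> = 2 ^ n * (\<Sum>b\<in>{0, 1}. \<Sum>a\<in>{0, 1}. ?c a b)" by (simp only: sum_distrib_left)
  \<comment> \<open>The exponent is \<open>(a + r (2 * n + 2)) * (b + r (2 * n + 1))\<close>, which
    is odd for exactly one of the four choices, so the sum is 3 - 1.\<close>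
  also have "(\<Sum>b\<in>{0, 1}. \<Sum>a\<in>{0, 1}. ?c a b) = 2"
    by (cases "even (r (2 * n + 1))"; cases "even (r (2 * n + 2))") simp_all
  finally show ?case by simp
qed

section \<open>Comparison of the even series with the Feynman functions, coefficient by
  coefficient\<close>

lemma feynman_series:
  fixes G :: "('v, 'e) polygon_graph" and hp :: "'e dedge \<Rightarrow> 'p::linorder"
  assumes cs: "chord_system G hp \<eta>"
    and rot: "\<And>p. prime_reduced_cycle G p \<Longrightarrow>
      (-1) ^ nat (rot g G s p) = signed_walks.cycle_weight (chord_system.\<tau> G hp) \<eta> p"
  shows "feynman g G s = product_series (signed_walks.class_coeff G (chord_system.\<tau> G hp) \<eta>)
    (cycle_monomial G) (cycle_classes G)"
proof
  fix \<alpha>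
  interpret chord_system G hp \<eta> by (rule cs)
  have "(-1) ^ card F * (\<Prod>\<gamma>\<in>F. (-1) ^ nat (rot g G s (representative G \<gamma>))) = (\<Prod>\<gamma>\<in>F. class_coeff \<gamma>)"
    if "F \<subseteq> cycle_classes G" for F
  proof -
    have "(-1) ^ nat (rot g G s (representative G \<gamma>)) = cycle_weight (representative G \<gamma>)" if "\<gamma> \<in> F" for \<gamma>
      using that \<open>F \<subseteq> cycle_classes G\<close> representative_props(1) rot by (auto simp: cycle_classes_def)
    then have "(\<Prod>\<gamma>\<in>F. class_coeff \<gamma>) = (\<Prod>\<gamma>\<in>F. (-1) * (-1) ^ nat (rot g G s (representative G \<gamma>)))"
      by (intro prod.cong) (simp_all add: class_coeff_def)
    then show ?thesis by (simp only: prod.distrib prod_constant)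
  qed
  then show "feynman g G s \<alpha> = series \<alpha>"
    by (simp add: feynman_def formal_sum_def product_series_def conj_assoc)
qed

context chord_system
begin

lemma series_support:
  assumes "series \<alpha> \<noteq> 0"
  shows "set_mset \<alpha> \<subseteq> edges G" "\<alpha> = mset_set (set_mset \<alpha>)"
proof -
  obtain F where F: "finite F" "F \<subseteq> cycle_classes G" "(\<Sum>\<gamma>\<in>F. cycle_monomial G \<gamma>) = \<alpha>"
  proof (rule ccontr)
    assume "\<not> thesis"
    then have none: "{F. finite F \<and> F \<subseteq> cycle_classes G \<and> (\<Sum>\<gamma>\<in>F. cycle_monomial G \<gamma>) = \<alpha>} = {}"
      using that by blast
    show False using assms unfolding product_series_def none by simp
  qed
  have sub: "set_mset (cycle_monomial G \<gamma>) \<subseteq> edges G" if \<gamma>: "\<gamma> \<in> F" for \<gamma>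
  proof -
    obtain p where p: "prime_reduced_cycle G p" "\<gamma> = unoriented p"
      using \<gamma> F(2) unfolding cycle_classes_def by blast
    from representative_props(1)[OF p(1)] have "fst ` set (representative G \<gamma>) \<subseteq> edges G"
      unfolding p(2) prime_reduced_cycle_def by blast
    then show ?thesis by (simp add: cycle_monomial_def)
  qed
  have "set_mset (\<Sum>\<gamma>\<in>F. cycle_monomial G \<gamma>) \<subseteq> edges G"
    using F(1) sub by (induction F rule: finite_induct) auto
  then show "set_mset \<alpha> \<subseteq> edges G" using F(3) by simp
  have "count \<alpha> e = count (mset_set (set_mset \<alpha>)) e" for e
  proof (cases "e \<in># \<alpha>")
    case True
    have "\<not> 2 \<le> count \<alpha> e" using series_eq_0[of \<alpha> e] assms by blast
    moreover have "0 < count \<alpha> e" using True by simp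
    ultimately have "count \<alpha> e = 1" by linarith
    then show ?thesis using True by simp
  next
    case False
    then show ?thesis by (simp add: not_in_iff)
  qed
  then show "\<alpha> = mset_set (set_mset \<alpha>)" by (rule multiset_eqI)
qed

lemma balanced_iff_even_set:
  assumes A: "A \<subseteq> edges G" and fin: "finite_graph G"
  shows "balanced (A \<times> UNIV) \<longleftrightarrow> even_set G A"
proof -
  have "finite A" using A finite_edges' finite_subset by blast
  have deg: "card {a \<in> A \<times> (UNIV :: bool set). dtail G a = v} = degree_in G A v" for v
  proof -
    have "{a \<in> A \<times> (UNIV :: bool set). dtail G a = v} =
        (\<lambda>e. (e, True)) ` {e \<in> A. src G e = v} \<union> (\<lambda>e. (e, False)) ` {e \<in> A. tgt G e = v}"
      by (auto simp: dtail_def image_iff split: if_splits)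
    then show ?thesis
      using \<open>finite A\<close> by (simp add: degree_in_def) (subst card_Un_disjoint; auto simp: card_image inj_on_def)
  qed
  have "degree_in G A v = 0" if "v \<notin> verts G" for v
  proof -
    have e: "{e \<in> A. src G e = v} = {}" "{e \<in> A. tgt G e = v} = {}"
      using that A fin by (auto simp: finite_graph_def)
    show ?thesis unfolding degree_in_def e by simp
  qed
  then show ?thesis using A unfolding balanced_def even_set_def deg by (metis even_zero)
qed

end

lemma even_series_eq:
  assumes "finite (edges G)"
  shows "even_series G \<alpha> = (if even_set G (set_mset \<alpha>) \<and> \<alpha> = mset_set (set_mset \<alpha>) then 1 else 0)"
proof -
  have eq: "set_mset \<alpha> = A" if "even_set G A" "mset_set A = \<alpha>" for A
  proof -
    have "finite A" using that(1) assms finite_subset by (auto simp: even_set_def)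
    then show ?thesis using that(2) by auto
  qed
  let ?C = "even_set G (set_mset \<alpha>) \<and> \<alpha> = mset_set (set_mset \<alpha>)"
  have "{A. even_set G A \<and> mset_set A = \<alpha>} = (if ?C then {set_mset \<alpha>} else {})"
  proof (cases ?C)
    case True
    have "A = set_mset \<alpha>" if A: "even_set G A" "mset_set A = \<alpha>" for A by (rule eq[OF A, symmetric])
    moreover have "even_set G (set_mset \<alpha>)" "mset_set (set_mset \<alpha>) = \<alpha>"
      by (rule True[THEN conjunct1], rule True[THEN conjunct2, symmetric])
    ultimately have "{A. even_set G A \<and> mset_set A = \<alpha>} = {set_mset \<alpha>}" by blast
    then show ?thesis unfolding if_P[OF True] .
  next
    case False
    have "\<not> (even_set G A \<and> mset_set A = \<alpha>)" for A
    proof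
      assume A: "even_set G A \<and> mset_set A = \<alpha>"
      have "?C" unfolding eq[OF A[THEN conjunct1] A[THEN conjunct2]]
        by (rule conjI[OF A[THEN conjunct1] A[THEN conjunct2, symmetric]])
      with False show False by (rule notE)
    qed
    then show ?thesis unfolding if_not_P[OF False] by blast
  qed
  then have sum: "even_series G \<alpha> = (\<Sum>A\<in>(if ?C then {set_mset \<alpha>} else {}). 1)"
    unfolding even_series_def formal_sum_def mem_Collect_eq by (rule arg_cong)
  show ?thesis
  proof (cases ?C)
    case True
    show ?thesis using sum unfolding if_P[OF True] by simp
  next
    case False
    show ?thesis using sum unfolding if_not_P[OF False] by simp
  qed
qed

text \<open>Isolates what the geometry has to provide: rotations as cycle weights, and the matching
  signs of balanced sets in terms of passage numbers \<open>r j A\<close>. The average over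
  \<open>s\<close> is then \<open>arf_sum\<close>.\<close>

lemma even_series_average:
  fixes G :: "('v, 'e) polygon_graph" and hp :: "'e dedge \<Rightarrow> 'p::linorder"
  assumes fin: "finite_graph G" and cs: "\<And>s. chord_system G hp (\<eta> s)"
    and rot: "\<And>s p. prime_reduced_cycle G p \<Longrightarrow>
      (-1) ^ nat (rot g G s p) = signed_walks.cycle_weight (chord_system.\<tau> G hp) (\<eta> s) p"
    and sgn: "\<And>s A. A \<subseteq> edges G \<Longrightarrow> chord_system.balanced G (A \<times> UNIV) \<Longrightarrow>
      chord_system.matching_sign hp (\<eta> s) A =
        (-1) ^ (\<Sum>j=1..2 * g. s j * r j A) * (-1) ^ (\<Sum>i=1..g. r (2 * i - 1) A * r (2 * i) A)"
  shows "even_series G = (\<lambda>\<alpha>. 1 / 2 ^ g * (\<Sum>s\<in>binary_vectors g. sign_vec g s * feynman g G s \<alpha>))"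
proof
  fix \<alpha> :: "'e multiset"
  let ?A = "set_mset \<alpha>"
  have finE: "finite (edges G)" using fin by (simp add: finite_graph_def)
  show "even_series G \<alpha> = 1 / 2 ^ g * (\<Sum>s\<in>binary_vectors g. sign_vec g s * feynman g G s \<alpha>)"
  proof (cases "?A \<subseteq> edges G \<and> \<alpha> = mset_set ?A")
    case False
    have "feynman g G s \<alpha> = 0" for s
    proof -
      interpret c: chord_system G hp "\<eta> s" by (rule cs)
      have "feynman g G s = c.series" by (rule feynman_series[OF cs rot])
      then show ?thesis using c.series_support[of \<alpha>] False by auto
    qed
    moreover have "even_series G \<alpha> = 0"
      unfolding even_series_eq[OF finE] using False by (auto simp: even_set_def)
    ultimately show ?thesis by simp
  next
    case True
    then have A: "?A \<subseteq> edges G" and \<alpha>: "\<alpha> = mset_set ?A" by auto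
    let ?q = "\<Sum>i=1..g. r (2 * i - 1) ?A * r (2 * i) ?A"
    have f: "feynman g G s \<alpha> =
        (if even_set G ?A then (-1) ^ (\<Sum>j=1..2 * g. s j * r j ?A) * (-1) ^ ?q else 0)" for s
    proof -
      interpret c: chord_system G hp "\<eta> s" by (rule cs)
      have "feynman g G s = c.series" by (rule feynman_series[OF cs rot])
      then have "feynman g G s \<alpha> = c.matching_coeff ?A"
        using c.series_mset_set[of ?A] A \<alpha> by simp
      then show ?thesis
        using sgn[OF A, of s] c.balanced_iff_even_set[OF A fin] by (simp add: c.matching_coeff_def)
    qed
    have "sign_vec g s * ((-1) ^ (\<Sum>j=1..2 * g. s j * r j ?A) * (-1) ^ ?q) = arf_weight (\<lambda>j. r j ?A) g s" for s
      unfolding sign_vec_def arf_weight_def sum_pairs sum.distrib power_add by (simp add: mult_ac)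
    then show ?thesis
      using arf_sum[of "\<lambda>j. r j ?A" g] \<alpha> unfolding even_series_eq[OF finE] f binary_vectors_def by simp
  qed
qed

theorem theorem2p8:
  fixes g :: nat and G :: "('v, 'e) polygon_graph"
  assumes "1 \<le> g"
    and "finite_graph G"
    and "embedded_in_surface g G"
  shows "even_series G =
    (\<lambda>\<alpha>. 1 / 2 ^ g * (\<Sum>s\<in>binary_vectors g. sign_vec g s * feynman g G s \<alpha>))"
proof (cases "edges G = {}")
  case True
  \<comment> \<open>Without edges \<open>exists_observer\<close> offers no observer. Constant
    positions serve instead, as the conditions on positions are vacuous here.\<close>
  have cs: "chord_system G (\<lambda>_. 0 :: nat) (\<lambda>a. if snd a then 1 else - 1)"
    by standard (use True in \<open>auto simp: dinv_def\<close>)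
  show ?thesis
  proof (rule even_series_average[OF assms(2), where \<eta> = "\<lambda>_ a. if snd a then 1 else - 1" and r = "\<lambda>_ _. 0", OF cs])
    show "(-1) ^ nat (rot g G s p) = signed_walks.cycle_weight (chord_system.\<tau> G (\<lambda>_. 0 :: nat)) (\<lambda>a. if snd a then 1 else - 1) p"
      if "prime_reduced_cycle G p" for s p
      using that True by (auto simp: prime_reduced_cycle_def)
    show "chord_system.matching_sign (\<lambda>_. 0 :: nat) (\<lambda>a. if snd a then 1 else - 1) A =
        (-1) ^ (\<Sum>j=1..2 * g. s j * 0) * (-1) ^ (\<Sum>i=1..g. 0 * 0)" if "A \<subseteq> edges G" for A s
      using that True by (simp add: chord_system.matching_sign_def[OF cs])
  qed
next
  case False
  interpret drawing g G by standard (rule assms)+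
  obtain ob where ob: "ob \<in> interior (polygon g)" "\<And>z. z \<in> nodes \<Longrightarrow> dist ob 1 < dist z 1"
    "\<And>e k z. e \<in> edges G \<Longrightarrow> k < len e \<Longrightarrow> z \<in> closed_segment (seg_start e k) (seg_end e k) \<Longrightarrow> dist ob 1 < dist z 1"
    "\<And>u v. u \<in> nodes \<Longrightarrow> v \<in> nodes \<Longrightarrow> u \<noteq> v \<Longrightarrow> cr (u - ob) (v - ob) \<noteq> 0"
    using exists_observer[OF False] by blast
  interpret polygon_observer ob g by standard (use ob(1) genus in auto)
  interpret observed_drawing g G ob by standard (use ob in \<open>auto simp: far_def\<close>)
  show ?thesis
  proof (rule even_series_average[OF assms(2) spin_chord_system, where r = passages])
    show "(-1) ^ nat (rot g G s p) = signed_walks.cycle_weight (chord_system.\<tau> G half_edge) (spin s) p"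
      if "prime_reduced_cycle G p" for s p
      using rotation_sign[OF that] cycle_weight_spin by simp
    show "chord_system.matching_sign half_edge (spin s) A =
        (-1) ^ (\<Sum>j=1..2 * g. s j * passages j A) * (-1) ^ (\<Sum>i=1..g. passages (2 * i - 1) A * passages (2 * i) A)"
      if "A \<subseteq> edges G" "base.balanced (A \<times> UNIV)" for s A
      using matching_sign_spin matching_sign_balanced[OF that] that(1) base.finite_edges' finite_subset by metis
  qed
qed

end
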